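(* Suppose that conditions (A1)-(A4) hold (with (A4) holding for the given $\mu\in\mathcal{M}_1(X)$), let $\mu_*$ be the unique invariant probability measure of $\{P_t\}_{t\ge 0}$, and let $g\in BL(X)$ satisfy $\langle g,\mu_*\rangle=0$. Then $\sigma_g^2:=\mathbb{E}_{\mu_*}\left[\left(\chi_g(\Phi_1)-\chi_g(\Phi_0)+I_1(g)\right)^2\right]$ is finite and, whenever $\sigma_g^2>0$, the process $\{I_t(g)\}_{t\geq 0}$, $I_t(g):=\int_0^t g(\Phi_s)\,ds$, satisfies the law of the iterated logarithm under $\mathbb{P}_{\mu}$, namely $$\liminf_{t\to\infty}\frac{I_t(g)}{\sqrt{2\sigma_g^2\, t\ln\ln t}}=-1 \quad \text{and}\quad \limsup_{t\to\infty}\frac{I_t(g)}{\sqrt{2\sigma_g^2 \,t\ln\ln t}}=1\quad\mathbb{P}_{\mu}\text{-a.s.}$$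
   Context: $(X,\rho)$ is a complete separable metric space with Borel $\sigma$-field $\mathcal{B}(X)$. $BC(X)$ is the set of bounded continuous functions $X\to\mathbb{R}$. For $f:X\to\mathbb{R}$, $\operatorname{Lip} f:=\sup\{|f(x)-f(y)|/\rho(x,y): x\neq y\}$; $L(X)$ is the set of $f$ with $\operatorname{Lip} f<\infty$, and $BL(X)$ the set of bounded $f\in L(X)$. $\mathcal{M}_1(X)$ is the set of Borel probability measures on $X$; for $r>0$, $\mathcal{M}_{1,r}(X)$ is the set of $\nu\in\mathcal{M}_1(X)$ with $\int_X\rho(x_0,x)^r\,\nu(dx)<\infty$ for some (equivalently every) $x_0\in X$. $\delta_x$ is the Dirac measure at $x$, and $\langle f,\nu\rangle:=\int_X f\,d\nu$. For $\nu_1,\nu_2\in\mathcal{M}_{1,1}(X)$, $d_W(\nu_1,\nu_2):=\sup\{|\langle f,\nu_1\rangle-\langle f,\nu_2\rangle|: f\in L(X),\ \operatorname{Lip} f\le 1\}$. A Markov semigroup $\{P_t\}_{t\ge 0}$ is a family of stochastic kernels $P_t:X\times\mathcal{B}(X)\to[0,1]$ such that $(t,x)\mapsto P_t(x,A)$ is jointly measurable for each $A\in\mathcal{B}(X)$, $P_0(x,\cdot)=\delta_x$, and $P_{s+t}(x,A)=\int_X P_t(y,A)P_s(x,dy)$. Write $\nu P_t(A):=\int_X P_t(x,A)\,\nu(dx)$ and $P_tf(x):=\int_X f(y)P_t(x,dy)$. A measure $\nu\in\mathcal{M}_1(X)$ is invariant if $\nu P_t=\nu$ for all $t\ge0$.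 $\Phi=(\Omega,\mathcal{F},\{\mathcal{F}_t\}_{t\ge0},\{\Phi_t\}_{t\ge0},\{\theta_t\}_{t\ge0},\{\mathbb{P}_x\}_{x\in X})$ is a time-homogeneous, progressively measurable Markov process with state space $X$ and transition semigroup $\{P_t\}_{t\ge0}$: $\Phi_t:\Omega\to X$, $\mathcal{F}=\sigma(\Phi_s:s\ge0)$, $\mathcal{F}_t=\sigma(\Phi_s:0\le s\le t)$; $\theta_t:\Omega\to\Omega$ satisfies $\Phi_{s+t}=\Phi_s\circ\theta_t$; each $\mathbb{P}_x$ is a probability measure on $(\Omega,\mathcal{F})$ with $\mathbb{P}_x(\Phi_0=x)=1$, $\mathbb{P}_x(\Phi_{t+s}\in A\,|\,\mathcal{F}_s)=\mathbb{P}_{\Phi_s}(\Phi_t\in A)$ $\mathbb{P}_x$-a.s., and $\mathbb{P}_x(\Phi_t\in A)=P_t(x,A)$; and for each $t\geq 0$ the map $[0,t]\times\Omega\ni(s,\omega)\mapsto\Phi_s(\omega)$ is $\mathcal{B}([0,t])\otimes\mathcal{F}_t/\mathcal{B}(X)$-measurable. For $\nu\in\mathcal{M}_1(X)$, $\mathbb{P}_\nu(F):=\int_X\mathbb{P}_x(F)\,\nu(dx)$; $\mathbb{E}_x,\mathbb{E}_\nu$ are the corresponding expectations. Conditions: (A1) $\lim_{t\to0^+}P_tf(x)=f(x)$ for all $x\in X$, $f\in BC(X)$. (A2) $P_tf\in BC(X)$ for all $f\in BC(X)$, $t\ge0$. (A3) $\nu P_t\in\mathcal{M}_{1,1}(X)$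 for all $\nu\in\mathcal{M}_{1,1}(X)$, $t>0$, and there is $\gamma\in(0,\infty)$ with $d_W(\delta_xP_t,\delta_yP_t)\le e^{-\gamma t}\rho(x,y)$ for all $t\ge0$, $x,y\in X$. (A4) For a given measure $\mu\in\mathcal{M}_1(X)$, there exist $x_0\in X$ and $\zeta\in(2,\infty)$ such that $\sup_{t\ge0}\langle V^\zeta,\mu P_t\rangle<\infty$, where $V:=\rho(x_0,\cdot)$. Under (A2)-(A4), $\{P_t\}_{t\ge0}$ has a unique invariant probability measure $\mu_*$, which belongs to $\mathcal{M}_{1,\zeta}(X)$, and for $g\in BL(X)$ with $\langle g,\mu_*\rangle=0$ the corrector function $\chi_g(x):=\int_0^\infty P_tg(x)\,dt$, $x\in X$, is well defined (absolutely convergent integral). *)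

theory Defs
  imports "HOL-Probability.Probability"
begin

section \<open>Lipschitz functions, moments, Wasserstein distance\<close>

definition Lip :: "('a::metric_space \<Rightarrow> real) \<Rightarrow> ennreal" where
  "Lip f = (SUP (x, y) \<in> {(x, y). x \<noteq> y}. ennreal (\<bar>f x - f y\<bar> / dist x y))"

definition L_funs :: "('a::metric_space \<Rightarrow> real) set" where
  "L_funs = {f. Lip f < \<infinity>}"

definition BL_funs :: "('a::metric_space \<Rightarrow> real) set" where
  "BL_funs = {f \<in> L_funs. bounded (range f)}"

definition BC_funs :: "('a::topological_space \<Rightarrow> real) set" where
  "BC_funs = {f. continuous_on UNIV f \<and> bounded (range f)}"

abbreviation prob_measures :: "'a::topological_space measure set" where
  "prob_measures \<equiv> space (prob_algebra borel)"

definition prob_measures_moment :: "real \<Rightarrow> 'a::metric_space measure set" where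
  "prob_measures_moment r =
     {\<nu> \<in> prob_measures. \<exists>x0. (\<integral>\<^sup>+ x. ennreal (dist x0 x powr r) \<partial>\<nu>) < \<infinity>}"

text \<open>The distance is only meaningful on \<open>prob_measures_moment 1\<close>, where every function
  in \<open>L_funs\<close> is integrable.\<close>

definition d_W :: "'a::metric_space measure \<Rightarrow> 'a measure \<Rightarrow> ennreal" where
  "d_W \<nu>1 \<nu>2 = (SUP f \<in> {f \<in> L_funs. Lip f \<le> 1}. ennreal \<bar>(\<integral>x. f x \<partial>\<nu>1) - (\<integral>x. f x \<partial>\<nu>2)\<bar>)"


section \<open>Markov semigroups\<close>

text \<open>Time is of type \<^typ>\<open>real\<close>, and everything is required for nonnegative times only.
  The measure \<open>\<nu>P\<^sub>t\<close> is the monadic bind \<open>\<nu> \<bind> P t\<close>.\<close>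

locale markov_semigroup =
  fixes P :: "real \<Rightarrow> 'a::polish_space \<Rightarrow> 'a measure"
  assumes kernel: "\<And>t. t \<ge> 0 \<Longrightarrow> P t \<in> borel \<rightarrow>\<^sub>M prob_algebra borel"
    and joint_measurable: "\<And>A. A \<in> sets borel \<Longrightarrow>
      (\<lambda>(t, x). measure (P t x) A) \<in> borel_measurable (restrict_space borel {0..} \<Otimes>\<^sub>M borel)"
    and P_zero: "\<And>x. P 0 x = return borel x"
    and chapman_kolmogorov: "\<And>s t x. s \<ge> 0 \<Longrightarrow> t \<ge> 0 \<Longrightarrow> P (s + t) x = P s x \<bind> P t"

definition semigroup_op ::
    "(real \<Rightarrow> 'a \<Rightarrow> 'a measure) \<Rightarrow> real \<Rightarrow> ('a \<Rightarrow> real) \<Rightarrow> 'a \<Rightarrow> real" where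
  "semigroup_op P t f x = (\<integral>y. f y \<partial>P t x)"

definition invariant_prob :: "(real \<Rightarrow> 'a::topological_space \<Rightarrow> 'a measure) \<Rightarrow> 'a measure \<Rightarrow> bool" where
  "invariant_prob P \<nu> \<longleftrightarrow> \<nu> \<in> prob_measures \<and> (\<forall>t\<ge>0. \<nu> \<bind> P t = \<nu>)"

definition cond_A1 :: "(real \<Rightarrow> 'a::topological_space \<Rightarrow> 'a measure) \<Rightarrow> bool" where
  "cond_A1 P \<longleftrightarrow> (\<forall>x. \<forall>f\<in>BC_funs. ((\<lambda>t. semigroup_op P t f x) \<longlongrightarrow> f x) (at_right 0))"

definition cond_A2 :: "(real \<Rightarrow> 'a::topological_space \<Rightarrow> 'a measure) \<Rightarrow> bool" where
  "cond_A2 P \<longleftrightarrow> (\<forall>f\<in>BC_funs. \<forall>t\<ge>0. semigroup_op P t f \<in> BC_funs)"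

definition cond_A3 :: "(real \<Rightarrow> 'a::metric_space \<Rightarrow> 'a measure) \<Rightarrow> bool" where
  "cond_A3 P \<longleftrightarrow>
     (\<forall>\<nu>\<in>prob_measures_moment 1. \<forall>t>0. \<nu> \<bind> P t \<in> prob_measures_moment 1) \<and>
     (\<exists>\<gamma>>0. \<forall>t\<ge>0. \<forall>x y.
        d_W (return borel x \<bind> P t) (return borel y \<bind> P t) \<le> ennreal (exp (- \<gamma> * t) * dist x y))"

definition cond_A4 :: "(real \<Rightarrow> 'a::metric_space \<Rightarrow> 'a measure) \<Rightarrow> 'a measure \<Rightarrow> bool" where
  "cond_A4 P \<mu> \<longleftrightarrow>
     (\<exists>x0. \<exists>\<zeta>>2. (SUP t\<in>{0..}. \<integral>\<^sup>+ x. ennreal (dist x0 x powr \<zeta>) \<partial>(\<mu> \<bind> P t)) < \<infinity>)"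

definition corrector :: "(real \<Rightarrow> 'a \<Rightarrow> 'a measure) \<Rightarrow> ('a \<Rightarrow> real) \<Rightarrow> 'a \<Rightarrow> real" where
  "corrector P g x = (LBINT t:{0..}. semigroup_op P t g x)"


section \<open>Markov processes\<close>

definition generated_by :: "'w set \<Rightarrow> (real \<Rightarrow> 'w \<Rightarrow> 'a::topological_space) \<Rightarrow> real set \<Rightarrow> 'w measure" where
  "generated_by \<Omega> \<Phi> T = sigma \<Omega> (\<Union>s\<in>T. {\<Phi> s -` A \<inter> \<Omega> | A. A \<in> sets borel})"

locale progressive_markov_process = markov_semigroup P
  for P :: "real \<Rightarrow> 'a::polish_space \<Rightarrow> 'a measure" +
  fixes \<Omega> :: "'w set"
    and \<Phi> :: "real \<Rightarrow> 'w \<Rightarrow> 'a"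
    and \<theta> :: "real \<Rightarrow> 'w \<Rightarrow> 'w"
    and \<PP> :: "'a \<Rightarrow> 'w measure"
  assumes shift_closed: "\<And>t. t \<ge> 0 \<Longrightarrow> \<theta> t \<in> \<Omega> \<rightarrow> \<Omega>"
    and shift: "\<And>s t \<omega>. s \<ge> 0 \<Longrightarrow> t \<ge> 0 \<Longrightarrow> \<omega> \<in> \<Omega> \<Longrightarrow> \<Phi> (s + t) \<omega> = \<Phi> s (\<theta> t \<omega>)"
    and prob_space_PP: "\<And>x. prob_space (\<PP> x)"
    and space_PP: "\<And>x. space (\<PP> x) = \<Omega>"
    and sets_PP: "\<And>x. sets (\<PP> x) = sets (generated_by \<Omega> \<Phi> {0..})"
    and start: "\<And>x. measure (\<PP> x) {\<omega> \<in> \<Omega>. \<Phi> 0 \<omega> = x} = 1"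
    and markov: "\<And>x s t A. s \<ge> 0 \<Longrightarrow> t \<ge> 0 \<Longrightarrow> A \<in> sets borel \<Longrightarrow>
      AE \<omega> in \<PP> x.
        real_cond_exp (\<PP> x) (generated_by \<Omega> \<Phi> {0..s}) (indicator {\<omega> \<in> \<Omega>. \<Phi> (t + s) \<omega> \<in> A}) \<omega>
        = measure (\<PP> (\<Phi> s \<omega>)) {\<omega>' \<in> \<Omega>. \<Phi> t \<omega>' \<in> A}"
    and transition: "\<And>x t A. t \<ge> 0 \<Longrightarrow> A \<in> sets borel \<Longrightarrow>
      measure (\<PP> x) {\<omega> \<in> \<Omega>. \<Phi> t \<omega> \<in> A} = measure (P t x) A"
    and progressive: "\<And>t. t \<ge> 0 \<Longrightarrow>
      (\<lambda>(s, \<omega>). \<Phi> s \<omega>) \<in> (restrict_space borel {0..t} \<Otimes>\<^sub>M generated_by \<Omega> \<Phi> {0..t}) \<rightarrow>\<^sub>M borel"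

text \<open>The law \<open>\<PP>\<^sub>\<nu>(F) = \<integral> \<PP>\<^sub>x(F) \<nu>(dx)\<close> of the process with initial distribution \<open>\<nu>\<close>.
  Measurability of \<open>x \<mapsto> \<PP>\<^sub>x(F)\<close>, on which \<open>\<bind>\<close> relies, is a consequence of
  \<open>markov\<close> and \<open>transition\<close> by a monotone class argument.\<close>

definition law_from :: "('a \<Rightarrow> 'w measure) \<Rightarrow> 'a measure \<Rightarrow> 'w measure" where
  "law_from \<PP> \<nu> = \<nu> \<bind> \<PP>"

definition integral_functional :: "(real \<Rightarrow> 'w \<Rightarrow> 'a) \<Rightarrow> ('a \<Rightarrow> real) \<Rightarrow> real \<Rightarrow> 'w \<Rightarrow> real" where
  "integral_functional \<Phi> g t \<omega> = (LBINT s:{0..t}. g (\<Phi> s \<omega>))"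

definition corrector_increment ::
    "(real \<Rightarrow> 'a \<Rightarrow> 'a measure) \<Rightarrow> (real \<Rightarrow> 'w \<Rightarrow> 'a) \<Rightarrow> ('a \<Rightarrow> real) \<Rightarrow> 'w \<Rightarrow> real" where
  "corrector_increment P \<Phi> g \<omega> =
     corrector P g (\<Phi> 1 \<omega>) - corrector P g (\<Phi> 0 \<omega>) + integral_functional \<Phi> g 1 \<omega>"

text \<open>A Bochner integral, hence 0 if the integrand is not integrable; finiteness of the
  variance is therefore a separate integrability claim.\<close>

definition asymptotic_variance ::
    "(real \<Rightarrow> 'a \<Rightarrow> 'a measure) \<Rightarrow> (real \<Rightarrow> 'w \<Rightarrow> 'a) \<Rightarrow> ('a \<Rightarrow> 'w measure) \<Rightarrow> 'a measure
      \<Rightarrow> ('a \<Rightarrow> real) \<Rightarrow> real" where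
  "asymptotic_variance P \<Phi> \<PP> \<nu> g = (\<integral>\<omega>. (corrector_increment P \<Phi> g \<omega>)\<^sup>2 \<partial>law_from \<PP> \<nu>)"

end

theory Submission
  imports Defs "HOL-Real_Asymp.Real_Asymp"
begin

text \<open>Write \<open>I\<^sub>t\<close> for the integral functional of \<open>g\<close> and \<open>\<nu>\<close> for the invariant law.
  Contraction in the Wasserstein distance damps the influence of the starting point
  geometrically, so that the law of \<open>I\<^sub>t\<close> depends on it in a Lipschitz way, uniformly in \<open>t\<close>:
  this is \<open>lipschitz_start\<close>, proved for Riemann sums of the integral and carried over to the
  integral by the continuity condition \<open>cond_A1\<close>. Integrated against \<open>\<nu>\<close> it
  says that the future after a pause \<open>r\<close> looks stationary up to \<open>e\<^bsup>-\<gamma>r\<^esup>\<close> times the mean distance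
  \<open>D x = \<integral> dist x y \<nu>(dy)\<close> (\<open>start_vs_stationary\<close>). Everything can therefore be computed in the
  stationary regime.

  There the central limit theorem holds with a polynomial rate. The time \<open>p\<^sup>8\<close> is cut into
  \<open>p\<^sup>6\<close> blocks of length \<open>p\<^sup>2\<close>, and from each block an initial gap of length \<open>p\<close> is discarded. The remaining
  blocks are independent up to exponentially small errors (\<open>block_decoupling\<close>), the gaps are
  negligible in mean square (\<open>gap_removal\<close>), and Lindeberg replacement compares the sum of independent
  blocks with a Gaussian variable (\<open>smooth_clt\<close>). The variance is identified by the corrector:
  \<open>\<chi>(\<Phi>\<^sub>n) - \<chi>(\<Phi>\<^sub>0) + I\<^sub>n\<close> has centred, hence orthogonal increments, so its second moment is
  exactly \<open>n\<sigma>\<^sup>2\<close>, and it differs from \<open>I\<^sub>n\<close> by a quantity bounded in mean square (\<open>I_variance\<close>). The outcome,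
  \<open>clt_start\<close>, is an error \<open>C / sqrt p + C D x / p\<^sup>4\<close> for the expectation of a smooth step function of
  \<open>I\<close> at time \<open>p\<^sup>8\<close>, divided by \<open>p\<^sup>4\<close>. Such a rate suffices for
  the law of the iterated logarithm: the tail probabilities that decide it are powers of \<open>ln t\<close>, and
  the errors are negative powers of \<open>t\<close>, hence summable along geometric sequences of times.

  Upper half (\<open>upper_lil\<close>): an inequality of Ottaviani type bounds the maximum of \<open>I\<close> up to time \<open>p\<^sup>8\<close> by its
  final value, except when the process is far away from \<open>x0\<close>; the moment of order \<open>\<zeta> > 2\<close> makes that
  exception summable, and the Borel-Cantelli lemma applies. Lower half (\<open>lower_lil\<close>): over consecutive time
  blocks of length \<open>q\<^bsup>8k\<^esup>\<close> the increment is large with conditional probability at least \<open>1/k\<close>,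
  a divergent series, so almost surely this occurs infinitely often, and the upper half for \<open>-g\<close>
  controls what was accumulated before the block. The limit inferior is the limit superior for \<open>-g\<close>.\<close>

section \<open>Integration against kernels\<close>

text \<open>The positive and the negative part obey the rule for nonnegative integrals; the two
  identities may be subtracted at almost every point because both parts have finite total
  integral.\<close>

lemma integral_bind_integrable:
  fixes f :: "'b \<Rightarrow> real"
  assumes M: "M \<in> space (prob_algebra S)" and K: "K \<in> S \<rightarrow>\<^sub>M prob_algebra N"
    and f: "integrable (M \<bind> K) f"
  shows "(\<integral>x. f x \<partial>(M \<bind> K)) = (\<integral>\<omega>. (\<integral>x. f x \<partial>K \<omega>) \<partial>M)"
proof -
  have sM [measurable_cong]: "sets M = sets S" and pM: "prob_space M" using M by (auto simp: space_prob_algebra)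
  interpret prob_space M by (rule pM)
  have ne: "space M \<noteq> {}" by (rule not_empty)
  have K1: "K \<in> M \<rightarrow>\<^sub>M subprob_algebra N"
    using measurable_prob_algebraD[OF K] by (simp cong: measurable_cong_sets add: sM)
  have sB: "sets (M \<bind> K) = sets N" by (rule sets_bind[OF sets_kernel[OF K1] ne])
  have fN [measurable]: "f \<in> borel_measurable N" using borel_measurable_integrable[OF f] sB by (simp cong: measurable_cong_sets)
  have mm [measurable]: "(\<lambda>\<omega>. \<integral>\<^sup>+x. h x \<partial>K \<omega>) \<in> borel_measurable M" if "h \<in> borel_measurable N" for h
    using measurable_compose[OF K1 nn_integral_measurable_subprob_algebra[OF that]] by simp
  have eq: "(\<integral>\<^sup>+x. ennreal (h x) \<partial>(M \<bind> K)) = (\<integral>\<^sup>+\<omega>. (\<integral>\<^sup>+x. ennreal (h x) \<partial>K \<omega>) \<partial>M)" if "h \<in> borel_measurable N" for h :: "'b \<Rightarrow> real"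
    by (rule nn_integral_bind[OF _ K1]) (use that in measurable)
  have fin: "(\<integral>\<^sup>+x. ennreal (h x) \<partial>(M \<bind> K)) < \<infinity>" if "h = f \<or> h = (\<lambda>x. - f x)" for h :: "'b \<Rightarrow> real"
    using integrableD(2,3)[OF f] that by (auto simp: less_top)
  have key: "(AE \<omega> in M. (\<integral>\<^sup>+x. ennreal (h x) \<partial>K \<omega>) < \<infinity>) \<and>
      integrable M (\<lambda>\<omega>. enn2real (\<integral>\<^sup>+x. ennreal (h x) \<partial>K \<omega>)) \<and>
      enn2real (\<integral>\<^sup>+x. ennreal (h x) \<partial>(M \<bind> K)) = (\<integral>\<omega>. enn2real (\<integral>\<^sup>+x. ennreal (h x) \<partial>K \<omega>) \<partial>M)"
    if h: "h = f \<or> h = (\<lambda>x. - f x)" for h :: "'b \<Rightarrow> real"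
  proof -
    have hm [measurable]: "h \<in> borel_measurable N" using h by auto
    have f1: "(\<integral>\<^sup>+\<omega>. (\<integral>\<^sup>+x. ennreal (h x) \<partial>K \<omega>) \<partial>M) < \<infinity>" using fin[OF h] eq[OF hm] by simp
    have ae: "AE \<omega> in M. (\<integral>\<^sup>+x. ennreal (h x) \<partial>K \<omega>) \<noteq> \<infinity>"
      by (rule nn_integral_PInf_AE) (use f1 in \<open>auto intro!: mm\<close>)
    have e2: "(\<integral>\<^sup>+\<omega>. ennreal (enn2real (\<integral>\<^sup>+x. ennreal (h x) \<partial>K \<omega>)) \<partial>M) = (\<integral>\<^sup>+\<omega>. (\<integral>\<^sup>+x. ennreal (h x) \<partial>K \<omega>) \<partial>M)"
      by (rule nn_integral_cong_AE) (use ae in \<open>auto simp: less_top\<close>)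
    have int: "integrable M (\<lambda>\<omega>. enn2real (\<integral>\<^sup>+x. ennreal (h x) \<partial>K \<omega>))"
      by (rule integrableI_nonneg) (use e2 f1 in \<open>auto intro!: borel_measurable_enn2real mm\<close>)
    have "(\<integral>\<omega>. enn2real (\<integral>\<^sup>+x. ennreal (h x) \<partial>K \<omega>) \<partial>M) = enn2real (\<integral>\<^sup>+\<omega>. ennreal (enn2real (\<integral>\<^sup>+x. ennreal (h x) \<partial>K \<omega>)) \<partial>M)"
      by (rule integral_eq_nn_integral) (auto intro!: borel_measurable_enn2real mm)
    with int ae e2 eq[OF hm] show ?thesis by (auto simp: less_top)
  qed
  have "(\<integral>\<omega>. (\<integral>x. f x \<partial>K \<omega>) \<partial>M) = (\<integral>\<omega>. enn2real (\<integral>\<^sup>+x. ennreal (f x) \<partial>K \<omega>) - enn2real (\<integral>\<^sup>+x. ennreal (- f x) \<partial>K \<omega>) \<partial>M)"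
  proof (rule integral_cong_AE)
    have sK: "\<And>\<omega>. \<omega> \<in> space M \<Longrightarrow> sets (K \<omega>) = sets N" using sets_kernel[OF K1] by auto
    show "AE \<omega> in M. (\<integral>x. f x \<partial>K \<omega>) = enn2real (\<integral>\<^sup>+x. ennreal (f x) \<partial>K \<omega>) - enn2real (\<integral>\<^sup>+x. ennreal (- f x) \<partial>K \<omega>)"
      using key[of f, simplified, THEN conjunct1] key[of "\<lambda>x. - f x", simplified, THEN conjunct1] AE_space
    proof eventually_elim
      fix \<omega> assume a: "(\<integral>\<^sup>+x. ennreal (f x) \<partial>K \<omega>) < top" "(\<integral>\<^sup>+x. ennreal (- f x) \<partial>K \<omega>) < top" "\<omega> \<in> space M"
      have [measurable]: "f \<in> borel_measurable (K \<omega>)" using fN sK[OF a(3)] by (simp cong: measurable_cong_sets)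
      have "integrable (K \<omega>) f" unfolding real_integrable_def using a by auto
      from real_lebesgue_integral_def[OF this] show "(\<integral>x. f x \<partial>K \<omega>) = enn2real (\<integral>\<^sup>+x. ennreal (f x) \<partial>K \<omega>) - enn2real (\<integral>\<^sup>+x. ennreal (- f x) \<partial>K \<omega>)" .
    qed
    show "(\<lambda>\<omega>. \<integral>x. f x \<partial>K \<omega>) \<in> borel_measurable M"
      using measurable_compose[OF K1 integral_measurable_subprob_algebra[OF fN]] by simp
  qed (auto intro!: borel_measurable_diff borel_measurable_enn2real mm)
  also have "\<dots> = (\<integral>\<omega>. enn2real (\<integral>\<^sup>+x. ennreal (f x) \<partial>K \<omega>) \<partial>M) - (\<integral>\<omega>. enn2real (\<integral>\<^sup>+x. ennreal (- f x) \<partial>K \<omega>) \<partial>M)"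
    by (rule Bochner_Integration.integral_diff) (use key[of f] key[of "\<lambda>x. - f x"] in auto)
  also have "\<dots> = (\<integral>x. f x \<partial>(M \<bind> K))"
    using key[of f] key[of "\<lambda>x. - f x"] real_lebesgue_integral_def[OF f] by auto
  finally show ?thesis by simp
qed

lemma integral_bind_bounded:
  fixes f :: "'b \<Rightarrow> real"
  assumes M: "M \<in> space (prob_algebra S)" and K: "K \<in> S \<rightarrow>\<^sub>M prob_algebra N"
    and f: "f \<in> borel_measurable N" and b: "\<And>x. x \<in> space N \<Longrightarrow> \<bar>f x\<bar> \<le> B"
  shows "(\<integral>x. f x \<partial>(M \<bind> K)) = (\<integral>\<omega>. (\<integral>x. f x \<partial>K \<omega>) \<partial>M)"
proof (rule integral_bind_integrable[OF M K])
  have B: "M \<bind> K \<in> space (prob_algebra N)"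
    using measurable_bind_prob_space[OF measurable_const[OF M, of "count_space UNIV"] K] by (auto simp: measurable_count_space_eq1)
  then interpret p: prob_space "M \<bind> K" by (auto simp: space_prob_algebra)
  have s: "sets (M \<bind> K) = sets N" "space (M \<bind> K) = space N"
    using B sets_eq_imp_space_eq[of "M \<bind> K" N] by (auto simp: space_prob_algebra)
  show "integrable (M \<bind> K) f"
    by (rule p.integrable_const_bound[of _ B]) (use b f s in \<open>auto cong: measurable_cong_sets\<close>)
qed

lemma abs_expectation_le:
  fixes f :: "'b \<Rightarrow> real"
  assumes "prob_space M" and b: "\<And>x. x \<in> space M \<Longrightarrow> \<bar>f x\<bar> \<le> B"
  shows "\<bar>\<integral>x. f x \<partial>M\<bar> \<le> B"
proof -
  interpret prob_space M by fact
  obtain z where z: "z \<in> space M" using not_empty by auto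
  have B: "0 \<le> B" using b[OF z] by linarith
  have "\<bar>\<integral>x. f x \<partial>M\<bar> \<le> (\<integral>x. \<bar>f x\<bar> \<partial>M)" by (rule integral_abs_bound)
  also have "\<dots> \<le> (\<integral>x. B \<partial>M)" by (rule integral_mono') (use b B in auto)
  finally show ?thesis by (simp add: prob_space)
qed

section \<open>A smooth step function\<close>

definition cube_plus :: "real \<Rightarrow> real" where
  "cube_plus x = (max 0 x)^3"

text \<open>The antiderivative of the quadratic B-spline with knots 0, 1, 2, 3: a twice differentiable
  step with Lipschitz second derivative. As a third difference of truncated cubes it inherits its
  Taylor expansion from them and no derivative has to be computed.\<close>

definition smooth_step :: "real \<Rightarrow> real" where
  "smooth_step x = (cube_plus x - 3 * cube_plus (x - 1) + 3 * cube_plus (x - 2) - cube_plus (x - 3)) / 6"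

text \<open>A Taylor bound with the cubic remainder that a piecewise cubic, twice differentiable
  function has even across its knot.\<close>

lemma cube_plus_taylor:
  "\<bar>cube_plus (s + y) - cube_plus s - 3 * (max 0 s)^2 * y - 3 * max 0 s * y^2\<bar> \<le> \<bar>y\<bar>^3"
proof -
  consider (a) "0 \<le> s" "0 \<le> s + y" | (b) "s \<le> 0" "s + y \<le> 0" | (c) "s \<le> 0" "0 \<le> s + y" | (d) "0 \<le> s" "s + y \<le> 0"
    by linarith
  then show ?thesis
  proof cases
    case a then show ?thesis by (simp add: cube_plus_def max_def power3_eq_cube power2_eq_square algebra_simps abs_mult)
  next
    case b
    then have "max 0 s = 0" "max 0 (s + y) = 0" by auto
    then show ?thesis by (simp add: cube_plus_def)
  next
    case c
    then have "(s + y)^3 \<le> y^3" "(s+y)^3 \<ge> 0" by (auto intro!: power_mono)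
    with c show ?thesis by (cases "s = 0") (auto simp add: cube_plus_def max_def)
  next
    case d
    have "(- (s + y))^3 \<le> (- y)^3" using d by (intro power_mono) auto
    moreover have "0 \<le> (- (s+y))^3" using d by auto
    moreover have "cube_plus (s + y) - cube_plus s - 3 * (max 0 s)^2 * y - 3 * max 0 s * y^2 = (-(s+y))^3 - (-y)^3"
    proof -
      have "max 0 s = s" "max 0 (s + y) = 0" using d by auto
      then show ?thesis by (simp add: cube_plus_def power3_eq_cube power2_eq_square algebra_simps)
    qed
    moreover have "\<bar>y\<bar>^3 = (-y)^3" using d by simp
    ultimately show ?thesis by linarith
  qed
qed

lemma smooth_step_0: "x \<le> 0 \<Longrightarrow> smooth_step x = 0"
  by (simp add: smooth_step_def cube_plus_def max_def)

lemma smooth_step_1: assumes "3 \<le> x" shows "smooth_step x = 1"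
  using assms by (simp add: smooth_step_def cube_plus_def max_def power3_eq_cube algebra_simps)

lemma smooth_step_range: "0 \<le> smooth_step x" "smooth_step x \<le> 1"
proof -
  consider "x \<le> 0" | "3 \<le> x" | (a) "0 \<le> x" "x \<le> 1" | (b) "1 \<le> x" "x \<le> 2" | (c) "2 \<le> x" "x \<le> 3" by linarith
  then have "0 \<le> smooth_step x \<and> smooth_step x \<le> 1"
  proof cases
    case a
    then have e: "smooth_step x = x^3/6" by (simp add: smooth_step_def cube_plus_def max_def)
    have "x^3 \<le> 1^3" "0 \<le> x^3" using a by (intro power_mono, auto)
    then show ?thesis unfolding e by simp
  next
    case b
    then have e: "smooth_step x = (x^3 - 3 * (x-1)^3)/6" by (cases "x=1") (simp_all add: smooth_step_def cube_plus_def max_def)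
    define t where "t = x - 1"
    have t: "0 \<le> t" "t \<le> 1" using b by (auto simp: t_def)
    have xt: "x = t + 1" by (simp add: t_def)
    have e': "smooth_step x = (1 + 3*t + 3*t^2 - 2*t^3)/6" unfolding e unfolding xt by (simp add: power3_eq_cube power2_eq_square algebra_simps)
    have "0 \<le> (1 - t)^2 * (1 + 2 * t)" "0 \<le> t^2 * (3 - 2 * t)" "0 \<le> t^2" using t by auto
    then have "2 * t^3 \<le> 3 * t^2" "3 * t^2 - 2 * t^3 \<le> 1"
      by (simp_all add: power3_eq_cube power2_eq_square algebra_simps)
    then show ?thesis unfolding e' using t by simp
  next
    case c
    then have "smooth_step x = (x^3 - 3 * (x-1)^3 + 3 * (x-2)^3)/6" by (cases "x = 3") (simp_all add: smooth_step_def cube_plus_def max_def)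
    then have e: "smooth_step x = 1 - (3-x)^3/6" by (simp add: power3_eq_cube field_simps)
    have "(3-x)^3 \<le> 1^3" "0 \<le> (3-x)^3" using c by (intro power_mono, auto)
    then show ?thesis unfolding e by auto
  qed (auto simp: smooth_step_0 smooth_step_1)
  then show "0 \<le> smooth_step x" "smooth_step x \<le> 1" by auto
qed

text \<open>The absolute values of the coefficients 1, 3, 3, 1 of a third difference add up to 8.\<close>

lemma binomial_combination_bound:
  fixes A B C D E :: real
  assumes "\<bar>A\<bar> \<le> D" "\<bar>B\<bar> \<le> D" "\<bar>C\<bar> \<le> D" "\<bar>E\<bar> \<le> D"
  shows "\<bar>(A - 3 * B + 3 * C - E) / 6\<bar> \<le> 4 / 3 * D"
proof -
  have "A \<le> D" "- A \<le> D" "B \<le> D" "- B \<le> D" "C \<le> D" "- C \<le> D" "E \<le> D" "- E \<le> D" using assms by auto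
  then have "(A - 3 * B + 3 * C - E) / 6 \<le> 4 / 3 * D" "- ((A - 3 * B + 3 * C - E) / 6) \<le> 4 / 3 * D"
    by (simp_all add: field_simps)
  then show ?thesis by (rule abs_leI)
qed

lemma smooth_step_lipschitz: "\<bar>smooth_step x - smooth_step y\<bar> \<le> 36 * \<bar>x - y\<bar>"
proof -
  define cl where "cl x = max 0 (min 3 x)" for x :: real
  have cl: "smooth_step x = smooth_step (cl x)" for x
    by (cases "x \<le> 0"; cases "x \<ge> 3") (auto simp: smooth_step_0 smooth_step_1 cl_def max_def min_def)
  have cub: "\<bar>a^3 - b^3\<bar> \<le> 27 * \<bar>a - b\<bar>" if "0 \<le> a" "a \<le> 3" "0 \<le> b" "b \<le> 3" for a b :: real
  proof -
    have "a^3 - b^3 = (a - b) * (a^2 + a * b + b^2)" by (simp add: power3_eq_cube power2_eq_square algebra_simps)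
    moreover have "a^2 \<le> 3^2" "b^2 \<le> 3^2" "a * b \<le> 3 * 3" "0 \<le> a * b" using that
      by (intro power_mono mult_mono mult_nonneg_nonneg; simp)+
    then have "\<bar>a^2 + a * b + b^2\<bar> \<le> 27" by (auto simp: abs_of_nonneg)
    then have "\<bar>a - b\<bar> * \<bar>a^2 + a * b + b^2\<bar> \<le> \<bar>a - b\<bar> * 27" by (rule mult_left_mono) auto
    ultimately show ?thesis by (simp add: abs_mult)
  qed
  have sh: "\<bar>cube_plus (cl x - c) - cube_plus (cl y - c)\<bar> \<le> 27 * \<bar>x - y\<bar>" if "0 \<le> c" for c
  proof -
    have "\<bar>max 0 (cl x - c) ^ 3 - max 0 (cl y - c) ^ 3\<bar> \<le> 27 * \<bar>max 0 (cl x - c) - max 0 (cl y - c)\<bar>"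
      by (rule cub) (use that in \<open>auto simp: cl_def\<close>)
    also have "\<dots> \<le> 27 * \<bar>x - y\<bar>" by (auto simp: cl_def max_def min_def)
    finally show ?thesis by (simp add: cube_plus_def)
  qed
  have "smooth_step (cl x) - smooth_step (cl y) = ((cube_plus (cl x) - cube_plus (cl y)) - 3 * (cube_plus (cl x - 1) - cube_plus (cl y - 1))
      + 3 * (cube_plus (cl x - 2) - cube_plus (cl y - 2)) - (cube_plus (cl x - 3) - cube_plus (cl y - 3))) / 6"
    unfolding smooth_step_def by (simp add: diff_divide_distrib[symmetric])
  then show ?thesis unfolding cl[of x] cl[of y]
    using binomial_combination_bound[OF sh[of 0] sh[of 1] sh[of 2] sh[of 3]] by simp
qed

text \<open>The expansion required in the Lindeberg argument. Of the coefficients, only a bound for the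
  quadratic one matters, since the linear term integrates to zero against a centred law.\<close>

lemma smooth_step_taylor:
  "\<exists>a b. \<bar>b\<bar> \<le> 6 \<and> (\<forall>y. \<bar>smooth_step (s + y) - smooth_step s - a * y - b * y^2\<bar> \<le> 2 * \<bar>y\<bar>^3)"
proof -
  define a where "a = ((max 0 s)^2 - 3 * (max 0 (s-1))^2 + 3 * (max 0 (s-2))^2 - (max 0 (s-3))^2) / 2"
  define b where "b = (max 0 s - 3 * (max 0 (s-1)) + 3 * (max 0 (s-2)) - (max 0 (s-3))) / 2"
  have "\<bar>b\<bar> \<le> 6" unfolding b_def by (auto simp: max_def)
  moreover have "\<bar>smooth_step (s + y) - smooth_step s - a * y - b * y^2\<bar> \<le> 2 * \<bar>y\<bar>^3" for y
  proof -
    define R where "R c = cube_plus ((s - c) + y) - cube_plus (s - c) - 3 * (max 0 (s-c))^2 * y - 3 * max 0 (s-c) * y^2" for c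
    have R: "\<bar>R c\<bar> \<le> \<bar>y\<bar>^3" for c unfolding R_def by (rule cube_plus_taylor)
    have "4 / 3 * \<bar>y\<bar>^3 \<le> 2 * \<bar>y\<bar>^3" by (intro mult_right_mono) auto
    with binomial_combination_bound[OF R[of 0] R[of 1] R[of 2] R[of 3]]
    have "\<bar>(R 0 - 3 * R 1 + 3 * R 2 - R 3)/6\<bar> \<le> 2 * \<bar>y\<bar>^3" by (rule order_trans)
    moreover have "smooth_step (s + y) - smooth_step s - a * y - b * y^2 = (R 0 - 3 * R 1 + 3 * R 2 - R 3)/6"
      unfolding R_def smooth_step_def a_def b_def by (simp add: algebra_simps add_divide_distrib diff_divide_distrib)
    ultimately show ?thesis by simp
  qed
  ultimately show ?thesis by blast
qed

lemma smooth_step_measurable [measurable]: "smooth_step \<in> borel_measurable borel"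
  unfolding smooth_step_def cube_plus_def by measurable

section \<open>Averaging operators\<close>

text \<open>Convolution operators. Sums of independent variables become powers of such an operator,
  which avoids product spaces.\<close>

definition avg :: "real measure \<Rightarrow> (real \<Rightarrow> real) \<Rightarrow> real \<Rightarrow> real" where
  "avg \<nu> f s = (\<integral>y. f (s + y) \<partial>\<nu>)"

definition gauss :: "real \<Rightarrow> real measure" where
  "gauss \<sigma> = density lborel (normal_density 0 \<sigma>)"

lemma sets_gauss [measurable_cong]: "sets (gauss \<sigma>) = sets borel"
  by (simp add: gauss_def)

lemma prob_space_gauss: "0 < \<sigma> \<Longrightarrow> prob_space (gauss \<sigma>)"
  unfolding gauss_def by (rule prob_space_normal_density)

lemma avg_measurable:
  assumes "prob_space \<nu>" and [measurable_cong]: "sets \<nu> = sets borel" and [measurable]: "f \<in> borel_measurable borel"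
  shows "avg \<nu> f \<in> borel_measurable borel"
proof -
  interpret prob_space \<nu> by fact
  show ?thesis unfolding avg_def [abs_def] by measurable
qed

lemma integrable_bounded_shift:
  fixes f :: "real \<Rightarrow> real"
  assumes "prob_space \<nu>" and [measurable_cong]: "sets \<nu> = sets borel" and [measurable]: "f \<in> borel_measurable borel"
    and "\<And>x. \<bar>f x\<bar> \<le> B"
  shows "integrable \<nu> (\<lambda>y. f (s + y))"
proof -
  interpret prob_space \<nu> by fact
  show ?thesis by (rule integrable_const_bound[of _ B]) (use assms in auto)
qed

lemma avg_bounded:
  assumes "prob_space \<nu>" and "sets \<nu> = sets borel" and "f \<in> borel_measurable borel"
    and b: "\<And>x. \<bar>f x\<bar> \<le> B"
  shows "\<bar>avg \<nu> f s\<bar> \<le> B"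
proof -
  interpret prob_space \<nu> by fact
  have "\<bar>avg \<nu> f s\<bar> \<le> (\<integral>y. \<bar>f (s + y)\<bar> \<partial>\<nu>)" unfolding avg_def by (rule integral_abs_bound)
  also have "\<dots> \<le> (\<integral>y. B \<partial>\<nu>)"
    by (rule integral_mono) (use integrable_bounded_shift[OF assms] b in auto)
  finally show ?thesis by (simp add: prob_space)
qed

lemma avg_diff:
  assumes "prob_space \<nu>" and "sets \<nu> = sets borel" and "f \<in> borel_measurable borel" "h \<in> borel_measurable borel"
    and "\<And>x. \<bar>f x\<bar> \<le> B" "\<And>x. \<bar>h x\<bar> \<le> B"
  shows "avg \<nu> (\<lambda>x. f x - h x) s = avg \<nu> f s - avg \<nu> h s"
  unfolding avg_def by (rule Bochner_Integration.integral_diff) (auto intro!: integrable_bounded_shift assms)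

lemma avg_lipschitz:
  assumes "prob_space \<nu>" and "sets \<nu> = sets borel" and "f \<in> borel_measurable borel"
    and "\<And>x. \<bar>f x\<bar> \<le> B" and L: "\<And>x y. \<bar>f x - f y\<bar> \<le> L * \<bar>x - y\<bar>"
  shows "\<bar>avg \<nu> f s - avg \<nu> f t\<bar> \<le> L * \<bar>s - t\<bar>"
proof -
  interpret prob_space \<nu> by fact
  note i = integrable_bounded_shift[OF assms(1-4)]
  have "avg \<nu> f s - avg \<nu> f t = (\<integral>y. f (s + y) - f (t + y) \<partial>\<nu>)"
    unfolding avg_def using i by simp
  also have "\<bar>\<dots>\<bar> \<le> (\<integral>y. \<bar>f (s + y) - f (t + y)\<bar> \<partial>\<nu>)" by (rule integral_abs_bound)
  also have "\<dots> \<le> (\<integral>y. L * \<bar>s - t\<bar> \<partial>\<nu>)"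
    by (rule integral_mono) (use i in \<open>auto intro: order_trans[OF L]\<close>)
  finally show ?thesis by (simp add: prob_space)
qed

lemma avg_commute:
  assumes "prob_space \<nu>" "prob_space \<nu>'" and [measurable_cong]: "sets \<nu> = sets borel" "sets \<nu>' = sets borel"
    and [measurable]: "f \<in> borel_measurable borel" and b: "\<And>x. \<bar>f x\<bar> \<le> B"
  shows "avg \<nu> (avg \<nu>' f) = avg \<nu>' (avg \<nu> f)"
proof
  fix s
  interpret p: pair_prob_space \<nu> \<nu>' by (intro pair_prob_space.intro pair_sigma_finite.intro prob_space_imp_sigma_finite assms)
  have "integrable (\<nu> \<Otimes>\<^sub>M \<nu>') (\<lambda>(x, y). f (s + x + y))"
    by (rule p.P.integrable_const_bound[of _ B]) (use b in auto)
  from p.Fubini_integral[OF this]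
  show "avg \<nu> (avg \<nu>' f) s = avg \<nu>' (avg \<nu> f) s"
    unfolding avg_def by (simp add: algebra_simps)
qed

text \<open>Lindeberg replacement without derivatives of the averaged function: averaging operators
  commute and contract the supremum norm, so the error of replacing all factors is the number of
  factors times the error of one replacement in the original function.\<close>

lemma avg_funpow_diff:
  assumes p: "prob_space \<nu>" "prob_space \<nu>'" and s: "sets \<nu> = sets borel" "sets \<nu>' = sets borel"
  shows "f \<in> borel_measurable borel \<Longrightarrow> (\<And>x. \<bar>f x\<bar> \<le> B) \<Longrightarrow> (\<And>x. \<bar>avg \<nu> f x - avg \<nu>' f x\<bar> \<le> d)
    \<Longrightarrow> \<bar>(avg \<nu> ^^ k) f a - (avg \<nu>' ^^ k) f a\<bar> \<le> real k * d"
proof (induction k arbitrary: f)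
  case 0 then show ?case by simp
next
  case (Suc k)
  note [measurable] = Suc.prems(1)
  have pow: "(avg \<rho> ^^ k) h \<in> borel_measurable borel \<and> (\<forall>x. \<bar>(avg \<rho> ^^ k) h x\<bar> \<le> C)"
    if "prob_space \<rho>" "sets \<rho> = sets borel" "h \<in> borel_measurable borel" "\<And>x. \<bar>h x\<bar> \<le> C" for \<rho> h C k
    by (induction k) (use that in \<open>auto intro!: avg_measurable avg_bounded\<close>)
  have lin: "(avg \<rho> ^^ k) (\<lambda>x. h x - h' x) = (\<lambda>x. (avg \<rho> ^^ k) h x - (avg \<rho> ^^ k) h' x)"
    if r: "prob_space \<rho>" "sets \<rho> = sets borel" and h: "h \<in> borel_measurable borel" "h' \<in> borel_measurable borel"
      "\<And>x. \<bar>h x\<bar> \<le> C" "\<And>x. \<bar>h' x\<bar> \<le> C" for \<rho> h h' C k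
  proof (induction k)
    case (Suc k)
    then show ?case using pow[OF r h(1) h(3), of k] pow[OF r h(2) h(4), of k]
      by (auto intro!: ext avg_diff[OF r, of _ _ C])
  qed simp
  note pb = avg_measurable[OF p(1) s(1) Suc.prems(1)] avg_measurable[OF p(2) s(2) Suc.prems(1)]
    avg_bounded[OF p(1) s(1) Suc.prems(1,2)] avg_bounded[OF p(2) s(2) Suc.prems(1,2)]
  have "\<bar>(avg \<nu> ^^ k) (\<lambda>x. avg \<nu> f x - avg \<nu>' f x) a\<bar> \<le> d"
    by (rule pow[OF p(1) s(1), THEN conjunct2, rule_format]) (use pb Suc.prems(3) in auto)
  then have 1: "\<bar>(avg \<nu> ^^ k) (avg \<nu> f) a - (avg \<nu> ^^ k) (avg \<nu>' f) a\<bar> \<le> d"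
    by (subst (asm) lin[OF p(1) s(1)]) (use pb in auto)
  have 2: "\<bar>(avg \<nu> ^^ k) (avg \<nu>' f) a - (avg \<nu>' ^^ k) (avg \<nu>' f) a\<bar> \<le> real k * d"
  proof (rule Suc.IH)
    fix x
    have "avg \<nu> (avg \<nu>' f) x - avg \<nu>' (avg \<nu>' f) x = avg \<nu>' (\<lambda>x. avg \<nu> f x - avg \<nu>' f x) x"
      by (subst avg_commute[OF p s Suc.prems(1,2)]) (subst avg_diff[OF p(2) s(2), of _ _ B], use pb in auto)
    then show "\<bar>avg \<nu> (avg \<nu>' f) x - avg \<nu>' (avg \<nu>' f) x\<bar> \<le> d"
      using avg_bounded[OF p(2) s(2) borel_measurable_diff[OF pb(1,2)] Suc.prems(3)] by simp
  qed (use pb in auto)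
  show ?case using 1 2 by (simp add: funpow_swap1 algebra_simps)
qed

lemma gauss_integrable:
  assumes "0 < \<sigma>" shows "integrable (gauss \<sigma>) (\<lambda>y. y)" "integrable (gauss \<sigma>) (\<lambda>y. y^2)" "integrable (gauss \<sigma>) (\<lambda>y. \<bar>y\<bar>^3)"
  using integrable_normal_moment[OF assms, of 0 1] integrable_normal_moment[OF assms, of 0 2] integrable_normal_moment_abs[OF assms, of 0 3]
  by (auto simp: gauss_def integrable_density)

lemma gauss_moments:
  assumes "0 < \<sigma>" shows "(\<integral>y. y \<partial>gauss \<sigma>) = 0" "(\<integral>y. y^2 \<partial>gauss \<sigma>) = \<sigma>^2" "(\<integral>y. \<bar>y\<bar>^3 \<partial>gauss \<sigma>) \<le> 2 * \<sigma>^3"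
proof -
  have "sqrt (2 / pi) \<le> 1" using pi_gt3 by simp
  then have "2 * \<sigma>^3 * sqrt (2 / pi) \<le> 2 * \<sigma>^3 * 1" using assms by (intro mult_left_mono) auto
  then show "(\<integral>y. \<bar>y\<bar>^3 \<partial>gauss \<sigma>) \<le> 2 * \<sigma>^3"
    using integral_normal_moment_abs_odd[OF assms, of 0 1] by (simp add: gauss_def integral_density eval_nat_numeral)
  show "(\<integral>y. y \<partial>gauss \<sigma>) = 0" "(\<integral>y. y^2 \<partial>gauss \<sigma>) = \<sigma>^2"
    using integral_normal_moment_odd[OF assms, of 0 0] integral_normal_moment_even[OF assms, of 0 1]
    by (simp_all add: gauss_def integral_density)
qed

lemma avg_gauss_gauss:
  assumes "0 < \<sigma>" "0 < \<tau>" and [measurable]: "f \<in> borel_measurable borel" and b: "\<And>x. \<bar>f x\<bar> \<le> B"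
  shows "avg (gauss \<sigma>) (avg (gauss \<tau>) f) = avg (gauss (sqrt (\<sigma>\<^sup>2 + \<tau>\<^sup>2))) f"
proof
  fix s
  interpret p: pair_prob_space "gauss \<sigma>" "gauss \<tau>"
    by (intro pair_prob_space.intro pair_sigma_finite.intro prob_space_imp_sigma_finite prob_space_gauss assms)
  have "gauss (sqrt (\<sigma>\<^sup>2 + \<tau>\<^sup>2)) = convolution (gauss \<sigma>) (gauss \<tau>)"
  proof -
    have "convolution (gauss \<sigma>) (gauss \<tau>) = density lborel (\<lambda>x. \<integral>\<^sup>+y. ennreal (normal_density 0 \<sigma> (x - y)) * ennreal (normal_density 0 \<tau> y) \<partial>lborel)"
      unfolding gauss_def using prob_space_gauss[OF assms(1)] prob_space_gauss[OF assms(2)]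
      by (intro convolution_density) (auto simp: gauss_def intro: prob_space.finite_measure)
    also have "\<dots> = gauss (sqrt (\<sigma>\<^sup>2 + \<tau>\<^sup>2))"
      unfolding gauss_def conv_normal_density_zero_mean[OF assms(1,2), symmetric]
      by (simp add: ennreal_mult)
    finally show ?thesis by simp
  qed
  then have "avg (gauss (sqrt (\<sigma>\<^sup>2 + \<tau>\<^sup>2))) f s = (\<integral>z. f (s + (fst z + snd z)) \<partial>(gauss \<sigma> \<Otimes>\<^sub>M gauss \<tau>))"
    unfolding avg_def by (simp add: convolution_def integral_distr case_prod_beta)
  also have "\<dots> = (\<integral>x. (\<integral>y. f (s + (x + y)) \<partial>gauss \<tau>) \<partial>gauss \<sigma>)"
  proof -
    have "integrable (gauss \<sigma> \<Otimes>\<^sub>M gauss \<tau>) (\<lambda>z. f (s + (fst z + snd z)))"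
      by (rule p.P.integrable_const_bound[of _ B]) (use b in auto)
    from p.integral_fst'[OF this] show ?thesis by simp
  qed
  finally show "avg (gauss \<sigma>) (avg (gauss \<tau>) f) s = avg (gauss (sqrt (\<sigma>\<^sup>2 + \<tau>\<^sup>2))) f s"
    by (simp add: avg_def algebra_simps)
qed

text \<open>Gaussian laws are stable under convolution, so the comparison operator of the Lindeberg
  argument is a single Gaussian average.\<close>

lemma avg_gauss_funpow:
  assumes "0 < \<tau>" and f [measurable]: "f \<in> borel_measurable borel" and b: "\<And>x. \<bar>f x\<bar> \<le> B"
  shows "(avg (gauss \<tau>) ^^ Suc k) f = avg (gauss (\<tau> * sqrt (real (Suc k)))) f"
proof (induction k)
  case (Suc k)
  have "(avg (gauss \<tau>) ^^ Suc (Suc k)) f = avg (gauss \<tau>) (avg (gauss (\<tau> * sqrt (real (Suc k)))) f)"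
    using Suc.IH by simp
  also have "\<dots> = avg (gauss (sqrt (\<tau>\<^sup>2 + (\<tau> * sqrt (real (Suc k)))\<^sup>2))) f"
    by (rule avg_gauss_gauss[OF _ _ f b]) (use assms in auto)
  also have "\<tau>\<^sup>2 + (\<tau> * sqrt (real (Suc k)))\<^sup>2 = \<tau>\<^sup>2 * real (Suc (Suc k))"
    by (simp add: power_mult_distrib algebra_simps)
  finally show ?case using assms by (simp add: real_sqrt_mult)
qed simp

text \<open>The value depends on the law only through its variance, up to its third absolute moment. Two
  centred laws with almost the same variance are therefore almost indistinguishable to one
  averaging step.\<close>

lemma avg_smooth_step_expand:
  assumes "prob_space \<nu>" and [measurable_cong]: "sets \<nu> = sets borel"
    and i: "integrable \<nu> (\<lambda>y. y)" "integrable \<nu> (\<lambda>y. y^2)" "integrable \<nu> (\<lambda>y. \<bar>y\<bar>^3)" and m: "(\<integral>y. y \<partial>\<nu>) = 0"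
    and tay: "\<And>y. \<bar>smooth_step (s + y) - smooth_step s - a * y - b * y^2\<bar> \<le> 2 * \<bar>y\<bar>^3"
  shows "\<bar>avg \<nu> smooth_step s - smooth_step s - b * (\<integral>y. y^2 \<partial>\<nu>)\<bar> \<le> 2 * (\<integral>y. \<bar>y\<bar>^3 \<partial>\<nu>)"
proof -
  interpret prob_space \<nu> by fact
  have si: "integrable \<nu> (\<lambda>y. smooth_step (s + y))"
  proof (rule integrable_bounded_shift[OF assms(1,2) smooth_step_measurable, of 1])
    show "\<bar>smooth_step x\<bar> \<le> 1" for x using smooth_step_range[of x] by simp
  qed
  have "avg \<nu> smooth_step s - smooth_step s - b * (\<integral>y. y^2 \<partial>\<nu>) = (\<integral>y. smooth_step (s + y) - smooth_step s - a * y - b * y^2 \<partial>\<nu>)"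
    unfolding avg_def using si i m by (simp add: prob_space)
  also have "\<bar>\<dots>\<bar> \<le> (\<integral>y. \<bar>smooth_step (s + y) - smooth_step s - a * y - b * y^2\<bar> \<partial>\<nu>)" by (rule integral_abs_bound)
  also have "\<dots> \<le> (\<integral>y. 2 * \<bar>y\<bar>^3 \<partial>\<nu>)"
    by (rule integral_mono) (use si i tay in auto)
  finally show ?thesis by simp
qed

text \<open>Gaussian laws with variance \<open>\<sigma>\<^sup>2 / K\<close> compose under \<open>K\<close> averaging steps to the Gaussian law
  with variance \<open>\<sigma>\<^sup>2\<close>; each replacement costs the difference of the variances and the third
  absolute moments.\<close>

lemma smooth_clt:
  assumes p: "prob_space \<nu>" and s: "sets \<nu> = sets borel"
    and i: "integrable \<nu> (\<lambda>y. y)" "integrable \<nu> (\<lambda>y. y^2)" "integrable \<nu> (\<lambda>y. \<bar>y\<bar>^3)" and m: "(\<integral>y. y \<partial>\<nu>) = 0"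
    and K: "0 < K" and \<sigma>: "0 < \<sigma>"
  shows "\<bar>(avg \<nu> ^^ K) smooth_step a - avg (gauss \<sigma>) smooth_step a\<bar> \<le>
     real K * (6 * \<bar>(\<integral>y. y^2 \<partial>\<nu>) - \<sigma>^2 / real K\<bar> + 2 * (\<integral>y. \<bar>y\<bar>^3 \<partial>\<nu>) + 4 * (\<sigma> / sqrt (real K))^3)"
proof -
  define \<tau> where "\<tau> = \<sigma> / sqrt (real K)"
  have \<tau>: "0 < \<tau>" "\<tau>^2 = \<sigma>^2 / real K" using K \<sigma> by (auto simp: \<tau>_def power_divide)
  have ss: "\<bar>smooth_step x\<bar> \<le> 1" for x using smooth_step_range[of x] by auto
  have one: "\<bar>avg \<nu> smooth_step x - avg (gauss \<tau>) smooth_step x\<bar> \<le> 6 * \<bar>(\<integral>y. y^2 \<partial>\<nu>) - \<sigma>^2 / real K\<bar> + 2 * (\<integral>y. \<bar>y\<bar>^3 \<partial>\<nu>) + 4 * \<tau>^3" for x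
  proof -
    obtain a b where ab: "\<bar>b\<bar> \<le> 6" and t: "\<And>y. \<bar>smooth_step (x + y) - smooth_step x - a * y - b * y^2\<bar> \<le> 2 * \<bar>y\<bar>^3"
      using smooth_step_taylor[of x] by auto
    have 1: "\<bar>avg \<nu> smooth_step x - smooth_step x - b * (\<integral>y. y^2 \<partial>\<nu>)\<bar> \<le> 2 * (\<integral>y. \<bar>y\<bar>^3 \<partial>\<nu>)"
      by (rule avg_smooth_step_expand[OF p s i m t])
    have 2: "\<bar>avg (gauss \<tau>) smooth_step x - smooth_step x - b * \<tau>^2\<bar> \<le> 2 * (\<integral>y. \<bar>y\<bar>^3 \<partial>gauss \<tau>)"
      using avg_smooth_step_expand[OF prob_space_gauss[OF \<tau>(1)] sets_gauss gauss_integrable[OF \<tau>(1)] gauss_moments(1)[OF \<tau>(1)] t]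
      by (simp add: gauss_moments(2)[OF \<tau>(1)])
    have 3: "\<bar>b * (\<integral>y. y^2 \<partial>\<nu>) - b * \<tau>^2\<bar> \<le> 6 * \<bar>(\<integral>y. y^2 \<partial>\<nu>) - \<tau>^2\<bar>"
      unfolding right_diff_distrib[symmetric] abs_mult by (rule mult_right_mono[OF ab]) auto
    show ?thesis using 1 2 3 gauss_moments(3)[OF \<tau>(1)] unfolding \<tau>(2)[symmetric] by linarith
  qed
  obtain k where k: "K = Suc k" using K by (cases K) auto
  have "(avg (gauss \<tau>) ^^ K) smooth_step = avg (gauss \<sigma>) smooth_step"
    using avg_gauss_funpow[OF \<tau>(1) smooth_step_measurable ss, of k] K unfolding k \<tau>_def by simp
  then show ?thesis
    using avg_funpow_diff[OF p prob_space_gauss[OF \<tau>(1)] s sets_gauss smooth_step_measurable ss one, of K a]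
    by (simp add: \<tau>_def)
qed

lemma avg_gauss:
  assumes "f \<in> borel_measurable borel"
  shows "avg (gauss \<sigma>) f s = (\<integral>y. normal_density 0 \<sigma> y * f (s + y) \<partial>lborel)"
proof -
  have "(\<lambda>y. f (s + y)) \<in> borel_measurable lborel" using assms by measurable
  then show ?thesis unfolding avg_def gauss_def
    using integral_density[of "\<lambda>y. f (s + y)" lborel "normal_density 0 \<sigma>"] normal_density_nonneg by simp
qed

text \<open>Exponential tilting: the normal density at \<open>y\<close>, multiplied by \<open>exp (x (y - x) / \<sigma>\<^sup>2)\<close>, is
  the factor on the right times the density centred at \<open>x\<close>, and the step function is below that
  exponential because it vanishes for \<open>y \<le> x\<close> and is at most 1 elsewhere.\<close>

lemma gauss_tail_upper:
  assumes "0 < \<sigma>" "0 \<le> x"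
  shows "avg (gauss \<sigma>) smooth_step (- x) \<le> exp (- x\<^sup>2 / (2 * \<sigma>\<^sup>2))"
proof -
  have "avg (gauss \<sigma>) smooth_step (- x) = (\<integral>y. normal_density 0 \<sigma> y * smooth_step (- x + y) \<partial>lborel)"
    by (rule avg_gauss) simp
  also have "\<dots> \<le> (\<integral>y. exp (- x\<^sup>2 / (2 * \<sigma>\<^sup>2)) * normal_density x \<sigma> y \<partial>lborel)"
  proof (rule integral_mono)
    show "integrable lborel (\<lambda>y. normal_density 0 \<sigma> y * smooth_step (- x + y))"
      by (rule Bochner_Integration.integrable_bound[OF integrable_normal_density[OF assms(1), of 0]])
        (auto simp: abs_mult normal_density_nonneg smooth_step_range mult_left_le)
    show "integrable lborel (\<lambda>y. exp (- x\<^sup>2 / (2 * \<sigma>\<^sup>2)) * normal_density x \<sigma> y)"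
      using integrable_normal_density[OF assms(1), of x] by simp
    fix y
    have eq: "exp (- x\<^sup>2 / (2 * \<sigma>\<^sup>2)) * normal_density x \<sigma> y = normal_density 0 \<sigma> y * exp (x * (y - x) / \<sigma>\<^sup>2)"
    proof -
      have "- x\<^sup>2 / (2 * \<sigma>\<^sup>2) + - (y - x)\<^sup>2 / (2 * \<sigma>\<^sup>2) = - (y - 0)\<^sup>2 / (2 * \<sigma>\<^sup>2) + x * (y - x) / \<sigma>\<^sup>2"
        using assms by (simp add: field_simps power2_eq_square)
      from arg_cong[OF this, of exp] show ?thesis unfolding exp_add normal_density_def by simp
    qed
    have "smooth_step (- x + y) \<le> exp (x * (y - x) / \<sigma>\<^sup>2)"
    proof (cases "y \<le> x")
      case True then show ?thesis by (simp add: smooth_step_0)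
    next
      case False
      then have "1 \<le> exp (x * (y - x) / \<sigma>\<^sup>2)" using assms by simp
      then show ?thesis using smooth_step_range(2)[of "- x + y"] by linarith
    qed
    then show "normal_density 0 \<sigma> y * smooth_step (- x + y) \<le> exp (- x\<^sup>2 / (2 * \<sigma>\<^sup>2)) * normal_density x \<sigma> y"
      unfolding eq by (rule mult_left_mono) (simp add: normal_density_nonneg)
  qed
  also have "\<dots> = exp (- x\<^sup>2 / (2 * \<sigma>\<^sup>2))" using assms by simp
  finally show ?thesis .
qed

text \<open>On the interval from \<open>x + 3\<close> to \<open>x + 4\<close>, which has length 1, the step has already reached 1
  and the density is at least its value at the right end.\<close>

lemma gauss_tail_lower:
  assumes "0 < \<sigma>" "0 \<le> x"
  shows "exp (- (x + 4)\<^sup>2 / (2 * \<sigma>\<^sup>2)) / sqrt (2 * pi * \<sigma>\<^sup>2) \<le> avg (gauss \<sigma>) smooth_step (- x)"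
proof -
  \<comment> \<open>The interval starts at \<open>x + 3\<close> because the step needs length 3 to rise from 0 to 1.\<close>
  have "exp (- (x + 4)\<^sup>2 / (2 * \<sigma>\<^sup>2)) / sqrt (2 * pi * \<sigma>\<^sup>2) = (\<integral>y. exp (- (x + 4)\<^sup>2 / (2 * \<sigma>\<^sup>2)) / sqrt (2 * pi * \<sigma>\<^sup>2) * indicator {x+3..x+4} y \<partial>lborel)"
    by simp
  also have "\<dots> \<le> (\<integral>y. normal_density 0 \<sigma> y * smooth_step (- x + y) \<partial>lborel)"
  proof (rule integral_mono)
    show "integrable lborel (\<lambda>y. normal_density 0 \<sigma> y * smooth_step (- x + y))"
      by (rule Bochner_Integration.integrable_bound[OF integrable_normal_density[OF assms(1), of 0]])
        (auto simp: abs_mult normal_density_nonneg smooth_step_range mult_left_le)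
    fix y
    show "exp (- (x + 4)\<^sup>2 / (2 * \<sigma>\<^sup>2)) / sqrt (2 * pi * \<sigma>\<^sup>2) * indicator {x+3..x+4} y \<le> normal_density 0 \<sigma> y * smooth_step (- x + y)"
    proof (cases "y \<in> {x+3..x+4}")
      case True
      then have "y\<^sup>2 \<le> (x+4)\<^sup>2" using assms by (intro power_mono) auto
      then have "exp (- (x + 4)\<^sup>2 / (2 * \<sigma>\<^sup>2)) \<le> exp (- y\<^sup>2 / (2 * \<sigma>\<^sup>2))" using assms by (simp add: divide_right_mono)
      moreover have "smooth_step (- x + y) = 1" using True by (intro smooth_step_1) auto
      ultimately show ?thesis using True assms by (simp add: normal_density_def divide_right_mono)
    next
      case False then show ?thesis by (simp add: normal_density_nonneg smooth_step_range)
    qed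
  qed simp
  also have "\<dots> = avg (gauss \<sigma>) smooth_step (- x)"
    by (rule avg_gauss[symmetric]) simp
  finally show ?thesis .
qed

section \<open>The Markov property for path functionals\<close>

context progressive_markov_process
begin

abbreviation "Paths \<equiv> generated_by \<Omega> \<Phi> {0..}"
abbreviation "Past s \<equiv> generated_by \<Omega> \<Phi> {0..s}"

lemma space_generated: "space (generated_by \<Omega> \<Phi> T) = \<Omega>"
  by (simp add: generated_by_def space_measure_of_conv)

lemma sets_generated: "sets (generated_by \<Omega> \<Phi> T) = sigma_sets \<Omega> (\<Union>s\<in>T. {\<Phi> s -` A \<inter> \<Omega> | A. A \<in> sets borel})"
  unfolding generated_by_def by (rule sets_measure_of) auto

lemma Phi_measurable: "s \<in> T \<Longrightarrow> \<Phi> s \<in> generated_by \<Omega> \<Phi> T \<rightarrow>\<^sub>M borel"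
  by (rule measurableI) (auto simp: space_generated sets_generated intro!: sigma_sets.Basic)

lemma measurable_generatedI:
  "f \<in> M \<rightarrow>\<^sub>M generated_by \<Omega> \<Phi> T" if "f \<in> space M \<rightarrow> \<Omega>" "\<And>s. s \<in> T \<Longrightarrow> (\<lambda>x. \<Phi> s (f x)) \<in> M \<rightarrow>\<^sub>M borel"
  unfolding generated_by_def
proof (rule measurable_measure_of)
  fix y assume "y \<in> (\<Union>s\<in>T. {\<Phi> s -` A \<inter> \<Omega> | A. A \<in> sets borel})"
  then obtain s A where sA: "s \<in> T" "A \<in> sets borel" "y = \<Phi> s -` A \<inter> \<Omega>" by auto
  have "f -` y \<inter> space M = (\<lambda>x. \<Phi> s (f x)) -` A \<inter> space M" using sA that(1) by auto
  then show "f -` y \<inter> space M \<in> sets M" using measurable_sets[OF that(2)[OF sA(1)] sA(2)] by simp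
qed (use that in auto)

lemma Past_mono: "sets (Past s) \<subseteq> sets Paths" "s \<le> t \<Longrightarrow> sets (Past s) \<subseteq> sets (Past t)"
  unfolding sets_generated by (intro sigma_sets_mono'; fastforce)+

lemma measurable_Past_Paths: "f \<in> Past s \<rightarrow>\<^sub>M M \<Longrightarrow> f \<in> Paths \<rightarrow>\<^sub>M M"
  using Past_mono(1)[of s] by (auto simp: measurable_def space_generated)

lemma measurable_Past_mono: "f \<in> Past s \<rightarrow>\<^sub>M M \<Longrightarrow> s \<le> t \<Longrightarrow> f \<in> Past t \<rightarrow>\<^sub>M M"
  using Past_mono(2)[of s t] by (auto simp: measurable_def space_generated)

lemma shift_measurable [measurable]: "t \<ge> 0 \<Longrightarrow> \<theta> t \<in> Paths \<rightarrow>\<^sub>M Paths"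
proof (rule measurable_generatedI)
  fix s :: real assume "t \<ge> 0" "s \<in> {0..}"
  then have "(\<lambda>x. \<Phi> (s + t) x) \<in> Paths \<rightarrow>\<^sub>M borel" by (auto intro!: Phi_measurable)
  then show "(\<lambda>x. \<Phi> s (\<theta> t x)) \<in> Paths \<rightarrow>\<^sub>M borel"
    using shift[of s t] \<open>t \<ge> 0\<close> \<open>s \<in> {0..}\<close> by (subst measurable_cong[where g="\<lambda>x. \<Phi> (s + t) x"]) (auto simp: space_generated)
qed (use shift_closed in \<open>auto simp: space_generated\<close>)

declare sets_PP [measurable_cong]

lemma measurable_PP: "measurable (\<PP> x) M = measurable Paths M"
  by (rule measurable_cong_sets) (simp_all add: sets_PP)

lemma Phi_Paths_measurable [measurable]: "0 \<le> s \<Longrightarrow> \<Phi> s \<in> Paths \<rightarrow>\<^sub>M borel"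
  by (rule Phi_measurable) auto

lemma P_prob: "t \<ge> 0 \<Longrightarrow> prob_space (P t x)" and P_sets: "t \<ge> 0 \<Longrightarrow> sets (P t x) = sets borel"
  using measurable_space[OF kernel, of t x] by (auto simp: space_prob_algebra)

lemma P_subprob: "t \<ge> 0 \<Longrightarrow> P t \<in> borel \<rightarrow>\<^sub>M subprob_algebra borel"
  using kernel by (rule measurable_prob_algebraD)

lemma distr_Phi: assumes "t \<ge> 0" shows "distr (\<PP> x) borel (\<Phi> t) = P t x"
proof (rule measure_eqI)
  interpret p: prob_space "\<PP> x" by (rule prob_space_PP)
  interpret q: prob_space "P t x" by (rule P_prob[OF assms])
  fix A assume "A \<in> sets (distr (\<PP> x) borel (\<Phi> t))"
  then have A: "A \<in> sets borel" by simp
  have "emeasure (distr (\<PP> x) borel (\<Phi> t)) A = emeasure (\<PP> x) (\<Phi> t -` A \<inter> space (\<PP> x))"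
    by (rule emeasure_distr) (use A assms in \<open>auto simp: measurable_PP\<close>)
  also have "\<Phi> t -` A \<inter> space (\<PP> x) = {\<omega> \<in> \<Omega>. \<Phi> t \<omega> \<in> A}" by (auto simp: space_PP)
  also have "emeasure (\<PP> x) \<dots> = emeasure (P t x) A"
    by (simp add: p.emeasure_eq_measure q.emeasure_eq_measure transition[OF assms A])
  finally show "emeasure (distr (\<PP> x) borel (\<Phi> t)) A = emeasure (P t x) A" .
qed (simp add: P_sets assms)

lemma start_AE: "AE \<omega> in \<PP> x. \<Phi> 0 \<omega> = x"
proof -
  interpret p: prob_space "\<PP> x" by (rule prob_space_PP)
  have "{\<omega> \<in> \<Omega>. \<Phi> 0 \<omega> = x} = \<Phi> 0 -` {x} \<inter> space (\<PP> x)" by (auto simp: space_PP)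
  also have "\<dots> \<in> p.events" by (rule measurable_sets[of _ _ borel]) (auto simp: measurable_PP)
  finally have "AE \<omega> in \<PP> x. \<omega> \<in> {\<omega> \<in> \<Omega>. \<Phi> 0 \<omega> = x}" using start[of x] p.AE_prob_1 by blast
  then show ?thesis by auto
qed

text \<open>The conditional expectation in the Markov property, integrated over an event of the past.\<close>

lemma markov_one_time_indicator:
  assumes s: "0 \<le> s" and r: "0 \<le> r" and H: "H \<in> sets (Past s)" and A: "A \<in> sets borel"
  shows "emeasure (\<PP> x) (H \<inter> {\<omega> \<in> \<Omega>. \<Phi> (s + r) \<omega> \<in> A}) = (\<integral>\<^sup>+\<omega>. indicator H \<omega> * emeasure (P r (\<Phi> s \<omega>)) A \<partial>\<PP> x)"
proof -
  interpret p: prob_space "\<PP> x" by (rule prob_space_PP)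
  interpret f: finite_measure_subalgebra "\<PP> x" "Past s"
    by unfold_locales (use Past_mono in \<open>auto simp: subalgebra_def space_PP space_generated sets_PP\<close>)
  define E where "E = {\<omega> \<in> \<Omega>. \<Phi> (r + s) \<omega> \<in> A}"
  have "E = \<Phi> (r + s) -` A \<inter> space (\<PP> x)" by (auto simp: E_def space_PP)
  then have E [measurable]: "E \<in> p.events" using s r A by (auto intro!: measurable_sets[of _ _ borel] simp: measurable_PP)
  have H' [measurable]: "H \<in> p.events" using H Past_mono by (auto simp: sets_PP)
  have HE: "H \<inter> {\<omega> \<in> \<Omega>. \<Phi> (s + r) \<omega> \<in> A} = H \<inter> E" by (auto simp: E_def add.commute)
  have [measurable]: "(\<lambda>\<omega>. measure (P r (\<Phi> s \<omega>)) A) \<in> borel_measurable (\<PP> x)"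
    unfolding measurable_PP using measurable_compose[OF Phi_Paths_measurable[OF s] measure_measurable_subprob_algebra2[of "borel" "\<lambda>_. A" borel "P r"]] A r
    by (auto simp: P_subprob)
  have int: "integrable (\<PP> x) (\<lambda>\<omega>. measure (P r (\<Phi> s \<omega>)) A)"
    by (rule p.integrable_const_bound[of _ 1]) (use P_prob[OF r] in \<open>auto intro: prob_space.prob_le_1\<close>)
  have iE: "integrable (\<PP> x) (indicator E :: _ \<Rightarrow> real)"
    by (rule p.integrable_const_bound[of _ 1]) auto
  have "measure (\<PP> x) (H \<inter> E) = (\<integral>\<omega>\<in>H. indicator E \<omega> \<partial>\<PP> x)"
  proof -
    have "H \<inter> E \<subseteq> space (\<PP> x)" using sets.sets_into_space[OF E] by auto
    then show ?thesis unfolding set_lebesgue_integral_def by (simp add: indicator_inter_arith[symmetric] Int_absorb2)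
  qed
  also have "\<dots> = (\<integral>\<omega>\<in>H. real_cond_exp (\<PP> x) (Past s) (indicator E) \<omega> \<partial>\<PP> x)"
    by (rule f.real_cond_exp_intA[OF iE H])
  also have "\<dots> = (\<integral>\<omega>. indicator H \<omega> * measure (P r (\<Phi> s \<omega>)) A \<partial>\<PP> x)"
    unfolding set_lebesgue_integral_def
  proof (rule integral_cong_AE)
    show "AE \<omega> in \<PP> x. indicator H \<omega> *\<^sub>R real_cond_exp (\<PP> x) (Past s) (indicator E) \<omega> = indicator H \<omega> * measure (P r (\<Phi> s \<omega>)) A"
      using markov[OF s r A, of x] by eventually_elim (simp add: E_def transition[OF r A])
    have "real_cond_exp (\<PP> x) (Past s) (indicator E) \<in> borel_measurable (\<PP> x)"
      unfolding measurable_PP by (rule measurable_Past_Paths[of _ s]) simp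
    then show "(\<lambda>\<omega>. indicator H \<omega> *\<^sub>R real_cond_exp (\<PP> x) (Past s) (indicator E) \<omega>) \<in> borel_measurable (\<PP> x)" by simp
  qed auto
  finally have "measure (\<PP> x) (H \<inter> E) = (\<integral>\<omega>. indicator H \<omega> * measure (P r (\<Phi> s \<omega>)) A \<partial>\<PP> x)" .
  moreover have "ennreal (\<integral>\<omega>. indicator H \<omega> * measure (P r (\<Phi> s \<omega>)) A \<partial>\<PP> x) = (\<integral>\<^sup>+\<omega>. ennreal (indicator H \<omega> * measure (P r (\<Phi> s \<omega>)) A) \<partial>\<PP> x)"
    by (rule nn_integral_eq_integral[symmetric]) (use integrable_mult_indicator[OF H' int] in auto)
  moreover have "(\<integral>\<^sup>+\<omega>. ennreal (indicator H \<omega> * measure (P r (\<Phi> s \<omega>)) A) \<partial>\<PP> x) = (\<integral>\<^sup>+\<omega>. indicator H \<omega> * emeasure (P r (\<Phi> s \<omega>)) A \<partial>\<PP> x)"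
    by (rule nn_integral_cong) (simp add: finite_measure.emeasure_eq_measure prob_space.finite_measure P_prob[OF r] split: split_indicator)
  ultimately show ?thesis unfolding HE by (simp add: p.emeasure_eq_measure)
qed

text \<open>Under the measure restricted to an event of the past, the law of \<open>\<Phi> (s + r)\<close> is that of
  \<open>\<Phi> s\<close> transported by the kernel \<open>P r\<close>; this extends the one-time Markov property from indicators
  to all nonnegative functions.\<close>

lemma markov_one_time:
  assumes s: "0 \<le> s" and r: "0 \<le> r" and H: "H \<in> sets (Past s)" and k: "k \<in> borel_measurable borel"
  shows "(\<integral>\<^sup>+\<omega>. indicator H \<omega> * k (\<Phi> (s + r) \<omega>) \<partial>\<PP> x) = (\<integral>\<^sup>+\<omega>. indicator H \<omega> * (\<integral>\<^sup>+y. k y \<partial>P r (\<Phi> s \<omega>)) \<partial>\<PP> x)"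
proof -
  interpret p: prob_space "\<PP> x" by (rule prob_space_PP)
  have H' [measurable]: "H \<in> p.events" using H Past_mono by (auto simp: sets_PP)
  let ?D = "density (\<PP> x) (indicator H)"
  have Pm: "\<Phi> t \<in> \<PP> x \<rightarrow>\<^sub>M borel" if "t \<ge> 0" for t using Phi_Paths_measurable[OF that] by (simp add: measurable_PP)
  have K: "(\<lambda>\<omega>. P r (\<Phi> s \<omega>)) \<in> ?D \<rightarrow>\<^sub>M subprob_algebra borel"
    using measurable_compose[OF Pm[OF s] P_subprob[OF r]] by simp
  have ne: "space ?D \<noteq> {}" using p.not_empty by simp
  have Km: "(\<lambda>\<omega>. \<integral>\<^sup>+y. h y \<partial>P r (\<Phi> s \<omega>)) \<in> borel_measurable (\<PP> x)" if "h \<in> borel_measurable borel" for h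
    using measurable_compose[OF K nn_integral_measurable_subprob_algebra[OF that]] by simp
  have eq: "distr ?D borel (\<Phi> (s + r)) = ?D \<bind> (\<lambda>\<omega>. P r (\<Phi> s \<omega>))"
  proof (rule measure_eqI)
    show "sets (distr ?D borel (\<Phi> (s + r))) = sets (?D \<bind> (\<lambda>\<omega>. P r (\<Phi> s \<omega>)))"
      using sets_bind[OF sets_kernel[OF K] ne] by simp
    fix A assume "A \<in> sets (distr ?D borel (\<Phi> (s + r)))"
    then have A: "A \<in> sets borel" by simp
    have me: "(\<lambda>\<omega>. emeasure (P r (\<Phi> s \<omega>)) A) \<in> borel_measurable (\<PP> x)"
      using Km[of "indicator A"] A P_sets[OF r] by simp
    have "emeasure (distr ?D borel (\<Phi> (s + r))) A = emeasure ?D (\<Phi> (s + r) -` A \<inter> space (\<PP> x))"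
      by (subst emeasure_distr) (use s r A Pm[of "s + r"] in auto)
    also have "\<dots> = emeasure (\<PP> x) (H \<inter> (\<Phi> (s + r) -` A \<inter> space (\<PP> x)))"
      by (rule emeasure_restricted) (use s r A Pm[of "s + r"] in \<open>auto intro: measurable_sets\<close>)
    also have "H \<inter> (\<Phi> (s + r) -` A \<inter> space (\<PP> x)) = H \<inter> {\<omega> \<in> \<Omega>. \<Phi> (s + r) \<omega> \<in> A}" by (auto simp: space_PP)
    also have "emeasure (\<PP> x) \<dots> = (\<integral>\<^sup>+\<omega>. indicator H \<omega> * emeasure (P r (\<Phi> s \<omega>)) A \<partial>\<PP> x)"
      by (rule markov_one_time_indicator[OF s r H A])
    also have "\<dots> = (\<integral>\<^sup>+\<omega>. emeasure (P r (\<Phi> s \<omega>)) A \<partial>?D)"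
      by (rule nn_integral_density[symmetric]) (use me in auto)
    also have "\<dots> = emeasure (?D \<bind> (\<lambda>\<omega>. P r (\<Phi> s \<omega>))) A"
      by (rule emeasure_bind[OF ne K A, symmetric])
    finally show "emeasure (distr ?D borel (\<Phi> (s + r))) A = emeasure (?D \<bind> (\<lambda>\<omega>. P r (\<Phi> s \<omega>))) A" .
  qed
  have "(\<integral>\<^sup>+\<omega>. indicator H \<omega> * k (\<Phi> (s + r) \<omega>) \<partial>\<PP> x) = (\<integral>\<^sup>+\<omega>. k (\<Phi> (s + r) \<omega>) \<partial>?D)"
    by (rule nn_integral_density[symmetric]) (use s r k Pm[of "s + r"] in \<open>auto intro: measurable_compose\<close>)
  also have "\<dots> = (\<integral>\<^sup>+y. k y \<partial>distr ?D borel (\<Phi> (s + r)))"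
    by (rule nn_integral_distr[symmetric]) (use s r k Pm[of "s + r"] in auto)
  also have "\<dots> = (\<integral>\<^sup>+\<omega>. (\<integral>\<^sup>+y. k y \<partial>P r (\<Phi> s \<omega>)) \<partial>?D)"
    unfolding eq by (rule nn_integral_bind[OF k K])
  also have "\<dots> = (\<integral>\<^sup>+\<omega>. indicator H \<omega> * (\<integral>\<^sup>+y. k y \<partial>P r (\<Phi> s \<omega>)) \<partial>\<PP> x)"
    by (rule nn_integral_density) (use Km[OF k] in auto)
  finally show ?thesis .
qed

text \<open>Cylinder events whose observation times are given by their successive increments, so that
  the Markov property peels off the first observation and leaves an event of the same kind.\<close>

fun cyl :: "real \<Rightarrow> (real \<times> 'a set) list \<Rightarrow> 'w set" where
  "cyl \<tau> [] = \<Omega>"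
| "cyl \<tau> ((r, A) # l) = {\<omega> \<in> \<Omega>. \<Phi> (\<tau> + r) \<omega> \<in> A} \<inter> cyl (\<tau> + r) l"

text \<open>The probability of a cylinder event for the process started at \<open>x\<close>, as an iterated integral
  of transition kernels (\<open>emeasure_cyl\<close>).\<close>

fun cyl_prob :: "(real \<times> 'a set) list \<Rightarrow> 'a \<Rightarrow> ennreal" where
  "cyl_prob [] x = 1"
| "cyl_prob ((r, A) # l) x = (\<integral>\<^sup>+y. indicator A y * cyl_prob l y \<partial>P r x)"

definition valid_cyl :: "(real \<times> 'a set) list \<Rightarrow> bool" where
  "valid_cyl l \<longleftrightarrow> (\<forall>(r, A)\<in>set l. 0 \<le> r \<and> A \<in> sets borel)"

lemma cyl_prob_measurable: "valid_cyl l \<Longrightarrow> cyl_prob l \<in> borel_measurable borel"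
proof (induction l)
  case (Cons a l)
  obtain r A where a: "a = (r, A)" by (cases a)
  with Cons have r: "0 \<le> r" and [measurable]: "A \<in> sets borel" "cyl_prob l \<in> borel_measurable borel"
    by (auto simp: valid_cyl_def)
  show ?case unfolding a cyl_prob.simps [abs_def]
    using measurable_compose[OF P_subprob[OF r] nn_integral_measurable_subprob_algebra[of "\<lambda>y. indicator A y * cyl_prob l y"]]
    by simp
next
  case Nil
  have "cyl_prob [] = (\<lambda>x. 1)" by auto
  then show ?case by simp
qed

lemma cyl_Past: "0 \<le> s \<Longrightarrow> A \<in> sets borel \<Longrightarrow> {\<omega> \<in> \<Omega>. \<Phi> s \<omega> \<in> A} \<in> sets (Past s)"
  using measurable_sets[OF Phi_measurable[of s "{0..s}"], of A] by (simp add: space_generated vimage_def Int_def conj_commute)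

text \<open>Iteration of the one-time property: observing the process at the first time yields an event
  of the past of that time, to which the induction hypothesis applies.\<close>

lemma cyl_markov:
  "valid_cyl l \<Longrightarrow> 0 \<le> s \<Longrightarrow> H \<in> sets (Past s) \<Longrightarrow>
    emeasure (\<PP> x) (H \<inter> cyl s l) = (\<integral>\<^sup>+\<omega>. indicator H \<omega> * cyl_prob l (\<Phi> s \<omega>) \<partial>\<PP> x)"
proof (induction l arbitrary: s H)
  case Nil
  then have "H \<in> sets (\<PP> x)" using Past_mono by (auto simp: sets_PP)
  then show ?case using sets.sets_into_space[of H "\<PP> x"] by (simp add: space_PP Int_absorb2)
next
  case (Cons a l)
  obtain r A where a: "a = (r, A)" by (cases a)
  with Cons have r: "0 \<le> r" and A [measurable]: "A \<in> sets borel" and l: "valid_cyl l"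
    by (auto simp: valid_cyl_def)
  note [measurable] = cyl_prob_measurable[OF l]
  let ?H = "H \<inter> {\<omega> \<in> \<Omega>. \<Phi> (s + r) \<omega> \<in> A}"
  have H: "?H \<in> sets (Past (s + r))"
    using Past_mono(2)[of s "s + r"] Cons.prems r cyl_Past[of "s + r" A] A by auto
  have "emeasure (\<PP> x) (H \<inter> cyl s (a # l)) = emeasure (\<PP> x) (?H \<inter> cyl (s + r) l)" by (simp add: a Int_assoc)
  also have "\<dots> = (\<integral>\<^sup>+\<omega>. indicator ?H \<omega> * cyl_prob l (\<Phi> (s + r) \<omega>) \<partial>\<PP> x)"
    by (rule Cons.IH[OF l _ H]) (use Cons.prems r in auto)
  also have "\<dots> = (\<integral>\<^sup>+\<omega>. indicator H \<omega> * (indicator A (\<Phi> (s + r) \<omega>) * cyl_prob l (\<Phi> (s + r) \<omega>)) \<partial>\<PP> x)"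
    by (rule nn_integral_cong) (auto simp: space_PP split: split_indicator)
  also have "\<dots> = (\<integral>\<^sup>+\<omega>. indicator H \<omega> * cyl_prob (a # l) (\<Phi> s \<omega>) \<partial>\<PP> x)"
    unfolding a cyl_prob.simps by (rule markov_one_time) (use Cons.prems r in auto)
  finally show ?case .
qed

lemma emeasure_cyl: assumes "valid_cyl l" shows "emeasure (\<PP> x) (cyl 0 l) = cyl_prob l x"
proof -
  interpret p: prob_space "\<PP> x" by (rule prob_space_PP)
  have "cyl \<tau> l \<subseteq> \<Omega>" for \<tau> by (induction l arbitrary: \<tau>) auto
  then have "emeasure (\<PP> x) (cyl 0 l) = emeasure (\<PP> x) (\<Omega> \<inter> cyl 0 l)" by (simp add: Int_absorb1)
  also have "\<dots> = (\<integral>\<^sup>+\<omega>. indicator \<Omega> \<omega> * cyl_prob l (\<Phi> 0 \<omega>) \<partial>\<PP> x)"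
    by (rule cyl_markov[OF assms]) (use sets.top[of "Past 0"] in \<open>auto simp: space_generated\<close>)
  also have "\<dots> = (\<integral>\<^sup>+\<omega>. cyl_prob l x \<partial>\<PP> x)"
    by (rule nn_integral_cong_AE) (use start_AE[of x] AE_space in \<open>eventually_elim, auto simp: space_PP\<close>)
  finally show ?thesis by (simp add: p.emeasure_space_1)
qed

text \<open>Finite-dimensional events with an unordered set of times. In contrast to cylinders they are
  visibly stable under intersection; sorting the times turns them into cylinders.\<close>

definition rect :: "real set \<Rightarrow> (real \<Rightarrow> 'a set) \<Rightarrow> 'w set" where
  "rect J A = {\<omega> \<in> \<Omega>. \<forall>t\<in>J. \<Phi> t \<omega> \<in> A t}"

definition rects :: "'w set set" where
  "rects = {rect J A | J A. finite J \<and> J \<subseteq> {0..} \<and> (\<forall>t. A t \<in> sets borel)}"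

lemma sorted_rect_cyl:
  assumes "\<forall>t. A t \<in> sets borel"
  shows "sorted ts \<Longrightarrow> (\<forall>t\<in>set ts. \<tau> \<le> t) \<Longrightarrow> \<exists>l. valid_cyl l \<and> rect (set ts) A = cyl \<tau> l"
proof (induction ts arbitrary: \<tau>)
  case Nil show ?case by (rule exI[of _ "[]"]) (simp add: rect_def valid_cyl_def)
next
  case (Cons t ts)
  from Cons.IH[of t] Cons.prems(1) obtain l where l: "valid_cyl l" "rect (set ts) A = cyl t l" by fastforce
  have "rect (set (t # ts)) A = cyl \<tau> ((t - \<tau>, A t) # l)"
    unfolding cyl.simps using l(2) by (auto simp: rect_def)
  then show ?case using l assms Cons.prems by (intro exI[of _ "(t - \<tau>, A t) # l"]) (auto simp: valid_cyl_def)
qed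

lemma rects_cyl: "B \<in> rects \<Longrightarrow> \<exists>l. valid_cyl l \<and> B = cyl 0 l"
proof -
  assume "B \<in> rects"
  then obtain J A where B: "B = rect J A" "finite J" "J \<subseteq> {0..}" "\<forall>t. A t \<in> sets borel" by (auto simp: rects_def)
  from sorted_rect_cyl[OF B(4), of "sorted_list_of_set J" 0] B show ?thesis by auto
qed

lemma rects_Int_stable: "Int_stable rects"
proof (rule Int_stableI)
  fix a b assume "a \<in> rects" "b \<in> rects"
  then obtain J A J' A' where *: "a = rect J A" "finite J" "J \<subseteq> {0..}" "\<forall>t. A t \<in> sets borel"
    "b = rect J' A'" "finite J'" "J' \<subseteq> {0..}" "\<forall>t. A' t \<in> sets borel" by (auto simp: rects_def)
  have "a \<inter> b = rect (J \<union> J') (\<lambda>t. (if t \<in> J then A t else UNIV) \<inter> (if t \<in> J' then A' t else UNIV))"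
    unfolding * rect_def by auto
  also have "\<dots> \<in> rects" unfolding rects_def
    by (rule CollectI, intro exI conjI, rule refl) (use * in auto)
  finally show "a \<inter> b \<in> rects" .
qed

lemma rects_Pow: "rects \<subseteq> Pow \<Omega>" by (auto simp: rects_def rect_def)

lemma Omega_rects: "\<Omega> \<in> rects"
  unfolding rects_def by (rule CollectI, rule exI[of _ "{}"], rule exI[of _ "\<lambda>_. {}"]) (simp add: rect_def)

lemma sets_Paths_rects: "sets Paths = sigma_sets \<Omega> rects"
proof (rule antisym)
  show "sets Paths \<subseteq> sigma_sets \<Omega> rects"
    unfolding sets_generated
  proof (rule sigma_sets_mono', safe)
    fix s :: real and A :: "'a set" assume "0 \<le> s" "A \<in> sets borel"
    then have "rect {s} (\<lambda>_. A) \<in> rects" unfolding rects_def by auto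
    moreover have "rect {s} (\<lambda>_. A) = \<Phi> s -` A \<inter> \<Omega>" by (auto simp: rect_def)
    ultimately show "\<Phi> s -` A \<inter> \<Omega> \<in> rects" by simp
  qed
  have "rects \<subseteq> sets Paths"
  proof
    fix B assume "B \<in> rects"
    then obtain J A where B: "B = rect J A" "finite J" "J \<subseteq> {0..}" "\<forall>t. A t \<in> sets borel" by (auto simp: rects_def)
    have "rect J A \<in> sets Paths" using B(2,3)
    proof (induction J)
      case empty then show ?case using sets.top[of Paths] by (simp add: rect_def space_generated)
    next
      case (insert t J)
      have "rect (insert t J) A = {\<omega> \<in> \<Omega>. \<Phi> t \<omega> \<in> A t} \<inter> rect J A" by (auto simp: rect_def)
      moreover have "{\<omega> \<in> \<Omega>. \<Phi> t \<omega> \<in> A t} \<in> sets Paths" using cyl_Past[of t "A t"] Past_mono(1)[of t] insert B(4) by auto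
      ultimately show ?case using insert by auto
    qed
    then show "B \<in> sets Paths" using B by simp
  qed
  then show "sigma_sets \<Omega> rects \<subseteq> sets Paths" using sets.sigma_sets_subset[of rects Paths] by (simp add: space_generated)
qed

text \<open>On the intersection-stable generator of finite-dimensional events the probability is an
  explicit, measurable iterated integral; a monotone class argument extends measurability in the
  starting point to all events.\<close>

lemma PP_kernel: "\<PP> \<in> borel \<rightarrow>\<^sub>M prob_algebra Paths"
proof (rule measurable_prob_algebra_generated[OF sets_Paths_rects rects_Int_stable rects_Pow])
  fix A assume "A \<in> rects"
  then obtain l where l: "valid_cyl l" "A = cyl 0 l" using rects_cyl by blast
  have "(\<lambda>a. emeasure (\<PP> a) A) = cyl_prob l" using emeasure_cyl[OF l(1)] l(2) by auto
  then show "(\<lambda>a. emeasure (\<PP> a) A) \<in> borel_measurable borel" using cyl_prob_measurable[OF l(1)] by simp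
qed (auto simp: prob_space_PP sets_PP)

lemma PP_subkernel [measurable]: "\<PP> \<in> borel \<rightarrow>\<^sub>M subprob_algebra Paths"
  using PP_kernel by (rule measurable_prob_algebraD)

lemma cyl_shift: "0 \<le> s \<Longrightarrow> 0 \<le> \<tau> \<Longrightarrow> valid_cyl l \<Longrightarrow> \<theta> s -` cyl \<tau> l \<inter> \<Omega> = cyl (\<tau> + s) l"
proof (induction l arbitrary: \<tau>)
  case Nil then show ?case using funcset_mem[OF shift_closed[of s]] by auto
next
  case (Cons a l)
  obtain r A where a: "a = (r, A)" by (cases a)
  have r: "0 \<le> r" and l: "valid_cyl l" using Cons.prems(3) unfolding a by (auto simp: valid_cyl_def)
  have e: "\<tau> + s + r = \<tau> + r + s" by simp
  have 1: "\<theta> s -` cyl (\<tau> + r) l \<inter> \<Omega> = cyl (\<tau> + r + s) l" by (rule Cons.IH) (use Cons.prems r l in auto)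
  have 2: "\<omega> \<in> \<Omega> \<Longrightarrow> \<Phi> (\<tau> + r) (\<theta> s \<omega>) = \<Phi> (\<tau> + r + s) \<omega>" for \<omega>
    using shift[of "\<tau> + r" s \<omega>] Cons.prems r by simp
  have 3: "\<omega> \<in> \<Omega> \<Longrightarrow> \<theta> s \<omega> \<in> \<Omega>" for \<omega> using funcset_mem[OF shift_closed[OF Cons.prems(1)]] .
  show ?case unfolding a cyl.simps e 1[symmetric] using 2 3 by auto
qed

text \<open>Both sides define finite measures in \<open>B\<close>; they agree on finite-dimensional events, which
  determine a measure.\<close>

lemma markov_path_event:
  assumes s: "0 \<le> s" and H: "H \<in> sets (Past s)" and B: "B \<in> sets Paths"
  shows "emeasure (\<PP> x) (H \<inter> (\<theta> s -` B \<inter> \<Omega>)) = (\<integral>\<^sup>+\<omega>. indicator H \<omega> * emeasure (\<PP> (\<Phi> s \<omega>)) B \<partial>\<PP> x)"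
proof -
  interpret p: prob_space "\<PP> x" by (rule prob_space_PP)
  have H' [measurable]: "H \<in> p.events" using H Past_mono by (auto simp: sets_PP)
  let ?D = "density (\<PP> x) (indicator H)"
  have Pm: "\<Phi> s \<in> \<PP> x \<rightarrow>\<^sub>M borel" using Phi_Paths_measurable[OF s] by (simp add: measurable_PP)
  have Tm: "\<theta> s \<in> \<PP> x \<rightarrow>\<^sub>M Paths" using shift_measurable[OF s] by (simp add: measurable_PP)
  have K: "(\<lambda>\<omega>. \<PP> (\<Phi> s \<omega>)) \<in> ?D \<rightarrow>\<^sub>M subprob_algebra Paths"
    using measurable_compose[OF Pm PP_subkernel] by simp
  have ne: "space ?D \<noteq> {}" using p.not_empty by simp
  have 1: "emeasure (distr ?D Paths (\<theta> s)) A = emeasure (\<PP> x) (H \<inter> (\<theta> s -` A \<inter> \<Omega>))" if A: "A \<in> sets Paths" for A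
  proof -
    have "emeasure (distr ?D Paths (\<theta> s)) A = emeasure ?D (\<theta> s -` A \<inter> space (\<PP> x))"
      by (subst emeasure_distr) (use A Tm in auto)
    also have "\<dots> = emeasure (\<PP> x) (H \<inter> (\<theta> s -` A \<inter> space (\<PP> x)))"
      by (rule emeasure_restricted) (use A Tm in \<open>auto intro: measurable_sets\<close>)
    finally show ?thesis by (simp add: space_PP)
  qed
  have 2: "emeasure (?D \<bind> (\<lambda>\<omega>. \<PP> (\<Phi> s \<omega>))) A = (\<integral>\<^sup>+\<omega>. indicator H \<omega> * emeasure (\<PP> (\<Phi> s \<omega>)) A \<partial>\<PP> x)" if A: "A \<in> sets Paths" for A
  proof -
    have me: "(\<lambda>\<omega>. emeasure (\<PP> (\<Phi> s \<omega>)) A) \<in> borel_measurable (\<PP> x)"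
      using measurable_compose[OF K measurable_emeasure_subprob_algebra[OF A]] by simp
    show ?thesis unfolding emeasure_bind[OF ne K A] by (rule nn_integral_density) (use me in auto)
  qed
  have "distr ?D Paths (\<theta> s) = ?D \<bind> (\<lambda>\<omega>. \<PP> (\<Phi> s \<omega>))"
  proof (rule measure_eqI_generator_eq[OF rects_Int_stable rects_Pow, where A="\<lambda>_. \<Omega>"])
    fix A assume A: "A \<in> rects"
    then obtain l where l: "valid_cyl l" "A = cyl 0 l" using rects_cyl by blast
    have A': "A \<in> sets Paths" using A sets_Paths_rects by (auto intro: sigma_sets.Basic)
    have "emeasure (\<PP> x) (H \<inter> (\<theta> s -` A \<inter> \<Omega>)) = emeasure (\<PP> x) (H \<inter> cyl s l)"
      unfolding l(2) using cyl_shift[OF s _ l(1), of 0] by simp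
    also have "\<dots> = (\<integral>\<^sup>+\<omega>. indicator H \<omega> * emeasure (\<PP> (\<Phi> s \<omega>)) A \<partial>\<PP> x)"
      unfolding cyl_markov[OF l(1) s H] l(2) emeasure_cyl[OF l(1)] ..
    finally show "emeasure (distr ?D Paths (\<theta> s)) A = emeasure (?D \<bind> (\<lambda>\<omega>. \<PP> (\<Phi> s \<omega>))) A"
      unfolding 1[OF A'] 2[OF A'] .
  next
    have "\<Omega> \<in> sets Paths" using sets.top[of Paths] by (simp add: space_generated)
    from 1[OF this] show "emeasure (distr ?D Paths (\<theta> s)) \<Omega> \<noteq> \<infinity>" for i :: nat by simp
  qed (use sets_bind[OF sets_kernel[OF K] ne] in \<open>auto simp: sets_Paths_rects Omega_rects\<close>)
  with 1[OF B] 2[OF B] show ?thesis by simp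
qed

lemma PP_in: "\<PP> x \<in> space (prob_algebra Paths)"
  by (simp add: space_prob_algebra sets_PP prob_space_PP)

lemma law_in: "\<mu> \<in> prob_measures \<Longrightarrow> law_from \<PP> \<mu> \<in> space (prob_algebra Paths)"
  unfolding law_from_def
  using prob_space_bind'[OF _ PP_kernel, of \<mu>] sets_bind'[OF _ PP_kernel, of \<mu>] by (auto simp: space_prob_algebra)

lemma law_prob: "\<mu> \<in> prob_measures \<Longrightarrow> prob_space (law_from \<PP> \<mu>)"
  and law_sets: "\<mu> \<in> prob_measures \<Longrightarrow> sets (law_from \<PP> \<mu>) = sets Paths"
  and law_space: "\<mu> \<in> prob_measures \<Longrightarrow> space (law_from \<PP> \<mu>) = \<Omega>"
  using law_in[of \<mu>] sets_eq_imp_space_eq[of "law_from \<PP> \<mu>" Paths] by (auto simp: space_prob_algebra space_generated)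

lemma law_measurable: "\<mu> \<in> prob_measures \<Longrightarrow> measurable (law_from \<PP> \<mu>) M = measurable Paths M"
  by (rule measurable_cong_sets) (simp_all add: law_sets)

lemma return_in: "return borel x \<in> prob_measures"
  by (simp add: space_prob_algebra prob_space_return)

lemma law_return: "law_from \<PP> (return borel x) = \<PP> x"
  unfolding law_from_def by (rule bind_return[OF PP_subkernel]) simp

lemma nn_integral_law:
  assumes \<mu>: "\<mu> \<in> prob_measures" and h: "h \<in> borel_measurable Paths"
  shows "(\<integral>\<^sup>+\<omega>. h \<omega> \<partial>law_from \<PP> \<mu>) = (\<integral>\<^sup>+x. (\<integral>\<^sup>+\<omega>. h \<omega> \<partial>\<PP> x) \<partial>\<mu>)"
  unfolding law_from_def
  by (rule nn_integral_bind[OF h]) (use \<mu> PP_subkernel in \<open>auto simp: space_prob_algebra cong: measurable_cong_sets\<close>)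

text \<open>The law of a pair that consists of the given path and of an independent new path started at
  its current position.\<close>

definition joint_kernel :: "real \<Rightarrow> 'w \<Rightarrow> ('w \<times> 'w) measure" where
  "joint_kernel s \<omega> = distr (\<PP> (\<Phi> s \<omega>)) (Past s \<Otimes>\<^sub>M Paths) (\<lambda>\<omega>'. (\<omega>, \<omega>'))"

lemma id_Past: "(\<lambda>x. x) \<in> Paths \<rightarrow>\<^sub>M Past s"
  by (rule measurable_Past_Paths[of _ s]) simp

lemma PP_Phi_kernel: "0 \<le> s \<Longrightarrow> (\<lambda>\<omega>. \<PP> (\<Phi> s \<omega>)) \<in> Paths \<rightarrow>\<^sub>M prob_algebra Paths"
  using measurable_compose[OF Phi_Paths_measurable PP_kernel] .

lemma joint_kernel_measurable: "0 \<le> s \<Longrightarrow> joint_kernel s \<in> Paths \<rightarrow>\<^sub>M prob_algebra (Past s \<Otimes>\<^sub>M Paths)"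
proof (rule measurable_prob_algebraI)
  assume s: "0 \<le> s"
  have Id: "(\<lambda>\<omega>'. (\<omega>, \<omega>')) \<in> Paths \<rightarrow>\<^sub>M Past s \<Otimes>\<^sub>M Paths" if "\<omega> \<in> \<Omega>" for \<omega>
    by (rule measurable_Pair1') (simp add: that space_generated)
  show "prob_space (joint_kernel s \<omega>)" if "\<omega> \<in> space Paths" for \<omega>
    unfolding joint_kernel_def
    by (rule prob_space.prob_space_distr[OF prob_space_PP]) (use Id that in \<open>auto simp: measurable_PP space_generated\<close>)
  have "(\<lambda>(x, y). (x, y)) \<in> Paths \<Otimes>\<^sub>M Paths \<rightarrow>\<^sub>M Past s \<Otimes>\<^sub>M Paths"
    unfolding case_prod_beta by (intro measurable_Pair measurable_compose[OF measurable_fst id_Past]) simp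
  from measurable_distr2[OF this measurable_prob_algebraD[OF PP_Phi_kernel[OF s]]]
  show "joint_kernel s \<in> Paths \<rightarrow>\<^sub>M subprob_algebra (Past s \<Otimes>\<^sub>M Paths)"
    unfolding joint_kernel_def [abs_def] .
qed

lemma shift_pair_measurable: "0 \<le> s \<Longrightarrow> (\<lambda>\<omega>. (\<omega>, \<theta> s \<omega>)) \<in> Paths \<rightarrow>\<^sub>M Past s \<Otimes>\<^sub>M Paths"
  by (intro measurable_Pair id_Past shift_measurable)

lemma joint_PP:
  assumes s: "0 \<le> s"
  shows "distr (\<PP> x) (Past s \<Otimes>\<^sub>M Paths) (\<lambda>\<omega>. (\<omega>, \<theta> s \<omega>)) = \<PP> x \<bind> joint_kernel s"
    (is "?J1 = ?J2")
proof -
  let ?E = "{a \<times> b | a b. a \<in> sets (Past s) \<and> b \<in> sets Paths}"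
  interpret p: prob_space "\<PP> x" by (rule prob_space_PP)
  have m: "(\<lambda>\<omega>. (\<omega>, \<theta> s \<omega>)) \<in> \<PP> x \<rightarrow>\<^sub>M Past s \<Otimes>\<^sub>M Paths"
    using shift_pair_measurable[OF s] by (simp add: measurable_PP)
  have sJ2: "sets ?J2 = sets (Past s \<Otimes>\<^sub>M Paths)"
    by (rule sets_bind'[OF PP_in joint_kernel_measurable[OF s]])
  have spE: "\<Omega> \<times> \<Omega> = space (Past s) \<times> space Paths" by (simp add: space_generated)
  show ?thesis
  proof (rule measure_eqI_generator_eq[of ?E "\<Omega> \<times> \<Omega>" _ _ "\<lambda>_. \<Omega> \<times> \<Omega>"])
    show "Int_stable ?E" by (rule Int_stable_pair_measure_generator)
    show "?E \<subseteq> Pow (\<Omega> \<times> \<Omega>)" unfolding spE by (auto dest: sets.sets_into_space)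
    show "sets ?J1 = sigma_sets (\<Omega> \<times> \<Omega>) ?E" unfolding spE by (simp add: sets_pair_measure)
    show "sets ?J2 = sigma_sets (\<Omega> \<times> \<Omega>) ?E" unfolding spE sJ2 by (simp add: sets_pair_measure)
    show "range (\<lambda>_. \<Omega> \<times> \<Omega>) \<subseteq> ?E" unfolding spE by blast
    show "(\<Union>i. \<Omega> \<times> \<Omega>) = \<Omega> \<times> \<Omega>" by simp
    interpret d: prob_space ?J1 by (rule p.prob_space_distr[OF m])
    show "emeasure ?J1 (\<Omega> \<times> \<Omega>) \<noteq> \<infinity>" by simp
    fix X assume "X \<in> ?E"
    then obtain A B where X: "X = A \<times> B" and A: "A \<in> sets (Past s)" and B: "B \<in> sets Paths" by auto
    have X': "X \<in> sets (Past s \<Otimes>\<^sub>M Paths)" unfolding X using A B by auto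
    have "A \<subseteq> \<Omega>" using sets.sets_into_space[OF A] by (simp add: space_generated)
    have "emeasure ?J1 X = emeasure (\<PP> x) ((\<lambda>\<omega>. (\<omega>, \<theta> s \<omega>)) -` X \<inter> space (\<PP> x))"
      by (rule emeasure_distr[OF m X'])
    also have "(\<lambda>\<omega>. (\<omega>, \<theta> s \<omega>)) -` X \<inter> space (\<PP> x) = A \<inter> (\<theta> s -` B \<inter> \<Omega>)" using \<open>A \<subseteq> \<Omega>\<close> by (auto simp: X space_PP)
    also have "emeasure (\<PP> x) \<dots> = (\<integral>\<^sup>+\<omega>. indicator A \<omega> * emeasure (\<PP> (\<Phi> s \<omega>)) B \<partial>\<PP> x)"
      by (rule markov_path_event[OF s A B])
    also have "\<dots> = (\<integral>\<^sup>+\<omega>. emeasure (joint_kernel s \<omega>) X \<partial>\<PP> x)"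
    proof (rule nn_integral_cong)
      fix \<omega> assume "\<omega> \<in> space (\<PP> x)"
      then have "\<omega> \<in> \<Omega>" by (simp add: space_PP)
      then have "(\<lambda>\<omega>'. (\<omega>, \<omega>')) \<in> \<PP> (\<Phi> s \<omega>) \<rightarrow>\<^sub>M Past s \<Otimes>\<^sub>M Paths"
        unfolding measurable_PP by (intro measurable_Pair1') (simp add: space_generated)
      then have "emeasure (joint_kernel s \<omega>) X = emeasure (\<PP> (\<Phi> s \<omega>)) ((\<lambda>\<omega>'. (\<omega>, \<omega>')) -` X \<inter> space (\<PP> (\<Phi> s \<omega>)))"
        unfolding joint_kernel_def by (rule emeasure_distr[OF _ X'])
      also have "(\<lambda>\<omega>'. (\<omega>, \<omega>')) -` X \<inter> space (\<PP> (\<Phi> s \<omega>)) = (if \<omega> \<in> A then B else {})"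
        using sets.sets_into_space[OF B] by (auto simp: X space_PP space_generated)
      finally show "indicator A \<omega> * emeasure (\<PP> (\<Phi> s \<omega>)) B = emeasure (joint_kernel s \<omega>) X" by simp
    qed
    also have "\<dots> = emeasure ?J2 X"
      by (rule emeasure_bind_prob_algebra[OF PP_in joint_kernel_measurable[OF s] X', symmetric])
    finally show "emeasure ?J1 X = emeasure ?J2 X" .
  qed
qed

text \<open>The Markov property in its most useful form: if a path is looked at only through its past up
  to \<open>s\<close>, then its continuation \<open>\<theta> s \<omega>\<close> may be replaced by a new path started at \<open>\<Phi> s \<omega>\<close>.\<close>

lemma joint_law:
  assumes \<mu>: "\<mu> \<in> prob_measures" and s: "0 \<le> s"
  shows "distr (law_from \<PP> \<mu>) (Past s \<Otimes>\<^sub>M Paths) (\<lambda>\<omega>. (\<omega>, \<theta> s \<omega>)) = law_from \<PP> \<mu> \<bind> joint_kernel s"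
proof -
  have sm: "sets \<mu> = sets borel" using \<mu> by (simp add: space_prob_algebra)
  have K: "\<PP> \<in> \<mu> \<rightarrow>\<^sub>M subprob_algebra Paths" using PP_subkernel sm by (simp cong: measurable_cong_sets)
  have ne: "space \<mu> \<noteq> {}" using \<mu> prob_space.not_empty[of \<mu>] by (auto simp: space_prob_algebra)
  have "law_from \<PP> \<mu> \<bind> joint_kernel s = \<mu> \<bind> (\<lambda>x. \<PP> x \<bind> joint_kernel s)"
    unfolding law_from_def by (rule bind_assoc[OF K measurable_prob_algebraD[OF joint_kernel_measurable[OF s]]])
  also have "\<dots> = \<mu> \<bind> (\<lambda>x. distr (\<PP> x) (Past s \<Otimes>\<^sub>M Paths) (\<lambda>\<omega>. (\<omega>, \<theta> s \<omega>)))"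
    using joint_PP[OF s] by simp
  also have "\<dots> = distr (law_from \<PP> \<mu>) (Past s \<Otimes>\<^sub>M Paths) (\<lambda>\<omega>. (\<omega>, \<theta> s \<omega>))"
    unfolding law_from_def by (rule distr_bind[OF K ne shift_pair_measurable[OF s], symmetric])
  finally show ?thesis by simp
qed

lemma joint_kernel_nn:
  assumes "\<omega> \<in> \<Omega>" and h: "h \<in> borel_measurable (Past s \<Otimes>\<^sub>M Paths)"
  shows "(\<integral>\<^sup>+z. h z \<partial>joint_kernel s \<omega>) = (\<integral>\<^sup>+\<omega>'. h (\<omega>, \<omega>') \<partial>\<PP> (\<Phi> s \<omega>))"
  unfolding joint_kernel_def using assms
  by (intro nn_integral_distr) (auto simp: measurable_PP space_generated intro!: measurable_Pair1')

lemma joint_kernel_integral: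
  fixes h :: "'w \<times> 'w \<Rightarrow> real"
  assumes "\<omega> \<in> \<Omega>" and h: "h \<in> borel_measurable (Past s \<Otimes>\<^sub>M Paths)"
  shows "(\<integral>z. h z \<partial>joint_kernel s \<omega>) = (\<integral>\<omega>'. h (\<omega>, \<omega>') \<partial>\<PP> (\<Phi> s \<omega>))"
  unfolding joint_kernel_def using assms
  by (intro integral_distr) (auto simp: measurable_PP space_generated intro!: measurable_Pair1')

lemma markov_nn:
  assumes \<mu>: "\<mu> \<in> prob_measures" and s: "0 \<le> s" and h: "h \<in> borel_measurable (Past s \<Otimes>\<^sub>M Paths)"
  shows "(\<integral>\<^sup>+\<omega>. h (\<omega>, \<theta> s \<omega>) \<partial>law_from \<PP> \<mu>) = (\<integral>\<^sup>+\<omega>. (\<integral>\<^sup>+\<omega>'. h (\<omega>, \<omega>') \<partial>\<PP> (\<Phi> s \<omega>)) \<partial>law_from \<PP> \<mu>)"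
proof -
  have "(\<integral>\<^sup>+\<omega>. h (\<omega>, \<theta> s \<omega>) \<partial>law_from \<PP> \<mu>) = (\<integral>\<^sup>+z. h z \<partial>distr (law_from \<PP> \<mu>) (Past s \<Otimes>\<^sub>M Paths) (\<lambda>\<omega>. (\<omega>, \<theta> s \<omega>)))"
    by (rule nn_integral_distr[symmetric]) (use shift_pair_measurable[OF s] h in \<open>auto simp: law_measurable[OF \<mu>]\<close>)
  also have "\<dots> = (\<integral>\<^sup>+\<omega>. (\<integral>\<^sup>+z. h z \<partial>joint_kernel s \<omega>) \<partial>law_from \<PP> \<mu>)"
    unfolding joint_law[OF \<mu> s]
    by (rule nn_integral_bind[OF h]) (use measurable_prob_algebraD[OF joint_kernel_measurable[OF s]] in \<open>simp add: law_measurable[OF \<mu>]\<close>)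
  also have "\<dots> = (\<integral>\<^sup>+\<omega>. (\<integral>\<^sup>+\<omega>'. h (\<omega>, \<omega>') \<partial>\<PP> (\<Phi> s \<omega>)) \<partial>law_from \<PP> \<mu>)"
    by (rule nn_integral_cong) (use h in \<open>simp add: law_space[OF \<mu>] joint_kernel_nn\<close>)
  finally show ?thesis .
qed

lemma markov_integral:
  fixes h :: "'w \<times> 'w \<Rightarrow> real"
  assumes \<mu>: "\<mu> \<in> prob_measures" and s: "0 \<le> s" and h: "h \<in> borel_measurable (Past s \<Otimes>\<^sub>M Paths)"
    and int: "integrable (law_from \<PP> \<mu>) (\<lambda>\<omega>. h (\<omega>, \<theta> s \<omega>))"
  shows "(\<integral>\<omega>. h (\<omega>, \<theta> s \<omega>) \<partial>law_from \<PP> \<mu>) = (\<integral>\<omega>. (\<integral>\<omega>'. h (\<omega>, \<omega>') \<partial>\<PP> (\<Phi> s \<omega>)) \<partial>law_from \<PP> \<mu>)"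
proof -
  have m: "(\<lambda>\<omega>. (\<omega>, \<theta> s \<omega>)) \<in> law_from \<PP> \<mu> \<rightarrow>\<^sub>M Past s \<Otimes>\<^sub>M Paths"
    using shift_pair_measurable[OF s] by (simp add: law_measurable[OF \<mu>])
  have "(\<integral>\<omega>. h (\<omega>, \<theta> s \<omega>) \<partial>law_from \<PP> \<mu>) = (\<integral>z. h z \<partial>distr (law_from \<PP> \<mu>) (Past s \<Otimes>\<^sub>M Paths) (\<lambda>\<omega>. (\<omega>, \<theta> s \<omega>)))"
    by (rule integral_distr[symmetric, OF m h])
  also have "\<dots> = (\<integral>\<omega>. (\<integral>z. h z \<partial>joint_kernel s \<omega>) \<partial>law_from \<PP> \<mu>)"
    unfolding joint_law[OF \<mu> s]
    by (rule integral_bind_integrable[OF law_in[OF \<mu>] joint_kernel_measurable[OF s]])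
      (use int in \<open>simp add: joint_law[OF \<mu> s, symmetric] integrable_distr_eq[OF m h]\<close>)
  also have "\<dots> = (\<integral>\<omega>. (\<integral>\<omega>'. h (\<omega>, \<omega>') \<partial>\<PP> (\<Phi> s \<omega>)) \<partial>law_from \<PP> \<mu>)"
    by (rule Bochner_Integration.integral_cong) (use h in \<open>simp_all add: law_space[OF \<mu>] joint_kernel_integral\<close>)
  finally show ?thesis .
qed

text \<open>Needed to integrate the inner expectation of the Markov property once more.\<close>

lemma integral_PP_measurable:
  fixes h :: "'w \<times> 'w \<Rightarrow> real"
  assumes s: "0 \<le> s" and h: "h \<in> borel_measurable (Past s \<Otimes>\<^sub>M Paths)"
  shows "(\<lambda>\<omega>. \<integral>\<omega>'. h (\<omega>, \<omega>') \<partial>\<PP> (\<Phi> s \<omega>)) \<in> borel_measurable Paths"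
proof -
  have "(\<lambda>\<omega>. \<integral>z. h z \<partial>joint_kernel s \<omega>) \<in> borel_measurable Paths"
    using measurable_compose[OF measurable_prob_algebraD[OF joint_kernel_measurable[OF s]] integral_measurable_subprob_algebra[OF h]] by simp
  then show ?thesis
    by (subst measurable_cong[where g="\<lambda>\<omega>. \<integral>z. h z \<partial>joint_kernel s \<omega>"]) (use h in \<open>auto simp: space_generated joint_kernel_integral\<close>)
qed

lemma PP_integral_measurable: "h \<in> borel_measurable Paths \<Longrightarrow> (\<lambda>x. \<integral>\<omega>. (h \<omega> :: real) \<partial>\<PP> x) \<in> borel_measurable borel"
  using measurable_compose[OF PP_subkernel integral_measurable_subprob_algebra] by simp

lemma PP_nn_measurable: "h \<in> borel_measurable Paths \<Longrightarrow> (\<lambda>x. \<integral>\<^sup>+\<omega>. h \<omega> \<partial>\<PP> x) \<in> borel_measurable borel"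
  using measurable_compose[OF PP_subkernel nn_integral_measurable_subprob_algebra] by simp

lemma integral_law:
  fixes h :: "'w \<Rightarrow> real"
  assumes \<mu>: "\<mu> \<in> prob_measures" and int: "integrable (law_from \<PP> \<mu>) h"
  shows "(\<integral>\<omega>. h \<omega> \<partial>law_from \<PP> \<mu>) = (\<integral>x. (\<integral>\<omega>. h \<omega> \<partial>\<PP> x) \<partial>\<mu>)"
  using integral_bind_integrable[OF \<mu> PP_kernel] int unfolding law_from_def by simp

lemma Phi_law: "0 \<le> t \<Longrightarrow> \<mu> \<in> prob_measures \<Longrightarrow> distr (law_from \<PP> \<mu>) borel (\<Phi> t) = \<mu> \<bind> P t"
proof -
  assume t: "0 \<le> t" and \<mu>: "\<mu> \<in> prob_measures"
  have K: "\<PP> \<in> \<mu> \<rightarrow>\<^sub>M subprob_algebra Paths" using PP_subkernel \<mu> by (simp add: space_prob_algebra cong: measurable_cong_sets)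
  have ne: "space \<mu> \<noteq> {}" using \<mu> prob_space.not_empty[of \<mu>] by (auto simp: space_prob_algebra)
  show ?thesis unfolding law_from_def distr_bind[OF K ne Phi_Paths_measurable[OF t]] using distr_Phi[OF t] by simp
qed

lemma nn_integral_Phi:
  assumes t: "0 \<le> t" and \<mu>: "\<mu> \<in> prob_measures" and k: "k \<in> borel_measurable borel"
  shows "(\<integral>\<^sup>+\<omega>. k (\<Phi> t \<omega>) \<partial>law_from \<PP> \<mu>) = (\<integral>\<^sup>+x. k x \<partial>(\<mu> \<bind> P t))"
  unfolding Phi_law[OF t \<mu>, symmetric] using Phi_Paths_measurable[OF t] k
  by (intro nn_integral_distr[symmetric]) (simp_all add: law_measurable[OF \<mu>])

lemma integral_Phi:
  fixes k :: "'a \<Rightarrow> real"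
  assumes t: "0 \<le> t" and \<mu>: "\<mu> \<in> prob_measures" and k: "k \<in> borel_measurable borel"
  shows "(\<integral>\<omega>. k (\<Phi> t \<omega>) \<partial>law_from \<PP> \<mu>) = (\<integral>x. k x \<partial>(\<mu> \<bind> P t))"
  unfolding Phi_law[OF t \<mu>, symmetric] using Phi_Paths_measurable[OF t] k
  by (intro integral_distr[symmetric]) (simp_all add: law_measurable[OF \<mu>])

lemma integral_Phi_PP:
  fixes k :: "'a \<Rightarrow> real"
  assumes t: "0 \<le> t" and k: "k \<in> borel_measurable borel"
  shows "(\<integral>\<omega>. k (\<Phi> t \<omega>) \<partial>\<PP> x) = (\<integral>y. k y \<partial>P t x)"
  unfolding distr_Phi[OF t, symmetric] using Phi_Paths_measurable[OF t] k
  by (intro integral_distr[symmetric]) (simp_all add: measurable_PP)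

lemma nn_integral_shift_invariant:
  assumes inv: "invariant_prob P \<nu>" and t: "0 \<le> t" and h: "h \<in> borel_measurable Paths"
  shows "(\<integral>\<^sup>+\<omega>. h (\<theta> t \<omega>) \<partial>law_from \<PP> \<nu>) = (\<integral>\<^sup>+\<omega>. h \<omega> \<partial>law_from \<PP> \<nu>)"
proof -
  have \<nu>: "\<nu> \<in> prob_measures" and e: "\<nu> \<bind> P t = \<nu>" using inv t by (auto simp: invariant_prob_def)
  have "(\<integral>\<^sup>+\<omega>. h (\<theta> t \<omega>) \<partial>law_from \<PP> \<nu>) = (\<integral>\<^sup>+\<omega>. (\<integral>\<^sup>+\<omega>'. h \<omega>' \<partial>\<PP> (\<Phi> t \<omega>)) \<partial>law_from \<PP> \<nu>)"
    using markov_nn[OF \<nu> t, of "\<lambda>z. h (snd z)"] h by simp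
  also have "\<dots> = (\<integral>\<^sup>+x. (\<integral>\<^sup>+\<omega>'. h \<omega>' \<partial>\<PP> x) \<partial>\<nu>)"
    using nn_integral_Phi[OF t \<nu> PP_nn_measurable[OF h]] e by simp
  finally show ?thesis using nn_integral_law[OF \<nu> h] by simp
qed

text \<open>A shift replaces the initial law \<open>\<nu>\<close> by \<open>\<nu>P\<^sub>t\<close>, which is \<open>\<nu>\<close> again.\<close>

lemma shift_invariant_law:
  assumes inv: "invariant_prob P \<nu>" and t: "0 \<le> t"
  shows "distr (law_from \<PP> \<nu>) Paths (\<theta> t) = law_from \<PP> \<nu>"
proof (rule measure_eqI)
  have \<nu>: "\<nu> \<in> prob_measures" using inv by (auto simp: invariant_prob_def)
  show "sets (distr (law_from \<PP> \<nu>) Paths (\<theta> t)) = sets (law_from \<PP> \<nu>)" by (simp add: law_sets[OF \<nu>])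
  fix A assume "A \<in> sets (distr (law_from \<PP> \<nu>) Paths (\<theta> t))"
  then have A: "A \<in> sets Paths" by simp
  have m: "\<theta> t \<in> law_from \<PP> \<nu> \<rightarrow>\<^sub>M Paths" using shift_measurable[OF t] by (simp add: law_measurable[OF \<nu>])
  have "emeasure (distr (law_from \<PP> \<nu>) Paths (\<theta> t)) A = (\<integral>\<^sup>+z. indicator A z \<partial>distr (law_from \<PP> \<nu>) Paths (\<theta> t))" using A by simp
  also have "\<dots> = (\<integral>\<^sup>+\<omega>. indicator A (\<theta> t \<omega>) \<partial>law_from \<PP> \<nu>)"
    by (rule nn_integral_distr[OF m]) (use A in simp)
  also have "\<dots> = (\<integral>\<^sup>+\<omega>. indicator A \<omega> \<partial>law_from \<PP> \<nu>)" by (rule nn_integral_shift_invariant[OF inv t]) (use A in simp)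
  also have "\<dots> = emeasure (law_from \<PP> \<nu>) A" using A by (simp add: law_sets[OF \<nu>])
  finally show "emeasure (distr (law_from \<PP> \<nu>) Paths (\<theta> t)) A = emeasure (law_from \<PP> \<nu>) A" .
qed

end

section \<open>Bounded additive functionals\<close>

locale bounded_functional = progressive_markov_process P \<Omega> \<Phi> \<theta> \<PP>
  for P :: "real \<Rightarrow> 'a::polish_space \<Rightarrow> 'a measure" and \<Omega> :: "'w set" and \<Phi> \<theta> \<PP> +
  fixes g :: "'a \<Rightarrow> real" and G :: real
  assumes g_measurable [measurable]: "g \<in> borel_measurable borel"
    and g_bounded: "\<And>x. \<bar>g x\<bar> \<le> G"
begin

abbreviation "I \<equiv> integral_functional \<Phi> g"

lemma G_nonneg: "0 \<le> G"
  using g_bounded[of undefined] by linarith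

lemma progressive_g:
  assumes "0 \<le> t"
  shows "(\<lambda>(s, \<omega>). g (\<Phi> s \<omega>)) \<in> borel_measurable (restrict_space borel {0..t} \<Otimes>\<^sub>M Past t)"
  using measurable_compose[OF progressive[OF assms] g_measurable] by (simp add: case_prod_beta)

lemma indicator_integrable: "integrable lborel (indicator {0..t::real} :: real \<Rightarrow> real)"
  by (rule integrable_real_indicator) (auto simp: emeasure_lborel_Icc_eq)

lemma path_set_integrable:
  assumes "\<omega> \<in> \<Omega>" "0 \<le> t"
  shows "set_integrable lborel {0..t} (\<lambda>s. g (\<Phi> s \<omega>))"
proof -
  have "(\<lambda>s. case_prod (\<lambda>s \<omega>. g (\<Phi> s \<omega>)) (s, \<omega>)) \<in> borel_measurable (restrict_space borel {0..t})"
    by (rule measurable_compose[OF measurable_Pair2' progressive_g[OF assms(2)]]) (simp add: assms space_generated)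
  then have "(\<lambda>s. g (\<Phi> s \<omega>)) \<in> borel_measurable (restrict_space lborel {0..t})"
    by (simp cong: measurable_cong_sets add: sets_restrict_space)
  then have m: "(\<lambda>s. indicator {0..t} s *\<^sub>R g (\<Phi> s \<omega>)) \<in> borel_measurable lborel"
    by (subst (asm) borel_measurable_restrict_space_iff) auto
  show ?thesis unfolding set_integrable_def
  proof (rule Bochner_Integration.integrable_bound[OF _ m])
    show "integrable lborel (\<lambda>s. G * indicator {0..t} s)"
      by (intro integrable_mult_right indicator_integrable)
    show "AE s in lborel. norm (indicator {0..t} s *\<^sub>R g (\<Phi> s \<omega>)) \<le> norm (G * indicator {0..t} s)"
      using g_bounded G_nonneg by (auto split: split_indicator)
  qed
qed

lemma I_bound:
  assumes "\<omega> \<in> \<Omega>" "0 \<le> t" shows "\<bar>I t \<omega>\<bar> \<le> G * t"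
proof -
  have "\<bar>I t \<omega>\<bar> \<le> (\<integral>s. \<bar>indicator {0..t} s *\<^sub>R g (\<Phi> s \<omega>)\<bar> \<partial>lborel)"
    unfolding integral_functional_def set_lebesgue_integral_def by (rule integral_abs_bound)
  also have "\<dots> \<le> (\<integral>s. G * indicator {0..t} s \<partial>lborel)"
    by (rule integral_mono) (use path_set_integrable[OF assms] indicator_integrable[of t] g_bounded G_nonneg in \<open>auto simp: set_integrable_def split: split_indicator\<close>)
  also have "\<dots> = G * t" using assms by simp
  finally show ?thesis .
qed

text \<open>Progressive measurability of the process makes the time integral adapted.\<close>

lemma I_Past:
  assumes t: "0 \<le> t" shows "I t \<in> borel_measurable (Past t)"
proof -
  have rs: "sigma_finite_measure (restrict_space lborel {0..t})"
    by (rule sigma_finite_measure_restrict_space) (auto intro: sigma_finite_lborel)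
  have m: "(\<lambda>(\<omega>, s). g (\<Phi> s \<omega>)) \<in> borel_measurable (Past t \<Otimes>\<^sub>M restrict_space lborel {0..t})"
  proof -
    have "sets (restrict_space lborel {0..t}) = sets (restrict_space borel {0..t})" by (simp add: sets_restrict_space)
    then have "(\<lambda>(s, \<omega>). g (\<Phi> s \<omega>)) \<in> borel_measurable (restrict_space lborel {0..t} \<Otimes>\<^sub>M Past t)"
      using progressive_g[OF t] measurable_cong_sets[OF sets_pair_measure_cong[of "restrict_space lborel {0..t}" "restrict_space borel {0..t}" "Past t" "Past t"], of borel borel] by simp
    from measurable_pair_swap[OF this] show ?thesis by (simp add: case_prod_beta)
  qed
  have "I t = (\<lambda>\<omega>. \<integral>s. g (\<Phi> s \<omega>) \<partial>restrict_space lborel {0..t})"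
    unfolding integral_functional_def set_lebesgue_integral_def by (simp add: integral_restrict_space fun_eq_iff)
  also have "\<dots> \<in> borel_measurable (Past t)"
    by (rule sigma_finite_measure.borel_measurable_lebesgue_integral[OF rs m])
  finally show ?thesis .
qed

lemma I_measurable [measurable]: "0 \<le> t \<Longrightarrow> I t \<in> borel_measurable Paths"
  by (rule measurable_Past_Paths[OF I_Past])

lemma shift_in: "0 \<le> t \<Longrightarrow> \<omega> \<in> \<Omega> \<Longrightarrow> \<theta> t \<omega> \<in> \<Omega>"
  using shift_closed by auto

text \<open>Additivity along the shift, on which all decompositions into time blocks rest.\<close>

lemma I_add:
  assumes \<omega>: "\<omega> \<in> \<Omega>" and s: "0 \<le> s" and t: "0 \<le> t"
  shows "I (s + t) \<omega> = I s \<omega> + I t (\<theta> s \<omega>)"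
proof -
  let ?f = "\<lambda>u. g (\<Phi> u \<omega>)"
  have i: "set_integrable lborel {0..s+t} ?f" by (rule path_set_integrable) (use assms in auto)
  have "{0..s+t} = {0..s} \<union> {s<..s+t}" using s t by auto
  then have "I (s + t) \<omega> = (LBINT u:{0..s} \<union> {s<..s+t}. ?f u)" by (simp add: integral_functional_def)
  also have "\<dots> = (LBINT u:{0..s}. ?f u) + (LBINT u:{s<..s+t}. ?f u)"
    by (rule set_integral_Un) (use s t in \<open>auto intro: set_integrable_subset[OF i]\<close>)
  also have "(LBINT u:{s<..s+t}. ?f u) = (LBINT u:{s..s+t}. ?f u)"
    unfolding set_lebesgue_integral_def
    by (rule integral_discrete_difference[of "{s}"]) (auto split: split_indicator)
  also have "\<dots> = (\<integral>u. indicator {s..s+t} (s + 1 * u) *\<^sub>R ?f (s + 1 * u) \<partial>lborel)"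
    unfolding set_lebesgue_integral_def by (subst lborel_integral_real_affine[where c=1 and t=s]) auto
  also have "\<dots> = I t (\<theta> s \<omega>)"
    unfolding integral_functional_def set_lebesgue_integral_def
    by (rule Bochner_Integration.integral_cong) (use shift[OF _ s \<omega>] in \<open>auto simp: add.commute split: split_indicator\<close>)
  finally show ?thesis by (simp add: integral_functional_def)
qed

text \<open>Consistency of iterated shifts, read off from the additivity of the functional.\<close>

lemma I_shift_shift:
  assumes \<omega>: "\<omega> \<in> \<Omega>" and s: "0 \<le> s" and r: "0 \<le> r" and t: "0 \<le> t"
  shows "I t (\<theta> r (\<theta> s \<omega>)) = I t (\<theta> (s + r) \<omega>)"
proof -
  have "I (s + (r + t)) \<omega> = I s \<omega> + (I r (\<theta> s \<omega>) + I t (\<theta> r (\<theta> s \<omega>)))"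
    using assms shift_in by (subst I_add, simp_all) (subst I_add, simp_all)
  moreover have "I ((s + r) + t) \<omega> = (I s \<omega> + I r (\<theta> s \<omega>)) + I t (\<theta> (s + r) \<omega>)"
    using assms by (subst I_add, simp_all) (subst I_add, simp_all)
  ultimately show ?thesis by (simp add: add.assoc)
qed

lemma I_diff_bound:
  assumes \<omega>: "\<omega> \<in> \<Omega>" and "0 \<le> s" "s \<le> t" shows "\<bar>I t \<omega> - I s \<omega>\<bar> \<le> G * (t - s)"
proof -
  have "I t \<omega> = I s \<omega> + I (t - s) (\<theta> s \<omega>)" using I_add[of \<omega> s "t - s"] assms by simp
  then show ?thesis using I_bound[of "\<theta> s \<omega>" "t - s"] shift_in assms by simp
qed

lemma I_0: "I 0 \<omega> = 0"
proof -
  have "(LBINT s:{0..0}. g (\<Phi> s \<omega>)) = (LBINT s:{}. g (\<Phi> s \<omega>))"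
    unfolding set_lebesgue_integral_def by (rule integral_discrete_difference[of "{0}"]) (auto split: split_indicator)
  then show ?thesis by (simp add: integral_functional_def set_lebesgue_integral_def)
qed

lemma integrable_bounded_law:
  fixes h :: "'w \<Rightarrow> real"
  assumes \<mu>: "\<mu> \<in> prob_measures" and "h \<in> borel_measurable Paths" "\<And>\<omega>. \<omega> \<in> \<Omega> \<Longrightarrow> \<bar>h \<omega>\<bar> \<le> B"
  shows "integrable (law_from \<PP> \<mu>) h"
proof -
  interpret prob_space "law_from \<PP> \<mu>" by (rule law_prob[OF \<mu>])
  show ?thesis by (rule integrable_const_bound[of _ B]) (use assms in \<open>auto simp: law_space law_measurable\<close>)
qed

lemma integrable_bounded_PP:
  fixes h :: "'w \<Rightarrow> real"
  assumes "h \<in> borel_measurable Paths" "\<And>\<omega>. \<omega> \<in> \<Omega> \<Longrightarrow> \<bar>h \<omega>\<bar> \<le> B"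
  shows "integrable (\<PP> x) h"
  using integrable_bounded_law[OF return_in assms, of x] by (simp add: law_return)

lemma finite_measure_interval: "finite_measure (restrict_space lborel {0..t::real})"
  by (rule finite_measureI) (simp add: space_restrict_space emeasure_restrict_space emeasure_lborel_Icc_eq)

lemma path_joint_measurable:
  assumes t: "0 \<le> t" and \<mu>: "\<mu> \<in> prob_measures"
  shows "(\<lambda>(s, \<omega>). g (\<Phi> s \<omega>)) \<in> borel_measurable (restrict_space lborel {0..t} \<Otimes>\<^sub>M law_from \<PP> \<mu>)"
proof -
  let ?R = "restrict_space lborel {0..t}" and ?L = "law_from \<PP> \<mu>"
  have sR: "sets ?R = sets (restrict_space borel {0..t})" by (simp add: sets_restrict_space)
  have "(\<lambda>z. (fst z, snd z)) \<in> ?R \<Otimes>\<^sub>M ?L \<rightarrow>\<^sub>M restrict_space borel {0..t} \<Otimes>\<^sub>M Past t"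
  proof (rule measurable_Pair)
    show "fst \<in> ?R \<Otimes>\<^sub>M ?L \<rightarrow>\<^sub>M restrict_space borel {0..t}"
      using measurable_fst[of ?R ?L] measurable_cong_sets[OF refl sR] by blast
    show "snd \<in> ?R \<Otimes>\<^sub>M ?L \<rightarrow>\<^sub>M Past t"
      using measurable_compose[OF measurable_snd[of ?R ?L], of "\<lambda>x. x" "Past t"] id_Past[of t] by (simp add: law_measurable[OF \<mu>])
  qed
  from measurable_compose[OF this progressive_g[OF t]] show ?thesis by (simp add: case_prod_beta)
qed

lemma path_fubini:
  assumes t: "0 \<le> t" and \<mu>: "\<mu> \<in> prob_measures"
  shows "(\<integral>\<omega>. I t \<omega> \<partial>law_from \<PP> \<mu>) = (\<integral>s. (\<integral>\<omega>. g (\<Phi> s \<omega>) \<partial>law_from \<PP> \<mu>) \<partial>restrict_space lborel {0..t})"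
    and "(\<lambda>s. \<integral>\<omega>. g (\<Phi> s \<omega>) \<partial>law_from \<PP> \<mu>) \<in> borel_measurable (restrict_space lborel {0..t})"
proof -
  define R where "R = restrict_space lborel {0..t}"
  interpret R: finite_measure R unfolding R_def by (rule finite_measure_interval)
  interpret p: prob_space "law_from \<PP> \<mu>" by (rule law_prob[OF \<mu>])
  interpret RP: pair_sigma_finite R "law_from \<PP> \<mu>" by (intro pair_sigma_finite.intro R.sigma_finite_measure p.sigma_finite_measure)
  note gm = path_joint_measurable[OF t \<mu>, folded R_def]
  have RPfin: "finite_measure (R \<Otimes>\<^sub>M law_from \<PP> \<mu>)" by (rule finite_measure_pair_measure) unfold_locales
  have int: "integrable (R \<Otimes>\<^sub>M law_from \<PP> \<mu>) (\<lambda>(s, \<omega>). g (\<Phi> s \<omega>))"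
    by (rule finite_measure.integrable_const_bound[OF RPfin, of _ G]) (use g_bounded gm in auto)
  have "(\<integral>\<omega>. I t \<omega> \<partial>law_from \<PP> \<mu>) = (\<integral>\<omega>. (\<integral>s. g (\<Phi> s \<omega>) \<partial>R) \<partial>law_from \<PP> \<mu>)"
    unfolding integral_functional_def set_lebesgue_integral_def R_def by (simp add: integral_restrict_space)
  also have "\<dots> = (\<integral>s. (\<integral>\<omega>. g (\<Phi> s \<omega>) \<partial>law_from \<PP> \<mu>) \<partial>R)" using RP.Fubini_integral[OF int] by simp
  finally show "(\<integral>\<omega>. I t \<omega> \<partial>law_from \<PP> \<mu>) = (\<integral>s. (\<integral>\<omega>. g (\<Phi> s \<omega>) \<partial>law_from \<PP> \<mu>) \<partial>restrict_space lborel {0..t})"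
    unfolding R_def .
  show "(\<lambda>s. \<integral>\<omega>. g (\<Phi> s \<omega>) \<partial>law_from \<PP> \<mu>) \<in> borel_measurable (restrict_space lborel {0..t})"
    using p.borel_measurable_lebesgue_integral[OF gm] unfolding R_def .
qed

lemma markov_integral_PP:
  fixes h :: "'w \<times> 'w \<Rightarrow> real"
  assumes "0 \<le> s" "h \<in> borel_measurable (Past s \<Otimes>\<^sub>M Paths)" "integrable (\<PP> x) (\<lambda>\<omega>. h (\<omega>, \<theta> s \<omega>))"
  shows "(\<integral>\<omega>. h (\<omega>, \<theta> s \<omega>) \<partial>\<PP> x) = (\<integral>\<omega>. (\<integral>\<omega>'. h (\<omega>, \<omega>') \<partial>\<PP> (\<Phi> s \<omega>)) \<partial>\<PP> x)"
  using markov_integral[OF return_in[of x]] assms by (simp add: law_return)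

end

section \<open>Lipschitz dependence on the starting point\<close>

text \<open>The contraction is stated for integrals of Lipschitz functions, the form in which it is
  applied; by duality this is the bound for the Wasserstein distance (\<open>d_W_contraction\<close>).\<close>

locale contractive_functional = bounded_functional P \<Omega> \<Phi> \<theta> \<PP> g G
  for P :: "real \<Rightarrow> 'a::polish_space \<Rightarrow> 'a measure" and \<Omega> :: "'w set" and \<Phi> \<theta> \<PP> g G +
  fixes Lg \<gamma> :: real
  assumes g_lipschitz: "\<And>x y. \<bar>g x - g y\<bar> \<le> Lg * dist x y"
    and Lg_nonneg: "0 \<le> Lg"
    and gamma_pos: "0 < \<gamma>"
    and contraction: "\<And>v L t x y. 0 \<le> t \<Longrightarrow> (\<And>a b. \<bar>v a - v b\<bar> \<le> L * dist a b) \<Longrightarrow>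
      \<bar>(\<integral>z. v z \<partial>P t x) - (\<integral>z. v z \<partial>P t y)\<bar> \<le> exp (- \<gamma> * t) * L * dist x y"
    and A1: "cond_A1 P"
begin

lemma lipschitz_measurable:
  fixes v :: "'a \<Rightarrow> real" assumes "\<And>a b. \<bar>v a - v b\<bar> \<le> L * dist a b" shows "v \<in> borel_measurable borel"
proof (rule borel_measurable_continuous_onI)
  have "(max L 0)-lipschitz_on UNIV v"
  proof (rule lipschitz_onI)
    fix x y :: 'a have "L * dist x y \<le> max L 0 * dist x y" by (rule mult_right_mono) auto
    with assms[of x y] show "dist (v x) (v y) \<le> max L 0 * dist x y" by (simp add: dist_real_def)
  qed simp
  then show "continuous_on UNIV v" by (rule lipschitz_on_continuous_on)
qed

definition path_sum :: "real \<Rightarrow> nat \<Rightarrow> 'w \<Rightarrow> real" where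
  "path_sum h N \<omega> = (\<Sum>i<N. g (\<Phi> ((real i + 1) * h) \<omega>))"

lemma path_sum_measurable [measurable]: "0 \<le> h \<Longrightarrow> path_sum h N \<in> borel_measurable Paths"
  unfolding path_sum_def [abs_def] by measurable

lemma path_sum_Suc:
  assumes "0 \<le> h" "\<omega> \<in> \<Omega>" shows "path_sum h (Suc N) \<omega> = g (\<Phi> h \<omega>) + path_sum h N (\<theta> h \<omega>)"
proof -
  have "\<Phi> ((real (Suc i) + 1) * h) \<omega> = \<Phi> ((real i + 1) * h) (\<theta> h \<omega>)" for i
    using shift[of "(real i + 1) * h" h \<omega>] assms by (simp add: algebra_simps)
  then show ?thesis unfolding path_sum_def by (subst sum.lessThan_Suc_shift) simp
qed

text \<open>Peel off the first grid point. If the constant is \<open>C = Lf Lg / \<gamma>\<close> for the remaining sum,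
  then the expectation as a function of the first position has Lipschitz constant
  \<open>Lf h Lg + C = C (1 + \<gamma> h)\<close>, and one step of length \<open>h\<close> contracts it by
  \<open>exp (-\<gamma> h) \<le> 1 / (1 + \<gamma> h)\<close>. The constant therefore survives every number of steps.\<close>

lemma riemann_lipschitz:
  assumes h: "0 \<le> h" and f [measurable]: "f \<in> borel_measurable borel" and fB: "\<And>z. \<bar>f z\<bar> \<le> B" and fL: "\<And>z w. \<bar>f z - f w\<bar> \<le> Lf * \<bar>z - w\<bar>"
  shows "\<bar>(\<integral>\<omega>. f (s + h * path_sum h N \<omega>) \<partial>\<PP> x) - (\<integral>\<omega>. f (s + h * path_sum h N \<omega>) \<partial>\<PP> y)\<bar> \<le> Lf * Lg / \<gamma> * dist x y"
proof (induction N arbitrary: s x y)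
  case 0
  have Lf: "0 \<le> Lf" using order_trans[OF abs_ge_zero fL[of 1 0]] by simp
  have "0 \<le> Lf * (Lg * dist x y) / \<gamma>" using Lf Lg_nonneg gamma_pos by simp
  then show ?case using prob_space.prob_space[OF prob_space_PP] by (simp add: path_sum_def)
next
  case (Suc N)
  have Lf: "0 \<le> Lf" using order_trans[OF abs_ge_zero fL[of 1 0]] by simp
  define u where "u s x = (\<integral>\<omega>. f (s + h * path_sum h N \<omega>) \<partial>\<PP> x)" for s x
  have ii: "integrable (\<PP> x) (\<lambda>\<omega>. f (s + h * path_sum h N \<omega>))" for s x
    by (rule integrable_bounded_PP[of _ B]) (use fB h in auto)
  have us: "\<bar>u s x - u s' x\<bar> \<le> Lf * \<bar>s - s'\<bar>" for s s' x
  proof -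
    interpret p: prob_space "\<PP> x" by (rule prob_space_PP)
    have "u s x - u s' x = (\<integral>\<omega>. f (s + h * path_sum h N \<omega>) - f (s' + h * path_sum h N \<omega>) \<partial>\<PP> x)"
      unfolding u_def using ii by simp
    also have "\<bar>\<dots>\<bar> \<le> (\<integral>\<omega>. \<bar>f (s + h * path_sum h N \<omega>) - f (s' + h * path_sum h N \<omega>)\<bar> \<partial>\<PP> x)" by (rule integral_abs_bound)
    also have "\<dots> \<le> (\<integral>\<omega>. Lf * \<bar>s - s'\<bar> \<partial>\<PP> x)"
      by (rule integral_mono) (use ii in \<open>auto intro: order_trans[OF fL]\<close>)
    finally show ?thesis by (simp add: p.prob_space)
  qed
  define v where "v z = u (s + h * g z) z" for z
  define C where "C = Lf * Lg / \<gamma>"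
  have vL: "\<bar>v a - v b\<bar> \<le> (Lf * h * Lg + C) * dist a b" for a b
  proof -
    have "\<bar>u (s + h * g a) a - u (s + h * g b) a\<bar> \<le> Lf * \<bar>(s + h * g a) - (s + h * g b)\<bar>" by (rule us)
    also have "\<dots> = Lf * h * \<bar>g a - g b\<bar>" using h by (simp add: right_diff_distrib[symmetric] abs_mult)
    also have "\<dots> \<le> Lf * h * (Lg * dist a b)" by (rule mult_left_mono[OF g_lipschitz]) (use Lf h in auto)
    finally have 1: "\<bar>u (s + h * g a) a - u (s + h * g b) a\<bar> \<le> Lf * h * Lg * dist a b" by simp
    have 2: "\<bar>u (s + h * g b) a - u (s + h * g b) b\<bar> \<le> C * dist a b" unfolding u_def C_def by (rule Suc.IH)
    show ?thesis using 1 2 unfolding v_def by (simp add: distrib_right)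
  qed
  have [measurable]: "v \<in> borel_measurable borel" using vL by (rule lipschitz_measurable)
  have eq: "(\<integral>\<omega>. f (s + h * path_sum h (Suc N) \<omega>) \<partial>\<PP> x) = (\<integral>z. v z \<partial>P h x)" for x
  proof -
    let ?H = "\<lambda>z. f (s + h * g (\<Phi> h (fst z)) + h * path_sum h N (snd z))"
    have [measurable]: "\<Phi> h \<in> Past h \<rightarrow>\<^sub>M borel" by (rule Phi_measurable) (use h in auto)
    have [measurable]: "path_sum h N \<in> borel_measurable Paths" using h by simp
    have "(\<integral>\<omega>. f (s + h * path_sum h (Suc N) \<omega>) \<partial>\<PP> x) = (\<integral>\<omega>. ?H (\<omega>, \<theta> h \<omega>) \<partial>\<PP> x)"
      by (rule Bochner_Integration.integral_cong) (use h in \<open>simp_all add: space_PP path_sum_Suc algebra_simps\<close>)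
    also have "\<dots> = (\<integral>\<omega>. (\<integral>\<omega>'. ?H (\<omega>, \<omega>') \<partial>\<PP> (\<Phi> h \<omega>)) \<partial>\<PP> x)"
    proof (rule markov_integral_PP[OF h])
      show "integrable (\<PP> x) (\<lambda>\<omega>. ?H (\<omega>, \<theta> h \<omega>))"
        by (rule integrable_bounded_PP[of _ B]) (use fB h in auto)
    qed simp
    also have "\<dots> = (\<integral>\<omega>. v (\<Phi> h \<omega>) \<partial>\<PP> x)" unfolding v_def u_def by simp
    also have "\<dots> = (\<integral>z. v z \<partial>P h x)" by (rule integral_Phi_PP[OF h]) simp
    finally show ?thesis .
  qed
  have "\<bar>(\<integral>z. v z \<partial>P h x) - (\<integral>z. v z \<partial>P h y)\<bar> \<le> exp (- \<gamma> * h) * (Lf * h * Lg + C) * dist x y"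
    by (rule contraction[OF h vL])
  also have "\<dots> \<le> C * dist x y"
  proof -
    have "1 + \<gamma> * h \<le> exp (\<gamma> * h)" by (rule exp_ge_add_one_self)
    then have "exp (- \<gamma> * h) * (1 + \<gamma> * h) \<le> exp (- \<gamma> * h) * exp (\<gamma> * h)" by (intro mult_left_mono) auto
    then have e: "exp (- \<gamma> * h) * (1 + \<gamma> * h) \<le> 1" by (simp add: exp_add[symmetric])
    have "0 \<le> Lf * (Lg * dist x y) / \<gamma>" using Lf Lg_nonneg gamma_pos by simp
    then have c: "0 \<le> C * dist x y" by (simp add: C_def)
    have "Lf * h * Lg + C = C * (1 + \<gamma> * h)" using gamma_pos by (simp add: C_def field_simps)
    then have "exp (- \<gamma> * h) * (Lf * h * Lg + C) * dist x y = (exp (- \<gamma> * h) * (1 + \<gamma> * h)) * (C * dist x y)" by simp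
    also have "\<dots> \<le> 1 * (C * dist x y)" by (rule mult_right_mono[OF e c])
    finally show ?thesis by simp
  qed
  finally show ?case unfolding eq C_def .
qed

text \<open>The mean oscillation of \<open>g\<close> over a time step; it measures the local error of a Riemann sum.\<close>

definition jump :: "real \<Rightarrow> 'a \<Rightarrow> real" where
  "jump r y = (\<integral>z. \<bar>g y - g z\<bar> \<partial>P r y)"

lemma jump_bound: "0 \<le> r \<Longrightarrow> 0 \<le> jump r y" "0 \<le> r \<Longrightarrow> jump r y \<le> 2 * G"
proof -
  assume r: "0 \<le> r"
  interpret p: prob_space "P r y" by (rule P_prob[OF r])
  have b: "\<bar>g y - g z\<bar> \<le> 2 * G" for z using g_bounded[of y] g_bounded[of z] by linarith
  have "jump r y \<le> (\<integral>z. 2 * G \<partial>P r y)" unfolding jump_def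
    by (rule integral_mono, rule p.integrable_const_bound[of _ "2 * G"]) (use b in \<open>auto simp: P_sets[OF r] cong: measurable_cong_sets\<close>)
  then show "jump r y \<le> 2 * G" by (simp add: p.prob_space)
  show "0 \<le> jump r y" unfolding jump_def by (rule Bochner_Integration.integral_nonneg) simp
qed

lemma jump_0: "jump 0 y = 0"
  unfolding jump_def P_zero by (subst integral_return) auto

text \<open>The function \<open>z \<mapsto> \<bar>g y - g z\<bar>\<close> is bounded, continuous and zero at \<open>y\<close>, so this is an
  instance of continuity of the semigroup at time 0.\<close>

lemma jump_tendsto: "((\<lambda>r. jump r y) \<longlongrightarrow> 0) (at_right 0)"
proof -
  have "continuous_on UNIV g"
  proof -
    have "Lg-lipschitz_on UNIV g"
    proof (rule lipschitz_onI)
      fix x y :: 'a show "dist (g x) (g y) \<le> Lg * dist x y" using g_lipschitz[of x y] by (simp add: dist_real_def)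
    qed (rule Lg_nonneg)
    then show ?thesis by (rule lipschitz_on_continuous_on)
  qed
  then have "continuous_on UNIV (\<lambda>z. \<bar>g y - g z\<bar>)" by (intro continuous_intros)
  moreover have "bounded (range (\<lambda>z. \<bar>g y - g z\<bar>))"
  proof (rule boundedI)
    fix u assume "u \<in> range (\<lambda>z. \<bar>g y - g z\<bar>)"
    then obtain z where "u = \<bar>g y - g z\<bar>" by auto
    then show "norm u \<le> 2 * G" using g_bounded[of y] g_bounded[of z] by simp
  qed
  ultimately have "(\<lambda>z. \<bar>g y - g z\<bar>) \<in> BC_funs" by (simp add: BC_funs_def)
  with A1 have "((\<lambda>t. semigroup_op P t (\<lambda>z. \<bar>g y - g z\<bar>) y) \<longlongrightarrow> \<bar>g y - g y\<bar>) (at_right 0)"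
    unfolding cond_A1_def by blast
  then show ?thesis by (simp add: semigroup_op_def jump_def)
qed

lemma jump_sequence:
  assumes "\<And>n. 0 \<le> r n" "r \<longlonglongrightarrow> 0" shows "(\<lambda>n. jump (r n) y) \<longlonglongrightarrow> 0"
proof (rule LIMSEQ_I)
  fix \<epsilon> :: real assume "0 < \<epsilon>"
  with jump_tendsto[of y] have "eventually (\<lambda>r. dist (jump r y) 0 < \<epsilon>) (at_right 0)" by (auto simp: tendsto_iff)
  then obtain b where b: "b > 0" "\<And>r. 0 < r \<Longrightarrow> r < b \<Longrightarrow> \<bar>jump r y\<bar> < \<epsilon>" by (auto simp: eventually_at_right_field)
  obtain N where N: "\<And>n. n \<ge> N \<Longrightarrow> \<bar>r n\<bar> < b" using LIMSEQ_D[OF assms(2) b(1)] by auto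
  show "\<exists>no. \<forall>n\<ge>no. norm (jump (r n) y - 0) < \<epsilon>"
  proof (intro exI[of _ N] allI impI)
    fix n assume "n \<ge> N"
    then have "\<bar>r n\<bar> < b" by (rule N)
    then show "norm (jump (r n) y - 0) < \<epsilon>"
      using assms(1)[of n] b(2)[of "r n"] jump_0[of y] \<open>0 < \<epsilon>\<close> by (cases "r n = 0") auto
  qed
qed

lemma jump_measurable: assumes r: "0 \<le> r" shows "jump r \<in> borel_measurable borel"
proof -
  have [measurable]: "\<Phi> 0 \<in> Paths \<rightarrow>\<^sub>M borel" "\<Phi> r \<in> Paths \<rightarrow>\<^sub>M borel" using r by simp_all
  have "jump r = (\<lambda>y. \<integral>\<omega>. \<bar>g (\<Phi> 0 \<omega>) - g (\<Phi> r \<omega>)\<bar> \<partial>\<PP> y)"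
  proof
    fix y
    have "jump r y = (\<integral>\<omega>. \<bar>g y - g (\<Phi> r \<omega>)\<bar> \<partial>\<PP> y)"
      unfolding jump_def by (rule integral_Phi_PP[OF r, symmetric]) simp
    also have "\<dots> = (\<integral>\<omega>. \<bar>g (\<Phi> 0 \<omega>) - g (\<Phi> r \<omega>)\<bar> \<partial>\<PP> y)"
      by (rule integral_cong_AE) (use start_AE[of y] in \<open>auto simp: measurable_PP\<close>)
    finally show "jump r y = (\<integral>\<omega>. \<bar>g (\<Phi> 0 \<omega>) - g (\<Phi> r \<omega>)\<bar> \<partial>\<PP> y)" .
  qed
  also have "\<dots> \<in> borel_measurable borel" by (rule PP_integral_measurable) simp
  finally show ?thesis .
qed

lemma expectation_increment:
  assumes s: "0 \<le> s" and r: "0 \<le> r"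
  shows "(\<integral>\<omega>. \<bar>g (\<Phi> s \<omega>) - g (\<Phi> (s + r) \<omega>)\<bar> \<partial>\<PP> x) = (\<integral>\<omega>. jump r (\<Phi> s \<omega>) \<partial>\<PP> x)"
proof -
  let ?H = "\<lambda>z. \<bar>g (\<Phi> s (fst z)) - g (\<Phi> r (snd z))\<bar>"
  have [measurable]: "\<Phi> s \<in> Past s \<rightarrow>\<^sub>M borel" by (rule Phi_measurable) (use s in auto)
  have [measurable]: "\<Phi> r \<in> Paths \<rightarrow>\<^sub>M borel" "\<Phi> s \<in> Paths \<rightarrow>\<^sub>M borel" using r s by simp_all
  have "(\<integral>\<omega>. \<bar>g (\<Phi> s \<omega>) - g (\<Phi> (s + r) \<omega>)\<bar> \<partial>\<PP> x) = (\<integral>\<omega>. ?H (\<omega>, \<theta> s \<omega>) \<partial>\<PP> x)"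
    by (rule Bochner_Integration.integral_cong) (use s r in \<open>simp_all add: space_PP shift[symmetric] add.commute\<close>)
  also have "\<dots> = (\<integral>\<omega>. (\<integral>\<omega>'. ?H (\<omega>, \<omega>') \<partial>\<PP> (\<Phi> s \<omega>)) \<partial>\<PP> x)"
  proof (rule markov_integral_PP[OF s])
    have "\<bar>g a - g b\<bar> \<le> 2 * G" for a b using g_bounded[of a] g_bounded[of b] by linarith
    then show "integrable (\<PP> x) (\<lambda>\<omega>. ?H (\<omega>, \<theta> s \<omega>))"
      by (intro integrable_bounded_PP[of _ "2 * G"]) (use s in auto)
  qed simp
  also have "\<dots> = (\<integral>\<omega>. jump r (\<Phi> s \<omega>) \<partial>\<PP> x)"
  proof -
    have "(\<integral>\<omega>'. \<bar>g y - g (\<Phi> r \<omega>')\<bar> \<partial>\<PP> z) = (\<integral>z'. \<bar>g y - g z'\<bar> \<partial>P r z)" for y z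
      by (rule integral_Phi_PP[OF r]) simp
    then show ?thesis unfolding jump_def by simp
  qed
  finally show ?thesis .
qed

lemma expectation_increment_tendsto:
  assumes s: "0 \<le> s" and r: "\<And>n. 0 \<le> r n" "r \<longlonglongrightarrow> 0"
  shows "(\<lambda>n. \<integral>\<omega>. \<bar>g (\<Phi> s \<omega>) - g (\<Phi> (s + r n) \<omega>)\<bar> \<partial>\<PP> x) \<longlonglongrightarrow> 0"
proof -
  interpret p: prob_space "\<PP> x" by (rule prob_space_PP)
  have "(\<lambda>n. \<integral>\<omega>. jump (r n) (\<Phi> s \<omega>) \<partial>\<PP> x) \<longlonglongrightarrow> (\<integral>\<omega>. 0 \<partial>\<PP> x)"
  proof (rule integral_dominated_convergence[where w="\<lambda>_. 2 * G"])
    show "(\<lambda>\<omega>. jump (r n) (\<Phi> s \<omega>)) \<in> borel_measurable (\<PP> x)" for n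
      unfolding measurable_PP by (rule measurable_compose[OF Phi_Paths_measurable[OF s] jump_measurable[OF r(1)]])
    show "AE \<omega> in \<PP> x. (\<lambda>n. jump (r n) (\<Phi> s \<omega>)) \<longlonglongrightarrow> 0" using jump_sequence[OF r] by simp
    show "AE \<omega> in \<PP> x. norm (jump (r n) (\<Phi> s \<omega>)) \<le> 2 * G" for n using jump_bound[OF r(1)] by (simp add: abs_of_nonneg)
  qed auto
  then show ?thesis using expectation_increment[OF s r(1)] by simp
qed

text \<open>The value of \<open>g\<close> along the path at the next grid point, as a function of time. Its time
  integral is the Riemann sum.\<close>

definition step_path :: "real \<Rightarrow> nat \<Rightarrow> real \<Rightarrow> 'w \<Rightarrow> real" where
  "step_path h N s \<omega> = (\<Sum>i<N. indicator {real i * h<..(real i + 1) * h} s * g (\<Phi> ((real i + 1) * h) \<omega>))"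

lemma step_path_eq:
  assumes h: "0 < h" and s: "0 < s" "s \<le> real N * h"
  obtains r where "0 \<le> r" "r \<le> h" "\<And>\<omega>. step_path h N s \<omega> = g (\<Phi> (s + r) \<omega>)"
proof -
  define k where "k = nat (\<lceil>s / h\<rceil> - 1)"
  have pos: "0 < \<lceil>s / h\<rceil>" using h s by simp
  then have k: "real k = of_int \<lceil>s / h\<rceil> - 1" by (simp add: k_def)
  have c: "s / h \<le> of_int \<lceil>s / h\<rceil>" "of_int \<lceil>s / h\<rceil> - 1 < s / h" by linarith+
  have k2: "real k * h < s" "s \<le> (real k + 1) * h" unfolding k
    using pos_less_divide_eq[OF h, THEN iffD1, OF c(2)] pos_divide_le_eq[OF h, THEN iffD1, OF c(1)] by simp_all
  have "real k * h < real N * h" using k2(1) s(2) by linarith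
  then have kN: "k < N" using h by simp
  have ind: "indicator {real i * h<..(real i + 1) * h} s = (if i = k then 1 else (0::real))" for i
  proof -
    have "\<not> (real i * h < s \<and> s \<le> (real i + 1) * h)" if "i \<noteq> k"
    proof
      assume a: "real i * h < s \<and> s \<le> (real i + 1) * h"
      have "real i * h < (real k + 1) * h" "real k * h < (real i + 1) * h" using a k2 by linarith+
      then have "real i < real k + 1" "real k < real i + 1" using h by (auto dest: mult_right_less_imp_less)
      then show False using that by linarith
    qed
    then show ?thesis using k2 by (auto split: split_indicator)
  qed
  have "step_path h N s \<omega> = (\<Sum>i<N. if i = k then g (\<Phi> ((real i + 1) * h) \<omega>) else 0)" for \<omega>
    unfolding step_path_def ind by (intro sum.cong) auto
  then have "step_path h N s \<omega> = g (\<Phi> (s + ((real k + 1) * h - s)) \<omega>)" for \<omega> using kN by simp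
  moreover have "0 \<le> (real k + 1) * h - s" "(real k + 1) * h - s \<le> h" using k2 by (auto simp: algebra_simps)
  ultimately show ?thesis using that by blast
qed

text \<open>By Fubini the error is at most the time integral of the mean difference between \<open>g\<close> at time
  \<open>s\<close> and at the next grid point. For fixed \<open>s\<close> this tends to 0 by
  \<open>expectation_increment_tendsto\<close>, and it is bounded by \<open>2 G\<close>.\<close>

lemma riemann_converges:
  assumes t: "0 < t"
  shows "(\<lambda>n. \<integral>\<omega>. \<bar>I t \<omega> - t / real (Suc n) * path_sum (t / real (Suc n)) (Suc n) \<omega>\<bar> \<partial>\<PP> x) \<longlonglongrightarrow> 0"
proof -
  define h where "h n = t / real (Suc n)" for n
  have h: "0 < h n" "real (Suc n) * h n = t" for n using t by (simp_all add: h_def)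
  have h0: "h \<longlonglongrightarrow> 0" unfolding h_def by (rule LIMSEQ_Suc[OF lim_const_over_n])
  define R where "R = restrict_space lborel {0..t}"
  interpret R: finite_measure R unfolding R_def by (rule finite_measure_interval)
  interpret p: prob_space "\<PP> x" by (rule prob_space_PP)
  interpret RP: pair_sigma_finite R "\<PP> x" by (intro pair_sigma_finite.intro R.sigma_finite_measure p.sigma_finite_measure)
  have sR: "sets R = sets (restrict_space borel {0..t})" by (simp add: R_def sets_restrict_space)
  have spR: "space R = {0..t}" by (simp add: R_def space_restrict_space)
  define F where "F n s \<omega> = \<bar>g (\<Phi> s \<omega>) - step_path (h n) (Suc n) s \<omega>\<bar>" for n s \<omega>
  have gm: "(\<lambda>(s, \<omega>). g (\<Phi> s \<omega>)) \<in> borel_measurable (R \<Otimes>\<^sub>M \<PP> x)"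
    using path_joint_measurable[OF less_imp_le[OF t] return_in[of x]] by (simp add: R_def law_return)
  have step_meas: "(\<lambda>(s, \<omega>). step_path (h n) (Suc n) s \<omega>) \<in> borel_measurable (R \<Otimes>\<^sub>M \<PP> x)" for n
  proof -
    have 1: "(\<lambda>s. indicator {real i * h n<..(real i + 1) * h n} s :: real) \<in> borel_measurable R" for i
      unfolding R_def by (rule measurable_restrict_space1) simp
    have 2: "(\<lambda>\<omega>. g (\<Phi> ((real i + 1) * h n) \<omega>)) \<in> borel_measurable (\<PP> x)" for i
      unfolding measurable_PP using h(1)[of n] by simp
    show ?thesis unfolding step_path_def case_prod_beta
      by (intro borel_measurable_sum borel_measurable_times measurable_compose[OF measurable_fst 1] measurable_compose[OF measurable_snd 2])
  qed
  have Fm: "(\<lambda>(s, \<omega>). F n s \<omega>) \<in> borel_measurable (R \<Otimes>\<^sub>M \<PP> x)" for n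
    using borel_measurable_abs[OF borel_measurable_diff[OF gm step_meas[of n]]] by (simp add: F_def case_prod_beta)
  have stepB: "\<bar>step_path (h n) (Suc n) s \<omega>\<bar> \<le> real (Suc n) * G" for n s \<omega>
  proof -
    have "\<bar>step_path (h n) (Suc n) s \<omega>\<bar> \<le> (\<Sum>i<Suc n. \<bar>indicator {real i * h n<..(real i + 1) * h n} s * g (\<Phi> ((real i + 1) * h n) \<omega>)\<bar>)"
      unfolding step_path_def by (rule sum_abs)
    also have "\<dots> \<le> (\<Sum>i<Suc n. G)" by (rule sum_mono) (use g_bounded G_nonneg in \<open>auto split: split_indicator\<close>)
    finally show ?thesis by simp
  qed
  have FB: "\<bar>F n s \<omega>\<bar> \<le> G + real (Suc n) * G" for n s \<omega>
    unfolding F_def using stepB[of n s \<omega>] g_bounded[of "\<Phi> s \<omega>"] by linarith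
  have RPfin: "finite_measure (R \<Otimes>\<^sub>M \<PP> x)" by (rule finite_measure_pair_measure) unfold_locales
  have Fint: "integrable (R \<Otimes>\<^sub>M \<PP> x) (\<lambda>(s, \<omega>). F n s \<omega>)" for n
    by (rule finite_measure.integrable_const_bound[OF RPfin, of _ "G + real (Suc n) * G"]) (use FB Fm in auto)
  have main: "(\<integral>\<omega>. \<bar>I t \<omega> - h n * path_sum (h n) (Suc n) \<omega>\<bar> \<partial>\<PP> x) \<le> (\<integral>s. (\<integral>\<omega>. F n s \<omega> \<partial>\<PP> x) \<partial>R)" for n
  proof -
    have pw: "\<bar>I t \<omega> - h n * path_sum (h n) (Suc n) \<omega>\<bar> \<le> (\<integral>s. F n s \<omega> \<partial>R)" if \<omega>: "\<omega> \<in> \<Omega>" for \<omega>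
    proof -
      have gi: "integrable R (\<lambda>s. g (\<Phi> s \<omega>))"
        using path_set_integrable[OF \<omega>, of t] t unfolding R_def set_integrable_def by (subst integrable_restrict_space) auto
      have mi: "(\<integral>s. indicator {real i * h n<..(real i + 1) * h n} s \<partial>R) = h n" if "i < Suc n" for i
      proof -
        have "(real i + 1) * h n \<le> real (Suc n) * h n" by (rule mult_right_mono) (use that h(1)[of n] in auto)
        then have sub: "{real i * h n<..(real i + 1) * h n} \<subseteq> {0..t}"
        proof (intro subsetI)
          fix u assume "u \<in> {real i * h n<..(real i + 1) * h n}"
          moreover have "0 \<le> real i * h n" using h(1)[of n] by simp
          ultimately show "u \<in> {0..t}" using \<open>(real i + 1) * h n \<le> real (Suc n) * h n\<close> unfolding h(2) by auto
        qed
        have "(\<integral>s. indicator {real i * h n<..(real i + 1) * h n} s \<partial>R) = measure R {real i * h n<..(real i + 1) * h n}"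
          using sub by (simp add: Bochner_Integration.integral_indicator spR Int_absorb2)
        also have "\<dots> = measure lborel {real i * h n<..(real i + 1) * h n}"
          unfolding R_def by (rule measure_restrict_space) (use sub in auto)
        also have "\<dots> = h n" using h(1)[of n] by (simp add: algebra_simps)
        finally show ?thesis .
      qed
      have ii: "integrable R (\<lambda>s. indicator {real i * h n<..(real i + 1) * h n} s * g (\<Phi> ((real i + 1) * h n) \<omega>))" for i
        by (rule R.integrable_const_bound[of _ G])
          (use g_bounded G_nonneg in \<open>auto simp: R_def intro!: measurable_restrict_space1 split: split_indicator\<close>)
      have si: "integrable R (\<lambda>s. step_path (h n) (Suc n) s \<omega>)" unfolding step_path_def by (intro Bochner_Integration.integrable_sum ii)
      have "(\<integral>s. step_path (h n) (Suc n) s \<omega> \<partial>R) = (\<Sum>i<Suc n. \<integral>s. indicator {real i * h n<..(real i + 1) * h n} s * g (\<Phi> ((real i + 1) * h n) \<omega>) \<partial>R)"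
        unfolding step_path_def by (intro Bochner_Integration.integral_sum ii)
      also have "\<dots> = (\<Sum>i<Suc n. h n * g (\<Phi> ((real i + 1) * h n) \<omega>))"
        by (intro sum.cong refl, subst integral_mult_left_zero, subst mi) auto
      finally have "(\<integral>s. step_path (h n) (Suc n) s \<omega> \<partial>R) = h n * path_sum (h n) (Suc n) \<omega>"
        unfolding path_sum_def sum_distrib_left .
      moreover have "I t \<omega> = (\<integral>s. g (\<Phi> s \<omega>) \<partial>R)"
        unfolding integral_functional_def set_lebesgue_integral_def R_def by (simp add: integral_restrict_space)
      ultimately have "I t \<omega> - h n * path_sum (h n) (Suc n) \<omega> = (\<integral>s. g (\<Phi> s \<omega>) - step_path (h n) (Suc n) s \<omega> \<partial>R)"
        using gi si by simp
      then show ?thesis unfolding F_def by (simp add: integral_abs_bound)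
    qed
    have "(\<integral>\<omega>. \<bar>I t \<omega> - h n * path_sum (h n) (Suc n) \<omega>\<bar> \<partial>\<PP> x) \<le> (\<integral>\<omega>. (\<integral>s. F n s \<omega> \<partial>R) \<partial>\<PP> x)"
    proof (rule integral_mono')
      show "integrable (\<PP> x) (\<lambda>\<omega>. \<integral>s. F n s \<omega> \<partial>R)" using RP.integrable_snd[OF Fint[of n]] .
      show "0 \<le> (\<integral>s. F n s \<omega> \<partial>R)" for \<omega>
        by (rule Bochner_Integration.integral_nonneg) (simp add: F_def)
    qed (use pw in \<open>auto simp: space_PP\<close>)
    also have "\<dots> = (\<integral>s. (\<integral>\<omega>. F n s \<omega> \<partial>\<PP> x) \<partial>R)" by (rule RP.Fubini_integral[OF Fint])
    finally show ?thesis .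
  qed
  have bnd: "\<bar>g a - g b\<bar> \<le> 2 * G" for a b using g_bounded[of a] g_bounded[of b] by linarith
  have lim: "(\<lambda>n. \<integral>s. (\<integral>\<omega>. F n s \<omega> \<partial>\<PP> x) \<partial>R) \<longlonglongrightarrow> (\<integral>s. 0 \<partial>R)"
  proof (rule integral_dominated_convergence[where w="\<lambda>_. 2 * G"])
    show "(\<lambda>s. \<integral>\<omega>. F n s \<omega> \<partial>\<PP> x) \<in> borel_measurable R" for n
      by (rule p.borel_measurable_lebesgue_integral[OF Fm])
    have ae: "AE s in R. 0 < s \<and> s \<le> t"
    proof -
      have "AE s in lborel. s \<noteq> (0::real)" by (rule AE_lborel_singleton)
      then show ?thesis unfolding R_def by (subst AE_restrict_space_iff) (auto elim!: eventually_mono)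
    qed
    show "AE s in R. (\<lambda>n. \<integral>\<omega>. F n s \<omega> \<partial>\<PP> x) \<longlonglongrightarrow> 0"
      using ae
    proof eventually_elim
      fix s assume s: "0 < s \<and> s \<le> t"
      have "\<exists>r. 0 \<le> r \<and> r \<le> h n \<and> (\<forall>\<omega>. step_path (h n) (Suc n) s \<omega> = g (\<Phi> (s + r) \<omega>))" for n
        using step_path_eq[of "h n" s "Suc n"] h[of n] s by metis
      then obtain r where r: "\<And>n. 0 \<le> r n" "\<And>n. r n \<le> h n" "\<And>n \<omega>. step_path (h n) (Suc n) s \<omega> = g (\<Phi> (s + r n) \<omega>)" by metis
      have "r \<longlonglongrightarrow> 0" by (rule tendsto_sandwich[OF _ _ tendsto_const h0]) (use r in auto)
      from expectation_increment_tendsto[OF _ r(1) this, of s x] s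
      show "(\<lambda>n. \<integral>\<omega>. F n s \<omega> \<partial>\<PP> x) \<longlonglongrightarrow> 0" unfolding F_def r(3) by simp
    qed
    show "AE s in R. norm (\<integral>\<omega>. F n s \<omega> \<partial>\<PP> x) \<le> 2 * G" for n
      using ae
    proof eventually_elim
      fix s assume s: "0 < s \<and> s \<le> t"
      obtain r where r: "0 \<le> r" "r \<le> h n" "\<And>\<omega>. step_path (h n) (Suc n) s \<omega> = g (\<Phi> (s + r) \<omega>)"
        using step_path_eq[of "h n" s "Suc n"] h[of n] s by metis
      show "norm (\<integral>\<omega>. F n s \<omega> \<partial>\<PP> x) \<le> 2 * G" unfolding real_norm_def
        by (rule abs_expectation_le[OF prob_space_PP]) (use bnd r(3) in \<open>auto simp: F_def\<close>)
    qed
  qed auto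
  show ?thesis
  proof (rule tendsto_sandwich[OF _ _ tendsto_const])
    show "(\<lambda>n. \<integral>s. (\<integral>\<omega>. F n s \<omega> \<partial>\<PP> x) \<partial>R) \<longlonglongrightarrow> 0" using lim by simp
    show "eventually (\<lambda>n. (\<integral>\<omega>. \<bar>I t \<omega> - t / real (Suc n) * path_sum (t / real (Suc n)) (Suc n) \<omega>\<bar> \<partial>\<PP> x) \<le> (\<integral>s. (\<integral>\<omega>. F n s \<omega> \<partial>\<PP> x) \<partial>R)) sequentially"
      using main by (simp add: h_def)
  qed auto
qed

text \<open>The bound for Riemann sums is uniform in the number of grid points and passes to the limit.\<close>

lemma lipschitz_start:
  assumes t: "0 \<le> t" and f [measurable]: "f \<in> borel_measurable borel" and fB: "\<And>z. \<bar>f z\<bar> \<le> B" and fL: "\<And>z w. \<bar>f z - f w\<bar> \<le> Lf * \<bar>z - w\<bar>"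
  shows "\<bar>(\<integral>\<omega>. f (I t \<omega>) \<partial>\<PP> x) - (\<integral>\<omega>. f (I t \<omega>) \<partial>\<PP> y)\<bar> \<le> Lf * Lg / \<gamma> * dist x y"
proof (cases "t = 0")
  case True
  have Lf: "0 \<le> Lf" using order_trans[OF abs_ge_zero fL[of 1 0]] by simp
  have "0 \<le> Lf * (Lg * dist x y) / \<gamma>" using Lf Lg_nonneg gamma_pos by simp
  then show ?thesis using True prob_space.prob_space[OF prob_space_PP] by (simp add: I_0)
next
  case False
  with t have t: "0 < t" by simp
  define h where "h n = t / real (Suc n)" for n
  have h: "0 \<le> h n" for n using t by (simp add: h_def)
  have lim: "(\<lambda>n. \<integral>\<omega>. f (h n * path_sum (h n) (Suc n) \<omega>) \<partial>\<PP> x) \<longlonglongrightarrow> (\<integral>\<omega>. f (I t \<omega>) \<partial>\<PP> x)" for x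
  proof (rule LIM_zero_cancel, rule tendsto_rabs_zero_cancel, rule tendsto_sandwich[OF _ _ tendsto_const])
    have [measurable]: "I t \<in> borel_measurable Paths" using t by simp
    have [measurable]: "path_sum (h n) N \<in> borel_measurable Paths" for n N using h by simp
    have i1: "integrable (\<PP> x) (\<lambda>\<omega>. f (h n * path_sum (h n) (Suc n) \<omega>))" "integrable (\<PP> x) (\<lambda>\<omega>. f (I t \<omega>))" for n
      using fB by (auto intro!: integrable_bounded_PP[of _ B])
    have psB: "\<bar>path_sum (h n) N \<omega>\<bar> \<le> real N * G" for n N \<omega>
      unfolding path_sum_def using sum_norm_bound[of "{..<N}" "\<lambda>i. g (\<Phi> ((real i + 1) * h n) \<omega>)" G] g_bounded by simp
    have i2: "integrable (\<PP> x) (\<lambda>\<omega>. \<bar>I t \<omega> - h n * path_sum (h n) (Suc n) \<omega>\<bar>)" for n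
    proof (rule integrable_bounded_PP[of _ "G * t + h n * (real (Suc n) * G)"])
      fix \<omega> assume "\<omega> \<in> \<Omega>"
      have "\<bar>h n * path_sum (h n) (Suc n) \<omega>\<bar> \<le> h n * (real (Suc n) * G)"
        unfolding abs_mult abs_of_nonneg[OF h] by (rule mult_left_mono[OF psB h])
      then show "\<bar>\<bar>I t \<omega> - h n * path_sum (h n) (Suc n) \<omega>\<bar>\<bar> \<le> G * t + h n * (real (Suc n) * G)"
        using I_bound[OF \<open>\<omega> \<in> \<Omega>\<close>, of t] t by linarith
    qed simp
    show "eventually (\<lambda>n. \<bar>(\<integral>\<omega>. f (h n * path_sum (h n) (Suc n) \<omega>) \<partial>\<PP> x) - (\<integral>\<omega>. f (I t \<omega>) \<partial>\<PP> x)\<bar> \<le> Lf * (\<integral>\<omega>. \<bar>I t \<omega> - h n * path_sum (h n) (Suc n) \<omega>\<bar> \<partial>\<PP> x)) sequentially"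
    proof (rule always_eventually, rule allI)
      fix n
      have "\<bar>(\<integral>\<omega>. f (h n * path_sum (h n) (Suc n) \<omega>) \<partial>\<PP> x) - (\<integral>\<omega>. f (I t \<omega>) \<partial>\<PP> x)\<bar> = \<bar>\<integral>\<omega>. f (h n * path_sum (h n) (Suc n) \<omega>) - f (I t \<omega>) \<partial>\<PP> x\<bar>"
        using i1 by simp
      also have "\<dots> \<le> (\<integral>\<omega>. \<bar>f (h n * path_sum (h n) (Suc n) \<omega>) - f (I t \<omega>)\<bar> \<partial>\<PP> x)" by (rule integral_abs_bound)
      also have "\<dots> \<le> (\<integral>\<omega>. Lf * \<bar>I t \<omega> - h n * path_sum (h n) (Suc n) \<omega>\<bar> \<partial>\<PP> x)"
        by (rule integral_mono) (use i1 i2 in \<open>auto intro: order_trans[OF fL] simp: abs_minus_commute\<close>)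
      finally show "\<bar>(\<integral>\<omega>. f (h n * path_sum (h n) (Suc n) \<omega>) \<partial>\<PP> x) - (\<integral>\<omega>. f (I t \<omega>) \<partial>\<PP> x)\<bar> \<le> Lf * (\<integral>\<omega>. \<bar>I t \<omega> - h n * path_sum (h n) (Suc n) \<omega>\<bar> \<partial>\<PP> x)" by simp
    qed
    show "(\<lambda>n. Lf * (\<integral>\<omega>. \<bar>I t \<omega> - h n * path_sum (h n) (Suc n) \<omega>\<bar> \<partial>\<PP> x)) \<longlonglongrightarrow> 0"
      using tendsto_mult_right_zero[OF riemann_converges[OF t, of x], of Lf] by (simp add: h_def)
  qed auto
  have "(\<lambda>n. \<bar>(\<integral>\<omega>. f (h n * path_sum (h n) (Suc n) \<omega>) \<partial>\<PP> x) - (\<integral>\<omega>. f (h n * path_sum (h n) (Suc n) \<omega>) \<partial>\<PP> y)\<bar>)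
      \<longlonglongrightarrow> \<bar>(\<integral>\<omega>. f (I t \<omega>) \<partial>\<PP> x) - (\<integral>\<omega>. f (I t \<omega>) \<partial>\<PP> y)\<bar>"
    by (intro tendsto_intros lim)
  then show ?thesis
    by (rule LIMSEQ_le_const2) (use riemann_lipschitz[OF h f fB fL, of _ 0] in auto)
qed

end

section \<open>The stationary regime\<close>

locale stationary_functional = contractive_functional P \<Omega> \<Phi> \<theta> \<PP> g G Lg \<gamma>
  for P :: "real \<Rightarrow> 'a::polish_space \<Rightarrow> 'a measure" and \<Omega> :: "'w set" and \<Phi> \<theta> \<PP> g G Lg \<gamma> +
  fixes \<nu> :: "'a measure" and x0 :: 'a
  assumes invariant: "invariant_prob P \<nu>"
    and mean_zero: "(\<integral>x. g x \<partial>\<nu>) = 0"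
    and second_moment: "integrable \<nu> (\<lambda>x. (dist x0 x)\<^sup>2)"
begin

lemma nu_prob: "\<nu> \<in> prob_measures" and nu_invariant: "0 \<le> t \<Longrightarrow> \<nu> \<bind> P t = \<nu>"
  using invariant by (auto simp: invariant_prob_def)

lemma nu_sets [measurable_cong]: "sets \<nu> = sets borel"
  using nu_prob by (simp add: space_prob_algebra)

lemma nu_prob_space: "prob_space \<nu>"
  using nu_prob by (simp add: space_prob_algebra)

abbreviation "Q \<equiv> law_from \<PP> \<nu>"

lemma Q_prob_space: "prob_space Q"
  by (rule law_prob[OF nu_prob])

lemma Q_measurable: "measurable Q M = measurable Paths M"
  by (rule law_measurable[OF nu_prob])

lemma Q_space: "space Q = \<Omega>"
  by (rule law_space[OF nu_prob])

text \<open>The price of forgetting the starting point \<open>x\<close>: its mean distance from a stationary starting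
  point.\<close>

definition D :: "'a \<Rightarrow> real" where "D x = (\<integral>y. dist x y \<partial>\<nu>)"

lemma dist_integrable: "integrable \<nu> (\<lambda>y. dist x y)"
proof -
  interpret n: prob_space \<nu> by (rule nu_prob_space)
  have "integrable \<nu> (\<lambda>y. dist x x0 + (1 + (dist x0 y)\<^sup>2))" using second_moment by simp
  then show ?thesis
  proof (rule Bochner_Integration.integrable_bound)
    show "AE y in \<nu>. norm (dist x y) \<le> norm (dist x x0 + (1 + (dist x0 y)\<^sup>2))"
    proof (rule AE_I2)
      fix y
      have "0 \<le> (dist x0 y)\<^sup>2 + 1 - 2 * dist x0 y" using zero_le_power2[of "dist x0 y - 1"] by (simp add: power2_diff)
      then have "dist x0 y \<le> 1 + (dist x0 y)\<^sup>2" using zero_le_dist[of x0 y] by linarith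
      then show "norm (dist x y) \<le> norm (dist x x0 + (1 + (dist x0 y)\<^sup>2))" using dist_triangle[of x y x0] by simp
    qed
  qed simp
qed

lemma D_nonneg: "0 \<le> D x"
  unfolding D_def by (rule Bochner_Integration.integral_nonneg) simp

lemma D_lipschitz: "\<bar>D x - D y\<bar> \<le> 1 * dist x y"
proof -
  interpret n: prob_space \<nu> by (rule nu_prob_space)
  have "D x - D y = (\<integral>z. dist x z - dist y z \<partial>\<nu>)" unfolding D_def using dist_integrable by simp
  also have "\<bar>\<dots>\<bar> \<le> (\<integral>z. \<bar>dist x z - dist y z\<bar> \<partial>\<nu>)" by (rule integral_abs_bound)
  also have "\<dots> \<le> (\<integral>z. dist x y \<partial>\<nu>)"
  proof (rule integral_mono)
    fix z
    show "\<bar>dist x z - dist y z\<bar> \<le> dist x y"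
      using dist_triangle[of x z y] dist_triangle[of y z x] by (simp add: dist_commute abs_le_iff)
  qed (use dist_integrable in auto)
  finally show ?thesis by (simp add: n.prob_space)
qed

lemma D_measurable [measurable]: "D \<in> borel_measurable borel"
  by (rule lipschitz_measurable[OF D_lipschitz])

lemma D_le: "D x \<le> dist x0 x + D x0"
  using D_lipschitz[of x x0] by (simp add: dist_commute)

lemma D_square_integrable: "integrable \<nu> (\<lambda>x. (D x)\<^sup>2)"
proof -
  interpret n: prob_space \<nu> by (rule nu_prob_space)
  have "integrable \<nu> (\<lambda>x. 2 * (dist x0 x)\<^sup>2 + 2 * (D x0)\<^sup>2)" using second_moment by simp
  then show ?thesis
  proof (rule Bochner_Integration.integrable_bound)
    show "AE x in \<nu>. norm ((D x)\<^sup>2) \<le> norm (2 * (dist x0 x)\<^sup>2 + 2 * (D x0)\<^sup>2)"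
    proof (rule AE_I2)
      fix x
      have "(D x)\<^sup>2 \<le> (dist x0 x + D x0)\<^sup>2" using D_le D_nonneg by (intro power_mono) auto
      also have "\<dots> \<le> 2 * (dist x0 x)\<^sup>2 + 2 * (D x0)\<^sup>2" using zero_le_power2[of "dist x0 x - D x0"] by (simp add: power2_sum power2_diff)
      finally show "norm ((D x)\<^sup>2) \<le> norm (2 * (dist x0 x)\<^sup>2 + 2 * (D x0)\<^sup>2)" by simp
    qed
  qed simp
qed

lemma D_integrable: "integrable \<nu> D"
proof -
  interpret n: prob_space \<nu> by (rule nu_prob_space)
  have "integrable \<nu> (\<lambda>x. 1 + (D x)\<^sup>2)" using D_square_integrable by simp
  then show ?thesis
  proof (rule Bochner_Integration.integrable_bound)
    show "AE x in \<nu>. norm (D x) \<le> norm (1 + (D x)\<^sup>2)"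
    proof (rule AE_I2)
      fix x
      have "D x \<le> 1 + (D x)\<^sup>2" using zero_le_power2[of "D x - 1"] D_nonneg[of x] by (simp add: power2_diff)
      then show "norm (D x) \<le> norm (1 + (D x)\<^sup>2)" using D_nonneg[of x] by simp
    qed
  qed simp
qed

definition Dbar :: real where "Dbar = (\<integral>x. D x \<partial>\<nu>)"

lemma Dbar_nonneg: "0 \<le> Dbar"
  unfolding Dbar_def by (rule Bochner_Integration.integral_nonneg) (rule D_nonneg)

lemma integral_Phi_Q:
  fixes k :: "'a \<Rightarrow> real"
  assumes "0 \<le> t" "k \<in> borel_measurable borel" shows "(\<integral>\<omega>. k (\<Phi> t \<omega>) \<partial>Q) = (\<integral>x. k x \<partial>\<nu>)"
  using integral_Phi[OF assms(1) nu_prob assms(2)] nu_invariant[OF assms(1)] by simp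

lemma integrable_Phi_Q:
  fixes k :: "'a \<Rightarrow> real"
  assumes "0 \<le> t" "integrable \<nu> k" shows "integrable Q (\<lambda>\<omega>. k (\<Phi> t \<omega>))"
proof -
  have "distr Q borel (\<Phi> t) = \<nu>" using Phi_law[OF assms(1) nu_prob] nu_invariant[OF assms(1)] by simp
  then have "integrable (distr Q borel (\<Phi> t)) k" using assms(2) by simp
  moreover have "\<Phi> t \<in> Q \<rightarrow>\<^sub>M borel" using Phi_Paths_measurable[OF assms(1)] by (simp add: Q_measurable)
  ultimately show ?thesis by (rule integrable_distr[rotated])
qed

text \<open>By invariance the stationary mean is an average of the means over all starting points, to
  which the contraction applies.\<close>

lemma mixing:
  assumes t: "0 \<le> t" and L: "\<And>a b. \<bar>v a - v b\<bar> \<le> L * dist a b" and B: "\<And>x. \<bar>v x\<bar> \<le> B"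
  shows "\<bar>(\<integral>z. v z \<partial>P t x) - (\<integral>z. v z \<partial>\<nu>)\<bar> \<le> exp (- \<gamma> * t) * L * D x"
proof -
  interpret n: prob_space \<nu> by (rule nu_prob_space)
  have [measurable]: "v \<in> borel_measurable borel" using L by (rule lipschitz_measurable)
  have m: "(\<lambda>y. \<integral>z. v z \<partial>P t y) \<in> borel_measurable borel"
    using measurable_compose[OF P_subprob[OF t] integral_measurable_subprob_algebra[of v borel]] by simp
  have bnd: "\<bar>\<integral>z. v z \<partial>P t y\<bar> \<le> B" for y
    by (rule abs_expectation_le[OF P_prob[OF t] B])
  have i: "integrable \<nu> (\<lambda>y. \<integral>z. v z \<partial>P t y)"
    by (rule n.integrable_const_bound[of _ B]) (use bnd m in \<open>auto cong: measurable_cong_sets\<close>)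
  have "(\<integral>z. v z \<partial>\<nu>) = (\<integral>y. (\<integral>z. v z \<partial>P t y) \<partial>\<nu>)"
    using integral_bind_bounded[OF nu_prob kernel[OF t], of v B] B nu_invariant[OF t] by simp
  then have "(\<integral>z. v z \<partial>P t x) - (\<integral>z. v z \<partial>\<nu>) = (\<integral>y. (\<integral>z. v z \<partial>P t x) - (\<integral>z. v z \<partial>P t y) \<partial>\<nu>)"
    using i by (simp add: n.prob_space)
  also have "\<bar>\<dots>\<bar> \<le> (\<integral>y. \<bar>(\<integral>z. v z \<partial>P t x) - (\<integral>z. v z \<partial>P t y)\<bar> \<partial>\<nu>)" by (rule integral_abs_bound)
  also have "\<dots> \<le> (\<integral>y. exp (- \<gamma> * t) * L * dist x y \<partial>\<nu>)"
    by (rule integral_mono) (use i dist_integrable contraction[OF t L] in auto)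
  also have "\<dots> = exp (- \<gamma> * t) * L * D x" unfolding D_def by simp
  finally show ?thesis .
qed

text \<open>The expectation of \<open>f (I t)\<close> is a Lipschitz function of the starting point; the pause \<open>r\<close>
  allows the semigroup to contract it before it is evaluated.\<close>

lemma start_vs_stationary:
  assumes t: "0 \<le> t" and r: "0 \<le> r" and f [measurable]: "f \<in> borel_measurable borel"
    and fB: "\<And>z. \<bar>f z\<bar> \<le> B" and fL: "\<And>z w. \<bar>f z - f w\<bar> \<le> Lf * \<bar>z - w\<bar>"
  shows "\<bar>(\<integral>\<omega>. f (I t (\<theta> r \<omega>)) \<partial>\<PP> x) - (\<integral>\<omega>. f (I t \<omega>) \<partial>Q)\<bar> \<le> exp (- \<gamma> * r) * (Lf * Lg / \<gamma>) * D x"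
proof -
  have [measurable]: "I t \<in> borel_measurable Paths" using t by simp
  have [measurable]: "\<theta> r \<in> Paths \<rightarrow>\<^sub>M Paths" using r by simp
  define v where "v y = (\<integral>\<omega>. f (I t \<omega>) \<partial>\<PP> y)" for y
  have v: "\<bar>v a - v b\<bar> \<le> Lf * Lg / \<gamma> * dist a b" for a b unfolding v_def by (rule lipschitz_start[OF t f fB fL])
  have vB: "\<bar>v y\<bar> \<le> B" for y
    unfolding v_def by (rule abs_expectation_le[OF prob_space_PP fB])
  have "(\<integral>\<omega>. f (I t (\<theta> r \<omega>)) \<partial>\<PP> x) = (\<integral>\<omega>. v (\<Phi> r \<omega>) \<partial>\<PP> x)"
  proof -
    let ?h = "\<lambda>z. f (I t (snd z))"
    have "?h \<in> borel_measurable (Past r \<Otimes>\<^sub>M Paths)" by measurable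
    moreover have "integrable (\<PP> x) (\<lambda>\<omega>. ?h (\<omega>, \<theta> r \<omega>))"
      by (rule integrable_bounded_PP[OF _ fB]) measurable
    ultimately show ?thesis using markov_integral_PP[OF r, of ?h x] by (simp add: v_def)
  qed
  also have "\<dots> = (\<integral>z. v z \<partial>P r x)" by (rule integral_Phi_PP[OF r lipschitz_measurable[OF v]])
  finally have 1: "(\<integral>\<omega>. f (I t (\<theta> r \<omega>)) \<partial>\<PP> x) = (\<integral>z. v z \<partial>P r x)" .
  have 2: "(\<integral>\<omega>. f (I t \<omega>) \<partial>Q) = (\<integral>z. v z \<partial>\<nu>)"
    unfolding v_def by (rule integral_law[OF nu_prob integrable_bounded_law[OF nu_prob _ fB]]) measurable
  show ?thesis unfolding 1 2 by (rule mixing[OF r v vB])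
qed

lemma integral_I_PP:
  assumes t: "0 \<le> t"
  shows "(\<integral>\<omega>. I t \<omega> \<partial>\<PP> x) = (LBINT s:{0..t}. semigroup_op P s g x)"
    and "(\<lambda>s. indicator {0..t} s * semigroup_op P s g x) \<in> borel_measurable borel"
proof -
  define R where "R = restrict_space lborel {0..t}"
  have sR: "sets R = sets (restrict_space borel {0..t})" by (simp add: R_def sets_restrict_space)
  have spR: "space R = {0..t}" by (simp add: R_def space_restrict_space)
  have sg: "(\<integral>\<omega>. g (\<Phi> s \<omega>) \<partial>\<PP> x) = semigroup_op P s g x" if "0 \<le> s" for s
    unfolding semigroup_op_def by (rule integral_Phi_PP[OF that]) simp
  note fubini = path_fubini[OF t return_in[of x], unfolded law_return R_def[symmetric]]
  have "(\<integral>\<omega>. I t \<omega> \<partial>\<PP> x) = (\<integral>s. semigroup_op P s g x \<partial>R)"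
    unfolding fubini(1) by (rule Bochner_Integration.integral_cong) (use sg in \<open>auto simp: spR\<close>)
  then show "(\<integral>\<omega>. I t \<omega> \<partial>\<PP> x) = (LBINT s:{0..t}. semigroup_op P s g x)"
    unfolding set_lebesgue_integral_def R_def by (simp add: integral_restrict_space)
  have "(\<lambda>s. semigroup_op P s g x) \<in> borel_measurable R"
    using fubini(2) by (subst measurable_cong[where g="\<lambda>s. \<integral>\<omega>. g (\<Phi> s \<omega>) \<partial>\<PP> x"]) (use sg in \<open>auto simp: spR\<close>)
  then have "(\<lambda>s. semigroup_op P s g x) \<in> borel_measurable (restrict_space borel {0..t})"
    using measurable_cong_sets[OF sR refl] by blast
  then show "(\<lambda>s. indicator {0..t} s * semigroup_op P s g x) \<in> borel_measurable borel"
    by (subst (asm) borel_measurable_restrict_space_iff) auto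
qed

lemma semigroup_decay:
  assumes "0 \<le> t" shows "\<bar>semigroup_op P t g x\<bar> \<le> exp (- \<gamma> * t) * Lg * D x"
  using mixing[OF assms g_lipschitz g_bounded, of x] by (simp add: semigroup_op_def mean_zero)

text \<open>Truncation at a level that the functional cannot exceed turns the identity and the absolute
  value into bounded Lipschitz functions without changing the integrals.\<close>

lemma clamp: 
  fixes b :: real
  shows "\<bar>max (- b) (min b z) - max (- b) (min b w)\<bar> \<le> 1 * \<bar>z - w\<bar>" and "0 \<le> b \<Longrightarrow> \<bar>max (- b) (min b z)\<bar> \<le> b"
    and "\<bar>z\<bar> \<le> b \<Longrightarrow> max (- b) (min b z) = z"
  by (auto simp: max_def min_def abs_le_iff)

lemma integral_I_Q: assumes t: "0 \<le> t" shows "(\<integral>\<omega>. I t \<omega> \<partial>Q) = 0"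
proof -
  have "(\<integral>\<omega>. I t \<omega> \<partial>Q) = (\<integral>s. 0 \<partial>restrict_space lborel {0..t})"
    unfolding path_fubini(1)[OF t nu_prob]
    by (rule Bochner_Integration.integral_cong) (use integral_Phi_Q mean_zero in \<open>auto simp: space_restrict_space\<close>)
  then show ?thesis by simp
qed

lemma integral_I_shift_PP:
  assumes t: "0 \<le> t" and r: "0 \<le> r"
  shows "\<bar>\<integral>\<omega>. I t (\<theta> r \<omega>) \<partial>\<PP> x\<bar> \<le> exp (- \<gamma> * r) * (Lg / \<gamma>) * D x"
proof -
  let ?f = "\<lambda>z. max (- (G * t)) (min (G * t) z)"
  have b: "0 \<le> G * t" using G_nonneg t by simp
  have "(\<integral>\<omega>. ?f (I t (\<theta> r \<omega>)) \<partial>\<PP> x) = (\<integral>\<omega>. I t (\<theta> r \<omega>) \<partial>\<PP> x)"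
    by (rule Bochner_Integration.integral_cong) (use I_bound[OF shift_in[OF r] t] in \<open>auto simp: space_PP intro!: clamp(3)\<close>)
  moreover have "(\<integral>\<omega>. ?f (I t \<omega>) \<partial>Q) = (\<integral>\<omega>. I t \<omega> \<partial>Q)"
    by (rule Bochner_Integration.integral_cong) (use I_bound[OF _ t] in \<open>auto simp: Q_space intro!: clamp(3)\<close>)
  ultimately show ?thesis
    using start_vs_stationary[OF t r _ clamp(2)[OF b] clamp(1), of x] by (simp add: integral_I_Q[OF t])
qed

lemma shift_Q: 
  fixes h :: "'w \<Rightarrow> real"
  assumes "0 \<le> t" "h \<in> borel_measurable Paths"
  shows "(\<integral>\<omega>. h (\<theta> t \<omega>) \<partial>Q) = (\<integral>\<omega>. h \<omega> \<partial>Q)" "integrable Q (\<lambda>\<omega>. h (\<theta> t \<omega>)) \<longleftrightarrow> integrable Q h"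
proof -
  have m: "\<theta> t \<in> Q \<rightarrow>\<^sub>M Paths" using shift_measurable[OF assms(1)] by (simp add: Q_measurable)
  show "(\<integral>\<omega>. h (\<theta> t \<omega>) \<partial>Q) = (\<integral>\<omega>. h \<omega> \<partial>Q)"
    using integral_distr[OF m assms(2)] shift_invariant_law[OF invariant assms(1)] by simp
  show "integrable Q (\<lambda>\<omega>. h (\<theta> t \<omega>)) \<longleftrightarrow> integrable Q h"
    using integrable_distr_eq[OF m assms(2)] shift_invariant_law[OF invariant assms(1)] by simp
qed

lemma I_shift_Past:
  assumes "0 \<le> s" "0 \<le> t" shows "(\<lambda>\<omega>. I t (\<theta> s \<omega>)) \<in> borel_measurable (Past (s + t))"
proof -
  have "(\<lambda>\<omega>. I (s + t) \<omega> - I s \<omega>) \<in> borel_measurable (Past (s + t))"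
    using I_Past[of "s + t"] measurable_Past_mono[OF I_Past[of s], of "s + t"] assms by (intro borel_measurable_diff) auto
  then show ?thesis
    by (subst measurable_cong[where g="\<lambda>\<omega>. I (s + t) \<omega> - I s \<omega>"]) (use I_add assms in \<open>auto simp: space_generated\<close>)
qed

text \<open>Given the past up to the end of the first block, the second block has almost its stationary
  mean, which is 0. Blocks separated by a gap are therefore nearly orthogonal.\<close>

lemma block_covariance:
  assumes l: "0 \<le> l" and s: "0 \<le> s" and r: "0 \<le> r"
  shows "\<bar>\<integral>\<omega>. I l (\<theta> s \<omega>) * I l (\<theta> (s + l + r) \<omega>) \<partial>Q\<bar> \<le> G * l * (exp (- \<gamma> * r) * (Lg / \<gamma>) * Dbar)"
proof -
  let ?u = "s + l"
  have u: "0 \<le> ?u" using l s by simp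
  have [measurable]: "I l \<in> borel_measurable Paths" "\<theta> r \<in> Paths \<rightarrow>\<^sub>M Paths" "\<theta> s \<in> Paths \<rightarrow>\<^sub>M Paths" "\<theta> ?u \<in> Paths \<rightarrow>\<^sub>M Paths" "\<Phi> ?u \<in> Paths \<rightarrow>\<^sub>M borel" using l s r by simp_all
  have [measurable]: "(\<lambda>\<omega>. I l (\<theta> s \<omega>)) \<in> borel_measurable (Past ?u)" by (rule I_shift_Past[OF s l])
  have "(\<integral>\<omega>. I l (\<theta> s \<omega>) * I l (\<theta> (?u + r) \<omega>) \<partial>Q) = (\<integral>\<omega>. I l (\<theta> s \<omega>) * I l (\<theta> r (\<theta> ?u \<omega>)) \<partial>Q)"
    by (rule Bochner_Integration.integral_cong) (use I_shift_shift[OF _ u r l] in \<open>auto simp: Q_space\<close>)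
  also have "\<dots> = (\<integral>\<omega>. (\<integral>\<omega>'. I l (\<theta> s \<omega>) * I l (\<theta> r \<omega>') \<partial>\<PP> (\<Phi> ?u \<omega>)) \<partial>Q)"
  proof -
    let ?h = "\<lambda>z. I l (\<theta> s (fst z)) * I l (\<theta> r (snd z))"
    have "?h \<in> borel_measurable (Past ?u \<Otimes>\<^sub>M Paths)" by measurable
    moreover have "integrable Q (\<lambda>\<omega>. ?h (\<omega>, \<theta> ?u \<omega>))"
    proof (rule integrable_bounded_law[OF nu_prob, of _ "(G * l) * (G * l)"])
      fix \<omega> assume "\<omega> \<in> \<Omega>"
      then have "\<bar>I l (\<theta> s \<omega>)\<bar> \<le> G * l" "\<bar>I l (\<theta> r (\<theta> ?u \<omega>))\<bar> \<le> G * l" using I_bound shift_in l s r u by auto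
      then show "\<bar>?h (\<omega>, \<theta> ?u \<omega>)\<bar> \<le> (G * l) * (G * l)"
        unfolding abs_mult fst_conv snd_conv by (intro mult_mono) (auto intro: order_trans[OF abs_ge_zero])
    qed measurable
    ultimately have "(\<integral>\<omega>. ?h (\<omega>, \<theta> ?u \<omega>) \<partial>Q) = (\<integral>\<omega>. (\<integral>\<omega>'. ?h (\<omega>, \<omega>') \<partial>\<PP> (\<Phi> ?u \<omega>)) \<partial>Q)"
      by (rule markov_integral[OF nu_prob u])
    then show ?thesis by (simp only: fst_conv snd_conv)
  qed
  finally have eq: "(\<integral>\<omega>. I l (\<theta> s \<omega>) * I l (\<theta> (?u + r) \<omega>) \<partial>Q) = (\<integral>\<omega>. (\<integral>\<omega>'. I l (\<theta> s \<omega>) * I l (\<theta> r \<omega>') \<partial>\<PP> (\<Phi> ?u \<omega>)) \<partial>Q)" .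
  have "\<bar>\<integral>\<omega>. (\<integral>\<omega>'. I l (\<theta> s \<omega>) * I l (\<theta> r \<omega>') \<partial>\<PP> (\<Phi> ?u \<omega>)) \<partial>Q\<bar> \<le> (\<integral>\<omega>. \<bar>\<integral>\<omega>'. I l (\<theta> s \<omega>) * I l (\<theta> r \<omega>') \<partial>\<PP> (\<Phi> ?u \<omega>)\<bar> \<partial>Q)"
    by (rule integral_abs_bound)
  also have "\<dots> \<le> (\<integral>\<omega>. G * l * (exp (- \<gamma> * r) * (Lg / \<gamma>) * D (\<Phi> ?u \<omega>)) \<partial>Q)"
  proof (rule integral_mono')
    show "integrable Q (\<lambda>\<omega>. G * l * (exp (- \<gamma> * r) * (Lg / \<gamma>) * D (\<Phi> ?u \<omega>)))"
      using integrable_Phi_Q[OF u D_integrable] by simp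
    fix \<omega> assume "\<omega> \<in> space Q"
    then have \<omega>: "\<omega> \<in> \<Omega>" by (simp add: Q_space)
    have "\<bar>\<integral>\<omega>'. I l (\<theta> s \<omega>) * I l (\<theta> r \<omega>') \<partial>\<PP> (\<Phi> ?u \<omega>)\<bar> = \<bar>I l (\<theta> s \<omega>)\<bar> * \<bar>\<integral>\<omega>'. I l (\<theta> r \<omega>') \<partial>\<PP> (\<Phi> ?u \<omega>)\<bar>"
      by (simp add: abs_mult)
    also have "\<dots> \<le> G * l * (exp (- \<gamma> * r) * (Lg / \<gamma>) * D (\<Phi> ?u \<omega>))"
      by (rule mult_mono) (use I_bound[OF shift_in[OF s \<omega>] l] integral_I_shift_PP[OF l r] G_nonneg l in auto)
    finally show "\<bar>\<integral>\<omega>'. I l (\<theta> s \<omega>) * I l (\<theta> r \<omega>') \<partial>\<PP> (\<Phi> ?u \<omega>)\<bar> \<le> G * l * (exp (- \<gamma> * r) * (Lg / \<gamma>) * D (\<Phi> ?u \<omega>))" .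
    show "0 \<le> G * l * (exp (- \<gamma> * r) * (Lg / \<gamma>) * D (\<Phi> ?u \<omega>))"
      using G_nonneg l Lg_nonneg gamma_pos D_nonneg by (intro mult_nonneg_nonneg) auto
  qed
  also have "\<dots> = G * l * (exp (- \<gamma> * r) * (Lg / \<gamma>) * Dbar)"
    using integral_Phi_Q[OF u D_measurable] by (simp add: Dbar_def)
  finally show ?thesis unfolding eq .
qed

text \<open>The sum of the geometric series of covariances of one block with all earlier blocks, counted
  twice.\<close>

definition cov_const :: real where "cov_const = 2 * (G * ((Lg / \<gamma>) * Dbar)) / (1 - exp (- \<gamma>))"

lemma cov_const_nonneg: "0 \<le> cov_const"
  unfolding cov_const_def using G_nonneg Lg_nonneg gamma_pos Dbar_nonneg by simp

text \<open>The block lengths \<open>l \<le> b\<close> leave a gap of \<open>b (j - i) - l \<ge> j - i - 1\<close> between the blocks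
  \<open>i < j\<close>; the covariances decay geometrically in it, so the second moment grows linearly.\<close>

lemma block_sum_second_moment:
  assumes l: "0 \<le> l" "l \<le> b" and b: "1 \<le> b"
  shows "(\<integral>\<omega>. (\<Sum>i<n. I l (\<theta> (real i * b) \<omega>))\<^sup>2 \<partial>Q) \<le> real n * ((\<integral>\<omega>. (I l \<omega>)\<^sup>2 \<partial>Q) + cov_const * l)"
proof (induction n)
  case (Suc n)
  define S where "S \<omega> = (\<Sum>i<n. I l (\<theta> (real i * b) \<omega>))" for \<omega>
  have pos: "0 \<le> real i * b" for i using b by simp
  have [measurable]: "I l \<in> borel_measurable Paths" using l by simp
  have [measurable]: "\<theta> (real i * b) \<in> Paths \<rightarrow>\<^sub>M Paths" for i by (rule shift_measurable[OF pos])
  have Bi: "\<omega> \<in> \<Omega> \<Longrightarrow> \<bar>I l (\<theta> (real i * b) \<omega>)\<bar> \<le> G * l" for \<omega> i using I_bound[OF shift_in[OF pos]] l by auto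
  have SB: "\<omega> \<in> \<Omega> \<Longrightarrow> \<bar>S \<omega>\<bar> \<le> real n * (G * l)" for \<omega>
    unfolding S_def using sum_norm_bound[of "{..<n}" "\<lambda>i. I l (\<theta> (real i * b) \<omega>)" "G * l"] Bi by simp
  have [measurable]: "S \<in> borel_measurable Paths" unfolding S_def by measurable
  have i1: "integrable Q (\<lambda>\<omega>. (S \<omega>)\<^sup>2)"
    by (rule integrable_bounded_law[OF nu_prob, of _ "(real n * (G * l))\<^sup>2"]) (use power_mono[OF SB abs_ge_zero, of _ 2] in auto)
  have i2: "integrable Q (\<lambda>\<omega>. (I l (\<theta> (real n * b) \<omega>))\<^sup>2)"
    by (rule integrable_bounded_law[OF nu_prob, of _ "(G * l)\<^sup>2"]) (use power_mono[OF Bi abs_ge_zero, of _ _ 2] in auto)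
  have i4: "integrable Q (\<lambda>\<omega>. I l (\<theta> (real i * b) \<omega>) * I l (\<theta> (real n * b) \<omega>))" for i
  proof (rule integrable_bounded_law[OF nu_prob, of _ "(G * l) * (G * l)"])
    fix \<omega> assume "\<omega> \<in> \<Omega>"
    then show "\<bar>I l (\<theta> (real i * b) \<omega>) * I l (\<theta> (real n * b) \<omega>)\<bar> \<le> (G * l) * (G * l)"
      unfolding abs_mult using Bi by (intro mult_mono) (auto intro: order_trans[OF abs_ge_zero])
  qed simp
  have i3: "integrable Q (\<lambda>\<omega>. S \<omega> * I l (\<theta> (real n * b) \<omega>))"
    unfolding S_def sum_distrib_right by (intro Bochner_Integration.integrable_sum i4)
  have cross: "(\<integral>\<omega>. S \<omega> * I l (\<theta> (real n * b) \<omega>) \<partial>Q) \<le> cov_const / 2 * l"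
  proof -
    have "(\<integral>\<omega>. S \<omega> * I l (\<theta> (real n * b) \<omega>) \<partial>Q) = (\<Sum>i<n. \<integral>\<omega>. I l (\<theta> (real i * b) \<omega>) * I l (\<theta> (real n * b) \<omega>) \<partial>Q)"
      unfolding S_def sum_distrib_right by (intro Bochner_Integration.integral_sum i4)
    also have "\<dots> \<le> (\<Sum>i<n. G * l * (exp (- \<gamma>) ^ (n - Suc i) * (Lg / \<gamma>) * Dbar))"
    proof (rule sum_mono)
      fix i assume "i \<in> {..<n}"
      then have i: "i < n" by simp
      define r where "r = real n * b - real i * b - l"
      have "real (n - Suc i) * 1 \<le> real (n - Suc i) * b" using b by (intro mult_left_mono) auto
      also have "\<dots> = real n * b - real i * b - b" using i by (simp add: of_nat_diff algebra_simps)
      finally have r: "real (n - Suc i) \<le> r" using l by (simp add: r_def)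
      then have r0: "0 \<le> r" by linarith
      have e: "exp (- \<gamma> * r) \<le> exp (- \<gamma>) ^ (n - Suc i)"
      proof -
        have "exp (- \<gamma> * r) \<le> exp (real (n - Suc i) * (- \<gamma>))" using r gamma_pos by (simp add: mult.commute)
        then show ?thesis by (simp only: exp_of_nat_mult)
      qed
      have "(\<integral>\<omega>. I l (\<theta> (real i * b) \<omega>) * I l (\<theta> (real n * b) \<omega>) \<partial>Q) \<le> G * l * (exp (- \<gamma> * r) * (Lg / \<gamma>) * Dbar)"
        using block_covariance[OF l(1) pos[of i] r0] by (simp add: r_def abs_le_iff)
      also have "\<dots> \<le> G * l * (exp (- \<gamma>) ^ (n - Suc i) * (Lg / \<gamma>) * Dbar)"
        by (intro mult_left_mono mult_right_mono e) (use G_nonneg l Lg_nonneg gamma_pos Dbar_nonneg in auto)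
      finally show "(\<integral>\<omega>. I l (\<theta> (real i * b) \<omega>) * I l (\<theta> (real n * b) \<omega>) \<partial>Q) \<le> G * l * (exp (- \<gamma>) ^ (n - Suc i) * (Lg / \<gamma>) * Dbar)" .
    qed
    also have "\<dots> = G * l * ((\<Sum>i<n. exp (- \<gamma>) ^ (n - Suc i)) * (Lg / \<gamma>) * Dbar)"
      by (simp add: sum_distrib_left sum_distrib_right sum_divide_distrib)
    also have "(\<Sum>i<n. exp (- \<gamma>) ^ (n - Suc i)) = (\<Sum>i<n. exp (- \<gamma>) ^ i)" by (rule sum.nat_diff_reindex)
    also have "G * l * ((\<Sum>i<n. exp (- \<gamma>) ^ i) * (Lg / \<gamma>) * Dbar) \<le> G * l * (1 / (1 - exp (- \<gamma>)) * (Lg / \<gamma>) * Dbar)"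
    proof (intro mult_left_mono mult_right_mono)
      have "(\<Sum>i<n. exp (- \<gamma>) ^ i) = (1 - exp (- \<gamma>) ^ n) / (1 - exp (- \<gamma>))" using gamma_pos by (subst sum_gp_strict) auto
      also have "\<dots> \<le> 1 / (1 - exp (- \<gamma>))" using gamma_pos by (intro divide_right_mono) auto
      finally show "(\<Sum>i<n. exp (- \<gamma>) ^ i) \<le> 1 / (1 - exp (- \<gamma>))" .
    qed (use G_nonneg l Lg_nonneg gamma_pos Dbar_nonneg in auto)
    finally have "(\<integral>\<omega>. S \<omega> * I l (\<theta> (real n * b) \<omega>) \<partial>Q) \<le> G * l * (1 / (1 - exp (- \<gamma>)) * (Lg / \<gamma>) * Dbar)" .
    moreover have "G * l * (1 / (1 - exp (- \<gamma>)) * (Lg / \<gamma>) * Dbar) = cov_const / 2 * l"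
    proof -
      have c: "cov_const / 2 = (G * ((Lg / \<gamma>) * Dbar)) / (1 - exp (- \<gamma>))" by (simp add: cov_const_def del: divide_divide_eq_left)
      show ?thesis unfolding c by (simp add: mult_ac)
    qed
    ultimately show ?thesis by (rule ord_le_eq_trans)
  qed
  have "(\<integral>\<omega>. (\<Sum>i<Suc n. I l (\<theta> (real i * b) \<omega>))\<^sup>2 \<partial>Q) = (\<integral>\<omega>. (S \<omega>)\<^sup>2 + 2 * (S \<omega> * I l (\<theta> (real n * b) \<omega>)) + (I l (\<theta> (real n * b) \<omega>))\<^sup>2 \<partial>Q)"
    by (simp add: S_def power2_sum algebra_simps)
  also have "\<dots> = (\<integral>\<omega>. (S \<omega>)\<^sup>2 \<partial>Q) + 2 * (\<integral>\<omega>. S \<omega> * I l (\<theta> (real n * b) \<omega>) \<partial>Q) + (\<integral>\<omega>. (I l (\<theta> (real n * b) \<omega>))\<^sup>2 \<partial>Q)"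
    using i1 i2 i3 by simp
  also have "(\<integral>\<omega>. (I l (\<theta> (real n * b) \<omega>))\<^sup>2 \<partial>Q) = (\<integral>\<omega>. (I l \<omega>)\<^sup>2 \<partial>Q)"
    by (rule shift_Q(1)[OF pos, of "\<lambda>\<omega>. (I l \<omega>)\<^sup>2"]) simp
  also have "(\<integral>\<omega>. (S \<omega>)\<^sup>2 \<partial>Q) \<le> real n * ((\<integral>\<omega>. (I l \<omega>)\<^sup>2 \<partial>Q) + cov_const * l)" using Suc.IH by (simp add: S_def)
  finally show ?case using cross by (simp add: algebra_simps)
qed simp

lemma I_block_sum:
  assumes "\<omega> \<in> \<Omega>" "0 \<le> b" shows "I (real n * b) \<omega> = (\<Sum>i<n. I b (\<theta> (real i * b) \<omega>))"
proof (induction n)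
  case (Suc n)
  have "I (real n * b + b) \<omega> = I (real n * b) \<omega> + I b (\<theta> (real n * b) \<omega>)" by (rule I_add) (use assms in auto)
  then show ?case using Suc.IH by (simp add: algebra_simps)
qed (simp add: I_0)

definition var_const :: real where "var_const = G\<^sup>2 + cov_const"

lemma var_const_nonneg: "0 \<le> var_const"
  unfolding var_const_def using cov_const_nonneg by simp

lemma I_second_moment: "(\<integral>\<omega>. (I (real n) \<omega>)\<^sup>2 \<partial>Q) \<le> var_const * real n"
proof -
  interpret q: prob_space Q by (rule Q_prob_space)
  have "(\<integral>\<omega>. (I (real n) \<omega>)\<^sup>2 \<partial>Q) = (\<integral>\<omega>. (\<Sum>i<n. I 1 (\<theta> (real i * 1) \<omega>))\<^sup>2 \<partial>Q)"
    by (rule Bochner_Integration.integral_cong) (use I_block_sum[of _ 1 n] in \<open>auto simp: Q_space\<close>)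
  also have "\<dots> \<le> real n * ((\<integral>\<omega>. (I 1 \<omega>)\<^sup>2 \<partial>Q) + cov_const * 1)" by (rule block_sum_second_moment) auto
  also have "\<dots> \<le> real n * (G\<^sup>2 + cov_const * 1)"
  proof (intro mult_left_mono add_right_mono)
    have b: "\<omega> \<in> \<Omega> \<Longrightarrow> (I 1 \<omega>)\<^sup>2 \<le> G\<^sup>2" for \<omega> using power_mono[OF I_bound[of \<omega> 1] abs_ge_zero, of 2] by simp
    have "(\<integral>\<omega>. (I 1 \<omega>)\<^sup>2 \<partial>Q) \<le> (\<integral>\<omega>. G\<^sup>2 \<partial>Q)"
      by (rule integral_mono', simp, use b in \<open>auto simp: Q_space\<close>)
    then show "(\<integral>\<omega>. (I 1 \<omega>)\<^sup>2 \<partial>Q) \<le> G\<^sup>2" by (simp add: q.prob_space)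
  qed auto
  finally show ?thesis by (simp add: var_const_def mult.commute)
qed

section \<open>The corrector and the asymptotic variance\<close>

abbreviation "corr \<equiv> corrector P g"

lemma integral_I_PP_bound: "0 \<le> t \<Longrightarrow> \<bar>\<integral>\<omega>. I t \<omega> \<partial>\<PP> x\<bar> \<le> (Lg / \<gamma>) * D x"
proof -
  assume t: "0 \<le> t"
  have "(\<integral>\<omega>. I t (\<theta> 0 \<omega>) \<partial>\<PP> x) = (\<integral>\<omega>. I t \<omega> \<partial>\<PP> x)"
    by (rule Bochner_Integration.integral_cong) (use I_add[of _ 0 t] t in \<open>auto simp: space_PP I_0\<close>)
  with integral_I_shift_PP[OF t, of 0 x] show ?thesis by simp
qed

text \<open>Exchanging the expectation with the time integral gives the integral of \<open>P\<^sub>s g x\<close> up to \<open>n\<close>,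
  and \<open>semigroup_decay\<close> provides an integrable majorant.\<close>

lemma corrector_limit: "(\<lambda>n. \<integral>\<omega>. I (real n) \<omega> \<partial>\<PP> x) \<longlonglongrightarrow> corr x"
proof -
  let ?S = "\<lambda>t. semigroup_op P t g x"
  have m: "(\<lambda>t. indicator {0..real n} t * ?S t) \<in> borel_measurable lborel" for n
    using integral_I_PP(2)[of "real n" x] by simp
  have lim: "(\<lambda>n. indicator {0..real n} t * ?S t) \<longlonglongrightarrow> indicator {0..} t * ?S t" for t
  proof (rule tendsto_eventually)
    obtain N :: nat where N: "t \<le> real N" using real_arch_simple by blast
    show "eventually (\<lambda>n. indicator {0..real n} t * ?S t = indicator {0..} t * ?S t) sequentially"
      using eventually_ge_at_top[of N]
    proof eventually_elim
      fix n assume "N \<le> n"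
      with N have "t \<le> real n" by linarith
      then show "indicator {0..real n} t * ?S t = indicator {0..} t * ?S t" by (auto split: split_indicator)
    qed
  qed
  have lm: "(\<lambda>t. indicator {0..} t * ?S t) \<in> borel_measurable lborel"
    by (rule borel_measurable_LIMSEQ_real[OF lim m])
  have wi: "integrable lborel (\<lambda>t. indicator {0<..} t * exp (- (t * \<gamma>)) * (Lg * D x))"
    using integrable_I0i_exp_mscale[OF gamma_pos] unfolding set_integrable_def by (intro integrable_mult_left) simp
  have "(\<lambda>n. \<integral>t. indicator {0..real n} t * ?S t \<partial>lborel) \<longlonglongrightarrow> (\<integral>t. indicator {0..} t * ?S t \<partial>lborel)"
  proof (rule integral_dominated_convergence[OF lm m wi])
    show "AE t in lborel. (\<lambda>n. indicator {0..real n} t * ?S t) \<longlonglongrightarrow> indicator {0..} t * ?S t" using lim by simp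
    fix n
    show "AE t in lborel. norm (indicator {0..real n} t * ?S t) \<le> indicator {0<..} t * exp (- (t * \<gamma>)) * (Lg * D x)"
      using AE_lborel_singleton[of "0::real"]
    proof eventually_elim
      fix t :: real assume "t \<noteq> 0"
      then show "norm (indicator {0..real n} t * ?S t) \<le> indicator {0<..} t * exp (- (t * \<gamma>)) * (Lg * D x)"
        using semigroup_decay[of t x] Lg_nonneg D_nonneg[of x] by (auto simp: mult_ac split: split_indicator)
    qed
  qed
  then show ?thesis unfolding corrector_def set_lebesgue_integral_def by (simp add: integral_I_PP(1) set_lebesgue_integral_def)
qed

lemma corrector_measurable [measurable]: "corr \<in> borel_measurable borel"
  by (rule borel_measurable_LIMSEQ_real[OF corrector_limit PP_integral_measurable]) simp

definition corr_const :: real where "corr_const = Lg / \<gamma>"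

lemma corr_const_nonneg: "0 \<le> corr_const"
  using Lg_nonneg gamma_pos by (simp add: corr_const_def)

lemma corrector_bound: "\<bar>corr x\<bar> \<le> corr_const * D x"
  by (rule LIMSEQ_le_const2[OF tendsto_rabs[OF corrector_limit]]) (use integral_I_PP_bound in \<open>auto simp: corr_const_def\<close>)

abbreviation "Z \<equiv> corrector_increment P \<Phi> g"

lemma Z_measurable [measurable]: "Z \<in> borel_measurable Paths"
proof -
  have [measurable]: "\<Phi> 1 \<in> Paths \<rightarrow>\<^sub>M borel" "\<Phi> 0 \<in> Paths \<rightarrow>\<^sub>M borel" "I 1 \<in> borel_measurable Paths" by simp_all
  show ?thesis unfolding corrector_increment_def [abs_def] by measurable
qed

text \<open>The Poisson equation of the corrector. The expectation of \<open>I\<close> at time \<open>n + 1\<close> splits into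
  the first unit of time and the expectation of \<open>I\<close> at time \<open>n\<close> from the position \<open>\<Phi> 1\<close>; in the
  limit this becomes \<open>\<chi>(x) = E\<^sub>x I\<^sub>1 + E\<^sub>x \<chi>(\<Phi>\<^sub>1)\<close>. It is established for those \<open>x\<close> for which
  \<open>\<chi>(\<Phi>\<^sub>1)\<close> is visibly integrable, that is, for almost all of them.\<close>

lemma increment_mean: "AE x in \<nu>. (\<integral>\<omega>. Z \<omega> \<partial>\<PP> x) = 0"
proof -
  have [measurable]: "\<Phi> 1 \<in> Paths \<rightarrow>\<^sub>M borel" "\<Phi> 0 \<in> Paths \<rightarrow>\<^sub>M borel" "\<theta> 1 \<in> Paths \<rightarrow>\<^sub>M Paths" by simp_all
  have [measurable]: "I (real n) \<in> borel_measurable Paths" "I 1 \<in> borel_measurable Paths" for n by simp_all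
  have "integrable Q (\<lambda>\<omega>. D (\<Phi> 1 \<omega>))" by (rule integrable_Phi_Q[OF _ D_integrable]) simp
  then have "(\<integral>\<^sup>+\<omega>. ennreal (D (\<Phi> 1 \<omega>)) \<partial>Q) < \<infinity>" by (simp add: real_integrable_def less_top)
  then have "(\<integral>\<^sup>+x. (\<integral>\<^sup>+\<omega>. ennreal (D (\<Phi> 1 \<omega>)) \<partial>\<PP> x) \<partial>\<nu>) \<noteq> \<infinity>"
    by (subst nn_integral_law[OF nu_prob, symmetric]) auto
  then have "AE x in \<nu>. (\<integral>\<^sup>+\<omega>. ennreal (D (\<Phi> 1 \<omega>)) \<partial>\<PP> x) \<noteq> \<infinity>"
    by (rule nn_integral_PInf_AE[rotated]) (use PP_nn_measurable[of "\<lambda>\<omega>. ennreal (D (\<Phi> 1 \<omega>))"] in \<open>simp cong: measurable_cong_sets add: nu_sets\<close>)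
  then show ?thesis
  proof eventually_elim
    fix x assume fin: "(\<integral>\<^sup>+\<omega>. ennreal (D (\<Phi> 1 \<omega>)) \<partial>\<PP> x) \<noteq> \<infinity>"
    interpret p: prob_space "\<PP> x" by (rule prob_space_PP)
    have iD: "integrable (\<PP> x) (\<lambda>\<omega>. D (\<Phi> 1 \<omega>))"
      by (rule integrableI_nonneg) (use fin D_nonneg in \<open>auto simp: measurable_PP less_top\<close>)
    have iI: "integrable (\<PP> x) (I (real n))" for n
      by (rule integrable_bounded_PP[of _ "G * real n"]) (use I_bound in auto)
    have iI1: "integrable (\<PP> x) (I 1)" using iI[of 1] by simp
    have icorr: "integrable (\<PP> x) (\<lambda>\<omega>. corr (\<Phi> 1 \<omega>))"
      by (rule Bochner_Integration.integrable_bound[OF integrable_mult_right[OF iD, of corr_const]])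
        (use corrector_bound corr_const_nonneg D_nonneg in \<open>auto simp: measurable_PP abs_mult\<close>)
    have 1: "(\<lambda>n. \<integral>\<omega>. (\<integral>\<omega>'. I (real n) \<omega>' \<partial>\<PP> (\<Phi> 1 \<omega>)) \<partial>\<PP> x) \<longlonglongrightarrow> (\<integral>\<omega>. corr (\<Phi> 1 \<omega>) \<partial>\<PP> x)"
    proof (rule integral_dominated_convergence[where w="\<lambda>\<omega>. corr_const * D (\<Phi> 1 \<omega>)"])
      show "(\<lambda>\<omega>. \<integral>\<omega>'. I (real n) \<omega>' \<partial>\<PP> (\<Phi> 1 \<omega>)) \<in> borel_measurable (\<PP> x)" for n
        unfolding measurable_PP by (rule measurable_compose[OF _ PP_integral_measurable]) simp_all
      show "AE \<omega> in \<PP> x. (\<lambda>n. \<integral>\<omega>'. I (real n) \<omega>' \<partial>\<PP> (\<Phi> 1 \<omega>)) \<longlonglongrightarrow> corr (\<Phi> 1 \<omega>)" using corrector_limit by simp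
      show "AE \<omega> in \<PP> x. norm (\<integral>\<omega>'. I (real n) \<omega>' \<partial>\<PP> (\<Phi> 1 \<omega>)) \<le> corr_const * D (\<Phi> 1 \<omega>)" for n
        using integral_I_PP_bound by (simp add: corr_const_def)
    qed (use iD in \<open>auto simp: measurable_PP\<close>)
    have 2: "(\<integral>\<omega>. (\<integral>\<omega>'. I (real n) \<omega>' \<partial>\<PP> (\<Phi> 1 \<omega>)) \<partial>\<PP> x) = (\<integral>\<omega>. I (real (Suc n)) \<omega> \<partial>\<PP> x) - (\<integral>\<omega>. I 1 \<omega> \<partial>\<PP> x)" for n
    proof -
      have "integrable (\<PP> x) (\<lambda>\<omega>. I (real n) (\<theta> 1 \<omega>))"
        by (rule integrable_bounded_PP[of _ "G * real n"]) (use I_bound[OF shift_in] in auto)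
      then have "(\<integral>\<omega>. I (real n) (\<theta> 1 \<omega>) \<partial>\<PP> x) = (\<integral>\<omega>. (\<integral>\<omega>'. I (real n) \<omega>' \<partial>\<PP> (\<Phi> 1 \<omega>)) \<partial>\<PP> x)"
        using markov_integral_PP[of 1 "\<lambda>z. I (real n) (snd z)" x] by simp
      moreover have "(\<integral>\<omega>. I (real n) (\<theta> 1 \<omega>) \<partial>\<PP> x) = (\<integral>\<omega>. I (real (Suc n)) \<omega> - I 1 \<omega> \<partial>\<PP> x)"
        by (rule Bochner_Integration.integral_cong) (use I_add[of _ 1 "real n"] in \<open>auto simp: space_PP\<close>)
      ultimately show ?thesis using iI[of "Suc n"] iI1 by simp
    qed
    have 3: "(\<lambda>n. (\<integral>\<omega>. I (real (Suc n)) \<omega> \<partial>\<PP> x) - (\<integral>\<omega>. I 1 \<omega> \<partial>\<PP> x)) \<longlonglongrightarrow> corr x - (\<integral>\<omega>. I 1 \<omega> \<partial>\<PP> x)"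
      by (intro tendsto_diff LIMSEQ_Suc[OF corrector_limit] tendsto_const)
    have 4: "(\<integral>\<omega>. corr (\<Phi> 1 \<omega>) \<partial>\<PP> x) = corr x - (\<integral>\<omega>. I 1 \<omega> \<partial>\<PP> x)"
      by (rule LIMSEQ_unique[OF 1]) (use 3 2 in simp)
    have "(\<integral>\<omega>. Z \<omega> \<partial>\<PP> x) = (\<integral>\<omega>. corr (\<Phi> 1 \<omega>) - corr x + I 1 \<omega> \<partial>\<PP> x)"
      unfolding corrector_increment_def
      by (rule integral_cong_AE) (use start_AE[of x] in \<open>auto simp: measurable_PP elim!: eventually_mono\<close>)
    also have "\<dots> = 0" using icorr iI1 4 by (simp add: p.prob_space)
    finally show "(\<integral>\<omega>. Z \<omega> \<partial>\<PP> x) = 0" .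
  qed
qed

lemma corrector_Phi_square_integrable: assumes "0 \<le> t" shows "integrable Q (\<lambda>\<omega>. (corr (\<Phi> t \<omega>))\<^sup>2)"
proof (rule Bochner_Integration.integrable_bound)
  show "integrable Q (\<lambda>\<omega>. corr_const\<^sup>2 * (D (\<Phi> t \<omega>))\<^sup>2)" using integrable_Phi_Q[OF assms D_square_integrable] by simp
  show "(\<lambda>\<omega>. (corr (\<Phi> t \<omega>))\<^sup>2) \<in> borel_measurable Q" using Phi_Paths_measurable[OF assms] by (simp add: Q_measurable)
  show "AE \<omega> in Q. norm ((corr (\<Phi> t \<omega>))\<^sup>2) \<le> norm (corr_const\<^sup>2 * (D (\<Phi> t \<omega>))\<^sup>2)"
    using power_mono[OF corrector_bound abs_ge_zero, of _ 2] by (simp add: power_mult_distrib)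
qed

text \<open>The martingale approximation of the functional.\<close>

definition M :: "nat \<Rightarrow> 'w \<Rightarrow> real" where
  "M n \<omega> = corr (\<Phi> (real n) \<omega>) - corr (\<Phi> 0 \<omega>) + I (real n) \<omega>"

lemma M_Past: "M n \<in> borel_measurable (Past (real n))"
proof -
  have [measurable]: "\<Phi> (real n) \<in> Past (real n) \<rightarrow>\<^sub>M borel" "\<Phi> 0 \<in> Past (real n) \<rightarrow>\<^sub>M borel" by (auto intro!: Phi_measurable)
  have [measurable]: "I (real n) \<in> borel_measurable (Past (real n))" by (rule I_Past) simp
  show ?thesis unfolding M_def [abs_def] by measurable
qed

lemma M_measurable [measurable]: "M n \<in> borel_measurable Paths"
  by (rule measurable_Past_Paths[OF M_Past])

lemma M_square_integrable: "integrable Q (\<lambda>\<omega>. (M n \<omega>)\<^sup>2)"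
proof (rule Bochner_Integration.integrable_bound)
  interpret q: prob_space Q by (rule Q_prob_space)
  let ?n = "real n"
  show "integrable Q (\<lambda>\<omega>. 3 * (corr (\<Phi> ?n \<omega>))\<^sup>2 + 3 * (corr (\<Phi> 0 \<omega>))\<^sup>2 + 3 * (G * ?n)\<^sup>2)"
    using corrector_Phi_square_integrable[of ?n] corrector_Phi_square_integrable[of 0] by simp
  show "(\<lambda>\<omega>. (M n \<omega>)\<^sup>2) \<in> borel_measurable Q" by (simp add: Q_measurable)
  show "AE \<omega> in Q. norm ((M n \<omega>)\<^sup>2) \<le> norm (3 * (corr (\<Phi> ?n \<omega>))\<^sup>2 + 3 * (corr (\<Phi> 0 \<omega>))\<^sup>2 + 3 * (G * ?n)\<^sup>2)"
  proof (rule AE_I2)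
    fix \<omega> assume "\<omega> \<in> space Q"
    then have i: "(I ?n \<omega>)\<^sup>2 \<le> (G * ?n)\<^sup>2" using power_mono[OF I_bound[of \<omega> ?n] abs_ge_zero, of 2] by (simp add: Q_space)
    have gen: "(a - b + c)\<^sup>2 \<le> 3 * a\<^sup>2 + 3 * b\<^sup>2 + 3 * c\<^sup>2" for a b c :: real
      using zero_le_power2[of "a + b"] zero_le_power2[of "a - c"] zero_le_power2[of "b + c"]
      by (simp add: power2_eq_square algebra_simps)
    show "norm ((M n \<omega>)\<^sup>2) \<le> norm (3 * (corr (\<Phi> ?n \<omega>))\<^sup>2 + 3 * (corr (\<Phi> 0 \<omega>))\<^sup>2 + 3 * (G * ?n)\<^sup>2)"
      using gen[of "corr (\<Phi> ?n \<omega>)" "corr (\<Phi> 0 \<omega>)" "I ?n \<omega>"] i by (simp add: M_def)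
  qed
qed

lemma Z_eq_M: "Z = M 1"
  by (simp add: fun_eq_iff corrector_increment_def M_def)

definition \<sigma>2 :: real where "\<sigma>2 = (\<integral>\<omega>. (Z \<omega>)\<^sup>2 \<partial>Q)"

lemma \<sigma>2_nonneg: "0 \<le> \<sigma>2"
  unfolding \<sigma>2_def by (rule Bochner_Integration.integral_nonneg) simp

lemma increment_square_integrable: "integrable Q (\<lambda>\<omega>. (Z \<omega>)\<^sup>2)"
  unfolding Z_eq_M by (rule M_square_integrable)

lemma product_integrable:
  fixes a b :: "'w \<Rightarrow> real"
  assumes "a \<in> borel_measurable Q" "b \<in> borel_measurable Q" "integrable Q (\<lambda>\<omega>. (a \<omega>)\<^sup>2)" "integrable Q (\<lambda>\<omega>. (b \<omega>)\<^sup>2)"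
  shows "integrable Q (\<lambda>\<omega>. a \<omega> * b \<omega>)"
proof (rule Bochner_Integration.integrable_bound)
  show "integrable Q (\<lambda>\<omega>. (a \<omega>)\<^sup>2 + (b \<omega>)\<^sup>2)" using assms by simp
  show "AE \<omega> in Q. norm (a \<omega> * b \<omega>) \<le> norm ((a \<omega>)\<^sup>2 + (b \<omega>)\<^sup>2)"
  proof (rule AE_I2)
    fix \<omega>
    have "2 * (\<bar>a \<omega>\<bar> * \<bar>b \<omega>\<bar>) \<le> (a \<omega>)\<^sup>2 + (b \<omega>)\<^sup>2" using zero_le_power2[of "\<bar>a \<omega>\<bar> - \<bar>b \<omega>\<bar>"] by (simp add: power2_diff)
    moreover have "0 \<le> \<bar>a \<omega>\<bar> * \<bar>b \<omega>\<bar>" by simp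
    ultimately have "\<bar>a \<omega>\<bar> * \<bar>b \<omega>\<bar> \<le> (a \<omega>)\<^sup>2 + (b \<omega>)\<^sup>2" by linarith
    then show "norm (a \<omega> * b \<omega>) \<le> norm ((a \<omega>)\<^sup>2 + (b \<omega>)\<^sup>2)" by (simp add: abs_mult)
  qed
qed (use assms in simp)

lemma AE_Phi_Q:
  assumes "0 \<le> t" "AE x in \<nu>. R x" shows "AE \<omega> in Q. R (\<Phi> t \<omega>)"
proof -
  have e: "distr Q borel (\<Phi> t) = \<nu>" using Phi_law[OF assms(1) nu_prob] nu_invariant[OF assms(1)] by simp
  have "AE x in distr Q borel (\<Phi> t). R x" unfolding e by (rule assms(2))
  then show ?thesis by (rule AE_distrD[rotated]) (use Phi_Paths_measurable[OF assms(1)] in \<open>simp add: Q_measurable\<close>)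
qed

text \<open>Each increment is a shifted copy of \<open>Z\<close>, which is centred given the past, so the mixed terms
  vanish.\<close>

lemma M_second_moment: "(\<integral>\<omega>. (M n \<omega>)\<^sup>2 \<partial>Q) = real n * \<sigma>2"
proof (induction n)
  case 0 then show ?case by (simp add: M_def I_0)
next
  case (Suc n)
  let ?n = "real n"
  have [measurable]: "\<theta> ?n \<in> Paths \<rightarrow>\<^sub>M Paths" by simp
  have mZ: "(\<lambda>\<omega>. Z (\<theta> ?n \<omega>)) \<in> borel_measurable Q" and mM: "M n \<in> borel_measurable Q" by (simp_all add: Q_measurable)
  have step: "M (Suc n) \<omega> = M n \<omega> + Z (\<theta> ?n \<omega>)" if "\<omega> \<in> \<Omega>" for \<omega>
    using shift[of 1 ?n \<omega>] shift[of 0 ?n \<omega>] I_add[of \<omega> ?n 1] that by (simp add: M_def corrector_increment_def add.commute)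
  have iZ: "integrable Q (\<lambda>\<omega>. (Z (\<theta> ?n \<omega>))\<^sup>2)"
    using shift_Q(2)[of ?n "\<lambda>\<omega>. (Z \<omega>)\<^sup>2"] increment_square_integrable by simp
  have iMZ: "integrable Q (\<lambda>\<omega>. M n \<omega> * Z (\<theta> ?n \<omega>))" by (rule product_integrable[OF mM mZ M_square_integrable iZ])
  have cross: "(\<integral>\<omega>. M n \<omega> * Z (\<theta> ?n \<omega>) \<partial>Q) = 0"
  proof -
    let ?h = "\<lambda>z. M n (fst z) * Z (snd z)"
    have [measurable]: "M n \<in> borel_measurable (Past ?n)" by (rule M_Past)
    have hm: "?h \<in> borel_measurable (Past ?n \<Otimes>\<^sub>M Paths)" by measurable
    have "(\<integral>\<omega>. ?h (\<omega>, \<theta> ?n \<omega>) \<partial>Q) = (\<integral>\<omega>. (\<integral>\<omega>'. ?h (\<omega>, \<omega>') \<partial>\<PP> (\<Phi> ?n \<omega>)) \<partial>Q)"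
      by (rule markov_integral[OF nu_prob _ hm]) (use iMZ in simp_all)
    also have "\<dots> = (\<integral>\<omega>. 0 \<partial>Q)"
    proof (rule integral_cong_AE)
      show "(\<lambda>\<omega>. \<integral>\<omega>'. ?h (\<omega>, \<omega>') \<partial>\<PP> (\<Phi> ?n \<omega>)) \<in> borel_measurable Q"
        unfolding Q_measurable by (rule integral_PP_measurable[OF _ hm]) simp
      show "AE \<omega> in Q. (\<integral>\<omega>'. ?h (\<omega>, \<omega>') \<partial>\<PP> (\<Phi> ?n \<omega>)) = 0"
        using AE_Phi_Q[OF _ increment_mean, of ?n] by (auto elim!: eventually_mono)
    qed simp
    finally show ?thesis by simp
  qed
  have "(\<integral>\<omega>. (M (Suc n) \<omega>)\<^sup>2 \<partial>Q) = (\<integral>\<omega>. (M n \<omega>)\<^sup>2 + 2 * (M n \<omega> * Z (\<theta> ?n \<omega>)) + (Z (\<theta> ?n \<omega>))\<^sup>2 \<partial>Q)"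
    by (rule Bochner_Integration.integral_cong) (simp_all add: Q_space step power2_sum algebra_simps)
  also have "\<dots> = (\<integral>\<omega>. (M n \<omega>)\<^sup>2 \<partial>Q) + 2 * (\<integral>\<omega>. M n \<omega> * Z (\<theta> ?n \<omega>) \<partial>Q) + (\<integral>\<omega>. (Z (\<theta> ?n \<omega>))\<^sup>2 \<partial>Q)"
    using M_square_integrable[of n] iMZ iZ by simp
  also have "(\<integral>\<omega>. (Z (\<theta> ?n \<omega>))\<^sup>2 \<partial>Q) = \<sigma>2"
    unfolding \<sigma>2_def by (rule shift_Q(1)[of ?n "\<lambda>\<omega>. (Z \<omega>)\<^sup>2"]) simp_all
  finally show ?case using cross Suc.IH by (simp add: algebra_simps)
qed

definition var_err :: real where "var_err = var_const + 2 * (4 * corr_const\<^sup>2 * (\<integral>x. (D x)\<^sup>2 \<partial>\<nu>))"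

lemma var_err_nonneg: "0 \<le> var_err"
  unfolding var_err_def using var_const_nonneg by (simp add: Bochner_Integration.integral_nonneg)

text \<open>The difference between \<open>I\<close> and the martingale is bounded in mean square uniformly in time,
  and the mixed term is of order \<open>sqrt n\<close> by the weighted arithmetic-geometric mean inequality.\<close>

lemma I_variance:
  assumes "0 < n" shows "\<bar>(\<integral>\<omega>. (I (real n) \<omega>)\<^sup>2 \<partial>Q) - real n * \<sigma>2\<bar> \<le> var_err * sqrt (real n)"
proof -
  interpret q: prob_space Q by (rule Q_prob_space)
  let ?n = "real n"
  have n1: "1 \<le> sqrt ?n" using assms by simp
  define E where "E \<omega> = corr (\<Phi> ?n \<omega>) - corr (\<Phi> 0 \<omega>)" for \<omega>
  have [measurable]: "I ?n \<in> borel_measurable Paths" "\<Phi> ?n \<in> Paths \<rightarrow>\<^sub>M borel" "\<Phi> 0 \<in> Paths \<rightarrow>\<^sub>M borel" by simp_all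
  have [measurable]: "E \<in> borel_measurable Paths" unfolding E_def by measurable
  have bnd: "integrable Q (\<lambda>\<omega>. 2 * corr_const\<^sup>2 * (D (\<Phi> ?n \<omega>))\<^sup>2 + 2 * corr_const\<^sup>2 * (D (\<Phi> 0 \<omega>))\<^sup>2)"
    using integrable_Phi_Q[OF _ D_square_integrable, of ?n] integrable_Phi_Q[OF _ D_square_integrable, of 0] by simp
  have pw: "(E \<omega>)\<^sup>2 \<le> 2 * corr_const\<^sup>2 * (D (\<Phi> ?n \<omega>))\<^sup>2 + 2 * corr_const\<^sup>2 * (D (\<Phi> 0 \<omega>))\<^sup>2" for \<omega>
  proof -
    have sq: "(corr x)\<^sup>2 \<le> corr_const\<^sup>2 * (D x)\<^sup>2" for x using power_mono[OF corrector_bound abs_ge_zero, of x 2] by (simp add: power_mult_distrib)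
    have "(E \<omega>)\<^sup>2 \<le> 2 * (corr (\<Phi> ?n \<omega>))\<^sup>2 + 2 * (corr (\<Phi> 0 \<omega>))\<^sup>2"
      using zero_le_power2[of "corr (\<Phi> ?n \<omega>) + corr (\<Phi> 0 \<omega>)"] by (simp add: E_def power2_sum power2_diff)
    with sq[of "\<Phi> ?n \<omega>"] sq[of "\<Phi> 0 \<omega>"] show ?thesis by linarith
  qed
  have iE: "integrable Q (\<lambda>\<omega>. (E \<omega>)\<^sup>2)"
    by (rule Bochner_Integration.integrable_bound[OF bnd]) (use pw in \<open>auto simp: Q_measurable intro: order_trans[OF _ abs_ge_self]\<close>)
  have EE: "(\<integral>\<omega>. (E \<omega>)\<^sup>2 \<partial>Q) \<le> 4 * corr_const\<^sup>2 * (\<integral>x. (D x)\<^sup>2 \<partial>\<nu>)"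
  proof -
    have "(\<integral>\<omega>. (E \<omega>)\<^sup>2 \<partial>Q) \<le> (\<integral>\<omega>. 2 * corr_const\<^sup>2 * (D (\<Phi> ?n \<omega>))\<^sup>2 + 2 * corr_const\<^sup>2 * (D (\<Phi> 0 \<omega>))\<^sup>2 \<partial>Q)"
      by (rule integral_mono[OF iE bnd pw])
    also have "\<dots> = 4 * corr_const\<^sup>2 * (\<integral>x. (D x)\<^sup>2 \<partial>\<nu>)"
      using integrable_Phi_Q[OF _ D_square_integrable, of ?n] integrable_Phi_Q[OF _ D_square_integrable, of 0]
        integral_Phi_Q[of ?n "\<lambda>x. (D x)\<^sup>2"] integral_Phi_Q[of 0 "\<lambda>x. (D x)\<^sup>2"] by simp
    finally show ?thesis .
  qed
  have iI: "integrable Q (\<lambda>\<omega>. (I ?n \<omega>)\<^sup>2)"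
    by (rule integrable_bounded_law[OF nu_prob, of _ "(G * ?n)\<^sup>2"]) (use power_mono[OF I_bound abs_ge_zero, of _ ?n 2] in auto)
  have iIE: "integrable Q (\<lambda>\<omega>. I ?n \<omega> * E \<omega>)" by (rule product_integrable[OF _ _ iI iE]) (simp_all add: Q_measurable)
  have "real n * \<sigma>2 = (\<integral>\<omega>. (I ?n \<omega>)\<^sup>2 + 2 * (I ?n \<omega> * E \<omega>) + (E \<omega>)\<^sup>2 \<partial>Q)"
    unfolding M_second_moment[symmetric] M_def E_def by (simp add: power2_eq_square algebra_simps)
  also have "\<dots> = (\<integral>\<omega>. (I ?n \<omega>)\<^sup>2 \<partial>Q) + 2 * (\<integral>\<omega>. I ?n \<omega> * E \<omega> \<partial>Q) + (\<integral>\<omega>. (E \<omega>)\<^sup>2 \<partial>Q)"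
    using iI iIE iE by simp
  finally have eq: "(\<integral>\<omega>. (I ?n \<omega>)\<^sup>2 \<partial>Q) - real n * \<sigma>2 = - (2 * (\<integral>\<omega>. I ?n \<omega> * E \<omega> \<partial>Q)) - (\<integral>\<omega>. (E \<omega>)\<^sup>2 \<partial>Q)" by simp
  have ab: "2 * (\<bar>a\<bar> * \<bar>b\<bar>) \<le> a\<^sup>2 / s + s * b\<^sup>2" if "0 < s" for a b s :: real
  proof -
    have "0 \<le> (\<bar>a\<bar> - s * \<bar>b\<bar>)\<^sup>2 / s" using that by simp
    also have "(\<bar>a\<bar> - s * \<bar>b\<bar>)\<^sup>2 / s = a\<^sup>2 / s + s * b\<^sup>2 - 2 * (\<bar>a\<bar> * \<bar>b\<bar>)"
      using that by (simp add: power2_diff power_mult_distrib field_simps power2_eq_square)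
    finally show ?thesis by simp
  qed
  have "\<bar>2 * (\<integral>\<omega>. I ?n \<omega> * E \<omega> \<partial>Q)\<bar> = \<bar>\<integral>\<omega>. 2 * (I ?n \<omega> * E \<omega>) \<partial>Q\<bar>" by simp
  also have "\<dots> \<le> (\<integral>\<omega>. \<bar>2 * (I ?n \<omega> * E \<omega>)\<bar> \<partial>Q)" by (rule integral_abs_bound)
  also have "\<dots> \<le> (\<integral>\<omega>. (I ?n \<omega>)\<^sup>2 / sqrt ?n + sqrt ?n * (E \<omega>)\<^sup>2 \<partial>Q)"
  proof (rule integral_mono)
    show "integrable Q (\<lambda>\<omega>. \<bar>2 * (I ?n \<omega> * E \<omega>)\<bar>)" using iIE by (intro integrable_abs integrable_mult_right)
  qed (use iI iE ab[of "sqrt ?n"] assms in \<open>auto simp: abs_mult\<close>)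
  also have "\<dots> = (\<integral>\<omega>. (I ?n \<omega>)\<^sup>2 \<partial>Q) / sqrt ?n + sqrt ?n * (\<integral>\<omega>. (E \<omega>)\<^sup>2 \<partial>Q)" using iI iE by simp
  also have "\<dots> \<le> var_const * sqrt ?n + sqrt ?n * (4 * corr_const\<^sup>2 * (\<integral>x. (D x)\<^sup>2 \<partial>\<nu>))"
  proof (intro add_mono mult_left_mono EE)
    have "(\<integral>\<omega>. (I ?n \<omega>)\<^sup>2 \<partial>Q) / sqrt ?n \<le> var_const * ?n / sqrt ?n" by (intro divide_right_mono I_second_moment) simp
    also have "\<dots> = var_const * sqrt ?n" using real_div_sqrt[of ?n] by (simp only: times_divide_eq_right[symmetric])
    finally show "(\<integral>\<omega>. (I ?n \<omega>)\<^sup>2 \<partial>Q) / sqrt ?n \<le> var_const * sqrt ?n" .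
  qed simp
  finally have 1: "\<bar>2 * (\<integral>\<omega>. I ?n \<omega> * E \<omega> \<partial>Q)\<bar> \<le> var_const * sqrt ?n + sqrt ?n * (4 * corr_const\<^sup>2 * (\<integral>x. (D x)\<^sup>2 \<partial>\<nu>))" .
  have 2: "0 \<le> (\<integral>\<omega>. (E \<omega>)\<^sup>2 \<partial>Q)" by (rule Bochner_Integration.integral_nonneg) simp
  have 3: "4 * corr_const\<^sup>2 * (\<integral>x. (D x)\<^sup>2 \<partial>\<nu>) \<le> sqrt ?n * (4 * corr_const\<^sup>2 * (\<integral>x. (D x)\<^sup>2 \<partial>\<nu>))"
    using mult_right_mono[OF n1, of "4 * corr_const\<^sup>2 * (\<integral>x. (D x)\<^sup>2 \<partial>\<nu>)"] by (simp add: Bochner_Integration.integral_nonneg)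
  have "\<bar>(\<integral>\<omega>. (I ?n \<omega>)\<^sup>2 \<partial>Q) - real n * \<sigma>2\<bar> \<le> \<bar>2 * (\<integral>\<omega>. I ?n \<omega> * E \<omega> \<partial>Q)\<bar> + (\<integral>\<omega>. (E \<omega>)\<^sup>2 \<partial>Q)"
    unfolding eq using 2 by linarith
  also have "\<dots> \<le> var_err * sqrt ?n"
  proof -
    have "var_err * sqrt ?n = var_const * sqrt ?n + 2 * (sqrt ?n * (4 * corr_const\<^sup>2 * (\<integral>x. (D x)\<^sup>2 \<partial>\<nu>)))"
      unfolding var_err_def by (simp add: algebra_simps)
    then show ?thesis using 1 3 EE by linarith
  qed
  finally show ?thesis .
qed

section \<open>A quantitative central limit theorem\<close>

text \<open>The last block is replaced first: given the past it has its stationary law up to the mixing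
  error, so integrating it out replaces \<open>f\<close> by its average, which has the same bound and Lipschitz
  constant. The induction then runs on the averaged function.\<close>

lemma block_decoupling:
  assumes l: "0 \<le> l" and m: "0 \<le> m" and sc: "0 < sc"
  shows "f \<in> borel_measurable borel \<Longrightarrow> (\<And>z. \<bar>f z\<bar> \<le> B) \<Longrightarrow> (\<And>z w. \<bar>f z - f w\<bar> \<le> Lf * \<bar>z - w\<bar>) \<Longrightarrow>
    \<bar>(\<integral>\<omega>. f (a + (\<Sum>i<k. I m (\<theta> (real i * (l + m) + l) \<omega>) / sc)) \<partial>Q) - (avg (distr Q borel (\<lambda>\<omega>. I m \<omega> / sc)) ^^ k) f a\<bar>
      \<le> real k * (exp (- \<gamma> * l) * (Lf / sc * Lg / \<gamma>) * Dbar)"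
proof (induction k arbitrary: f)
  case 0
  interpret q: prob_space Q by (rule Q_prob_space)
  show ?case by (simp add: q.prob_space)
next
  case (Suc k)
  interpret q: prob_space Q by (rule Q_prob_space)
  note f [measurable] = Suc.prems(1)
  let ?s = "real k * (l + m)"
  let ?\<rho> = "distr Q borel (\<lambda>\<omega>. I m \<omega> / sc)"
  define J where "J \<omega> = (\<Sum>i<k. I m (\<theta> (real i * (l + m) + l) \<omega>) / sc)" for \<omega>
  have s: "0 \<le> ?s" using l m by simp
  have pos: "0 \<le> real i * (l + m) + l" for i using l m by simp
  have [measurable]: "I m \<in> borel_measurable Paths" "\<theta> l \<in> Paths \<rightarrow>\<^sub>M Paths" "\<theta> ?s \<in> Paths \<rightarrow>\<^sub>M Paths" using l m s by simp_all
  have [measurable]: "\<theta> (real i * (l + m) + l) \<in> Paths \<rightarrow>\<^sub>M Paths" for i by (rule shift_measurable[OF pos])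
  have J1: "(\<lambda>\<omega>. I m (\<theta> (real i * (l + m) + l) \<omega>)) \<in> borel_measurable (Past ?s)" if "i < k" for i
  proof (rule measurable_Past_mono[OF I_shift_Past[OF pos m]])
    have "real (Suc i) * (l + m) \<le> ?s" by (rule mult_right_mono) (use that l m in auto)
    then show "real i * (l + m) + l + m \<le> ?s" by (simp add: algebra_simps)
  qed
  have [measurable]: "J \<in> borel_measurable (Past ?s)" unfolding J_def
    by (intro borel_measurable_sum borel_measurable_divide J1) auto
  have [measurable]: "J \<in> borel_measurable Paths" by (rule measurable_Past_Paths[of _ ?s]) simp
  have rho: "prob_space ?\<rho>" by (rule q.prob_space_distr) (simp add: Q_measurable)
  have avg_eq: "avg ?\<rho> f c = (\<integral>\<omega>. f (c + I m \<omega> / sc) \<partial>Q)" for c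
    unfolding avg_def by (subst integral_distr) (simp_all add: Q_measurable)
  have avgf: "avg ?\<rho> f \<in> borel_measurable borel" "\<And>z. \<bar>avg ?\<rho> f z\<bar> \<le> B" "\<And>z w. \<bar>avg ?\<rho> f z - avg ?\<rho> f w\<bar> \<le> Lf * \<bar>z - w\<bar>"
    using avg_measurable[OF rho _ f] avg_bounded[OF rho _ f Suc.prems(2)] avg_lipschitz[OF rho _ f Suc.prems(2,3)] by simp_all
  note IH = Suc.IH[OF avgf, folded J_def]
  define w where "w \<omega> = (\<integral>\<omega>'. f (a + J \<omega> + I m (\<theta> l \<omega>') / sc) \<partial>\<PP> (\<Phi> ?s \<omega>))" for \<omega>
  have hm: "(\<lambda>z. f (a + J (fst z) + I m (\<theta> l (snd z)) / sc)) \<in> borel_measurable (Past ?s \<Otimes>\<^sub>M Paths)" by measurable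
  have step: "(\<integral>\<omega>. f (a + (\<Sum>i<Suc k. I m (\<theta> (real i * (l + m) + l) \<omega>) / sc)) \<partial>Q) = (\<integral>\<omega>. w \<omega> \<partial>Q)"
  proof -
    let ?h = "\<lambda>z. f (a + J (fst z) + I m (\<theta> l (snd z)) / sc)"
    have "(\<integral>\<omega>. f (a + (\<Sum>i<Suc k. I m (\<theta> (real i * (l + m) + l) \<omega>) / sc)) \<partial>Q) = (\<integral>\<omega>. ?h (\<omega>, \<theta> ?s \<omega>) \<partial>Q)"
      by (rule Bochner_Integration.integral_cong) (use I_shift_shift[OF _ s l m] in \<open>simp_all add: Q_space J_def add.assoc\<close>)
    also have "\<dots> = (\<integral>\<omega>. (\<integral>\<omega>'. ?h (\<omega>, \<omega>') \<partial>\<PP> (\<Phi> ?s \<omega>)) \<partial>Q)"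
    proof (rule markov_integral[OF nu_prob s hm])
      show "integrable Q (\<lambda>\<omega>. ?h (\<omega>, \<theta> ?s \<omega>))"
        by (rule integrable_bounded_law[OF nu_prob _ Suc.prems(2)]) measurable
    qed
    finally show ?thesis by (simp add: w_def)
  qed
  have wm: "w \<in> borel_measurable Q" unfolding w_def Q_measurable using integral_PP_measurable[OF s hm] by simp
  have wB: "\<bar>w \<omega>\<bar> \<le> B" for \<omega> unfolding w_def by (rule abs_expectation_le[OF prob_space_PP Suc.prems(2)])
  have am: "(\<lambda>\<omega>. avg ?\<rho> f (a + J \<omega>)) \<in> borel_measurable Q"
    unfolding Q_measurable using avgf(1) by measurable
  have iw: "integrable Q w" by (rule q.integrable_const_bound[of _ B]) (use wB wm in auto)
  have ia: "integrable Q (\<lambda>\<omega>. avg ?\<rho> f (a + J \<omega>))" by (rule q.integrable_const_bound[of _ B]) (use avgf(2) am in auto)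
  define e where "e = exp (- \<gamma> * l) * (Lf / sc * Lg / \<gamma>)"
  have pw: "\<bar>w \<omega> - avg ?\<rho> f (a + J \<omega>)\<bar> \<le> e * D (\<Phi> ?s \<omega>)" for \<omega>
  proof -
    have fL': "\<bar>f (a + J \<omega> + z / sc) - f (a + J \<omega> + z' / sc)\<bar> \<le> Lf / sc * \<bar>z - z'\<bar>" for z z'
    proof -
      have "\<bar>f (a + J \<omega> + z / sc) - f (a + J \<omega> + z' / sc)\<bar> \<le> Lf * \<bar>(a + J \<omega> + z / sc) - (a + J \<omega> + z' / sc)\<bar>" by (rule Suc.prems(3))
      also have "(a + J \<omega> + z / sc) - (a + J \<omega> + z' / sc) = (z - z') / sc" by (simp add: diff_divide_distrib)
      finally show ?thesis using sc by simp
    qed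
    have fm: "(\<lambda>z. f (a + J \<omega> + z / sc)) \<in> borel_measurable borel" by measurable
    show ?thesis unfolding w_def avg_eq e_def
      using start_vs_stationary[OF m l fm Suc.prems(2) fL', where x="\<Phi> ?s \<omega>"] by simp
  qed
  have "\<bar>(\<integral>\<omega>. w \<omega> \<partial>Q) - (\<integral>\<omega>. avg ?\<rho> f (a + J \<omega>) \<partial>Q)\<bar> = \<bar>\<integral>\<omega>. w \<omega> - avg ?\<rho> f (a + J \<omega>) \<partial>Q\<bar>" using iw ia by simp
  also have "\<dots> \<le> (\<integral>\<omega>. \<bar>w \<omega> - avg ?\<rho> f (a + J \<omega>)\<bar> \<partial>Q)" by (rule integral_abs_bound)
  also have "\<dots> \<le> (\<integral>\<omega>. e * D (\<Phi> ?s \<omega>) \<partial>Q)"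
    by (rule integral_mono) (use iw ia pw integrable_Phi_Q[OF s D_integrable] in auto)
  also have "\<dots> = e * Dbar" using integral_Phi_Q[OF s D_measurable] by (simp add: Dbar_def)
  finally have 1: "\<bar>(\<integral>\<omega>. w \<omega> \<partial>Q) - (\<integral>\<omega>. avg ?\<rho> f (a + J \<omega>) \<partial>Q)\<bar> \<le> e * Dbar" .
  have 2: "(avg ?\<rho> ^^ Suc k) f a = (avg ?\<rho> ^^ k) (avg ?\<rho> f) a" by (simp add: funpow_swap1)
  have 3: "real (Suc k) * (e * Dbar) = e * Dbar + real k * (e * Dbar)" by (simp add: algebra_simps)
  show ?case unfolding step 2 e_def[symmetric] 3 using 1 IH[folded e_def] by linarith
qed

lemma I_gap_blocks:
  assumes \<omega>: "\<omega> \<in> \<Omega>" and l: "0 \<le> l" and m: "0 \<le> m"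
  shows "I (real n * (l + m)) \<omega> = (\<Sum>i<n. I l (\<theta> (real i * (l + m)) \<omega>)) + (\<Sum>i<n. I m (\<theta> (real i * (l + m) + l) \<omega>))"
proof -
  have "I (l + m) (\<theta> (real i * (l + m)) \<omega>) = I l (\<theta> (real i * (l + m)) \<omega>) + I m (\<theta> (real i * (l + m) + l) \<omega>)" for i
    using I_add[OF shift_in[OF _ \<omega>] l m, of "real i * (l + m)"] I_shift_shift[OF \<omega> _ l m, of "real i * (l + m)"] l m by simp
  then show ?thesis using I_block_sum[OF \<omega>, of "l + m" n] l m by (simp add: sum.distrib)
qed

lemma smooth_step_abs: "\<bar>smooth_step z\<bar> \<le> 1"
  using smooth_step_range[of z] by simp

text \<open>There are \<open>p\<^sup>6\<close> gaps of length \<open>p\<close>; by \<open>block_sum_second_moment\<close> their total has second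
  moment of order \<open>p\<^sup>7\<close>, which after division by \<open>p\<^sup>4\<close> is a mean absolute value of order
  \<open>p powr (- 1 / 2)\<close>. This is the dominant error of the whole approximation.\<close>

lemma gap_removal:
  fixes p :: nat
  assumes p: "2 \<le> p" and m: "m = real p ^ 2 - real p" and ll: "l = real p"
  shows "\<bar>(\<integral>\<omega>. smooth_step (a + I (real p ^ 8) \<omega> / real p ^ 4) \<partial>Q)
    - (\<integral>\<omega>. smooth_step (a + (\<Sum>i<p ^ 6. I m (\<theta> (real i * (l + m) + l) \<omega>) / real p ^ 4)) \<partial>Q)\<bar> \<le> 36 * (1 + var_const + cov_const) / sqrt (real p)"
proof -
  interpret q: prob_space Q by (rule Q_prob_space)
  define r where "r = real p"
  have r: "2 \<le> r" using p by (simp add: r_def)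
  have "r * 1 \<le> r * r" using r by (intro mult_left_mono) auto
  then have m0: "0 \<le> m" and l0: "0 \<le> l" and lm: "l + m = r\<^sup>2" using r by (auto simp: m ll r_def power2_eq_square)
  have K: "real (p ^ 6) = r ^ 6" by (simp add: r_def)
  have T: "real (p ^ 6) * (l + m) = r ^ 8" unfolding K lm by (simp add: power_add[symmetric])
  define R where "R \<omega> = (\<Sum>i<p^6. I l (\<theta> (real i * (l + m)) \<omega>))" for \<omega>
  define J where "J \<omega> = (\<Sum>i<p^6. I m (\<theta> (real i * (l + m) + l) \<omega>) / r ^ 4)" for \<omega>
  have pos: "0 \<le> real i * (l + m)" "0 \<le> real i * (l + m) + l" for i using l0 m0 by auto
  have [measurable]: "I l \<in> borel_measurable Paths" "I m \<in> borel_measurable Paths" using l0 m0 by simp_all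
  have [measurable]: "\<theta> (real i * (l + m)) \<in> Paths \<rightarrow>\<^sub>M Paths" "\<theta> (real i * (l + m) + l) \<in> Paths \<rightarrow>\<^sub>M Paths" for i using pos by (auto intro!: shift_measurable)
  have [measurable]: "R \<in> borel_measurable Paths" "J \<in> borel_measurable Paths" unfolding R_def J_def by measurable
  have [measurable]: "I (r ^ 8) \<in> borel_measurable Paths" using r by simp
  have split: "I (r ^ 8) \<omega> / r ^ 4 = R \<omega> / r ^ 4 + J \<omega>" if "\<omega> \<in> \<Omega>" for \<omega>
    using I_gap_blocks[OF that l0 m0, of "p ^ 6"] unfolding T by (simp add: R_def J_def add_divide_distrib sum_divide_distrib)
  have RB: "\<bar>R \<omega>\<bar> \<le> real (p^6) * (G * l)" if "\<omega> \<in> \<Omega>" for \<omega>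
    unfolding R_def using sum_norm_bound[of "{..<p^6}" "\<lambda>i. I l (\<theta> (real i * (l + m)) \<omega>)" "G * l"] I_bound[OF shift_in[OF pos(1) that] l0] by simp
  have iR: "integrable Q (\<lambda>\<omega>. \<bar>R \<omega>\<bar>)" by (rule integrable_bounded_law[OF nu_prob, of _ "real (p^6) * (G * l)"]) (use RB in auto)
  have iR2: "integrable Q (\<lambda>\<omega>. (R \<omega>)\<^sup>2)"
    by (rule integrable_bounded_law[OF nu_prob, of _ "(real (p^6) * (G * l))\<^sup>2"]) (use power_mono[OF RB abs_ge_zero, of _ 2] in auto)
  have R2: "(\<integral>\<omega>. (R \<omega>)\<^sup>2 \<partial>Q) \<le> (var_const + cov_const) * r ^ 7"
  proof -
    have "(\<integral>\<omega>. (R \<omega>)\<^sup>2 \<partial>Q) \<le> real (p^6) * ((\<integral>\<omega>. (I l \<omega>)\<^sup>2 \<partial>Q) + cov_const * l)"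
      unfolding R_def
    proof (rule block_sum_second_moment[OF l0])
      show "l \<le> l + m" using m0 by simp
      have "1 \<le> r" using r by simp
      then show "1 \<le> l + m" unfolding lm by (rule one_le_power)
    qed
    also have "\<dots> \<le> real (p^6) * (var_const * l + cov_const * l)"
      unfolding ll by (intro mult_left_mono add_right_mono I_second_moment) simp
    also have "\<dots> = (var_const + cov_const) * r ^ 7" unfolding K ll r_def by (simp add: algebra_simps eval_nat_numeral)
    finally show ?thesis .
  qed
  \<comment> \<open>The square root of \<open>r\<^sup>7\<close>, the weight that balances the two terms in \<open>\<bar>R\<bar> \<le> c + R\<^sup>2 / c\<close>.\<close>
  define c where "c = r ^ 3 * sqrt r"
  have c: "0 < c" using r by (simp add: c_def)
  have sr: "sqrt r * sqrt r = r" using r by simp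
  have "(\<integral>\<omega>. \<bar>R \<omega>\<bar> \<partial>Q) \<le> (\<integral>\<omega>. c + (R \<omega>)\<^sup>2 / c \<partial>Q)"
  proof (rule integral_mono)
    fix \<omega>
    have "0 \<le> (\<bar>R \<omega>\<bar> - c)\<^sup>2" by simp
    then have "2 * (\<bar>R \<omega>\<bar> * c) \<le> c\<^sup>2 + (R \<omega>)\<^sup>2" by (simp add: power2_diff)
    moreover have "0 \<le> \<bar>R \<omega>\<bar> * c" using c by simp
    ultimately have "\<bar>R \<omega>\<bar> * c \<le> c\<^sup>2 + (R \<omega>)\<^sup>2" by linarith
    then have "\<bar>R \<omega>\<bar> \<le> (c\<^sup>2 + (R \<omega>)\<^sup>2) / c" using c by (simp add: pos_le_divide_eq)
    then show "\<bar>R \<omega>\<bar> \<le> c + (R \<omega>)\<^sup>2 / c" using c by (simp add: add_divide_distrib power2_eq_square)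
  qed (use iR iR2 in auto)
  also have "\<dots> = c + (\<integral>\<omega>. (R \<omega>)\<^sup>2 \<partial>Q) / c" using iR2 by (simp add: q.prob_space)
  also have "\<dots> \<le> c + (var_const + cov_const) * r ^ 7 / c" using R2 c by (intro add_left_mono divide_right_mono) auto
  also have "c + (var_const + cov_const) * r ^ 7 / c = c + (var_const + cov_const) * (r ^ 7 / c)" by simp
  also have "r ^ 7 / c = c"
  proof -
    have "c * c = (r ^ 3 * r ^ 3) * (sqrt r * sqrt r)" unfolding c_def by (simp only: mult_ac)
    also have "\<dots> = r ^ 7" unfolding sr by (simp add: eval_nat_numeral)
    finally show ?thesis using c by (simp add: field_simps)
  qed
  also have "c + (var_const + cov_const) * c = (1 + var_const + cov_const) * c" by (simp add: algebra_simps)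
  finally have ER: "(\<integral>\<omega>. \<bar>R \<omega>\<bar> \<partial>Q) \<le> (1 + var_const + cov_const) * c" .
  have i1: "integrable Q (\<lambda>\<omega>. smooth_step (a + I (r ^ 8) \<omega> / r ^ 4))" "integrable Q (\<lambda>\<omega>. smooth_step (a + J \<omega>))"
    by (rule integrable_bounded_law[OF nu_prob _ smooth_step_abs], measurable)+
  have "\<bar>(\<integral>\<omega>. smooth_step (a + I (r ^ 8) \<omega> / r ^ 4) \<partial>Q) - (\<integral>\<omega>. smooth_step (a + J \<omega>) \<partial>Q)\<bar>
      = \<bar>\<integral>\<omega>. smooth_step (a + I (r ^ 8) \<omega> / r ^ 4) - smooth_step (a + J \<omega>) \<partial>Q\<bar>" using i1 by simp
  also have "\<dots> \<le> (\<integral>\<omega>. \<bar>smooth_step (a + I (r ^ 8) \<omega> / r ^ 4) - smooth_step (a + J \<omega>)\<bar> \<partial>Q)" by (rule integral_abs_bound)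
  also have "\<dots> \<le> (\<integral>\<omega>. 36 / r ^ 4 * \<bar>R \<omega>\<bar> \<partial>Q)"
  proof (rule integral_mono)
    fix \<omega> assume "\<omega> \<in> space Q"
    then have \<omega>: "\<omega> \<in> \<Omega>" by (simp add: Q_space)
    have "\<bar>smooth_step (a + I (r ^ 8) \<omega> / r ^ 4) - smooth_step (a + J \<omega>)\<bar> \<le> 36 * \<bar>(a + I (r ^ 8) \<omega> / r ^ 4) - (a + J \<omega>)\<bar>"
      by (rule smooth_step_lipschitz)
    also have "(a + I (r ^ 8) \<omega> / r ^ 4) - (a + J \<omega>) = R \<omega> / r ^ 4" unfolding split[OF \<omega>] by simp
    finally show "\<bar>smooth_step (a + I (r ^ 8) \<omega> / r ^ 4) - smooth_step (a + J \<omega>)\<bar> \<le> 36 / r ^ 4 * \<bar>R \<omega>\<bar>" using r by simp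
  qed (use i1 iR in auto)
  also have "\<dots> = 36 / r ^ 4 * (\<integral>\<omega>. \<bar>R \<omega>\<bar> \<partial>Q)" by simp
  also have "\<dots> \<le> 36 / r ^ 4 * ((1 + var_const + cov_const) * c)" using r by (intro mult_left_mono ER) auto
  also have "\<dots> = 36 * (1 + var_const + cov_const) * (c / r ^ 4)" by simp
  also have "c / r ^ 4 = 1 / sqrt r"
  proof -
    have "c * sqrt r = r ^ 3 * (sqrt r * sqrt r)" by (simp add: c_def)
    also have "\<dots> = r ^ 4" unfolding sr by (simp add: eval_nat_numeral)
    finally show ?thesis using r by (simp add: field_simps)
  qed
  finally show ?thesis unfolding J_def r_def by simp
qed

text \<open>The summands come, in this order, from the gaps, from decoupling, from the variance of a
  block, from the third moment of a block, and from the third moment of the Gaussian law.\<close>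

definition clt_const :: real where
  "clt_const = 36 * (1 + var_const + cov_const) + 36 * 27 * corr_const * Dbar / \<gamma> ^ 3
     + 6 * (var_err + \<sigma>2) + 2 * G * var_const + 4 * sqrt \<sigma>2 ^ 3"

text \<open>Three errors add up: discarding the gaps, decoupling the blocks, and Lindeberg replacement
  for \<open>p\<^sup>6\<close> independent blocks whose variance is \<open>p\<^sup>2 \<sigma>\<^sup>2 + O(p)\<close> and whose third absolute moment
  is \<open>O(p\<^sup>4)\<close>.\<close>

lemma clt_stationary:
  fixes p :: nat
  assumes p: "2 \<le> p" and s2: "0 < \<sigma>2"
  shows "\<bar>(\<integral>\<omega>. smooth_step (a + I (real p ^ 8) \<omega> / real p ^ 4) \<partial>Q) - avg (gauss (sqrt \<sigma>2)) smooth_step a\<bar> \<le> clt_const / sqrt (real p)"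
proof -
  interpret q: prob_space Q by (rule Q_prob_space)
  define r where "r = real p"
  have r: "2 \<le> r" using p by (simp add: r_def)
  define l m where "l = r" and "m = r ^ 2 - r"
  have rr: "r * 2 \<le> r * r" using r by (intro mult_left_mono) auto
  then have m0: "0 < m" and l0: "0 \<le> l" and lm: "l + m = r\<^sup>2" and mr: "m \<le> r\<^sup>2" using r by (auto simp: l_def m_def power2_eq_square)
  define n where "n = p\<^sup>2 - p"
  have "p \<le> p\<^sup>2" using p by (simp add: power2_eq_square)
  then have mn: "m = real n" by (simp add: m_def n_def r_def of_nat_diff)
  then have n0: "0 < n" using m0 by simp
  define s where "s = sqrt r"
  have s: "1 \<le> s" "s * s = r" "s \<le> r" using r real_sqrt_ge_1_iff[of r] mult_left_mono[of 1 "sqrt r" "sqrt r"] by (auto simp: s_def)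
  have inv: "1 / r ^ k \<le> 1 / s" if "1 \<le> k" for k
  proof -
    have "r ^ 1 \<le> r ^ k" using r that by (intro power_increasing) auto
    then have "s \<le> r ^ k" using s by simp
    then show ?thesis using s by (intro divide_left_mono) auto
  qed
  let ?\<rho> = "distr Q borel (\<lambda>\<omega>. I m \<omega> / r ^ 4)"
  have [measurable]: "I m \<in> borel_measurable Paths" using m0 by simp
  have mm: "(\<lambda>\<omega>. I m \<omega> / r ^ 4) \<in> Q \<rightarrow>\<^sub>M borel" by (simp add: Q_measurable)
  have rho: "prob_space ?\<rho>" by (rule q.prob_space_distr[OF mm])
  have IB: "\<bar>I m \<omega>\<bar> \<le> G * m" if "\<omega> \<in> \<Omega>" for \<omega> using I_bound[OF that, of m] m0 by simp
  have iI: "integrable Q (I m)" by (rule integrable_bounded_law[OF nu_prob _ IB]) measurable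
  have iI2: "integrable Q (\<lambda>\<omega>. (I m \<omega>)\<^sup>2)"
    by (rule integrable_bounded_law[OF nu_prob, of _ "(G * m)\<^sup>2"]) (use power_mono[OF IB abs_ge_zero, of _ 2] in auto)
  have iI3: "integrable Q (\<lambda>\<omega>. \<bar>I m \<omega>\<bar> ^ 3)"
    by (rule integrable_bounded_law[OF nu_prob, of _ "(G * m)^3"]) (use power_mono[OF IB abs_ge_zero, of _ 3] in auto)
  have i: "integrable ?\<rho> (\<lambda>y. y)" "integrable ?\<rho> (\<lambda>y. y\<^sup>2)" "integrable ?\<rho> (\<lambda>y. \<bar>y\<bar>^3)"
    by (subst integrable_distr_eq[OF mm], simp, use iI iI2 iI3 r in \<open>simp add: power_divide abs_divide\<close>)+
  have e1: "(\<integral>y. y \<partial>?\<rho>) = 0" using integral_I_Q[of m] m0 by (subst integral_distr[OF mm]) auto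
  have e2: "(\<integral>y. y\<^sup>2 \<partial>?\<rho>) = (\<integral>\<omega>. (I m \<omega>)\<^sup>2 \<partial>Q) / r ^ 8"
    by (subst integral_distr[OF mm]) (simp_all add: power_divide power_mult[symmetric])
  have e3: "(\<integral>y. \<bar>y\<bar>^3 \<partial>?\<rho>) = (\<integral>\<omega>. \<bar>I m \<omega>\<bar>^3 \<partial>Q) / r ^ 12"
    using r by (subst integral_distr[OF mm]) (simp_all add: power_divide abs_divide power_mult[symmetric])
  have v: "\<bar>(\<integral>\<omega>. (I m \<omega>)\<^sup>2 \<partial>Q) - r\<^sup>2 * \<sigma>2\<bar> \<le> (var_err + \<sigma>2) * r"
  proof -
    have "\<bar>(\<integral>\<omega>. (I m \<omega>)\<^sup>2 \<partial>Q) - m * \<sigma>2\<bar> \<le> var_err * sqrt m" unfolding mn by (rule I_variance[OF n0])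
    also have "\<dots> \<le> var_err * r"
    proof (rule mult_left_mono[OF _ var_err_nonneg])
      have "sqrt m \<le> sqrt (r\<^sup>2)" by (rule real_sqrt_le_mono[OF mr])
      then show "sqrt m \<le> r" using r by simp
    qed
    finally have "\<bar>(\<integral>\<omega>. (I m \<omega>)\<^sup>2 \<partial>Q) - m * \<sigma>2\<bar> \<le> var_err * r" .
    moreover have "m * \<sigma>2 = r\<^sup>2 * \<sigma>2 - r * \<sigma>2" by (simp add: m_def left_diff_distrib)
    moreover have "0 \<le> r * \<sigma>2" using r s2 by simp
    moreover have "(var_err + \<sigma>2) * r = var_err * r + r * \<sigma>2" by (simp add: algebra_simps)
    ultimately show ?thesis by linarith
  qed
  \<comment> \<open>One factor is estimated by its maximum \<open>G m\<close>, the other two by the second moment.\<close>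
  have t3: "(\<integral>\<omega>. \<bar>I m \<omega>\<bar>^3 \<partial>Q) \<le> G * var_const * r ^ 4"
  proof -
    have "(\<integral>\<omega>. \<bar>I m \<omega>\<bar>^3 \<partial>Q) \<le> (\<integral>\<omega>. G * m * (I m \<omega>)\<^sup>2 \<partial>Q)"
    proof (rule integral_mono)
      fix \<omega> assume "\<omega> \<in> space Q"
      then have "\<bar>I m \<omega>\<bar> * (I m \<omega>)\<^sup>2 \<le> G * m * (I m \<omega>)\<^sup>2" by (intro mult_right_mono IB) (auto simp: Q_space)
      then show "\<bar>I m \<omega>\<bar>^3 \<le> G * m * (I m \<omega>)\<^sup>2" by (simp add: power3_eq_cube power2_eq_square)
    qed (use iI2 iI3 in auto)
    also have "\<dots> = G * m * (\<integral>\<omega>. (I m \<omega>)\<^sup>2 \<partial>Q)" by simp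
    also have "\<dots> \<le> G * m * (var_const * m)" using I_second_moment[of n] G_nonneg m0 by (intro mult_left_mono) (auto simp: mn)
    also have "\<dots> = G * var_const * (m * m)" by simp
    also have "\<dots> \<le> G * var_const * (r\<^sup>2 * r\<^sup>2)" using G_nonneg var_const_nonneg mr m0 by (intro mult_left_mono mult_mono) auto
    finally show ?thesis by (simp add: power_add[symmetric])
  qed
  have K: "real (p ^ 6) = r ^ 6" by (simp add: r_def)
  have sK: "sqrt (r ^ 6) = r ^ 3"
  proof -
    have "(r ^ 3)\<^sup>2 = r ^ 6" by (simp add: power_mult[symmetric])
    then show ?thesis by (rule real_sqrt_unique) (use r in simp)
  qed
  have C: "\<bar>(avg ?\<rho> ^^ (p ^ 6)) smooth_step a - avg (gauss (sqrt \<sigma>2)) smooth_step a\<bar> \<le> (6 * (var_err + \<sigma>2) + 2 * G * var_const + 4 * sqrt \<sigma>2 ^ 3) * (1 / s)"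
  proof -
    have "\<bar>(avg ?\<rho> ^^ (p ^ 6)) smooth_step a - avg (gauss (sqrt \<sigma>2)) smooth_step a\<bar>
        \<le> real (p ^ 6) * (6 * \<bar>(\<integral>y. y\<^sup>2 \<partial>?\<rho>) - (sqrt \<sigma>2)\<^sup>2 / real (p ^ 6)\<bar> + 2 * (\<integral>y. \<bar>y\<bar>^3 \<partial>?\<rho>) + 4 * (sqrt \<sigma>2 / sqrt (real (p ^ 6)))^3)"
      by (rule smooth_clt[OF rho _ i e1]) (use p s2 in auto)
    also have "\<dots> = 6 * (r ^ 6 * \<bar>(\<integral>\<omega>. (I m \<omega>)\<^sup>2 \<partial>Q) / r ^ 8 - \<sigma>2 / r ^ 6\<bar>) + 2 * (r ^ 6 * ((\<integral>\<omega>. \<bar>I m \<omega>\<bar>^3 \<partial>Q) / r ^ 12)) + 4 * (r ^ 6 * (sqrt \<sigma>2 / r ^ 3)^3)"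
      unfolding e2 e3 K sK using s2 by (simp add: algebra_simps)
    also have "r ^ 6 * \<bar>(\<integral>\<omega>. (I m \<omega>)\<^sup>2 \<partial>Q) / r ^ 8 - \<sigma>2 / r ^ 6\<bar> = \<bar>(\<integral>\<omega>. (I m \<omega>)\<^sup>2 \<partial>Q) - r\<^sup>2 * \<sigma>2\<bar> / r\<^sup>2"
    proof -
      have "r ^ 6 * \<bar>x / r ^ 8 - \<sigma>2 / r ^ 6\<bar> = \<bar>x - r\<^sup>2 * \<sigma>2\<bar> / r\<^sup>2" for x
      proof -
        have "r ^ 8 = r ^ 6 * r ^ 2" by (simp add: power_add[symmetric])
        then have "x / r ^ 8 - \<sigma>2 / r ^ 6 = (x - r\<^sup>2 * \<sigma>2) / (r ^ 6 * r\<^sup>2)" using r by (simp add: field_simps)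
        moreover have "A * \<bar>y / (A * B)\<bar> = \<bar>y\<bar> / B" if "0 < A" "0 < B" for A B y :: real
          using that by (simp add: abs_mult)
        ultimately show ?thesis using r by (simp only: zero_less_power)
      qed
      then show ?thesis .
    qed
    also have "\<dots> \<le> (var_err + \<sigma>2) * r / r\<^sup>2" using v by (intro divide_right_mono) auto
    also have "(var_err + \<sigma>2) * r / r\<^sup>2 = (var_err + \<sigma>2) * (1 / r ^ 1)" using r by (simp add: power2_eq_square)
    also have "\<dots> \<le> (var_err + \<sigma>2) * (1 / s)" by (intro mult_left_mono inv) (use var_err_nonneg s2 in auto)
    also have "r ^ 6 * ((\<integral>\<omega>. \<bar>I m \<omega>\<bar>^3 \<partial>Q) / r ^ 12) \<le> G * var_const * (1 / s)"
    proof -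
      have "r ^ 6 * ((\<integral>\<omega>. \<bar>I m \<omega>\<bar>^3 \<partial>Q) / r ^ 12) \<le> r ^ 6 * ((G * var_const * r ^ 4) / r ^ 12)"
        using r by (intro mult_left_mono divide_right_mono t3) auto
      also have "\<dots> = G * var_const * (1 / r ^ 2)"
      proof -
        have "r ^ 12 = r ^ 6 * r ^ 4 * r ^ 2" by (simp add: power_add[symmetric])
        moreover have "A * (C * B / (A * B * E)) = C * (1 / E)" if "0 < A" "0 < B" for A B C E :: real
          using that by simp
        moreover have "0 < r ^ 6" "0 < r ^ 4" using r by auto
        ultimately show ?thesis by (simp only:)
      qed
      also have "\<dots> \<le> G * var_const * (1 / s)" by (intro mult_left_mono inv) (use G_nonneg var_const_nonneg in auto)
      finally show ?thesis .
    qed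
    also have "r ^ 6 * (sqrt \<sigma>2 / r ^ 3)^3 \<le> sqrt \<sigma>2 ^ 3 * (1 / s)"
    proof -
      have "(sqrt \<sigma>2 / r ^ 3)^3 = sqrt \<sigma>2 ^ 3 / (r ^ 6 * r ^ 3)" by (simp add: power_divide power_mult[symmetric] power_add[symmetric])
      moreover have "A * (C / (A * B)) = C * (1 / B)" if "0 < A" for A B C :: real using that by simp
      moreover have "0 < r ^ 6" using r by auto
      ultimately have "r ^ 6 * (sqrt \<sigma>2 / r ^ 3)^3 = sqrt \<sigma>2 ^ 3 * (1 / r ^ 3)" by (simp only:)
      also have "\<dots> \<le> sqrt \<sigma>2 ^ 3 * (1 / s)" by (intro mult_left_mono inv) (use s2 in auto)
      finally show ?thesis .
    qed
    finally show ?thesis by (simp add: algebra_simps)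
  qed
  have Bd: "\<bar>(\<integral>\<omega>. smooth_step (a + (\<Sum>i<p ^ 6. I m (\<theta> (real i * (l + m) + l) \<omega>) / r ^ 4)) \<partial>Q) - (avg ?\<rho> ^^ (p ^ 6)) smooth_step a\<bar>
      \<le> 36 * 27 * corr_const * Dbar / \<gamma> ^ 3 * (1 / s)"
  proof -
    have "\<bar>(\<integral>\<omega>. smooth_step (a + (\<Sum>i<p ^ 6. I m (\<theta> (real i * (l + m) + l) \<omega>) / r ^ 4)) \<partial>Q) - (avg ?\<rho> ^^ (p ^ 6)) smooth_step a\<bar>
       \<le> real (p ^ 6) * (exp (- \<gamma> * l) * (36 / r ^ 4 * Lg / \<gamma>) * Dbar)"
      by (rule block_decoupling[OF l0 _ _ smooth_step_measurable smooth_step_abs smooth_step_lipschitz]) (use m0 r in auto)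
    also have "\<dots> = 36 * corr_const * Dbar * (r ^ 2 * exp (- \<gamma> * r))"
    proof -
      have 6: "r ^ 6 = r ^ 4 * r ^ 2" by (simp add: power_add[symmetric])
      have "A * B * (E * (36 / A * Lg / \<gamma>) * Dbar) = 36 * (Lg / \<gamma>) * Dbar * (B * E)" if "0 < A" for A B E :: real
        using that by simp
      moreover have "0 < r ^ 4" using r by auto
      ultimately show ?thesis unfolding K l_def corr_const_def 6 by (simp only:)
    qed
    \<comment> \<open>Cubing \<open>u / 3 \<le> exp (u / 3)\<close> gives \<open>exp (-u) \<le> 27 / u\<^sup>3\<close>.\<close>
    also have "36 * corr_const * Dbar * (r ^ 2 * exp (- \<gamma> * r)) \<le> 36 * corr_const * Dbar * (r ^ 2 * (27 / (\<gamma> * r) ^ 3))"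
    proof (intro mult_left_mono)
      have pos: "0 < \<gamma> * r" using gamma_pos r by simp
      have "\<gamma> * r / 3 \<le> exp (\<gamma> * r / 3)" using exp_ge_add_one_self[of "\<gamma> * r / 3"] by linarith
      then have "(\<gamma> * r / 3) ^ 3 \<le> exp (\<gamma> * r / 3) ^ 3" using pos by (intro power_mono) auto
      also have "\<dots> = exp (\<gamma> * r)" by (simp add: exp_of_nat_mult[symmetric])
      finally have "(\<gamma> * r) ^ 3 / 27 \<le> exp (\<gamma> * r)" by (simp add: power_divide)
      then have "inverse (exp (\<gamma> * r)) \<le> inverse ((\<gamma> * r) ^ 3 / 27)" using pos by (intro le_imp_inverse_le) auto
      then show "exp (- \<gamma> * r) \<le> 27 / (\<gamma> * r) ^ 3" by (simp add: exp_minus)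
    qed (use corr_const_nonneg Dbar_nonneg in auto)
    also have "r ^ 2 * (27 / (\<gamma> * r) ^ 3) = 27 / \<gamma> ^ 3 * (1 / r ^ 1)" using r by (simp add: power_mult_distrib power2_eq_square power3_eq_cube)
    also have "36 * corr_const * Dbar * (27 / \<gamma> ^ 3 * (1 / r ^ 1)) \<le> 36 * corr_const * Dbar * (27 / \<gamma> ^ 3 * (1 / s))"
      by (intro mult_left_mono inv) (use corr_const_nonneg Dbar_nonneg gamma_pos in auto)
    finally show ?thesis by (simp add: mult_ac)
  qed
  have A: "\<bar>(\<integral>\<omega>. smooth_step (a + I (r ^ 8) \<omega> / r ^ 4) \<partial>Q)
    - (\<integral>\<omega>. smooth_step (a + (\<Sum>i<p ^ 6. I m (\<theta> (real i * (l + m) + l) \<omega>) / r ^ 4)) \<partial>Q)\<bar> \<le> 36 * (1 + var_const + cov_const) * (1 / s)"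
    using gap_removal[OF p, of m l a] by (simp add: m_def l_def r_def s_def)
  have "clt_const / sqrt (real p) = 36 * (1 + var_const + cov_const) * (1 / s) + 36 * 27 * corr_const * Dbar / \<gamma> ^ 3 * (1 / s)
    + (6 * (var_err + \<sigma>2) + 2 * G * var_const + 4 * sqrt \<sigma>2 ^ 3) * (1 / s)"
    unfolding clt_const_def s_def r_def by (simp add: add_divide_distrib)
  then show ?thesis using A Bd C unfolding r_def by linarith
qed

text \<open>The step function has slope at most 36, so as a function of \<open>I\<close> it has Lipschitz constant
  \<open>36 / p\<^sup>4\<close>, and \<open>start_vs_stationary\<close> without a pause applies.\<close>

lemma clt_start:
  fixes p :: nat
  assumes p: "2 \<le> p" and s2: "0 < \<sigma>2"
  shows "\<bar>(\<integral>\<omega>. smooth_step (a + I (real p ^ 8) \<omega> / real p ^ 4) \<partial>\<PP> x) - avg (gauss (sqrt \<sigma>2)) smooth_step a\<bar>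
    \<le> clt_const / sqrt (real p) + 36 * corr_const * D x / real p ^ 4"
proof -
  let ?f = "\<lambda>z. smooth_step (a + z / real p ^ 4)"
  have p0: "0 < real p ^ 4" using p by simp
  have fL: "\<bar>?f z - ?f w\<bar> \<le> 36 / real p ^ 4 * \<bar>z - w\<bar>" for z w
  proof -
    have "\<bar>?f z - ?f w\<bar> \<le> 36 * \<bar>(a + z / real p ^ 4) - (a + w / real p ^ 4)\<bar>" by (rule smooth_step_lipschitz)
    also have "(a + z / real p ^ 4) - (a + w / real p ^ 4) = (z - w) / real p ^ 4" by (simp add: diff_divide_distrib)
    finally show ?thesis by simp
  qed
  have T: "0 \<le> real p ^ 8" by simp
  have "\<bar>(\<integral>\<omega>. ?f (I (real p ^ 8) (\<theta> 0 \<omega>)) \<partial>\<PP> x) - (\<integral>\<omega>. ?f (I (real p ^ 8) \<omega>) \<partial>Q)\<bar> \<le> exp (- \<gamma> * 0) * (36 / real p ^ 4 * Lg / \<gamma>) * D x"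
    by (rule start_vs_stationary[OF T _ _ _ fL, of 0 1]) (use smooth_step_abs in auto)
  moreover have "(\<integral>\<omega>. ?f (I (real p ^ 8) (\<theta> 0 \<omega>)) \<partial>\<PP> x) = (\<integral>\<omega>. ?f (I (real p ^ 8) \<omega>) \<partial>\<PP> x)"
    by (rule Bochner_Integration.integral_cong) (use I_add[of _ 0 "real p ^ 8"] in \<open>auto simp: space_PP I_0\<close>)
  ultimately have "\<bar>(\<integral>\<omega>. ?f (I (real p ^ 8) \<omega>) \<partial>\<PP> x) - (\<integral>\<omega>. ?f (I (real p ^ 8) \<omega>) \<partial>Q)\<bar> \<le> 36 * corr_const * D x / real p ^ 4"
    by (simp add: corr_const_def mult.commute)
  with clt_stationary[OF p s2, of a] show ?thesis by linarith
qed

text \<open>The absolute value, truncated at the level \<open>G n\<close>, is an admissible test function for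
  \<open>start_vs_stationary\<close>, and the stationary mean is at most the root of the second moment.\<close>

lemma abs_I_start:
  "(\<integral>\<omega>. \<bar>I (real n) \<omega>\<bar> \<partial>\<PP> x) \<le> sqrt (var_const * real n) + corr_const * D x"
proof -
  interpret q: prob_space Q by (rule Q_prob_space)
  have [measurable]: "I (real n) \<in> borel_measurable Paths" by simp
  let ?B = "G * real n"
  let ?f = "\<lambda>z. \<bar>max (- ?B) (min ?B z)\<bar>"
  have B: "0 \<le> ?B" using G_nonneg by simp
  have fL: "\<bar>?f z - ?f w\<bar> \<le> 1 * \<bar>z - w\<bar>" for z w
    using order_trans[OF abs_triangle_ineq3 clamp(1)[of ?B z w]] .
  have fB: "\<bar>?f z\<bar> \<le> ?B" for z using clamp(2)[OF B, of z] by simp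
  have e: "?f (I (real n) \<omega>) = \<bar>I (real n) \<omega>\<bar>" if "\<omega> \<in> \<Omega>" for \<omega>
    using clamp(3)[OF I_bound[OF that, of "real n"]] by simp
  have "\<bar>(\<integral>\<omega>. ?f (I (real n) (\<theta> 0 \<omega>)) \<partial>\<PP> x) - (\<integral>\<omega>. ?f (I (real n) \<omega>) \<partial>Q)\<bar> \<le> exp (- \<gamma> * 0) * (1 * Lg / \<gamma>) * D x"
    by (rule start_vs_stationary[OF _ _ _ fB fL]) auto
  moreover have "(\<integral>\<omega>. ?f (I (real n) (\<theta> 0 \<omega>)) \<partial>\<PP> x) = (\<integral>\<omega>. \<bar>I (real n) \<omega>\<bar> \<partial>\<PP> x)"
    by (rule Bochner_Integration.integral_cong[OF refl]) (use I_add[of _ 0 "real n"] e in \<open>auto simp: space_PP I_0\<close>)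
  moreover have "(\<integral>\<omega>. ?f (I (real n) \<omega>) \<partial>Q) = (\<integral>\<omega>. \<bar>I (real n) \<omega>\<bar> \<partial>Q)"
    by (rule Bochner_Integration.integral_cong[OF refl]) (use e in \<open>auto simp: Q_space\<close>)
  moreover have "(\<integral>\<omega>. \<bar>I (real n) \<omega>\<bar> \<partial>Q) \<le> sqrt (var_const * real n)"
  proof (rule real_le_rsqrt)
    have i2: "integrable Q (\<lambda>\<omega>. (I (real n) \<omega>)\<^sup>2)"
      by (rule integrable_bounded_law[OF nu_prob, of _ "?B\<^sup>2"]) (use power_mono[OF I_bound abs_ge_zero, of _ "real n" 2] in auto)
    have i1: "integrable Q (\<lambda>\<omega>. \<bar>I (real n) \<omega>\<bar>)"
      by (rule integrable_bounded_law[OF nu_prob, of _ ?B]) (use I_bound in auto)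
    have "0 \<le> q.variance (\<lambda>\<omega>. \<bar>I (real n) \<omega>\<bar>)" by simp
    also have "q.variance (\<lambda>\<omega>. \<bar>I (real n) \<omega>\<bar>) = (\<integral>\<omega>. \<bar>I (real n) \<omega>\<bar>\<^sup>2 \<partial>Q) - (\<integral>\<omega>. \<bar>I (real n) \<omega>\<bar> \<partial>Q)\<^sup>2"
      by (rule q.variance_eq) (use i1 i2 in auto)
    finally show "(\<integral>\<omega>. \<bar>I (real n) \<omega>\<bar> \<partial>Q)\<^sup>2 \<le> var_const * real n" using I_second_moment[of n] by simp
  qed
  ultimately show ?thesis by (simp add: corr_const_def)
qed

end

section \<open>The upper half of the law of the iterated logarithm\<close>

locale lil_functional = stationary_functional P \<Omega> \<Phi> \<theta> \<PP> g G Lg \<gamma> \<nu> x0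
  for P :: "real \<Rightarrow> 'a::polish_space \<Rightarrow> 'a measure" and \<Omega> :: "'w set" and \<Phi> \<theta> \<PP> g G Lg \<gamma> \<nu> x0 +
  fixes \<mu> :: "'a measure" and \<zeta> C\<^sub>V :: real
  assumes mu_prob: "\<mu> \<in> prob_measures"
    and zeta: "2 < \<zeta>" and CV_nonneg: "0 \<le> C\<^sub>V"
    and moment_bound: "\<And>t. 0 \<le> t \<Longrightarrow> (\<integral>\<^sup>+x. ennreal (dist x0 x powr \<zeta>) \<partial>(\<mu> \<bind> P t)) \<le> ennreal C\<^sub>V"
    and variance_pos: "0 < \<sigma>2"
begin

abbreviation "W \<equiv> law_from \<PP> \<mu>"

lemma W_prob_space: "prob_space W"
  by (rule law_prob[OF mu_prob])

sublocale W: prob_space W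
  by (rule W_prob_space)

lemma W_measurable: "measurable W N = measurable Paths N"
  by (rule law_measurable[OF mu_prob])

lemma W_space: "space W = \<Omega>"
  by (rule law_space[OF mu_prob])

lemma W_sets: "sets W = sets Paths"
  by (rule law_sets[OF mu_prob])

definition V :: "real \<Rightarrow> 'w \<Rightarrow> real" where "V t \<omega> = dist x0 (\<Phi> t \<omega>)"

lemma V_measurable [measurable]: "0 \<le> t \<Longrightarrow> V t \<in> borel_measurable Paths"
  unfolding V_def by measurable

text \<open>Markov's inequality for the moment of order \<open>\<zeta>\<close>.\<close>

lemma V_tail:
  assumes t: "0 \<le> t" and a: "0 < a"
  shows "W.prob {\<omega> \<in> \<Omega>. a < V t \<omega>} \<le> C\<^sub>V / a powr \<zeta>"
proof -
  have [measurable]: "V t \<in> borel_measurable Paths" using t by simp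
  have S: "{\<omega> \<in> \<Omega>. a < V t \<omega>} \<in> sets W"
  proof -
    have "{\<omega> \<in> space Paths. a < V t \<omega>} \<in> sets Paths" by measurable
    then show ?thesis by (simp add: W_sets space_generated)
  qed
  have ap: "0 < a powr \<zeta>" using a by simp
  have "ennreal (a powr \<zeta>) * emeasure W {\<omega> \<in> \<Omega>. a < V t \<omega>} = (\<integral>\<^sup>+\<omega>. ennreal (a powr \<zeta>) * indicator {\<omega> \<in> \<Omega>. a < V t \<omega>} \<omega> \<partial>W)"
    by (rule nn_integral_cmult_indicator[symmetric, OF S])
  also have "\<dots> \<le> (\<integral>\<^sup>+\<omega>. ennreal (dist x0 (\<Phi> t \<omega>) powr \<zeta>) \<partial>W)"
  proof (rule nn_integral_mono)
    fix \<omega>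
    show "ennreal (a powr \<zeta>) * indicator {\<omega> \<in> \<Omega>. a < V t \<omega>} \<omega> \<le> ennreal (dist x0 (\<Phi> t \<omega>) powr \<zeta>)"
      using a zeta by (auto simp: V_def split: split_indicator intro!: ennreal_leI powr_mono2)
  qed
  also have "\<dots> = (\<integral>\<^sup>+x. ennreal (dist x0 x powr \<zeta>) \<partial>(\<mu> \<bind> P t))"
    by (rule nn_integral_Phi[OF t mu_prob]) simp
  also have "\<dots> \<le> ennreal C\<^sub>V" by (rule moment_bound[OF t])
  finally have "ennreal (a powr \<zeta> * W.prob {\<omega> \<in> \<Omega>. a < V t \<omega>}) \<le> ennreal C\<^sub>V"
    by (simp add: W.emeasure_eq_measure ennreal_mult'' measure_nonneg)
  then have "a powr \<zeta> * W.prob {\<omega> \<in> \<Omega>. a < V t \<omega>} \<le> C\<^sub>V" using CV_nonneg by (simp add: ennreal_le_iff)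
  then show ?thesis using ap by (simp add: pos_le_divide_eq mult.commute)
qed

definition start_moment :: real where "start_moment = 1 + C\<^sub>V + D x0"

lemma start_moment_nonneg: "0 \<le> start_moment"
  using CV_nonneg D_nonneg[of x0] by (simp add: start_moment_def)

text \<open>The case \<open>t = 0\<close> of the moment bound, since \<open>\<mu>P\<^sub>0 = \<mu>\<close>.\<close>

lemma D_mean:
  shows "integrable \<mu> D" and "(\<integral>x. D x \<partial>\<mu>) \<le> start_moment"
proof -
  have [measurable_cong]: "sets \<mu> = sets borel" using mu_prob by (simp add: space_prob_algebra)
  interpret m: prob_space \<mu> using mu_prob by (simp add: space_prob_algebra)
  have "P 0 = return borel" using P_zero by auto
  then have "\<mu> \<bind> P 0 = \<mu>" using bind_return''[of \<mu> borel] by (simp add: \<open>sets \<mu> = sets borel\<close>)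
  then have mb: "(\<integral>\<^sup>+x. ennreal (dist x0 x powr \<zeta>) \<partial>\<mu>) \<le> ennreal C\<^sub>V" using moment_bound[of 0] by simp
  have i: "integrable \<mu> (\<lambda>x. dist x0 x powr \<zeta>)"
    by (rule integrableI_nonneg) (use mb in \<open>auto intro: le_less_trans\<close>)
  have le: "D x \<le> 1 + dist x0 x powr \<zeta> + D x0" for x
  proof -
    have "dist x0 x \<le> 1 + dist x0 x powr \<zeta>"
    proof (cases "dist x0 x \<le> 1")
      case True then show ?thesis by (simp add: add_increasing2)
    next
      case False
      then have "dist x0 x powr 1 \<le> dist x0 x powr \<zeta>" using zeta by (intro powr_mono) auto
      then show ?thesis using False by simp
    qed
    with D_le[of x] show ?thesis by linarith
  qed
  have i2: "integrable \<mu> (\<lambda>x. 1 + dist x0 x powr \<zeta> + D x0)" using i by simp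
  show iD: "integrable \<mu> D"
    by (rule Bochner_Integration.integrable_bound[OF i2]) (use le D_nonneg in \<open>auto intro: order_trans\<close>)
  have "(\<integral>x. D x \<partial>\<mu>) \<le> (\<integral>x. 1 + dist x0 x powr \<zeta> + D x0 \<partial>\<mu>)" by (rule integral_mono[OF iD i2 le])
  also have "\<dots> = 1 + (\<integral>x. dist x0 x powr \<zeta> \<partial>\<mu>) + D x0" using i by (simp add: m.prob_space)
  also have "(\<integral>x. dist x0 x powr \<zeta> \<partial>\<mu>) \<le> C\<^sub>V"
    by (rule integral_real_bounded[OF CV_nonneg mb])
  finally show "(\<integral>x. D x \<partial>\<mu>) \<le> start_moment" by (simp add: start_moment_def)
qed

lemma I_event: "0 \<le> t \<Longrightarrow> A \<in> sets borel \<Longrightarrow> {\<omega> \<in> \<Omega>. I t \<omega> \<in> A} \<in> sets (Past t)"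
  using measurable_sets[OF I_Past[of t], of A] by (simp add: space_generated vimage_def Int_def conj_commute)

lemma V_event: "0 \<le> t \<Longrightarrow> A \<in> sets borel \<Longrightarrow> {\<omega> \<in> \<Omega>. V t \<omega> \<in> A} \<in> sets (Past t)"
proof -
  assume t: "0 \<le> t" and A: "A \<in> sets borel"
  have [measurable]: "\<Phi> t \<in> Past t \<rightarrow>\<^sub>M borel" by (rule Phi_measurable) (use t in auto)
  have "V t \<in> borel_measurable (Past t)" unfolding V_def [abs_def] by measurable
  from measurable_sets[OF this A] show ?thesis by (simp add: space_generated vimage_def Int_def conj_commute)
qed

lemma sets_Past_W: "A \<in> sets (Past t) \<Longrightarrow> A \<in> sets W"
  using Past_mono(1) by (auto simp: W_sets)

definition tail_const :: real where "tail_const = clt_const + 36 * corr_const * start_moment"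

text \<open>The step function that starts at \<open>x\<close> equals 1 beyond \<open>x + 3\<close>, hence dominates the
  indicator.\<close>

lemma one_time_upper:
  fixes p :: nat
  assumes p: "2 \<le> p" and x: "0 \<le> x"
  shows "W.prob {\<omega> \<in> \<Omega>. (x + 3) * real p ^ 4 \<le> I (real p ^ 8) \<omega>} \<le> exp (- x\<^sup>2 / (2 * \<sigma>2)) + tail_const / sqrt (real p)"
proof -
  have [measurable]: "I (real p ^ 8) \<in> borel_measurable Paths" by simp
  have p0: "0 < real p ^ 4" using p by simp
  let ?S = "{\<omega> \<in> \<Omega>. (x + 3) * real p ^ 4 \<le> I (real p ^ 8) \<omega>}"
  let ?h = "\<lambda>\<omega>. smooth_step (- x + I (real p ^ 8) \<omega> / real p ^ 4)"
  have S: "?S \<in> sets W" using sets_Past_W[OF I_event[of "real p ^ 8" "{(x + 3) * real p ^ 4..}"]] by simp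
  have ih: "integrable W ?h" by (rule integrable_bounded_law[OF mu_prob _ smooth_step_abs]) measurable
  have "W.prob ?S = (\<integral>\<omega>. indicator ?S \<omega> \<partial>W)" using S by simp
  also have "\<dots> \<le> (\<integral>\<omega>. ?h \<omega> \<partial>W)"
  proof (rule integral_mono)
    show "integrable W (indicator ?S :: _ \<Rightarrow> real)" by (rule W.integrable_const_bound[of _ 1]) (use S in auto)
    fix \<omega>
    show "indicator ?S \<omega> \<le> ?h \<omega>"
    proof (cases "\<omega> \<in> ?S")
      case True
      then have "x + 3 \<le> I (real p ^ 8) \<omega> / real p ^ 4" using p0 by (simp add: pos_le_divide_eq)
      then show ?thesis using True smooth_step_1[of "- x + I (real p ^ 8) \<omega> / real p ^ 4"] by simp
    qed (simp add: smooth_step_range)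
  qed (rule ih)
  also have "\<dots> = (\<integral>y. (\<integral>\<omega>. ?h \<omega> \<partial>\<PP> y) \<partial>\<mu>)" by (rule integral_law[OF mu_prob ih])
  also have "\<dots> \<le> (\<integral>y. avg (gauss (sqrt \<sigma>2)) smooth_step (- x) + clt_const / sqrt (real p) + 36 * corr_const * D y / real p ^ 4 \<partial>\<mu>)"
  proof (rule integral_mono)
    interpret m: prob_space \<mu> using mu_prob by (simp add: space_prob_algebra)
    have sm: "sets \<mu> = sets borel" using mu_prob by (simp add: space_prob_algebra)
    show "integrable \<mu> (\<lambda>y. avg (gauss (sqrt \<sigma>2)) smooth_step (- x) + clt_const / sqrt (real p) + 36 * corr_const * D y / real p ^ 4)"
      using D_mean(1) by simp
    have "(\<lambda>y. \<integral>\<omega>. ?h \<omega> \<partial>\<PP> y) \<in> borel_measurable borel" by (rule PP_integral_measurable) measurable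
    then have "(\<lambda>y. \<integral>\<omega>. ?h \<omega> \<partial>\<PP> y) \<in> borel_measurable \<mu>" using measurable_cong_sets[OF sm refl] by blast
    then show "integrable \<mu> (\<lambda>y. \<integral>\<omega>. ?h \<omega> \<partial>\<PP> y)"
      by (rule m.integrable_const_bound[of _ 1, rotated]) (use abs_expectation_le[OF prob_space_PP smooth_step_abs] in auto)
    fix y
    show "(\<integral>\<omega>. ?h \<omega> \<partial>\<PP> y) \<le> avg (gauss (sqrt \<sigma>2)) smooth_step (- x) + clt_const / sqrt (real p) + 36 * corr_const * D y / real p ^ 4"
      using clt_start[OF p variance_pos, where a="- x" and x=y] by linarith
  qed
  also have "\<dots> = avg (gauss (sqrt \<sigma>2)) smooth_step (- x) + clt_const / sqrt (real p) + 36 * corr_const * (\<integral>y. D y \<partial>\<mu>) / real p ^ 4"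
  proof -
    interpret m: prob_space \<mu> using mu_prob by (simp add: space_prob_algebra)
    show ?thesis using D_mean(1) by (simp add: m.prob_space)
  qed
  also have "\<dots> \<le> exp (- x\<^sup>2 / (2 * \<sigma>2)) + clt_const / sqrt (real p) + 36 * corr_const * start_moment / sqrt (real p)"
  proof (intro add_mono order_refl)
    show "avg (gauss (sqrt \<sigma>2)) smooth_step (- x) \<le> exp (- x\<^sup>2 / (2 * \<sigma>2))"
      using gauss_tail_upper[OF _ x, of "sqrt \<sigma>2"] variance_pos by simp
    have sp: "sqrt (real p) \<le> real p ^ 4"
    proof -
      have "sqrt (real p) \<le> real p" using p by (intro real_le_lsqrt) (auto simp: power2_eq_square)
      also have "real p ^ 1 \<le> real p ^ 4" using p by (intro power_increasing) auto
      finally show ?thesis by simp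
    qed
    have "36 * corr_const * (\<integral>y. D y \<partial>\<mu>) / real p ^ 4 \<le> 36 * corr_const * start_moment / real p ^ 4"
      by (intro divide_right_mono mult_left_mono D_mean(2)) (use corr_const_nonneg in auto)
    also have "\<dots> \<le> 36 * corr_const * start_moment / sqrt (real p)"
      by (rule divide_left_mono[OF sp]) (use corr_const_nonneg start_moment_nonneg p in auto)
    finally show "36 * corr_const * (\<integral>y. D y \<partial>\<mu>) / real p ^ 4 \<le> 36 * corr_const * start_moment / sqrt (real p)" .
  qed
  finally show ?thesis by (simp add: tail_const_def add_divide_distrib)
qed

text \<open>Twice the bound of \<open>abs_I_start\<close> for the mean of \<open>\<bar>I\<bar>\<close> up to time \<open>n\<close>, in units of \<open>sqrt n\<close>
  and for starting points within \<open>sqrt n\<close> of \<open>x0\<close>; the summand 1 makes it positive.\<close>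

definition ottaviani :: real where
  "ottaviani = 1 + 2 * (sqrt var_const + corr_const * (1 + D x0))"

lemma ottaviani_pos: "0 < ottaviani"
proof -
  have "0 \<le> sqrt var_const + corr_const * (1 + D x0)" using var_const_nonneg corr_const_nonneg D_nonneg[of x0] by simp
  then show ?thesis by (simp add: ottaviani_def)
qed

text \<open>Markov's inequality: the level is at least twice the mean of \<open>\<bar>I\<bar>\<close>.\<close>

lemma no_deep_descent:
  assumes n: "0 < n" "m \<le> n" and y: "dist x0 y \<le> sqrt (real n)"
  shows "1 / 2 \<le> measure (\<PP> y) {\<omega> \<in> \<Omega>. - ottaviani * sqrt (real n) \<le> I (real m) \<omega>}"
proof -
  interpret p: prob_space "\<PP> y" by (rule prob_space_PP)
  let ?a = "ottaviani * sqrt (real n)"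
  have n1: "1 \<le> sqrt (real n)" using n by simp
  have a: "0 < ?a" using ottaviani_pos n by simp
  let ?S = "{\<omega> \<in> \<Omega>. - ottaviani * sqrt (real n) \<le> I (real m) \<omega>}"
  have S: "?S \<in> p.events" using I_event[of "real m" "{- ottaviani * sqrt (real n)..}"] Past_mono(1) by (auto simp: sets_PP)
  have iI: "integrable (\<PP> y) (\<lambda>\<omega>. \<bar>I (real m) \<omega>\<bar>)"
    by (rule integrable_bounded_PP[of _ "G * real m"]) (use I_bound in auto)
  have "p.prob (space (\<PP> y) - ?S) = (\<integral>\<omega>. indicator (space (\<PP> y) - ?S) \<omega> \<partial>\<PP> y)" using S by simp
  also have "\<dots> \<le> (\<integral>\<omega>. \<bar>I (real m) \<omega>\<bar> / ?a \<partial>\<PP> y)"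
  proof (rule integral_mono)
    show "integrable (\<PP> y) (indicator (space (\<PP> y) - ?S) :: _ \<Rightarrow> real)"
      by (rule p.integrable_const_bound[of _ 1]) (use S in auto)
    show "integrable (\<PP> y) (\<lambda>\<omega>. \<bar>I (real m) \<omega>\<bar> / ?a)" using iI by simp
    fix \<omega> assume "\<omega> \<in> space (\<PP> y)"
    show "indicator (space (\<PP> y) - ?S) \<omega> \<le> \<bar>I (real m) \<omega>\<bar> / ?a"
    proof (cases "\<omega> \<in> ?S")
      case False
      then have "?a \<le> \<bar>I (real m) \<omega>\<bar>" using \<open>\<omega> \<in> space (\<PP> y)\<close> by (auto simp: space_PP)
      then have "1 \<le> \<bar>I (real m) \<omega>\<bar> / ?a" using a by (simp add: pos_le_divide_eq)
      then show ?thesis by (simp add: indicator_def)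
    qed (use a in auto)
  qed
  also have "\<dots> = (\<integral>\<omega>. \<bar>I (real m) \<omega>\<bar> \<partial>\<PP> y) / ?a" by simp
  also have "\<dots> \<le> (?a / 2) / ?a"
  proof (rule divide_right_mono)
    have "(\<integral>\<omega>. \<bar>I (real m) \<omega>\<bar> \<partial>\<PP> y) \<le> sqrt (var_const * real m) + corr_const * D y" by (rule abs_I_start)
    also have "\<dots> \<le> sqrt var_const * sqrt (real n) + corr_const * ((1 + D x0) * sqrt (real n))"
    proof (intro add_mono mult_left_mono)
      have "sqrt (var_const * real m) \<le> sqrt (var_const * real n)"
        using n var_const_nonneg by (intro real_sqrt_le_mono mult_left_mono) auto
      then show "sqrt (var_const * real m) \<le> sqrt var_const * sqrt (real n)" by (simp add: real_sqrt_mult)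
      have "D x0 * 1 \<le> D x0 * sqrt (real n)" by (rule mult_left_mono[OF n1 D_nonneg])
      then show "D y \<le> (1 + D x0) * sqrt (real n)" using D_le[of y] y by (simp add: algebra_simps)
    qed (rule corr_const_nonneg)
    also have "\<dots> \<le> ?a / 2" using n1 by (simp add: ottaviani_def algebra_simps)
    finally show "(\<integral>\<omega>. \<bar>I (real m) \<omega>\<bar> \<partial>\<PP> y) \<le> ?a / 2" .
  qed (use a in simp)
  also have "\<dots> = 1 / 2"
  proof -
    have "z / 2 / z = 1 / 2" if "0 < z" for z :: real using that by simp
    from this[OF a] show ?thesis .
  qed
  finally have "p.prob (space (\<PP> y) - ?S) \<le> 1 / 2" .
  then show ?thesis using p.prob_compl[OF S] by simp
qed

lemma markov_event:
  assumes s: "0 \<le> s" and H: "H \<in> sets (Past s)" and B: "B \<in> sets Paths"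
  shows "W.prob (H \<inter> (\<theta> s -` B \<inter> \<Omega>)) = (\<integral>\<omega>. indicator H \<omega> * measure (\<PP> (\<Phi> s \<omega>)) B \<partial>W)"
proof -
  have [measurable]: "H \<in> sets (Past s)" "B \<in> sets Paths" by fact+
  let ?h = "\<lambda>z. indicator H (fst z) * indicator B (snd z) :: real"
  have hm: "?h \<in> borel_measurable (Past s \<Otimes>\<^sub>M Paths)" by measurable
  have Tm: "\<theta> s -` B \<inter> \<Omega> \<in> sets W" using measurable_sets[OF shift_measurable[OF s] B] by (simp add: W_sets space_generated)
  have HW: "H \<in> sets W" by (rule sets_Past_W[OF H])
  have "W.prob (H \<inter> (\<theta> s -` B \<inter> \<Omega>)) = (\<integral>\<omega>. indicator (H \<inter> (\<theta> s -` B \<inter> \<Omega>)) \<omega> \<partial>W)" using Tm HW by simp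
  also have "\<dots> = (\<integral>\<omega>. ?h (\<omega>, \<theta> s \<omega>) \<partial>W)"
    by (rule Bochner_Integration.integral_cong) (auto simp: W_space split: split_indicator)
  also have "\<dots> = (\<integral>\<omega>. (\<integral>\<omega>'. ?h (\<omega>, \<omega>') \<partial>\<PP> (\<Phi> s \<omega>)) \<partial>W)"
  proof (rule markov_integral[OF mu_prob s hm], rule integrable_bounded_law[OF mu_prob])
    show "(\<lambda>\<omega>. ?h (\<omega>, \<theta> s \<omega>)) \<in> borel_measurable Paths"
      using measurable_compose[OF shift_pair_measurable[OF s] hm] .
    show "\<bar>?h (\<omega>, \<theta> s \<omega>)\<bar> \<le> 1" for \<omega> by (simp split: split_indicator)
  qed
  also have "\<dots> = (\<integral>\<omega>. indicator H \<omega> * measure (\<PP> (\<Phi> s \<omega>)) B \<partial>W)" using B by (simp add: sets_PP)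
  finally show ?thesis .
qed

lemma integrable_indicator_prob:
  assumes s: "0 \<le> s" and H: "H \<in> sets (Past s)" and B: "B \<in> sets Paths"
  shows "integrable W (\<lambda>\<omega>. indicator H \<omega> * measure (\<PP> (\<Phi> s \<omega>)) B)"
proof (rule W.integrable_const_bound[of _ 1])
  have "(\<lambda>y. measure (\<PP> y) B) \<in> borel_measurable borel"
    using measurable_compose[OF PP_subkernel measurable_measure_subprob_algebra[OF B]] .
  then have [measurable]: "(\<lambda>\<omega>. measure (\<PP> (\<Phi> s \<omega>)) B) \<in> borel_measurable W"
    unfolding W_measurable by (rule measurable_compose[OF Phi_Paths_measurable[OF s]])
  have [measurable]: "H \<in> sets W" by (rule sets_Past_W[OF H])
  show "(\<lambda>\<omega>. indicator H \<omega> * measure (\<PP> (\<Phi> s \<omega>)) B) \<in> borel_measurable W" by measurable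
  show "AE \<omega> in W. norm (indicator H \<omega> * measure (\<PP> (\<Phi> s \<omega>)) B) \<le> 1"
    using prob_space.prob_le_1[OF prob_space_PP] by (auto split: split_indicator)
qed

text \<open>If the level \<open>x + ottaviani\<close> is first crossed at time \<open>j\<close> with the process not too far from
  \<open>x0\<close>, then with conditional probability at least \<open>1/2\<close> the remaining increment does not fall
  below \<open>-ottaviani\<close>, and the final value is still above \<open>x\<close>.\<close>

lemma ottaviani_inequality:
  assumes n: "0 < n"
  shows "W.prob {\<omega> \<in> \<Omega>. \<exists>j\<le>n. (x + ottaviani) * sqrt (real n) \<le> I (real j) \<omega>}
    \<le> 2 * W.prob {\<omega> \<in> \<Omega>. x * sqrt (real n) \<le> I (real n) \<omega>} + (\<Sum>j\<le>n. W.prob {\<omega> \<in> \<Omega>. sqrt (real n) < V (real j) \<omega>})"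
proof -
  let ?c = "(x + ottaviani) * sqrt (real n)"
  define F' where "F' j = {\<omega> \<in> \<Omega>. ?c \<le> I (real j) \<omega> \<and> V (real j) \<omega> \<le> sqrt (real n) \<and> (\<forall>i<j. I (real i) \<omega> < ?c)}" for j :: nat
  have FP: "F' j \<in> sets (Past (real j))" for j
  proof -
    have "{\<omega> \<in> \<Omega>. \<forall>i<k. I (real i) \<omega> < ?c} \<in> sets (Past (real j))" if "k \<le> j" for k
      using that
    proof (induction k)
      case 0 show ?case using sets.top[of "Past (real j)"] by (simp add: space_generated)
    next
      case (Suc k)
      have e: "{\<omega> \<in> \<Omega>. \<forall>i<Suc k. I (real i) \<omega> < ?c} = {\<omega> \<in> \<Omega>. \<forall>i<k. I (real i) \<omega> < ?c} \<inter> {\<omega> \<in> \<Omega>. I (real k) \<omega> \<in> {..<?c}}"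
        by (auto simp: less_Suc_eq)
      have s: "sets (Past (real k)) \<subseteq> sets (Past (real j))" by (rule Past_mono(2)) (use Suc.prems in simp)
      have "{\<omega> \<in> \<Omega>. I (real k) \<omega> \<in> {..<?c}} \<in> sets (Past (real j))"
        by (rule subsetD[OF s I_event]) simp_all
      moreover have "{\<omega> \<in> \<Omega>. \<forall>i<k. I (real i) \<omega> < ?c} \<in> sets (Past (real j))" by (rule Suc.IH) (use Suc.prems in simp)
      ultimately show ?case unfolding e by (intro sets.Int)
    qed
    note 1 = this[OF order_refl]
    have "F' j = {\<omega> \<in> \<Omega>. I (real j) \<omega> \<in> {?c..}} \<inter> {\<omega> \<in> \<Omega>. V (real j) \<omega> \<in> {..sqrt (real n)}} \<inter> {\<omega> \<in> \<Omega>. \<forall>i<j. I (real i) \<omega> < ?c}"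
      by (auto simp: F'_def)
    also have "\<dots> \<in> sets (Past (real j))"
      by (intro sets.Int I_event V_event 1) simp_all
    finally show ?thesis .
  qed
  have FW: "F' j \<in> sets W" for j by (rule sets_Past_W[OF FP])
  have disj: "disjoint_family_on F' {..n}"
    unfolding disjoint_family_on_def
  proof (intro ballI impI)
    fix i j :: nat assume "i \<noteq> j"
    then consider "i < j" | "j < i" by linarith
    then show "F' i \<inter> F' j = {}"
    proof cases
      case 1 then show ?thesis unfolding F'_def by fastforce
    next
      case 2 then show ?thesis unfolding F'_def by fastforce
    qed
  qed
  let ?E = "{\<omega> \<in> \<Omega>. x * sqrt (real n) \<le> I (real n) \<omega>}"
  have EW: "?E \<in> sets W" using sets_Past_W[OF I_event[of "real n" "{x * sqrt (real n)..}"]] by simp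
  have half: "W.prob (F' j) \<le> 2 * W.prob (F' j \<inter> ?E)" if j: "j \<le> n" for j
  proof -
    let ?B = "{\<omega> \<in> \<Omega>. - ottaviani * sqrt (real n) \<le> I (real (n - j)) \<omega>}"
    have B: "?B \<in> sets Paths" using I_event[of "real (n - j)" "{- ottaviani * sqrt (real n)..}"] Past_mono(1) by auto
    have "W.prob (F' j) / 2 = (\<integral>\<omega>. indicator (F' j) \<omega> * (1 / 2) \<partial>W)" using FW by simp
    also have "\<dots> \<le> (\<integral>\<omega>. indicator (F' j) \<omega> * measure (\<PP> (\<Phi> (real j) \<omega>)) ?B \<partial>W)"
    proof (rule integral_mono)
      show "integrable W (\<lambda>\<omega>. indicator (F' j) \<omega> * measure (\<PP> (\<Phi> (real j) \<omega>)) ?B)"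
        by (rule integrable_indicator_prob[OF _ FP B]) simp
      show "integrable W (\<lambda>\<omega>. indicator (F' j) \<omega> * (1 / 2 :: real))"
        by (rule W.integrable_const_bound[of _ 1]) (use FW in \<open>auto split: split_indicator\<close>)
      fix \<omega>
      show "indicator (F' j) \<omega> * (1 / 2) \<le> indicator (F' j) \<omega> * measure (\<PP> (\<Phi> (real j) \<omega>)) ?B"
        using no_deep_descent[OF n, of "n - j" "\<Phi> (real j) \<omega>"] by (auto simp: F'_def V_def split: split_indicator)
    qed
    also have "\<dots> = W.prob (F' j \<inter> (\<theta> (real j) -` ?B \<inter> \<Omega>))" by (rule markov_event[symmetric, OF _ FP B]) simp
    also have "\<dots> \<le> W.prob (F' j \<inter> ?E)"
    proof (rule W.finite_measure_mono)
      show "F' j \<inter> (\<theta> (real j) -` ?B \<inter> \<Omega>) \<subseteq> F' j \<inter> ?E"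
      proof
        fix \<omega> assume w: "\<omega> \<in> F' j \<inter> (\<theta> (real j) -` ?B \<inter> \<Omega>)"
        then have "I (real n) \<omega> = I (real j) \<omega> + I (real (n - j)) (\<theta> (real j) \<omega>)"
          using I_add[of \<omega> "real j" "real (n - j)"] j by (simp add: of_nat_diff)
        moreover have "?c \<le> I (real j) \<omega>" "- ottaviani * sqrt (real n) \<le> I (real (n - j)) (\<theta> (real j) \<omega>)" using w by (auto simp: F'_def)
        moreover have "?c = x * sqrt (real n) + ottaviani * sqrt (real n)" by (rule distrib_right)
        ultimately have "x * sqrt (real n) \<le> I (real n) \<omega>" by simp
        then show "\<omega> \<in> F' j \<inter> ?E" using w by simp
      qed
    qed (use FW EW in auto)
    finally show ?thesis by simp
  qed
  let ?A = "{\<omega> \<in> \<Omega>. \<exists>j\<le>n. ?c \<le> I (real j) \<omega>}"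
  let ?Vb = "\<lambda>j. {\<omega> \<in> \<Omega>. sqrt (real n) < V (real j) \<omega>}"
  have VW: "?Vb j \<in> sets W" for j using sets_Past_W[OF V_event[of "real j" "{sqrt (real n)<..}"]] by simp
  have sub: "?A \<subseteq> (\<Union>j\<in>{..n}. F' j) \<union> (\<Union>j\<in>{..n}. ?Vb j)"
  proof
    fix \<omega> assume "\<omega> \<in> ?A"
    then obtain j where j: "\<omega> \<in> \<Omega>" "j \<le> n" "?c \<le> I (real j) \<omega>" by auto
    define k where "k = (LEAST k. ?c \<le> I (real k) \<omega>)"
    have k: "?c \<le> I (real k) \<omega>" unfolding k_def by (rule LeastI[of "\<lambda>k. ?c \<le> I (real k) \<omega>", OF j(3)])
    have "k \<le> j" unfolding k_def by (rule Least_le[of "\<lambda>k. ?c \<le> I (real k) \<omega>", OF j(3)])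
    then have kn: "k \<in> {..n}" using j(2) by simp
    have m: "I (real i) \<omega> < ?c" if "i < k" for i
      using not_less_Least[of i "\<lambda>k. ?c \<le> I (real k) \<omega>"] that unfolding k_def by (simp only: not_le)
    show "\<omega> \<in> (\<Union>j\<in>{..n}. F' j) \<union> (\<Union>j\<in>{..n}. ?Vb j)"
    proof (cases "V (real k) \<omega> \<le> sqrt (real n)")
      case True
      then have "\<omega> \<in> F' k" unfolding F'_def using j(1) k m by blast
      then show ?thesis using kn by blast
    next
      case False
      then have "\<omega> \<in> ?Vb k" using j(1) by (simp only: not_le mem_Collect_eq simp_thms)
      then show ?thesis using kn by blast
    qed
  qed
  have UF: "(\<Union>j\<in>{..n}. F' j) \<in> sets W" by (intro sets.finite_UN FW) simp
  have UV: "(\<Union>j\<in>{..n}. ?Vb j) \<in> sets W" by (intro sets.finite_UN VW) simp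
  have FE: "F' j \<inter> ?E \<in> sets W" for j by (intro sets.Int FW EW)
  have disjE: "disjoint_family_on (\<lambda>j. F' j \<inter> ?E) {..n}" using disj unfolding disjoint_family_on_def by blast
  have "W.prob ?A \<le> W.prob ((\<Union>j\<in>{..n}. F' j) \<union> (\<Union>j\<in>{..n}. ?Vb j))"
    by (rule W.finite_measure_mono[OF sub]) (intro sets.Un UF UV)
  also have "\<dots> \<le> W.prob (\<Union>j\<in>{..n}. F' j) + W.prob (\<Union>j\<in>{..n}. ?Vb j)"
    by (rule measure_Un_le[OF UF UV])
  also have "W.prob (\<Union>j\<in>{..n}. ?Vb j) \<le> (\<Sum>j\<le>n. W.prob (?Vb j))"
    by (rule W.finite_measure_subadditive_finite[OF finite_atMost]) (rule image_subsetI, rule VW)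
  also have "W.prob (\<Union>j\<in>{..n}. F' j) = (\<Sum>j\<le>n. W.prob (F' j))"
    by (rule W.finite_measure_finite_Union[OF finite_atMost _ disj]) (rule image_subsetI, rule FW)
  also have "(\<Sum>j\<le>n. W.prob (F' j)) \<le> (\<Sum>j\<le>n. 2 * W.prob (F' j \<inter> ?E))"
    by (rule sum_mono, rule half) simp
  also have "\<dots> = 2 * (\<Sum>j\<le>n. W.prob (F' j \<inter> ?E))" by (rule sum_distrib_left[symmetric])
  also have "(\<Sum>j\<le>n. W.prob (F' j \<inter> ?E)) = W.prob (\<Union>j\<in>{..n}. F' j \<inter> ?E)"
    by (rule W.finite_measure_finite_Union[OF finite_atMost _ disjE, symmetric]) (rule image_subsetI, rule FE)
  also have "W.prob (\<Union>j\<in>{..n}. F' j \<inter> ?E) \<le> W.prob ?E"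
    by (rule W.finite_measure_mono[OF _ EW]) blast
  finally show ?thesis by simp
qed

text \<open>The position is bad at one of \<open>p\<^sup>8\<close> times with probability of order \<open>p\<^sup>8 (p\<^sup>4) powr (-\<zeta>)\<close>,
  which decays because \<open>\<zeta> > 2\<close>.\<close>

lemma maximal_upper:
  fixes p :: nat
  assumes p: "2 \<le> p" and x: "0 \<le> x"
  shows "W.prob {\<omega> \<in> \<Omega>. \<exists>j\<le>p ^ 8. (x + 3 + ottaviani) * real p ^ 4 \<le> I (real j) \<omega>}
    \<le> 2 * exp (- x\<^sup>2 / (2 * \<sigma>2)) + 2 * tail_const / sqrt (real p) + 2 * C\<^sub>V * real p powr (8 - 4 * \<zeta>)"
proof -
  have p0: "0 < real p" "1 \<le> real p" using p by auto
  have sq: "sqrt (real (p ^ 8)) = real p ^ 4"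
    by (rule real_sqrt_unique) (simp_all add: power_mult[symmetric])
  have "W.prob {\<omega> \<in> \<Omega>. \<exists>j\<le>p ^ 8. (x + 3 + ottaviani) * real p ^ 4 \<le> I (real j) \<omega>}
    \<le> 2 * W.prob {\<omega> \<in> \<Omega>. (x + 3) * real p ^ 4 \<le> I (real p ^ 8) \<omega>} + (\<Sum>j\<le>p ^ 8. W.prob {\<omega> \<in> \<Omega>. real p ^ 4 < V (real j) \<omega>})"
    using ottaviani_inequality[of "p ^ 8" "x + 3"] p unfolding sq by simp
  also have "(\<Sum>j\<le>p ^ 8. W.prob {\<omega> \<in> \<Omega>. real p ^ 4 < V (real j) \<omega>}) \<le> (\<Sum>j\<le>p ^ 8. C\<^sub>V / (real p ^ 4) powr \<zeta>)"
    by (intro sum_mono V_tail) (use p in auto)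
  also have "\<dots> = (real p ^ 8 + 1) * (C\<^sub>V / (real p ^ 4) powr \<zeta>)" by simp
  also have "\<dots> \<le> (2 * real p ^ 8) * (C\<^sub>V / (real p ^ 4) powr \<zeta>)"
    by (intro mult_right_mono) (use CV_nonneg one_le_power[OF p0(2), of 8] in auto)
  also have "\<dots> = 2 * C\<^sub>V * real p powr (8 - 4 * \<zeta>)"
  proof -
    have "real p ^ 4 = real p powr 4" using powr_realpow[OF p0(1), of 4] by simp
    then have "(real p ^ 4) powr \<zeta> = real p powr (4 * \<zeta>)" by (simp only: powr_powr)
    moreover have "real p ^ 8 = real p powr 8" using p0 powr_realpow[of "real p" 8] by simp
    ultimately show ?thesis by (simp add: powr_diff)
  qed
  also have "2 * W.prob {\<omega> \<in> \<Omega>. (x + 3) * real p ^ 4 \<le> I (real p ^ 8) \<omega>} \<le> 2 * (exp (- x\<^sup>2 / (2 * \<sigma>2)) + tail_const / sqrt (real p))"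
    by (intro mult_left_mono one_time_upper[OF p x]) simp
  finally show ?thesis by (simp add: algebra_simps)
qed

definition iter :: "real \<Rightarrow> real" where "iter t = sqrt (2 * \<sigma>2 * t * ln (ln t))"

lemma iter_mono: assumes "exp 1 \<le> s" "s \<le> t" shows "iter s \<le> iter t"
proof -
  have s0: "0 < s" using assms(1) exp_gt_zero[of "1::real"] by linarith
  have s1: "1 \<le> ln s" using assms(1) s0 by (simp add: ln_ge_iff)
  have "ln s \<le> ln t" using s0 assms(2) by simp
  then have l: "ln (ln s) \<le> ln (ln t)" using s1 by simp
  have "s * ln (ln s) \<le> t * ln (ln t)" by (rule mult_mono) (use assms s0 s1 l in auto)
  then have "2 * \<sigma>2 * (s * ln (ln s)) \<le> 2 * \<sigma>2 * (t * ln (ln t))" using variance_pos by (intro mult_left_mono) auto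
  then show ?thesis unfolding iter_def by (simp add: mult.assoc)
qed

lemma iter_nonneg: "exp 1 \<le> s \<Longrightarrow> 0 \<le> iter s"
proof -
  assume s: "exp 1 \<le> s"
  have s0: "0 < s" using s exp_gt_zero[of "1::real"] by linarith
  have s1: "1 \<le> ln s" using s s0 by (simp add: ln_ge_iff)
  then show ?thesis unfolding iter_def using variance_pos s0 by simp
qed

lemma iter_at_top: "filterlim iter at_top at_top"
proof -
  have "filterlim (\<lambda>t. sqrt (2 * s * t * ln (ln t))) at_top at_top" if "0 < s" for s :: real
    using that by real_asymp
  from this[OF variance_pos] show ?thesis unfolding iter_def [abs_def] .
qed

text \<open>At the times \<open>r\<^sup>8\<close> the norming is the scale \<open>r\<^sup>4\<close> of the central limit theorem times a level
  that depends only on the iterated logarithm.\<close>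

lemma iter_pow8: assumes "0 < r" shows "iter (r ^ 8) = r ^ 4 * sqrt (2 * \<sigma>2 * ln (ln (r ^ 8)))"
proof -
  have "sqrt ((r ^ 4)\<^sup>2) = r ^ 4" using assms by (intro real_sqrt_unique) auto
  moreover have "(r ^ 4)\<^sup>2 = r ^ 8" by (simp add: power_mult[symmetric])
  ultimately have "sqrt (r ^ 8) = r ^ 4" by simp
  moreover have "2 * \<sigma>2 * r ^ 8 * ln (ln (r ^ 8)) = r ^ 8 * (2 * \<sigma>2 * ln (ln (r ^ 8)))" by simp
  ultimately show ?thesis unfolding iter_def by (simp only: real_sqrt_mult)
qed

lemma upper_ratio:
  fixes c :: real assumes "0 < c"
  shows "(\<lambda>k::nat. ((exp (c * (real k + 1)) + 1) ^ 8 * ln (ln ((exp (c * (real k + 1)) + 1) ^ 8))) / (exp (c * real k) ^ 8 * ln (ln (exp (c * real k) ^ 8)))) \<longlonglongrightarrow> exp (8 * c)"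
proof -
  have "inverse (exp (- c) ^ 8) = exp (8 * c)" by (simp add: exp_minus power_inverse flip: exp_of_nat_mult)
  then show ?thesis using assms by real_asymp
qed

text \<open>Along \<open>p\<^sub>k\<close> close to \<open>e\<^bsup>ck\<^esup>\<close> the maximal inequality at a level slightly above the critical
  one has Gaussian tail of order \<open>k powr (- (1 + \<epsilon> / 4))\<close>, and its other terms are geometric in
  \<open>k\<close>; all are summable. The maximum covers the times between consecutive \<open>p\<^sub>k\<^sup>8\<close>, and a small \<open>c\<close>
  makes the norming at both ends comparable.\<close>

lemma upper_lil:
  assumes \<epsilon>: "0 < \<epsilon>" "\<epsilon> \<le> 1"
  shows "AE \<omega> in W. eventually (\<lambda>j. I (real j) \<omega> \<le> (1 + \<epsilon>) * iter (real j)) sequentially"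
proof -
  \<comment> \<open>Between consecutive times the norming grows by a factor tending to \<open>exp (4 c)\<close>, for which
    \<open>exp (9 c)\<close> leaves room.\<close>
  define c where "c = ln ((1 + \<epsilon>) / (1 + \<epsilon> / 2)) / 9"
  have rat: "1 < (1 + \<epsilon>) / (1 + \<epsilon> / 2)" using \<epsilon> by simp
  then have c: "0 < c" by (simp add: c_def)
  have ec: "exp (9 * c) = (1 + \<epsilon>) / (1 + \<epsilon> / 2)" using rat by (simp add: c_def)
  define p where "p k = nat \<lceil>exp (c * real k)\<rceil>" for k
  have p1: "exp (c * real k) \<le> real (p k)" for k unfolding p_def by (rule real_nat_ceiling_ge)
  have p2: "real (p k) \<le> exp (c * real k) + 1" for k
    unfolding p_def using ceiling_correct[of "exp (c * real k)"] by (simp add: less_imp_le)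
  have p0: "0 < real (p k)" for k using p1[of k] exp_gt_zero[of "c * real k"] by linarith
  define \<Lambda> where "\<Lambda> k = ln (ln (real (p k) ^ 8))" for k
  \<comment> \<open>The constants lost in \<open>maximal_upper\<close> are subtracted in advance; they are negligible against
    the growing level.\<close>
  define x where "x k = (1 + \<epsilon> / 2) * sqrt (2 * \<sigma>2 * \<Lambda> k) - 3 - ottaviani" for k
  have \<Lambda>lim: "filterlim \<Lambda> at_top sequentially"
  proof (rule filterlim_at_top_mono)
    show "filterlim (\<lambda>k::nat. ln (ln (exp (c * real k) ^ 8))) at_top sequentially" using c by real_asymp
    have "eventually (\<lambda>k::nat. 1 < exp (c * real k) ^ 8) sequentially" using c by real_asymp
    then show "eventually (\<lambda>k. ln (ln (exp (c * real k) ^ 8)) \<le> \<Lambda> k) sequentially"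
    proof eventually_elim
      fix k :: nat assume a: "1 < exp (c * real k) ^ 8"
      have "exp (c * real k) ^ 8 \<le> real (p k) ^ 8" using p1[of k] by (intro power_mono) auto
      then have "ln (exp (c * real k) ^ 8) \<le> ln (real (p k) ^ 8)" using a by (intro ln_mono) auto
      moreover have "0 < ln (exp (c * real k) ^ 8)" using a by (rule ln_gt_zero)
      ultimately show "ln (ln (exp (c * real k) ^ 8)) \<le> \<Lambda> k" unfolding \<Lambda>_def by (rule ln_mono)
    qed
  qed
  have ev1: "eventually (\<lambda>k. (1 + \<epsilon> / 4) * sqrt (2 * \<sigma>2 * \<Lambda> k) \<le> x k \<and> 0 \<le> \<Lambda> k) sequentially"
  proof -
    have "filterlim (\<lambda>L. e / 4 * sqrt (2 * s * L)) at_top at_top" if "0 < e" "0 < s" for e s :: real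
      using that by real_asymp
    from this[OF \<epsilon>(1) variance_pos] have "filterlim (\<lambda>k. \<epsilon> / 4 * sqrt (2 * \<sigma>2 * \<Lambda> k)) at_top sequentially" using \<Lambda>lim by (rule filterlim_compose)
    then have "eventually (\<lambda>k. 3 + ottaviani \<le> \<epsilon> / 4 * sqrt (2 * \<sigma>2 * \<Lambda> k)) sequentially" unfolding filterlim_at_top by blast
    moreover have "eventually (\<lambda>k. 0 \<le> \<Lambda> k) sequentially" using \<Lambda>lim unfolding filterlim_at_top by blast
    ultimately show ?thesis
    proof eventually_elim
      fix k assume a: "3 + ottaviani \<le> \<epsilon> / 4 * sqrt (2 * \<sigma>2 * \<Lambda> k)" "0 \<le> \<Lambda> k"
      have "(1 + \<epsilon> / 2) * sqrt (2 * \<sigma>2 * \<Lambda> k) = (1 + \<epsilon> / 4) * sqrt (2 * \<sigma>2 * \<Lambda> k) + \<epsilon> / 4 * sqrt (2 * \<sigma>2 * \<Lambda> k)"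
        by (simp add: algebra_simps)
      then show "(1 + \<epsilon> / 4) * sqrt (2 * \<sigma>2 * \<Lambda> k) \<le> x k \<and> 0 \<le> \<Lambda> k" using a unfolding x_def by linarith
    qed
  qed
  define A where "A k = {\<omega> \<in> \<Omega>. \<exists>j\<le>p k ^ 8. (x k + 3 + ottaviani) * real (p k) ^ 4 \<le> I (real j) \<omega>}" for k
  have AW: "A k \<in> sets W" for k
  proof -
    have "A k = (\<Union>j\<in>{..p k ^ 8}. {\<omega> \<in> \<Omega>. I (real j) \<omega> \<in> {(x k + 3 + ottaviani) * real (p k) ^ 4..}})"
      unfolding A_def by auto
    also have "\<dots> \<in> sets W" by (intro sets.finite_UN sets_Past_W[OF I_event]) auto
    finally show ?thesis .
  qed
  define b where "b k = 2 * (8 * c * real k) powr (- (1 + \<epsilon> / 4)) + 2 * tail_const * exp (- (c / 2)) ^ k + 2 * C\<^sub>V * exp (- ((4 * \<zeta> - 8) * c)) ^ k" for k :: nat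
  have sb: "summable b" unfolding b_def
  proof (intro summable_add summable_mult summable_geometric)
    have "summable (\<lambda>k. real k powr (- (1 + \<epsilon> / 4)))" using \<epsilon> by (subst summable_real_powr_iff) auto
    then have "summable (\<lambda>k. (8 * c) powr (- (1 + \<epsilon> / 4)) * real k powr (- (1 + \<epsilon> / 4)))" by (rule summable_mult)
    then show "summable (\<lambda>k. (8 * c * real k) powr (- (1 + \<epsilon> / 4)))" using c by (simp add: powr_mult)
  qed (use c zeta in auto)
  have tc: "0 \<le> tail_const"
    unfolding tail_const_def clt_const_def using corr_const_nonneg start_moment_nonneg var_const_nonneg cov_const_nonneg Dbar_nonneg gamma_pos var_err_nonneg \<sigma>2_nonneg G_nonneg
    by simp
  have ev2: "eventually (\<lambda>k. norm (W.prob (A k)) \<le> b k) sequentially"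
  proof -
    have e1: "eventually (\<lambda>k::nat. 1 < 8 * c * real k) sequentially" using c by real_asymp
    have e2: "eventually (\<lambda>k::nat. 2 \<le> exp (c * real k)) sequentially" using c by real_asymp
    show ?thesis using e1 e2 ev1
    proof eventually_elim
      fix k assume k: "1 < 8 * c * real k" "2 \<le> exp (c * real k)" and x': "(1 + \<epsilon> / 4) * sqrt (2 * \<sigma>2 * \<Lambda> k) \<le> x k \<and> 0 \<le> \<Lambda> k"
      have pk: "2 \<le> p k" using k(2) p1[of k] by simp
      have x0: "0 \<le> x k" using x' \<epsilon> variance_pos by (intro order_trans[OF _ conjunct1[OF x']]) simp
      have \<Lambda>: "ln (8 * c * real k) \<le> \<Lambda> k"
      proof -
        have "exp (c * real k) ^ 8 \<le> real (p k) ^ 8" using p1[of k] by (intro power_mono) auto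
        then have "ln (exp (c * real k) ^ 8) \<le> ln (real (p k) ^ 8)" by (intro ln_mono) auto
        moreover have "ln (exp (c * real k) ^ 8) = 8 * c * real k" by (simp add: ln_realpow)
        ultimately show ?thesis unfolding \<Lambda>_def using k(1) by (intro ln_mono) auto
      qed
      have l0: "0 < ln (8 * c * real k)" using k(1) by (rule ln_gt_zero)
      have "(1 + \<epsilon> / 4) * ln (8 * c * real k) \<le> (1 + \<epsilon> / 4) * \<Lambda> k" using \<Lambda> \<epsilon> by (intro mult_left_mono) auto
      also have "\<dots> \<le> (1 + \<epsilon> / 4)\<^sup>2 * \<Lambda> k"
      proof (rule mult_right_mono)
        show "1 + \<epsilon> / 4 \<le> (1 + \<epsilon> / 4)\<^sup>2" using self_le_power[of "1 + \<epsilon> / 4" 2] \<epsilon> by simp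
      qed (use x' in simp)
      also have "\<dots> = ((1 + \<epsilon> / 4) * sqrt (2 * \<sigma>2 * \<Lambda> k))\<^sup>2 / (2 * \<sigma>2)"
        using variance_pos x' by (simp add: power_mult_distrib)
      also have "\<dots> \<le> (x k)\<^sup>2 / (2 * \<sigma>2)"
        using x' variance_pos \<epsilon> by (intro divide_right_mono power_mono) auto
      finally have "exp (- (x k)\<^sup>2 / (2 * \<sigma>2)) \<le> exp (- ((1 + \<epsilon> / 4) * ln (8 * c * real k)))" by simp
      also have "\<dots> = (8 * c * real k) powr (- (1 + \<epsilon> / 4))"
      proof -
        have "exp (- (s * ln y)) = y powr (- s)" if "1 < y" for s y :: real using that by (simp add: powr_def)
        from this[OF k(1)] show ?thesis .
      qed
      finally have t1: "exp (- (x k)\<^sup>2 / (2 * \<sigma>2)) \<le> (8 * c * real k) powr (- (1 + \<epsilon> / 4))" .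
      have t2: "1 / sqrt (real (p k)) \<le> exp (- (c / 2)) ^ k"
      proof -
        have "exp (c / 2 * real k) = sqrt (exp (c * real k))"
          by (rule real_sqrt_unique[symmetric]) (simp_all add: exp_double[symmetric] power2_eq_square exp_add[symmetric])
        also have "\<dots> \<le> sqrt (real (p k))" using p1[of k] by simp
        finally have "1 / sqrt (real (p k)) \<le> 1 / exp (c / 2 * real k)" using p0[of k] by (intro divide_left_mono) auto
        also have "\<dots> = exp (real k * - (c / 2))" by (simp add: exp_minus field_simps)
        finally show ?thesis by (simp only: exp_of_nat_mult)
      qed
      have t3: "real (p k) powr (8 - 4 * \<zeta>) \<le> exp (- ((4 * \<zeta> - 8) * c)) ^ k"
      proof -
        have "real (p k) powr (8 - 4 * \<zeta>) \<le> exp (c * real k) powr (8 - 4 * \<zeta>)"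
          by (rule powr_mono2') (use zeta p1[of k] in auto)
        also have "\<dots> = exp (real k * - ((4 * \<zeta> - 8) * c))" by (simp add: powr_def algebra_simps)
        finally show ?thesis by (simp only: exp_of_nat_mult)
      qed
      have "W.prob (A k) \<le> 2 * exp (- (x k)\<^sup>2 / (2 * \<sigma>2)) + 2 * tail_const * (1 / sqrt (real (p k))) + 2 * C\<^sub>V * real (p k) powr (8 - 4 * \<zeta>)"
        unfolding A_def using maximal_upper[OF pk x0] by simp
      also have "\<dots> \<le> b k" unfolding b_def
        by (intro add_mono mult_left_mono t1 t2 t3) (use tc CV_nonneg in auto)
      finally show "norm (W.prob (A k)) \<le> b k" by simp
    qed
  qed
  have bc: "AE \<omega> in W. eventually (\<lambda>k. \<omega> \<in> space W - A k) sequentially"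
    by (rule borel_cantelli_AE1[OF AW]) (auto intro: summable_comparison_test_ev[OF ev2 sb] simp: less_top[symmetric])
  have ev3: "eventually (\<lambda>k. (1 + \<epsilon> / 2) * iter (real (p (Suc k)) ^ 8) \<le> (1 + \<epsilon>) * iter (real (p k) ^ 8)) sequentially"
  proof -
    let ?u = "\<lambda>k::nat. (exp (c * (real k + 1)) + 1) ^ 8" and ?v = "\<lambda>k::nat. exp (c * real k) ^ 8"
    have "exp (8 * c) < (exp (9 * c))\<^sup>2" using c by (simp add: exp_double[symmetric])
    from order_tendstoD(2)[OF upper_ratio[OF c] this]
    have "eventually (\<lambda>k. (?u k * ln (ln (?u k))) / (?v k * ln (ln (?v k))) < (exp (9 * c))\<^sup>2) sequentially" .
    moreover have "eventually (\<lambda>k. exp 1 \<le> ?v k \<and> 0 < ln (ln (?v k))) sequentially" by (intro eventually_conj) (use c in real_asymp)+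
    ultimately show ?thesis
    proof eventually_elim
      fix k assume a: "(?u k * ln (ln (?u k))) / (?v k * ln (ln (?v k))) < (exp (9 * c))\<^sup>2" and v: "exp 1 \<le> ?v k \<and> 0 < ln (ln (?v k))"
      have vv: "0 < ?v k * ln (ln (?v k))" using v by simp
      then have "?u k * ln (ln (?u k)) \<le> (exp (9 * c))\<^sup>2 * (?v k * ln (ln (?v k)))" using a by (simp add: pos_divide_less_eq less_imp_le)
      then have "2 * \<sigma>2 * (?u k * ln (ln (?u k))) \<le> 2 * \<sigma>2 * ((exp (9 * c))\<^sup>2 * (?v k * ln (ln (?v k))))" using variance_pos by (intro mult_left_mono) auto
      then have "2 * \<sigma>2 * ?u k * ln (ln (?u k)) \<le> (exp (9 * c))\<^sup>2 * (2 * \<sigma>2 * ?v k * ln (ln (?v k)))" by (simp only: mult_ac)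
      then have "sqrt (2 * \<sigma>2 * ?u k * ln (ln (?u k))) \<le> sqrt ((exp (9 * c))\<^sup>2 * (2 * \<sigma>2 * ?v k * ln (ln (?v k))))" by (rule real_sqrt_le_mono)
      then have uv: "iter (?u k) \<le> exp (9 * c) * iter (?v k)" unfolding iter_def real_sqrt_mult[of "(exp (9 * c))\<^sup>2"] by simp
      have v1: "?v k \<le> real (p k) ^ 8" using p1[of k] by (intro power_mono) auto
      have "c * real k \<le> c * real (Suc k)" using c by (intro mult_left_mono) auto
      then have "exp (c * real k) \<le> real (p (Suc k))" using p1[of "Suc k"] order_trans[of "exp (c * real k)" "exp (c * real (Suc k))"] by simp
      then have v2: "?v k \<le> real (p (Suc k)) ^ 8" by (intro power_mono) auto
      have u1: "real (p (Suc k)) ^ 8 \<le> ?u k" using p2[of "Suc k"] by (intro power_mono) (auto simp: add.commute)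
      have "iter (real (p (Suc k)) ^ 8) \<le> iter (?u k)" by (rule iter_mono[OF _ u1]) (use v v2 in linarith)
      also note uv
      also have "exp (9 * c) * iter (?v k) \<le> exp (9 * c) * iter (real (p k) ^ 8)" by (intro mult_left_mono iter_mono v1) (use v in auto)
      finally have "(1 + \<epsilon> / 2) * iter (real (p (Suc k)) ^ 8) \<le> (1 + \<epsilon> / 2) * (exp (9 * c) * iter (real (p k) ^ 8))"
        using \<epsilon> by (intro mult_left_mono) auto
      also have "\<dots> = (1 + \<epsilon>) * iter (real (p k) ^ 8)" unfolding ec using \<epsilon> by simp
      finally show "(1 + \<epsilon> / 2) * iter (real (p (Suc k)) ^ 8) \<le> (1 + \<epsilon>) * iter (real (p k) ^ 8)" .
    qed
  qed
  have ev4: "eventually (\<lambda>k. exp 1 \<le> real (p k) ^ 8) sequentially"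
  proof -
    have "eventually (\<lambda>k::nat. exp 1 \<le> exp (c * real k) ^ 8) sequentially" using c by real_asymp
    then show ?thesis
    proof eventually_elim
      fix k :: nat assume "exp 1 \<le> exp (c * real k) ^ 8"
      also have "\<dots> \<le> real (p k) ^ 8" using p1[of k] by (intro power_mono) auto
      finally show "exp 1 \<le> real (p k) ^ 8" .
    qed
  qed
  show ?thesis using bc
  proof eventually_elim
    fix \<omega> assume "eventually (\<lambda>k. \<omega> \<in> space W - A k) sequentially"
    then have "eventually (\<lambda>k. (\<omega> \<in> space W - A k) \<and> (1 + \<epsilon> / 2) * iter (real (p (Suc k)) ^ 8) \<le> (1 + \<epsilon>) * iter (real (p k) ^ 8) \<and> exp 1 \<le> real (p k) ^ 8) sequentially"
      using ev3 ev4 by eventually_elim auto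
    then obtain K where K: "\<And>k. K \<le> k \<Longrightarrow> \<omega> \<in> \<Omega> \<and> \<omega> \<notin> A k"
      "\<And>k. K \<le> k \<Longrightarrow> (1 + \<epsilon> / 2) * iter (real (p (Suc k)) ^ 8) \<le> (1 + \<epsilon>) * iter (real (p k) ^ 8)"
      "\<And>k. K \<le> k \<Longrightarrow> exp 1 \<le> real (p k) ^ 8"
      unfolding eventually_sequentially by (auto simp: W_space)
    show "eventually (\<lambda>j. I (real j) \<omega> \<le> (1 + \<epsilon>) * iter (real j)) sequentially"
      using eventually_gt_at_top[of "p K ^ 8"]
    proof eventually_elim
      fix j assume j: "p K ^ 8 < j"
      have "\<exists>k. K \<le> k \<and> j \<le> p k ^ 8"
      proof -
        have "filterlim (\<lambda>k::nat. exp (c * real k)) at_top sequentially" using c by real_asymp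
        then have "eventually (\<lambda>k::nat. real j \<le> exp (c * real k)) sequentially" unfolding filterlim_at_top by blast
        then have "eventually (\<lambda>k::nat. K \<le> k \<and> real j \<le> exp (c * real k)) sequentially" using eventually_ge_at_top[of K] by eventually_elim auto
        then obtain k where k: "K \<le> k" "real j \<le> exp (c * real k)" by (auto dest: eventually_happens)
        then have "j \<le> p k" using p1[of k] by linarith
        also have "p k \<le> p k ^ 8" using p0[of k] by (intro self_le_power) auto
        finally show ?thesis using k by blast
      qed
      then obtain k where k: "K \<le> k" "j \<le> p k ^ 8" and kmin: "\<And>i. i < k \<Longrightarrow> \<not> (K \<le> i \<and> j \<le> p i ^ 8)"
        using exists_least_iff[of "\<lambda>k. K \<le> k \<and> j \<le> p k ^ 8"] by blast
      have "k \<noteq> K" using k(2) j by auto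
      then obtain k' where k': "k = Suc k'" "K \<le> k'" using k(1) by (cases k) auto
      have pj: "p k' ^ 8 < j" using kmin[of k'] k' by auto
      have xk: "(x k + 3 + ottaviani) * real (p k) ^ 4 = (1 + \<epsilon> / 2) * iter (real (p k) ^ 8)"
        unfolding x_def \<Lambda>_def iter_pow8[OF p0] by simp
      have "I (real j) \<omega> < (1 + \<epsilon> / 2) * iter (real (p k) ^ 8)"
        using K(1)[OF k(1)] k(2) unfolding A_def xk by (fastforce simp: not_le)
      also have "\<dots> \<le> (1 + \<epsilon>) * iter (real (p k') ^ 8)" using K(2)[OF k'(2)] k'(1) by simp
      also have "\<dots> \<le> (1 + \<epsilon>) * iter (real j)"
      proof (intro mult_left_mono iter_mono)
        show "exp 1 \<le> real (p k') ^ 8" by (rule K(3)[OF k'(2)])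
        have "real (p k' ^ 8) \<le> real j" using pj by (simp only: of_nat_le_iff less_imp_le)
        then show "real (p k') ^ 8 \<le> real j" by simp
      qed (use \<epsilon> in auto)
      finally show "I (real j) \<omega> \<le> (1 + \<epsilon>) * iter (real j)" by simp
    qed
  qed
qed

section \<open>The lower half of the law of the iterated logarithm\<close>

text \<open>The step function that starts at \<open>x\<close> vanishes below \<open>x\<close>, hence is dominated by the
  indicator. The starting point is kept, since the estimate serves as a conditional probability
  given the past.\<close>

lemma one_time_lower:
  fixes p :: nat
  assumes p: "2 \<le> p" and x: "0 \<le> x"
  shows "exp (- (x + 4)\<^sup>2 / (2 * \<sigma>2)) / sqrt (2 * pi * \<sigma>2) - clt_const / sqrt (real p) - 36 * corr_const * D y / real p ^ 4
    \<le> measure (\<PP> y) {\<omega> \<in> \<Omega>. x * real p ^ 4 \<le> I (real p ^ 8) \<omega>}"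
proof -
  interpret p: prob_space "\<PP> y" by (rule prob_space_PP)
  have [measurable]: "I (real p ^ 8) \<in> borel_measurable Paths" by simp
  have p0: "0 < real p ^ 4" using p by simp
  let ?S = "{\<omega> \<in> \<Omega>. x * real p ^ 4 \<le> I (real p ^ 8) \<omega>}"
  let ?h = "\<lambda>\<omega>. smooth_step (- x + I (real p ^ 8) \<omega> / real p ^ 4)"
  have "{\<omega> \<in> \<Omega>. I (real p ^ 8) \<omega> \<in> {x * real p ^ 4..}} \<in> sets (Past (real p ^ 8))" by (rule I_event) simp_all
  then have S: "?S \<in> p.events" using Past_mono(1) by (auto simp: sets_PP)
  have "exp (- (x + 4)\<^sup>2 / (2 * \<sigma>2)) / sqrt (2 * pi * \<sigma>2) \<le> avg (gauss (sqrt \<sigma>2)) smooth_step (- x)"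
    using gauss_tail_lower[OF _ x, of "sqrt \<sigma>2"] variance_pos by simp
  also have "\<dots> \<le> (\<integral>\<omega>. ?h \<omega> \<partial>\<PP> y) + (clt_const / sqrt (real p) + 36 * corr_const * D y / real p ^ 4)"
    using clt_start[OF p variance_pos, where a="- x" and x=y] by linarith
  also have "(\<integral>\<omega>. ?h \<omega> \<partial>\<PP> y) \<le> (\<integral>\<omega>. indicator ?S \<omega> \<partial>\<PP> y)"
  proof (rule integral_mono)
    show "integrable (\<PP> y) (indicator ?S :: _ \<Rightarrow> real)" by (rule p.integrable_const_bound[of _ 1]) (use S in auto)
    show "integrable (\<PP> y) ?h" by (rule integrable_bounded_PP[OF _ smooth_step_abs]) measurable
    fix \<omega> assume "\<omega> \<in> space (\<PP> y)"
    then have \<omega>: "\<omega> \<in> \<Omega>" by (simp add: space_PP)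
    show "?h \<omega> \<le> indicator ?S \<omega>"
    proof (cases "\<omega> \<in> ?S")
      case False
      then have "I (real p ^ 8) \<omega> / real p ^ 4 \<le> x" using p0 \<omega> by (simp add: pos_divide_le_eq)
      then show ?thesis using smooth_step_0[of "- x + I (real p ^ 8) \<omega> / real p ^ 4"] by simp
    qed (simp add: smooth_step_range)
  qed
  also have "(\<integral>\<omega>. indicator ?S \<omega> \<partial>\<PP> y) = measure (\<PP> y) ?S" using S by simp
  finally show ?thesis by linarith
qed

text \<open>The Gaussian tail at a subcritical level is a power \<open>k powr (-a)\<close> with \<open>a < 1\<close>, which
  exceeds \<open>1/k\<close> even after an exponentially small error is deducted.\<close>

lemma exponential_beats_power:
  fixes a c C b :: real
  assumes "0 < a" "a < 1" "0 < c" "0 < C" "0 < b"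
  shows "eventually (\<lambda>k::nat. 1 / real k \<le> b * (8 * c * real k) powr (- a) - C * exp (- (c / 2) * real k)) sequentially"
  using assms by real_asymp

lemma lnln_double:
  fixes c :: real assumes "0 < c"
  shows "(\<lambda>k::nat. ln (ln (2 * exp (c * real k) ^ 8)) / ln (ln (exp (c * real k) ^ 8))) \<longlonglongrightarrow> 1"
  using assms by real_asymp

text \<open>The times \<open>s\<^sub>k\<close> separate consecutive blocks of lengths \<open>q\<^bsup>8k\<^esup>\<close>. Given the past up to \<open>s\<^sub>k\<close>
  and a position not too far from \<open>x0\<close>, the increment over the next block is large with
  probability at least \<open>1/k\<close>, so the probability that this fails for all blocks from \<open>k0\<close> to
  \<open>n - 1\<close> is at most the product of \<open>1 - 1/k\<close>, which telescopes to \<open>(k0 - 1) / (n - 1)\<close>. The large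
  increment dominates the value at \<open>s\<^sub>k\<close>, which the assumption bounds from below, because \<open>s\<^sub>k\<close> is
  a small fraction of the block length.\<close>

lemma lower_lil:
  assumes \<epsilon>: "0 < \<epsilon>" "\<epsilon> \<le> 1 / 4"
    and below: "AE \<omega> in W. eventually (\<lambda>j. - I (real j) \<omega> \<le> 2 * iter (real j)) sequentially"
  shows "AE \<omega> in W. frequently (\<lambda>j. (1 - 4 * \<epsilon>) * iter (real j) \<le> I (real j) \<omega>) sequentially"
proof -
  \<comment> \<open>With \<open>q \<epsilon> \<ge> 3\<close> the past, of length at most \<open>2 / q\<^sup>8\<close> times the block, costs no more than a
    fraction \<open>\<epsilon>\<close> of the norming.\<close>
  obtain q :: nat where q0: "max 2 (3 / \<epsilon>) \<le> real q" using real_arch_simple by blast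
  then have q: "2 \<le> real q" "3 / \<epsilon> \<le> real q" "2 \<le> q" by auto
  define r where "r k = real q ^ k" for k :: nat
  define s where "s k = (\<Sum>i<k. q ^ (8 * i))" for k :: nat
  define c where "c = ln (real q)"
  have c: "0 < c" using q by (simp add: c_def)
  have r_exp: "r k = exp (c * real k)" for k
  proof -
    have "exp (c * real k) = exp (real k * c)" by (simp add: mult.commute)
    also have "\<dots> = exp c ^ k" by (rule exp_of_nat_mult)
    finally show ?thesis using q by (simp add: r_def c_def)
  qed
  have r1: "1 \<le> r k" for k unfolding r_def using q by (intro one_le_power) auto
  have r8: "r k ^ 8 = real (q ^ (8 * k))" for k by (simp add: r_def power_mult[symmetric] mult.commute)
  have rq: "r k = real (q ^ k)" for k by (simp add: r_def)
  define \<Lambda> where "\<Lambda> k = ln (8 * c * real k)" for k :: nat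
  have \<Lambda>: "ln (ln (r k ^ 8)) = \<Lambda> k" for k unfolding r_exp \<Lambda>_def by (simp add: ln_realpow mult.assoc)
  have \<Lambda>lim: "filterlim \<Lambda> at_top sequentially" unfolding \<Lambda>_def using c by real_asymp
  define x where "x k = (1 - \<epsilon>) * sqrt (2 * \<sigma>2 * \<Lambda> k)" for k
  define B where "B k = {\<omega> \<in> \<Omega>. x k * r k ^ 4 \<le> I (r k ^ 8) \<omega>}" for k
  \<comment> \<open>Good positions; their radius \<open>r\<^sub>k\<^sup>2\<close> is small against \<open>r\<^sub>k\<^sup>4\<close>, yet leaving it infinitely often
    has probability 0.\<close>
  define G where "G k = {\<omega> \<in> \<Omega>. V (real (s k)) \<omega> \<in> {..(r k)\<^sup>2}}" for k
  define E where "E k = \<theta> (real (s k)) -` B k \<inter> \<Omega>" for k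
  define C where "C = clt_const + 36 * corr_const * (1 + D x0) + 1"
  have clt0: "0 \<le> clt_const"
    unfolding clt_const_def using corr_const_nonneg start_moment_nonneg var_const_nonneg cov_const_nonneg Dbar_nonneg gamma_pos var_err_nonneg \<sigma>2_nonneg G_nonneg
    by simp
  have C: "0 < C" unfolding C_def using clt0 corr_const_nonneg D_nonneg[of x0] by (simp add: add_nonneg_pos)
  have rk4: "0 \<le> r k ^ 8" "0 \<le> r k ^ 4" "0 < r k" for k using r1[of k] by auto
  have BP: "B k \<in> sets Paths" for k
  proof -
    have "{\<omega> \<in> \<Omega>. I (r k ^ 8) \<omega> \<in> {x k * r k ^ 4..}} \<in> sets (Past (r k ^ 8))" by (rule I_event[OF rk4(1)]) simp
    then show ?thesis unfolding B_def using Past_mono(1) by auto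
  qed
  have GP: "G k \<in> sets (Past (real (s k)))" for k unfolding G_def by (rule V_event) simp_all
  have sSuc: "real (s (Suc k)) = real (s k) + r k ^ 8" for k unfolding r8 by (simp add: s_def)
  have EP: "E k \<in> sets (Past (real (s (Suc k))))" for k
  proof -
    have "(\<lambda>\<omega>. I (r k ^ 8) (\<theta> (real (s k)) \<omega>)) \<in> borel_measurable (Past (real (s k) + r k ^ 8))" by (rule I_shift_Past) (use rk4 in auto)
    from measurable_sets[OF this, of "{x k * r k ^ 4..}"]
    have "(\<lambda>\<omega>. I (r k ^ 8) (\<theta> (real (s k)) \<omega>)) -` {x k * r k ^ 4..} \<inter> \<Omega> \<in> sets (Past (real (s (Suc k))))"
      unfolding sSuc by (simp add: space_generated)
    moreover have "E k = (\<lambda>\<omega>. I (r k ^ 8) (\<theta> (real (s k)) \<omega>)) -` {x k * r k ^ 4..} \<inter> \<Omega>"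
      using shift_in[of "real (s k)"] by (auto simp: E_def B_def)
    ultimately show ?thesis by simp
  qed
  have prob: "eventually (\<lambda>k. \<forall>\<omega>\<in>G k. 1 / real k \<le> measure (\<PP> (\<Phi> (real (s k)) \<omega>)) (B k)) sequentially"
  proof -
    have b: "0 < 1 / sqrt (2 * pi * \<sigma>2)" using variance_pos by simp
    have e1: "eventually (\<lambda>k. 1 / real k \<le> 1 / sqrt (2 * pi * \<sigma>2) * (8 * c * real k) powr (- (1 - \<epsilon>)) - C * exp (- (c / 2) * real k)) sequentially"
      by (rule exponential_beats_power[OF _ _ c C b]) (use \<epsilon> in auto)
    have "filterlim (\<lambda>L. e * sqrt (2 * v * L)) at_top at_top" if "0 < e" "0 < v" for e v :: real using that by real_asymp
    note lim = this
    \<comment> \<open>The gain that absorbs the shift by 4 in \<open>one_time_lower\<close>.\<close>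
    have d: "0 < sqrt (1 - \<epsilon>) - (1 - \<epsilon>)"
    proof -
      have "(1 - \<epsilon>) * (1 - \<epsilon>) < (1 - \<epsilon>) * 1" using \<epsilon> by (intro mult_strict_left_mono) auto
      then have "1 - \<epsilon> < sqrt (1 - \<epsilon>)" by (intro real_less_rsqrt) (simp add: power2_eq_square)
      then show ?thesis by simp
    qed
    have "filterlim (\<lambda>k. (sqrt (1 - \<epsilon>) - (1 - \<epsilon>)) * sqrt (2 * \<sigma>2 * \<Lambda> k)) at_top sequentially"
      by (rule filterlim_compose[OF lim[OF d variance_pos] \<Lambda>lim])
    then have e2: "eventually (\<lambda>k. 4 \<le> (sqrt (1 - \<epsilon>) - (1 - \<epsilon>)) * sqrt (2 * \<sigma>2 * \<Lambda> k)) sequentially" unfolding filterlim_at_top by blast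
    have e3: "eventually (\<lambda>k. 1 \<le> \<Lambda> k) sequentially" using \<Lambda>lim unfolding filterlim_at_top by blast
    have e4: "eventually (\<lambda>k::nat. 1 < 8 * c * real k) sequentially" using c by real_asymp
    show ?thesis using e1 e2 e3 e4 eventually_ge_at_top[of 1]
    proof eventually_elim
      fix k :: nat
      assume a1: "1 / real k \<le> 1 / sqrt (2 * pi * \<sigma>2) * (8 * c * real k) powr (- (1 - \<epsilon>)) - C * exp (- (c / 2) * real k)"
        and a2: "4 \<le> (sqrt (1 - \<epsilon>) - (1 - \<epsilon>)) * sqrt (2 * \<sigma>2 * \<Lambda> k)" and a3: "1 \<le> \<Lambda> k" and a4: "1 < 8 * c * real k" and k1: "1 \<le> k"
      have qk: "2 \<le> q ^ k" using q(3) self_le_power[of q k] k1 by (auto intro: order_trans)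
      have x0: "0 \<le> x k" unfolding x_def using \<epsilon> variance_pos a3 by simp
      have xx: "(x k + 4)\<^sup>2 / (2 * \<sigma>2) \<le> (1 - \<epsilon>) * \<Lambda> k"
      proof -
        have "(sqrt (1 - \<epsilon>) - (1 - \<epsilon>)) * sqrt (2 * \<sigma>2 * \<Lambda> k) = sqrt (1 - \<epsilon>) * sqrt (2 * \<sigma>2 * \<Lambda> k) - x k"
          by (simp add: x_def left_diff_distrib)
        then have "x k + 4 \<le> sqrt (1 - \<epsilon>) * sqrt (2 * \<sigma>2 * \<Lambda> k)" using a2 by linarith
        then have "(x k + 4)\<^sup>2 \<le> (sqrt (1 - \<epsilon>) * sqrt (2 * \<sigma>2 * \<Lambda> k))\<^sup>2" using x0 by (intro power_mono) auto
        also have "\<dots> = (1 - \<epsilon>) * \<Lambda> k * (2 * \<sigma>2)" using \<epsilon> variance_pos a3 by (simp add: power_mult_distrib)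
        finally show ?thesis using variance_pos by (simp add: pos_divide_le_eq)
      qed
      have g: "(8 * c * real k) powr (- (1 - \<epsilon>)) \<le> exp (- (x k + 4)\<^sup>2 / (2 * \<sigma>2))"
      proof -
        have "y powr (- u) = exp (- (u * ln y))" if "1 < y" for u y :: real using that by (simp add: powr_def)
        from this[OF a4, of "1 - \<epsilon>"] xx show ?thesis unfolding \<Lambda>_def by simp
      qed
      have sr: "1 / sqrt (r k) = exp (- (c / 2) * real k)"
      proof -
        have "sqrt (exp (c * real k)) = exp (c / 2 * real k)"
          by (rule real_sqrt_unique) (simp_all add: power2_eq_square exp_add[symmetric])
        then show ?thesis unfolding r_exp by (simp add: exp_minus field_simps)
      qed
      show "\<forall>\<omega>\<in>G k. 1 / real k \<le> measure (\<PP> (\<Phi> (real (s k)) \<omega>)) (B k)"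
      proof
        fix \<omega> assume "\<omega> \<in> G k"
        then have v: "dist x0 (\<Phi> (real (s k)) \<omega>) \<le> (r k)\<^sup>2" by (simp add: G_def V_def)
        let ?y = "\<Phi> (real (s k)) \<omega>"
        have "D ?y \<le> (1 + D x0) * (r k)\<^sup>2"
        proof -
          have "D x0 * 1 \<le> D x0 * (r k)\<^sup>2" using r1[of k] by (intro mult_left_mono D_nonneg one_le_power) auto
          then show ?thesis using D_le[of ?y] v by (simp add: algebra_simps)
        qed
        then have "36 * corr_const * D ?y / r k ^ 4 \<le> 36 * corr_const * ((1 + D x0) * (r k)\<^sup>2) / r k ^ 4"
          using corr_const_nonneg rk4 by (intro divide_right_mono mult_left_mono) auto
        also have "\<dots> = 36 * corr_const * (1 + D x0) * (1 / (r k)\<^sup>2)"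
          using rk4(3)[of k] by (simp add: field_simps eval_nat_numeral)
        also have "\<dots> \<le> 36 * corr_const * (1 + D x0) * (1 / sqrt (r k))"
        proof (intro mult_left_mono divide_left_mono)
          have "sqrt (r k) \<le> r k" using r1[of k] by (intro real_le_lsqrt) (auto simp: power2_eq_square)
          also have "r k \<le> (r k)\<^sup>2" using self_le_power[OF r1[of k], of 2] by simp
          finally show "sqrt (r k) \<le> (r k)\<^sup>2" .
        qed (use corr_const_nonneg D_nonneg[of x0] rk4(3)[of k] in auto)
        finally have err: "36 * corr_const * D ?y / r k ^ 4 \<le> 36 * corr_const * (1 + D x0) * (1 / sqrt (r k))" .
        have "exp (- (x k + 4)\<^sup>2 / (2 * \<sigma>2)) / sqrt (2 * pi * \<sigma>2) - clt_const / sqrt (r k) - 36 * corr_const * D ?y / r k ^ 4 \<le> measure (\<PP> ?y) (B k)"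
          unfolding B_def rq by (rule one_time_lower[OF qk x0])
        moreover have "1 / sqrt (2 * pi * \<sigma>2) * (8 * c * real k) powr (- (1 - \<epsilon>)) \<le> exp (- (x k + 4)\<^sup>2 / (2 * \<sigma>2)) / sqrt (2 * pi * \<sigma>2)"
          using mult_left_mono[OF g less_imp_le[OF b]] by simp
        moreover have "clt_const / sqrt (r k) + 36 * corr_const * (1 + D x0) * (1 / sqrt (r k)) \<le> C * exp (- (c / 2) * real k)"
        proof -
          have "clt_const / sqrt (r k) + 36 * corr_const * (1 + D x0) * (1 / sqrt (r k)) = (C - 1) * (1 / sqrt (r k))"
            by (simp add: C_def algebra_simps add_divide_distrib)
          also have "\<dots> \<le> C * (1 / sqrt (r k))" using rk4(3)[of k] by (intro mult_right_mono) auto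
          finally show ?thesis unfolding sr .
        qed
        ultimately show "1 / real k \<le> measure (\<PP> ?y) (B k)" using a1 err by linarith
      qed
    qed
  qed
  then obtain K0 where K0: "\<And>k \<omega>. K0 \<le> k \<Longrightarrow> \<omega> \<in> G k \<Longrightarrow> 1 / real k \<le> measure (\<PP> (\<Phi> (real (s k)) \<omega>)) (B k)"
    unfolding eventually_sequentially by blast
  define K where "K = max K0 2"
  have escape: "W.prob {\<omega> \<in> \<Omega>. \<forall>k\<ge>k0. \<omega> \<notin> E k \<and> \<omega> \<in> G k} = 0"
    and escape_sets: "{\<omega> \<in> \<Omega>. \<forall>k\<ge>k0. \<omega> \<notin> E k \<and> \<omega> \<in> G k} \<in> sets W" if k0: "K \<le> k0" for k0
  proof -
    define H where "H n = {\<omega> \<in> \<Omega>. \<forall>k. k0 \<le> k \<and> k < n \<longrightarrow> \<omega> \<notin> E k \<and> \<omega> \<in> G k}" for n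
    have H0: "H k0 = \<Omega>" unfolding H_def by auto
    have HS: "H (Suc n) = (H n \<inter> G n) \<inter> (\<theta> (real (s n)) -` (\<Omega> - B n) \<inter> \<Omega>)" if "k0 \<le> n" for n
    proof -
      have "\<theta> (real (s n)) -` (\<Omega> - B n) \<inter> \<Omega> = \<Omega> - E n" using shift_in[of "real (s n)"] by (auto simp: E_def)
      then show ?thesis unfolding H_def using that by (auto simp: less_Suc_eq)
    qed
    have CB: "\<Omega> - B n \<in> sets Paths" for n using sets.compl_sets[OF BP[of n]] by (simp add: space_generated)
    have HP: "H n \<in> sets (Past (real (s n)))" if "k0 \<le> n" for n
      using that
    proof (induction n rule: dec_induct)
      case base show ?case unfolding H0 using sets.top[of "Past (real (s k0))"] by (simp add: space_generated)
    next
      case (step n)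
      have sub: "sets (Past (real (s n))) \<subseteq> sets (Past (real (s (Suc n))))" by (rule Past_mono(2)) (use sSuc[of n] rk4(1)[of n] in simp)
      have "H (Suc n) = (H n \<inter> G n) \<inter> (space (Past (real (s (Suc n)))) - E n)"
        unfolding H_def using step.hyps by (auto simp: less_Suc_eq space_generated)
      also have "\<dots> \<in> sets (Past (real (s (Suc n))))"
        by (intro sets.Int sets.compl_sets EP subsetD[OF sub] step.IH GP)
      finally show ?case .
    qed
    have HW: "H n \<in> sets W" if "k0 \<le> n" for n by (rule sets_Past_W[OF HP[OF that]])
    have k2: "2 \<le> k0" using k0 by (simp add: K_def)
    have bound: "W.prob (H n) \<le> (real k0 - 1) / (real n - 1)" if "k0 \<le> n" for n
      using that
    proof (induction n rule: dec_induct)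
      case base show ?case unfolding H0 using W.prob_space k2 by (simp add: W_space)
    next
      case (step n)
      have n: "2 \<le> n" "K0 \<le> n" using step.hyps k0 k2 by (auto simp: K_def)
      have HG: "H n \<inter> G n \<in> sets (Past (real (s n)))" by (intro sets.Int HP GP step.hyps)
      have "W.prob (H (Suc n)) = (\<integral>\<omega>. indicator (H n \<inter> G n) \<omega> * measure (\<PP> (\<Phi> (real (s n)) \<omega>)) (\<Omega> - B n) \<partial>W)"
        unfolding HS[OF step.hyps(1)] by (rule markov_event[OF _ HG CB]) simp
      also have "\<dots> \<le> (\<integral>\<omega>. (1 - 1 / real n) * indicator (H n) \<omega> \<partial>W)"
      proof (rule integral_mono)
        show "integrable W (\<lambda>\<omega>. indicator (H n \<inter> G n) \<omega> * measure (\<PP> (\<Phi> (real (s n)) \<omega>)) (\<Omega> - B n))"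
          by (rule integrable_indicator_prob[OF _ HG CB]) simp
        show "integrable W (\<lambda>\<omega>. (1 - 1 / real n) * indicator (H n) \<omega>)"
          by (rule integrable_mult_right, rule W.integrable_const_bound[of _ 1]) (use HW[OF step.hyps(1)] in auto)
        fix \<omega>
        show "indicator (H n \<inter> G n) \<omega> * measure (\<PP> (\<Phi> (real (s n)) \<omega>)) (\<Omega> - B n) \<le> (1 - 1 / real n) * indicator (H n) \<omega>"
        proof (cases "\<omega> \<in> H n \<inter> G n")
          case True
          have "measure (\<PP> (\<Phi> (real (s n)) \<omega>)) (\<Omega> - B n) = 1 - measure (\<PP> (\<Phi> (real (s n)) \<omega>)) (B n)"
            using prob_space.prob_compl[OF prob_space_PP, of "B n" "\<Phi> (real (s n)) \<omega>"] BP[of n] by (simp add: space_PP sets_PP)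
          also have "\<dots> \<le> 1 - 1 / real n" using K0[OF n(2), of \<omega>] True by simp
          finally show ?thesis using True by simp
        next
          case False
          then show ?thesis using n by (simp add: indicator_def)
        qed
      qed
      also have "\<dots> = (1 - 1 / real n) * W.prob (H n)" using HW[OF step.hyps(1)] by simp
      also have "\<dots> \<le> (1 - 1 / real n) * ((real k0 - 1) / (real n - 1))" using n step.IH by (intro mult_left_mono) auto
      also have "\<dots> = (real k0 - 1) / (real (Suc n) - 1)" using n by (simp add: field_simps)
      finally show ?case .
    qed
    let ?N = "{\<omega> \<in> \<Omega>. \<forall>k\<ge>k0. \<omega> \<notin> E k \<and> \<omega> \<in> G k}"
    have Neq: "?N = (\<Inter>n\<in>{k0..}. H n)" unfolding H_def by force
    show NW: "?N \<in> sets W" unfolding Neq by (rule sets.countable_INT') (use HW in auto)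
    have "W.prob ?N \<le> (real k0 - 1) / (real n - 1)" if "k0 \<le> n" for n
    proof -
      have "W.prob ?N \<le> W.prob (H n)" by (rule W.finite_measure_mono[OF _ HW[OF that]]) (auto simp: H_def)
      with bound[OF that] show ?thesis by linarith
    qed
    moreover have "(\<lambda>n. (real k0 - 1) / (real n - 1)) \<longlonglongrightarrow> 0" by real_asymp
    ultimately have "W.prob ?N \<le> 0" by (intro LIMSEQ_le_const) auto
    then show "W.prob ?N = 0" using measure_nonneg[of W ?N] by linarith
  qed
  have ae1: "AE \<omega> in W. \<forall>k0\<ge>K. \<exists>k\<ge>k0. \<omega> \<in> E k \<or> \<omega> \<notin> G k"
  proof -
    have "AE \<omega> in W. k0 \<ge> K \<longrightarrow> (\<exists>k\<ge>k0. \<omega> \<in> E k \<or> \<omega> \<notin> G k)" for k0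
    proof (cases "K \<le> k0")
      case True
      have "AE \<omega> in W. \<omega> \<notin> {\<omega> \<in> \<Omega>. \<forall>k\<ge>k0. \<omega> \<notin> E k \<and> \<omega> \<in> G k}"
        using escape[OF True] W.prob_eq_0[OF escape_sets[OF True]] by simp
      then show ?thesis using AE_space by eventually_elim (auto simp: W_space)
    qed simp
    then show ?thesis by (simp add: AE_all_countable)
  qed
  have ae2: "AE \<omega> in W. eventually (\<lambda>k. \<omega> \<in> G k) sequentially"
  proof -
    have CG: "space W - G k \<in> sets W" for k by (intro sets.compl_sets sets_Past_W[OF GP])
    have "W.prob (space W - G k) \<le> C\<^sub>V * exp (- 2 * c) ^ k" for k
    proof -
      have "W.prob (space W - G k) = W.prob {\<omega> \<in> \<Omega>. (r k)\<^sup>2 < V (real (s k)) \<omega>}"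
        by (rule arg_cong[where f=W.prob]) (auto simp: G_def W_space)
      also have "\<dots> \<le> C\<^sub>V / ((r k)\<^sup>2) powr \<zeta>" by (rule V_tail) (use rk4(3)[of k] in auto)
      also have "\<dots> \<le> C\<^sub>V / (r k)\<^sup>2"
      proof (rule divide_left_mono[OF _ CV_nonneg])
        have "((r k)\<^sup>2) powr 1 \<le> ((r k)\<^sup>2) powr \<zeta>" using zeta one_le_power[OF r1[of k], of 2] by (intro powr_mono) auto
        then show "(r k)\<^sup>2 \<le> ((r k)\<^sup>2) powr \<zeta>" using rk4(3)[of k] by simp
      qed (use rk4(3)[of k] in auto)
      also have "\<dots> = C\<^sub>V * exp (- 2 * c) ^ k"
      proof -
        have "exp (- 2 * c) ^ k = exp (real k * (- 2 * c))" by (rule exp_of_nat_mult[symmetric])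
        also have "\<dots> = inverse (exp (c * real k) * exp (c * real k))" by (simp add: exp_add[symmetric] exp_minus[symmetric])
        finally show ?thesis unfolding r_exp by (simp add: power2_eq_square field_simps)
      qed
      finally show ?thesis .
    qed
    then have "summable (\<lambda>k. W.prob (space W - G k))"
      by (intro summable_comparison_test_ev[OF always_eventually summable_mult[OF summable_geometric[of "exp (- 2 * c)"]]]) (use c in auto)
    then have "AE \<omega> in W. eventually (\<lambda>k. \<omega> \<in> space W - (space W - G k)) sequentially"
      by (intro borel_cantelli_AE1[OF CG]) (auto simp: less_top[symmetric])
    then show ?thesis by eventually_elim (auto elim: eventually_mono)
  qed
  have sq: "real (s k) \<le> 2 / real q ^ 8 * r k ^ 8" for k
  proof (induction k)
    case 0 then show ?case by (simp add: s_def r_def)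
  next
    case (Suc k)
    have "2 \<le> real q ^ 8" using q(1) self_le_power[of "real q" 8] by linarith
    moreover have "2 / z \<le> 1" if "2 \<le> z" for z :: real using that by simp
    ultimately have "2 / real q ^ 8 * r k ^ 8 \<le> 1 * r k ^ 8" by (intro mult_right_mono rk4)
    moreover have "2 / real q ^ 8 * r (Suc k) ^ 8 = 2 * r k ^ 8" using q(1) by (simp add: r_def power_mult_distrib)
    ultimately show ?case unfolding sSuc using Suc by linarith
  qed
  have q8: "real q \<le> real q ^ 8" using q(1) by (intro self_le_power) auto
  have q3: "3 \<le> real q * \<epsilon>" using q(2) \<epsilon> by (simp add: pos_divide_le_eq)
  have small: "2 / real q ^ 8 \<le> \<epsilon>"
  proof -
    have "2 / real q ^ 8 \<le> 2 / real q" using q8 q by (intro divide_left_mono) auto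
    also have "\<dots> \<le> \<epsilon>" using q3 q by (simp add: pos_divide_le_eq mult.commute)
    finally show ?thesis .
  qed
  have small': "2 * sqrt (2 / real q ^ 8) \<le> \<epsilon>"
  proof -
    have "2 / real q ^ 8 \<le> (\<epsilon> / 2)\<^sup>2"
    proof -
      have "3 * 3 \<le> (real q * \<epsilon>) * (real q * \<epsilon>)" using q3 by (intro mult_mono) auto
      then have "8 \<le> (real q)\<^sup>2 * \<epsilon>\<^sup>2" by (simp add: power2_eq_square mult_ac)
      also have "\<dots> \<le> real q ^ 8 * \<epsilon>\<^sup>2" using q(1) by (intro mult_right_mono power_increasing) auto
      finally show ?thesis using q(1) by (simp add: pos_divide_le_eq power_divide mult.commute)
    qed
    then have "sqrt (2 / real q ^ 8) \<le> \<epsilon> / 2" using \<epsilon> by (intro real_le_lsqrt) auto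
    then show ?thesis by simp
  qed
  have sk: "k \<le> s k" for k
  proof (induction k)
    case (Suc k) then show ?case using q(3) by (simp add: s_def) (metis One_nat_def Suc_leI add_mono_thms_linordered_semiring(1) not_numeral_le_zero plus_1_eq_Suc zero_less_power gr0I add.commute)
  qed (simp add: s_def)
  have scale: "iter u \<le> sqrt (a * b) * iter t" if "0 \<le> u" "u \<le> a * t" "0 \<le> a" "0 \<le> b" "0 \<le> t" "0 \<le> ln (ln u)" "ln (ln u) \<le> b * ln (ln t)" for u t a b
  proof -
    have "u * ln (ln u) \<le> (a * t) * (b * ln (ln t))" using that by (intro mult_mono) auto
    then have "2 * \<sigma>2 * (u * ln (ln u)) \<le> 2 * \<sigma>2 * ((a * t) * (b * ln (ln t)))" using variance_pos by (intro mult_left_mono) auto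
    then have "2 * \<sigma>2 * u * ln (ln u) \<le> (a * b) * (2 * \<sigma>2 * t * ln (ln t))" by (simp only: mult_ac)
    then have "iter u \<le> sqrt ((a * b) * (2 * \<sigma>2 * t * ln (ln t)))" unfolding iter_def by (rule real_sqrt_le_mono)
    then show ?thesis unfolding iter_def real_sqrt_mult[of "a * b"] .
  qed
  have "eventually (\<lambda>k. ln (ln (2 * r k ^ 8)) / ln (ln (r k ^ 8)) < 1 + \<epsilon>) sequentially"
    unfolding r_exp by (rule order_tendstoD(2)[OF lnln_double[OF c]]) (use \<epsilon> in simp)
  moreover have "eventually (\<lambda>k. 1 \<le> \<Lambda> k) sequentially" using \<Lambda>lim unfolding filterlim_at_top by blast
  ultimately have ev: "eventually (\<lambda>k. ln (ln (2 * r k ^ 8)) \<le> (1 + \<epsilon>) * ln (ln (r k ^ 8)) \<and> 1 \<le> \<Lambda> k) sequentially"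
  proof eventually_elim
    fix k assume "ln (ln (2 * r k ^ 8)) / ln (ln (r k ^ 8)) < 1 + \<epsilon>" "1 \<le> \<Lambda> k"
    then show "ln (ln (2 * r k ^ 8)) \<le> (1 + \<epsilon>) * ln (ln (r k ^ 8)) \<and> 1 \<le> \<Lambda> k"
      unfolding \<Lambda> by (simp add: pos_divide_less_eq)
  qed
  show ?thesis using ae1 ae2 below AE_space
  proof eventually_elim
    fix \<omega> assume f: "\<forall>k0\<ge>K. \<exists>k\<ge>k0. \<omega> \<in> E k \<or> \<omega> \<notin> G k" and g: "eventually (\<lambda>k. \<omega> \<in> G k) sequentially"
      and lo: "eventually (\<lambda>j. - I (real j) \<omega> \<le> 2 * iter (real j)) sequentially" and "\<omega> \<in> space W"
    then have \<omega>: "\<omega> \<in> \<Omega>" by (simp add: W_space)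
    obtain K1 where K1: "\<And>k. K1 \<le> k \<Longrightarrow> \<omega> \<in> G k" using g unfolding eventually_sequentially by blast
    obtain K2 where K2: "\<And>j. K2 \<le> j \<Longrightarrow> - I (real j) \<omega> \<le> 2 * iter (real j)" using lo unfolding eventually_sequentially by blast
    obtain K3 where K3: "\<And>k. K3 \<le> k \<Longrightarrow> ln (ln (2 * r k ^ 8)) \<le> (1 + \<epsilon>) * ln (ln (r k ^ 8)) \<and> 1 \<le> \<Lambda> k"
      using ev unfolding eventually_sequentially by blast
    show "frequently (\<lambda>j. (1 - 4 * \<epsilon>) * iter (real j) \<le> I (real j) \<omega>) sequentially"
      unfolding frequently_sequentially
    proof
      fix n0
      define k0 where "k0 = max (max K K1) (max (max K2 K3) (max 3 n0))"
      obtain k where k: "k0 \<le> k" "\<omega> \<in> E k" using f[rule_format, of k0] K1 unfolding k0_def by fastforce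
      have kk: "K2 \<le> k" "K3 \<le> k" "3 \<le> k" "n0 \<le> k" using k(1) by (auto simp: k0_def)
      have e3: "exp 1 \<le> real (s k)"
      proof -
        have "exp 1 \<le> (3::real)" by (rule exp_le)
        also have "3 \<le> real (s k)" using sk[of k] kk(3) by linarith
        finally show ?thesis .
      qed
      have T0: "0 < r k ^ 8" using rk4(3)[of k] by simp
      have a3: "1 \<le> ln (ln (r k ^ 8))" unfolding \<Lambda> using K3[OF kk(2)] by simp
      have sT: "real (s k) \<le> r k ^ 8"
      proof -
        have "2 / real q ^ 8 * r k ^ 8 \<le> 1 * r k ^ 8" using small \<epsilon> by (intro mult_right_mono rk4) auto
        with sq[of k] show ?thesis by linarith
      qed
      have "0 < real (s k)" using e3 exp_gt_zero[of "1::real"] by linarith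
      then have ls: "1 \<le> ln (real (s k))" using e3 by (subst ln_ge_iff)
      have i1: "iter (real (s k)) \<le> sqrt (2 / real q ^ 8 * 1) * iter (r k ^ 8)"
      proof (rule scale[OF _ sq[of k]])
        have s0: "0 < real (s k)" using e3 exp_gt_zero[of "1::real"] by linarith
        have "ln (real (s k)) \<le> ln (r k ^ 8)" using sT s0 by (rule ln_mono)
        then show "ln (ln (real (s k))) \<le> 1 * ln (ln (r k ^ 8))" using ls by (simp add: ln_mono)
      qed (use T0 ls in auto)
      have i2: "iter (real (s (Suc k))) \<le> sqrt ((1 + \<epsilon>) * (1 + \<epsilon>)) * iter (r k ^ 8)"
      proof (rule scale)
        have 1: "real (s (Suc k)) \<le> (1 + 2 / real q ^ 8) * r k ^ 8" unfolding sSuc using sq[of k] by (simp add: algebra_simps)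
        also have "\<dots> \<le> (1 + \<epsilon>) * r k ^ 8" using small by (intro mult_right_mono rk4) auto
        finally show 2: "real (s (Suc k)) \<le> (1 + \<epsilon>) * r k ^ 8" .
        have "(1 + \<epsilon>) * r k ^ 8 \<le> 2 * r k ^ 8" using \<epsilon> by (intro mult_right_mono rk4) auto
        with 2 have 3: "real (s (Suc k)) \<le> 2 * r k ^ 8" by linarith
        have ss: "real (s k) \<le> real (s (Suc k))" unfolding sSuc using rk4(1)[of k] by simp
        have s0: "0 < real (s k)" using e3 exp_gt_zero[of "1::real"] by linarith
        have l1: "ln (real (s k)) \<le> ln (real (s (Suc k)))" using ss s0 by (rule ln_mono)
        then show "0 \<le> ln (ln (real (s (Suc k))))" using ls by simp
        have "ln (real (s (Suc k))) \<le> ln (2 * r k ^ 8)" using 3 less_le_trans[OF s0 ss] by (rule ln_mono)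
        moreover have "0 < ln (real (s (Suc k)))" using l1 ls by linarith
        ultimately have "ln (ln (real (s (Suc k)))) \<le> ln (ln (2 * r k ^ 8))" by (rule ln_mono)
        then show "ln (ln (real (s (Suc k)))) \<le> (1 + \<epsilon>) * ln (ln (r k ^ 8))" using K3[OF kk(2)] by linarith
      qed (use \<epsilon> T0 in auto)
      have "x k * r k ^ 4 \<le> I (r k ^ 8) (\<theta> (real (s k)) \<omega>)" using k(2) by (simp add: E_def B_def)
      moreover have "x k * r k ^ 4 = (1 - \<epsilon>) * iter (r k ^ 8)" unfolding x_def iter_pow8[OF rk4(3)] \<Lambda> by simp
      moreover have "I (real (s (Suc k))) \<omega> = I (real (s k)) \<omega> + I (r k ^ 8) (\<theta> (real (s k)) \<omega>)"
        unfolding sSuc by (rule I_add[OF \<omega>]) (use rk4 in auto)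
      moreover have "- I (real (s k)) \<omega> \<le> 2 * iter (real (s k))" by (rule K2) (use sk[of k] kk(1) in linarith)
      moreover have "2 * iter (real (s k)) \<le> \<epsilon> * iter (r k ^ 8)"
      proof -
        have ip: "0 \<le> iter (r k ^ 8)" using e3 sT by (intro iter_nonneg) linarith
        have "2 * iter (real (s k)) \<le> 2 * sqrt (2 / real q ^ 8) * iter (r k ^ 8)" using i1 by simp
        also have "\<dots> \<le> \<epsilon> * iter (r k ^ 8)" by (rule mult_right_mono[OF small' ip])
        finally show ?thesis .
      qed
      ultimately have "(1 - 2 * \<epsilon>) * iter (r k ^ 8) \<le> I (real (s (Suc k))) \<omega>" by (simp add: algebra_simps)
      moreover have "(1 - 4 * \<epsilon>) * iter (real (s (Suc k))) \<le> (1 - 2 * \<epsilon>) * iter (r k ^ 8)"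
      proof -
        have ip: "0 \<le> iter (r k ^ 8)" using e3 sT by (intro iter_nonneg) linarith
        have "iter (real (s (Suc k))) \<le> (1 + \<epsilon>) * iter (r k ^ 8)" using i2 \<epsilon> by simp
        then have "(1 - 4 * \<epsilon>) * iter (real (s (Suc k))) \<le> (1 - 4 * \<epsilon>) * ((1 + \<epsilon>) * iter (r k ^ 8))" using \<epsilon> by (intro mult_left_mono) auto
        also have "\<dots> = ((1 - 4 * \<epsilon>) * (1 + \<epsilon>)) * iter (r k ^ 8)" by simp
        also have "\<dots> \<le> (1 - 2 * \<epsilon>) * iter (r k ^ 8)"
        proof (rule mult_right_mono[OF _ ip])
          have "(1 - 4 * \<epsilon>) * (1 + \<epsilon>) = 1 - 3 * \<epsilon> - 4 * (\<epsilon> * \<epsilon>)" by (simp add: algebra_simps)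
          moreover have "0 \<le> \<epsilon> * \<epsilon>" by simp
          ultimately show "(1 - 4 * \<epsilon>) * (1 + \<epsilon>) \<le> 1 - 2 * \<epsilon>" using \<epsilon> by linarith
        qed
        finally show ?thesis .
      qed
      ultimately have "(1 - 4 * \<epsilon>) * iter (real (s (Suc k))) \<le> I (real (s (Suc k))) \<omega>" by linarith
      moreover have "n0 \<le> s (Suc k)" using sk[of "Suc k"] kk(4) by linarith
      ultimately show "\<exists>n\<ge>n0. (1 - 4 * \<epsilon>) * iter (real n) \<le> I (real n) \<omega>" by blast
    qed
  qed
qed

section \<open>The limit superior in continuous time\<close>

text \<open>Between integer times the functional moves by at most \<open>G\<close>, which is negligible against the
  norming. The lower bound has to hold only along a sequence of integers.\<close>

lemma limsup_eq_one:
  assumes \<omega>: "\<omega> \<in> \<Omega>"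
    and up: "\<And>n::nat. eventually (\<lambda>j. I (real j) \<omega> \<le> (1 + 1 / (real n + 4)) * iter (real j)) sequentially"
    and lo: "\<And>n::nat. frequently (\<lambda>j. (1 - 4 * (1 / (real n + 4))) * iter (real j) \<le> I (real j) \<omega>) sequentially"
  shows "Limsup at_top (\<lambda>t. ereal (I t \<omega> / iter t)) = 1"
proof (rule antisym)
  have iter_big: "eventually (\<lambda>t. B \<le> iter t) at_top" for B using iter_at_top unfolding filterlim_at_top by blast
  show "Limsup at_top (\<lambda>t. ereal (I t \<omega> / iter t)) \<le> 1"
  proof (rule ereal_le_epsilon2)
    fix e :: real assume e: "0 < e"
    obtain n :: nat where n: "2 / e \<le> real n" using real_arch_simple by blast
    have "1 / (real n + 4) \<le> e / 2"
    proof -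
      have "2 / e \<le> real n + 4" using n by linarith
      then have "2 \<le> (real n + 4) * e" using e by (simp add: pos_divide_le_eq)
      then show ?thesis by (simp add: pos_divide_le_eq mult.commute)
    qed
    obtain N where N: "\<And>j. N \<le> j \<Longrightarrow> I (real j) \<omega> \<le> (1 + 1 / (real n + 4)) * iter (real j)"
      using up[of n] unfolding eventually_sequentially by blast
    have "eventually (\<lambda>t. I t \<omega> / iter t \<le> 1 + e) at_top"
      using eventually_ge_at_top[of "real N + 4"] iter_big[of "max 1 (2 * G / e)"]
    proof eventually_elim
      fix t :: real assume t: "real N + 4 \<le> t" and it: "max 1 (2 * G / e) \<le> iter t"
      define j where "j = nat \<lfloor>t\<rfloor>"
      have t0: "0 \<le> t" using t by linarith
      have j: "real j \<le> t" "t - real j \<le> 1" unfolding j_def using t0 by linarith+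
      have j4: "real N + 3 \<le> real j" using j t by linarith
      then have Nj: "N \<le> j" by linarith
      have e3: "exp 1 \<le> real j" using j4 exp_le by (simp add: order_trans[of "exp 1" 3])
      have ij: "iter (real j) \<le> iter t" by (rule iter_mono[OF e3 j(1)])
      have "G * (t - real j) \<le> G * 1" using j G_nonneg by (intro mult_left_mono) auto
      then have "I t \<omega> \<le> I (real j) \<omega> + G" using I_diff_bound[OF \<omega>, of "real j" t] j by (simp add: abs_le_iff)
      also have "\<dots> \<le> (1 + e / 2) * iter t + G"
      proof (intro add_right_mono order_trans[OF N[OF Nj]] mult_mono ij)
        show "1 + 1 / (real n + 4) \<le> 1 + e / 2" using \<open>1 / (real n + 4) \<le> e / 2\<close> by simp
      qed (use e iter_nonneg[OF e3] in auto)
      also have "G \<le> e / 2 * iter t"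
      proof -
        have "2 * G / e \<le> iter t" using it by simp
        then show ?thesis using e by (simp add: pos_divide_le_eq mult.commute)
      qed
      finally have "I t \<omega> \<le> (1 + e) * iter t" by (simp add: algebra_simps)
      then show "I t \<omega> / iter t \<le> 1 + e" using it by (simp add: pos_divide_le_eq)
    qed
    then have "Limsup at_top (\<lambda>t. ereal (I t \<omega> / iter t)) \<le> ereal (1 + e)"
      by (intro Limsup_bounded) (auto elim: eventually_mono)
    then show "Limsup at_top (\<lambda>t. ereal (I t \<omega> / iter t)) \<le> 1 + ereal e" by (simp add: one_ereal_def)
  qed
  show "1 \<le> Limsup at_top (\<lambda>t. ereal (I t \<omega> / iter t))"
  proof (rule ereal_le_epsilon2, rule ccontr)
    fix e :: real assume e: "0 < e" and "\<not> 1 \<le> Limsup at_top (\<lambda>t. ereal (I t \<omega> / iter t)) + ereal e"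
    then have "Limsup at_top (\<lambda>t. ereal (I t \<omega> / iter t)) < ereal (1 - e)"
      by (cases "Limsup at_top (\<lambda>t. ereal (I t \<omega> / iter t))") (auto simp: one_ereal_def)
    from Limsup_lessD[OF this] have "eventually (\<lambda>t. I t \<omega> / iter t < 1 - e) at_top" by simp
    then have "eventually (\<lambda>t. I t \<omega> < (1 - e) * iter t \<and> 0 < iter t) at_top"
      using iter_big[of 1] by eventually_elim (auto simp: pos_divide_less_eq)
    then have ev: "eventually (\<lambda>j. I (real j) \<omega> < (1 - e) * iter (real j) \<and> 0 < iter (real j)) sequentially"
      using filterlim_real_sequentially unfolding filterlim_iff by blast
    obtain n :: nat where n: "4 / e \<le> real n" using real_arch_simple by blast
    have "4 * (1 / (real n + 4)) \<le> e"
    proof -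
      have "4 / e \<le> real n + 4" using n by linarith
      then have "4 \<le> (real n + 4) * e" using e by (simp add: pos_divide_le_eq)
      then show ?thesis by (simp add: pos_divide_le_eq mult.commute)
    qed
    then have "frequently (\<lambda>j. I (real j) \<omega> < (1 - e) * iter (real j) \<and> 0 < iter (real j) \<and> (1 - e) * iter (real j) \<le> I (real j) \<omega>) sequentially"
      using frequently_eventually_frequently[OF lo[of n] ev]
    proof (elim frequently_elim1, elim conjE, intro conjI)
      fix j assume a: "(1 - 4 * (1 / (real n + 4))) * iter (real j) \<le> I (real j) \<omega>" "0 < iter (real j)"
      have "(1 - e) * iter (real j) \<le> (1 - 4 * (1 / (real n + 4))) * iter (real j)"
        using \<open>4 * (1 / (real n + 4)) \<le> e\<close> a(2) by (intro mult_right_mono) auto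
      then show "(1 - e) * iter (real j) \<le> I (real j) \<omega>" using a(1) by linarith
    qed
    then show False by (auto dest: frequently_ex)
  qed
qed

text \<open>A countable set of accuracies suffices; \<open>1 / (n + 4)\<close> keeps them within the range of
  \<open>lower_lil\<close>.\<close>

lemma lil_limsup:
  assumes below: "AE \<omega> in W. eventually (\<lambda>j. - I (real j) \<omega> \<le> 2 * iter (real j)) sequentially"
  shows "AE \<omega> in W. Limsup at_top (\<lambda>t. ereal (I t \<omega> / iter t)) = 1"
proof -
  have 1: "AE \<omega> in W. \<forall>n::nat. eventually (\<lambda>j. I (real j) \<omega> \<le> (1 + 1 / (real n + 4)) * iter (real j)) sequentially"
    unfolding AE_all_countable by (intro allI upper_lil) (auto simp: divide_le_eq)
  have 2: "AE \<omega> in W. \<forall>n::nat. frequently (\<lambda>j. (1 - 4 * (1 / (real n + 4))) * iter (real j) \<le> I (real j) \<omega>) sequentially"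
    unfolding AE_all_countable by (intro allI lower_lil[OF _ _ below]) (auto simp: divide_le_eq)
  show ?thesis using 1 2 AE_space
    by eventually_elim (rule limsup_eq_one, auto simp: W_space)
qed

end

section \<open>Consequences of the contraction and moment conditions\<close>

lemma Lip_bound:
  fixes g :: "'a::metric_space \<Rightarrow> real"
  assumes "g \<in> L_funs" shows "\<bar>g x - g y\<bar> \<le> enn2real (Lip g) * dist x y"
proof (cases "x = y")
  case False
  have "ennreal (\<bar>g x - g y\<bar> / dist x y) \<le> Lip g"
    unfolding Lip_def by (rule SUP_upper2[of "(x, y)"]) (use False in auto)
  then have "\<bar>g x - g y\<bar> / dist x y \<le> enn2real (Lip g)"
    using assms by (metis L_funs_def enn2real_ennreal enn2real_mono infinity_ennreal_def mem_Collect_eq divide_nonneg_nonneg abs_ge_zero zero_le_dist)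
  then show ?thesis using False by (simp add: pos_divide_le_eq)
qed simp

text \<open>Scaling \<open>v\<close> by its Lipschitz constant makes it admissible in the supremum that defines the
  distance.\<close>

lemma d_W_contraction:
  fixes v :: "'a::metric_space \<Rightarrow> real"
  assumes v: "\<And>a b. \<bar>v a - v b\<bar> \<le> L * dist a b" and d: "d_W \<nu>1 \<nu>2 \<le> ennreal c" and c: "0 \<le> c"
    and p: "prob_space \<nu>1" "prob_space \<nu>2" and L: "0 \<le> L"
  shows "\<bar>(\<integral>z. v z \<partial>\<nu>1) - (\<integral>z. v z \<partial>\<nu>2)\<bar> \<le> L * c"
proof (cases "L = 0")
  case True
  \<comment> \<open>For \<open>L = 0\<close> the function cannot be scaled, but it is constant.\<close>
  then have "v z = v undefined" for z using v[of z undefined] by simp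
  then have "v = (\<lambda>_. v undefined)" by (rule ext)
  then obtain b where "v = (\<lambda>_. b)" by blast
  then show ?thesis using p True by (simp add: prob_space.prob_space)
next
  case False
  with L have L: "0 < L" by simp
  let ?f = "\<lambda>z. v z / L"
  have f: "\<bar>?f a - ?f b\<bar> \<le> dist a b" for a b
    using v[of a b] L by (simp add: diff_divide_distrib[symmetric] pos_divide_le_eq mult.commute)
  have "Lip ?f \<le> 1" unfolding Lip_def
  proof (rule SUP_least)
    fix z :: "'a \<times> 'a" assume "z \<in> {(x, y). x \<noteq> y}"
    then obtain x y where z: "z = (x, y)" "x \<noteq> y" by auto
    have "\<bar>?f x - ?f y\<bar> / dist x y \<le> 1" using f[of x y] z(2) by (subst pos_divide_le_eq) simp_all
    then show "(case z of (x, y) \<Rightarrow> ennreal (\<bar>?f x - ?f y\<bar> / dist x y)) \<le> 1" unfolding z by simp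
  qed
  moreover from this have "?f \<in> L_funs" unfolding L_funs_def by (auto intro: le_less_trans)
  ultimately have "ennreal \<bar>(\<integral>z. ?f z \<partial>\<nu>1) - (\<integral>z. ?f z \<partial>\<nu>2)\<bar> \<le> d_W \<nu>1 \<nu>2"
    unfolding d_W_def by (intro SUP_upper) simp
  also note d
  finally have "\<bar>(\<integral>z. ?f z \<partial>\<nu>1) - (\<integral>z. ?f z \<partial>\<nu>2)\<bar> \<le> c" using c by (simp add: ennreal_le_iff)
  then have "\<bar>((\<integral>z. v z \<partial>\<nu>1) - (\<integral>z. v z \<partial>\<nu>2)) / L\<bar> \<le> c" by (simp add: diff_divide_distrib)
  then show ?thesis using L by (simp add: abs_divide pos_divide_le_eq mult.commute)
qed

context progressive_markov_process
begin

text \<open>Contraction makes \<open>\<mu>P\<^sub>t\<close> converge to the invariant law on bounded Lipschitz functions, and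
  the truncated squared distances are such functions. Their integrals are bounded along \<open>\<mu>P\<^sub>t\<close>,
  because a square is at most 1 plus the power \<open>\<zeta> > 2\<close>; the bound passes first to the invariant
  law and then, by Fatou, to the limit of no truncation.\<close>

lemma invariant_second_moment:
  assumes gam: "0 < \<gamma>"
    and contr: "\<And>v L t x y. 0 \<le> t \<Longrightarrow> (\<And>a b. \<bar>v a - v b\<bar> \<le> L * dist a b) \<Longrightarrow>
      \<bar>(\<integral>z. v z \<partial>P t x) - (\<integral>z. v z \<partial>P t y)\<bar> \<le> exp (- \<gamma> * t) * L * dist x y"
    and inv: "invariant_prob P \<nu>" and mu: "\<mu> \<in> prob_measures" and z: "2 < \<zeta>" and C: "0 \<le> C"
    and mom: "\<And>t. 0 \<le> t \<Longrightarrow> (\<integral>\<^sup>+x. ennreal (dist x0 x powr \<zeta>) \<partial>(\<mu> \<bind> P t)) \<le> ennreal C"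
  shows "integrable \<nu> (\<lambda>x. (dist x0 x)\<^sup>2)"
proof -
  have nu: "\<nu> \<in> prob_measures" using inv by (simp add: invariant_prob_def)
  have sn [measurable_cong]: "sets \<nu> = sets borel" and sm [measurable_cong]: "sets \<mu> = sets borel" using nu mu by (auto simp: space_prob_algebra)
  interpret n: prob_space \<nu> using nu by (simp add: space_prob_algebra)
  interpret m: prob_space \<mu> using mu by (simp add: space_prob_algebra)
  define f where "f R x = (min (dist x0 x) (real R))\<^sup>2" for R x
  have f0: "0 \<le> f R x" for R x by (simp add: f_def)
  have fB: "f R x \<le> (real R)\<^sup>2" for R x unfolding f_def by (intro power_mono) auto
  have fL: "\<bar>f R a - f R b\<bar> \<le> 2 * real R * dist a b" for R a b
  proof -
    let ?a = "min (dist x0 a) (real R)" and ?b = "min (dist x0 b) (real R)"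
    have "\<bar>?a - ?b\<bar> \<le> dist a b"
      using dist_triangle[of x0 a b] dist_triangle[of x0 b a] by (simp add: dist_commute min_def abs_le_iff)
    moreover have "0 \<le> ?a + ?b" "?a + ?b \<le> 2 * real R" by auto
    moreover have "f R a - f R b = (?a + ?b) * (?a - ?b)" by (simp add: f_def power2_eq_square algebra_simps)
    ultimately show ?thesis unfolding abs_mult by (auto simp: abs_mult intro!: mult_mono)
  qed
  have fm [measurable]: "f R \<in> borel_measurable borel" for R unfolding f_def [abs_def] by measurable
  have Pf: "(\<lambda>x. \<integral>z. f R z \<partial>P t x) \<in> borel_measurable borel" if "0 \<le> t" for t R
    using measurable_compose[OF P_subprob[OF that] integral_measurable_subprob_algebra[OF fm]] by simp
  have absf: "\<bar>f R x\<bar> \<le> (real R)\<^sup>2" for R x using f0 fB by simp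
  have PfB: "\<bar>\<integral>z. f R z \<partial>P t x\<bar> \<le> (real R)\<^sup>2" if "0 \<le> t" for t x R
    by (rule abs_expectation_le[OF P_prob[OF that] absf])
  have bound: "(\<integral>z. f R z \<partial>(\<mu> \<bind> P t)) \<le> 1 + C" if t: "0 \<le> t" for R t
  proof -
    have b: "\<mu> \<bind> P t \<in> prob_measures"
      using prob_space_bind'[OF mu kernel[OF t]] sets_bind'[OF mu kernel[OF t]] by (simp add: space_prob_algebra)
    have sb: "sets (\<mu> \<bind> P t) = sets borel" using b by (simp add: space_prob_algebra)
    interpret b: prob_space "\<mu> \<bind> P t" using b by (simp add: space_prob_algebra)
    have pw: "f R x \<le> 1 + dist x0 x powr \<zeta>" for x
    proof -
      have "f R x \<le> (dist x0 x)\<^sup>2" unfolding f_def by (intro power_mono) auto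
      also have "\<dots> \<le> 1 + dist x0 x powr \<zeta>"
      proof (cases "dist x0 x \<le> 1")
        case True
        then have "(dist x0 x)\<^sup>2 \<le> 1" by (intro power_le_one) auto
        then show ?thesis by (simp add: add_increasing2)
      next
        case False
        then have "dist x0 x powr 2 \<le> dist x0 x powr \<zeta>" using z by (intro powr_mono) auto
        moreover have "dist x0 x powr 2 = (dist x0 x)\<^sup>2" using False powr_realpow[of "dist x0 x" 2] by simp
        ultimately show ?thesis by simp
      qed
      finally show ?thesis .
    qed
    have "(\<integral>\<^sup>+x. ennreal (f R x) \<partial>(\<mu> \<bind> P t)) \<le> (\<integral>\<^sup>+x. 1 + ennreal (dist x0 x powr \<zeta>) \<partial>(\<mu> \<bind> P t))"
      by (rule nn_integral_mono) (metis pw ennreal_leI ennreal_plus ennreal_1 zero_le_one powr_ge_zero)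
    also have "\<dots> = 1 + (\<integral>\<^sup>+x. ennreal (dist x0 x powr \<zeta>) \<partial>(\<mu> \<bind> P t))"
      by (subst nn_integral_add) (auto simp: b.emeasure_space_1 sb cong: measurable_cong_sets)
    also have "\<dots> \<le> 1 + ennreal C" by (intro add_left_mono mom[OF t])
    also have "\<dots> = ennreal (1 + C)" using C by (simp add: ennreal_plus)
    finally show ?thesis using C by (intro integral_real_bounded) auto
  qed
  \<comment> \<open>A bound for the difference of the means of \<open>f R\<close> under \<open>\<nu>\<close> and under \<open>P\<^sub>k x\<close>. The minimum is an
    integrable majorant before any moment of \<open>\<nu>\<close> is known.\<close>
  define h where "h R k x = (\<integral>y. min (2 * (real R)\<^sup>2) (exp (- \<gamma> * real k) * (2 * real R) * dist x y) \<partial>\<nu>)" for R k x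
  have hm: "h R k \<in> borel_measurable \<mu>" for R k
    unfolding h_def [abs_def] by (rule n.borel_measurable_lebesgue_integral) measurable
  have hB: "\<bar>h R k x\<bar> \<le> 2 * (real R)\<^sup>2" for R k x
    unfolding h_def by (rule abs_expectation_le[OF n.prob_space_axioms]) (simp add: abs_of_nonneg)
  have elim: "(\<lambda>k::nat. exp (- \<gamma> * real k)) \<longlonglongrightarrow> 0" using gam by real_asymp
  have h0: "(\<lambda>k. h R k x) \<longlonglongrightarrow> 0" for R x
  proof -
    have "(\<lambda>k. h R k x) \<longlonglongrightarrow> (\<integral>y. 0 \<partial>\<nu>)"
      unfolding h_def
    proof (rule integral_dominated_convergence[where w="\<lambda>_. 2 * (real R)\<^sup>2"])
      have "(\<lambda>k. min (2 * (real R)\<^sup>2) (exp (- \<gamma> * real k) * (2 * real R) * dist x y)) \<longlonglongrightarrow> min (2 * (real R)\<^sup>2) (0 * (2 * real R) * dist x y)" for y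
        by (intro tendsto_intros elim)
      then show "AE y in \<nu>. (\<lambda>k. min (2 * (real R)\<^sup>2) (exp (- \<gamma> * real k) * (2 * real R) * dist x y)) \<longlonglongrightarrow> 0" by simp
    qed (auto simp: abs_of_nonneg)
    then show ?thesis by simp
  qed
  have nuf: "(\<integral>z. f R z \<partial>\<nu>) \<le> 1 + C" for R
  proof -
    have diff: "(\<integral>z. f R z \<partial>\<nu>) \<le> 1 + C + (\<integral>x. h R k x \<partial>\<mu>)" for k
    proof -
      have k: "0 \<le> real k" by simp
      have i: "integrable \<nu> (\<lambda>y. \<integral>z. f R z \<partial>P (real k) y)" "integrable \<mu> (\<lambda>y. \<integral>z. f R z \<partial>P (real k) y)"
        using PfB[OF k] Pf[OF k, of R]
        by (auto intro!: n.integrable_const_bound[of _ "(real R)\<^sup>2"] m.integrable_const_bound[of _ "(real R)\<^sup>2"] cong: measurable_cong_sets)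
      have e: "(\<integral>z. f R z \<partial>\<nu>) = (\<integral>y. (\<integral>z. f R z \<partial>P (real k) y) \<partial>\<nu>)"
        using integral_bind_bounded[OF nu kernel[OF k] fm absf] inv by (simp add: invariant_prob_def)
      have e2: "(\<integral>z. f R z \<partial>(\<mu> \<bind> P (real k))) = (\<integral>x. (\<integral>z. f R z \<partial>P (real k) x) \<partial>\<mu>)"
        by (rule integral_bind_bounded[OF mu kernel[OF k] fm absf])
      have pw: "(\<integral>z. f R z \<partial>\<nu>) - (\<integral>z. f R z \<partial>P (real k) x) \<le> h R k x" for x
      proof -
        have "(\<integral>z. f R z \<partial>\<nu>) - (\<integral>z. f R z \<partial>P (real k) x) = (\<integral>y. (\<integral>z. f R z \<partial>P (real k) y) - (\<integral>z. f R z \<partial>P (real k) x) \<partial>\<nu>)"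
          unfolding e using i by (simp add: n.prob_space)
        also have "\<dots> \<le> h R k x" unfolding h_def
        proof (rule integral_mono)
          show "integrable \<nu> (\<lambda>y. (\<integral>z. f R z \<partial>P (real k) y) - (\<integral>z. f R z \<partial>P (real k) x))" using i by simp
          show "integrable \<nu> (\<lambda>y. min (2 * (real R)\<^sup>2) (exp (- \<gamma> * real k) * (2 * real R) * dist x y))"
            by (rule n.integrable_const_bound[of _ "2 * (real R)\<^sup>2"]) (auto simp: abs_of_nonneg)
          fix y
          have "(\<integral>z. f R z \<partial>P (real k) y) - (\<integral>z. f R z \<partial>P (real k) x) \<le> 2 * (real R)\<^sup>2"
            using PfB[OF k, of y R] PfB[OF k, of x R] by linarith
          moreover have "(\<integral>z. f R z \<partial>P (real k) y) - (\<integral>z. f R z \<partial>P (real k) x) \<le> exp (- \<gamma> * real k) * (2 * real R) * dist x y"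
            using contr[OF k fL, of y R x] by (simp add: dist_commute)
          ultimately show "(\<integral>z. f R z \<partial>P (real k) y) - (\<integral>z. f R z \<partial>P (real k) x) \<le> min (2 * (real R)\<^sup>2) (exp (- \<gamma> * real k) * (2 * real R) * dist x y)" by simp
        qed
        finally show ?thesis .
      qed
      have ih: "integrable \<mu> (h R k)" by (rule m.integrable_const_bound[of _ "2 * (real R)\<^sup>2"]) (use hB hm in auto)
      have "(\<integral>z. f R z \<partial>\<nu>) - (\<integral>z. f R z \<partial>(\<mu> \<bind> P (real k))) = (\<integral>x. (\<integral>z. f R z \<partial>\<nu>) - (\<integral>z. f R z \<partial>P (real k) x) \<partial>\<mu>)"
        unfolding e2 using i by (simp add: m.prob_space)
      also have "\<dots> \<le> (\<integral>x. h R k x \<partial>\<mu>)" by (rule integral_mono) (use i ih pw in auto)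
      finally show ?thesis using bound[OF k, of R] by linarith
    qed
    have "(\<lambda>k. \<integral>x. h R k x \<partial>\<mu>) \<longlonglongrightarrow> (\<integral>x. 0 \<partial>\<mu>)"
      by (rule integral_dominated_convergence[where w="\<lambda>_. 2 * (real R)\<^sup>2"]) (use hm h0 hB in auto)
    then have "(\<lambda>k. 1 + C + (\<integral>x. h R k x \<partial>\<mu>)) \<longlonglongrightarrow> 1 + C + (\<integral>x. 0 \<partial>\<mu>)" by (intro tendsto_intros)
    then show ?thesis using LIMSEQ_le_const[of _ "1 + C + (\<integral>x. 0 \<partial>\<mu>)" "\<integral>z. f R z \<partial>\<nu>"] diff by simp
  qed
  have lim: "(\<lambda>R. ennreal (f R x)) \<longlonglongrightarrow> ennreal ((dist x0 x)\<^sup>2)" for x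
  proof (rule tendsto_eventually)
    obtain N :: nat where N: "dist x0 x \<le> real N" using real_arch_simple by blast
    show "eventually (\<lambda>R. ennreal (f R x) = ennreal ((dist x0 x)\<^sup>2)) sequentially"
      using eventually_ge_at_top[of N]
    proof eventually_elim
      fix R assume "N \<le> R"
      with N have "dist x0 x \<le> real R" by linarith
      then show "ennreal (f R x) = ennreal ((dist x0 x)\<^sup>2)" by (simp add: f_def min_def)
    qed
  qed
  have "(\<integral>\<^sup>+x. ennreal ((dist x0 x)\<^sup>2) \<partial>\<nu>) = (\<integral>\<^sup>+x. liminf (\<lambda>R. ennreal (f R x)) \<partial>\<nu>)"
    by (intro nn_integral_cong) (simp add: lim_imp_Liminf[OF _ lim])
  also have "\<dots> \<le> liminf (\<lambda>R. \<integral>\<^sup>+x. ennreal (f R x) \<partial>\<nu>)" by (rule nn_integral_liminf) measurable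
  also have "\<dots> \<le> liminf (\<lambda>R. ennreal (1 + C))"
  proof (rule Liminf_mono, rule always_eventually, rule allI)
    fix R
    have "integrable \<nu> (f R)" by (rule n.integrable_const_bound[of _ "(real R)\<^sup>2"]) (use absf in auto)
    then have "(\<integral>\<^sup>+x. ennreal (f R x) \<partial>\<nu>) = ennreal (\<integral>x. f R x \<partial>\<nu>)" by (rule nn_integral_eq_integral) (simp add: f0)
    then show "(\<integral>\<^sup>+x. ennreal (f R x) \<partial>\<nu>) \<le> ennreal (1 + C)" using nuf[of R] by (simp add: ennreal_leI)
  qed
  also have "\<dots> = ennreal (1 + C)" by (simp add: Liminf_const)
  finally show ?thesis by (intro integrableI_nonneg) (auto intro: le_less_trans)
qed

end

section \<open>The law of the iterated logarithm\<close>

lemma corrector_uminus: "corrector P (\<lambda>x. - g x) x = - corrector P g x"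
  unfolding corrector_def semigroup_op_def set_lebesgue_integral_def by simp

lemma integral_functional_uminus: "integral_functional \<Phi> (\<lambda>x. - g x) t \<omega> = - integral_functional \<Phi> g t \<omega>"
  unfolding integral_functional_def set_lebesgue_integral_def by simp

lemma corrector_increment_uminus: "corrector_increment P \<Phi> (\<lambda>x. - g x) \<omega> = - corrector_increment P \<Phi> g \<omega>"
  unfolding corrector_increment_def corrector_uminus integral_functional_uminus by simp

theorem theorem3p1:
  fixes P :: "real \<Rightarrow> 'a::polish_space \<Rightarrow> 'a measure"
    and \<Omega> :: "'w set"
    and \<Phi> :: "real \<Rightarrow> 'w \<Rightarrow> 'a"
    and \<theta> :: "real \<Rightarrow> 'w \<Rightarrow> 'w"
    and \<PP> :: "'a \<Rightarrow> 'w measure"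
    and \<mu> \<mu>\<^sub>s :: "'a measure"
    and g :: "'a \<Rightarrow> real"
    and \<sigma>2 :: real
  defines "\<sigma>2 \<equiv> asymptotic_variance P \<Phi> \<PP> \<mu>\<^sub>s g"
  assumes "progressive_markov_process P \<Omega> \<Phi> \<theta> \<PP>"
    and "\<mu> \<in> prob_measures"
    and "cond_A1 P" and "cond_A2 P" and "cond_A3 P" and "cond_A4 P \<mu>"
    and "invariant_prob P \<mu>\<^sub>s"
    and "g \<in> BL_funs" and "(\<integral>x. g x \<partial>\<mu>\<^sub>s) = 0"
  shows "integrable (law_from \<PP> \<mu>\<^sub>s) (\<lambda>\<omega>. (corrector_increment P \<Phi> g \<omega>)\<^sup>2) \<and>
    (\<sigma>2 > 0 \<longrightarrow>
      (AE \<omega> in law_from \<PP> \<mu>.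
        Liminf at_top (\<lambda>t. ereal (integral_functional \<Phi> g t \<omega> / sqrt (2 * \<sigma>2 * t * ln (ln t)))) = -1 \<and>
        Limsup at_top (\<lambda>t. ereal (integral_functional \<Phi> g t \<omega> / sqrt (2 * \<sigma>2 * t * ln (ln t)))) = 1))"
proof -
  interpret progressive_markov_process P \<Omega> \<Phi> \<theta> \<PP> by fact
  define Lg where "Lg = enn2real (Lip g)"
  have gL: "\<bar>g x - g y\<bar> \<le> Lg * dist x y" for x y
    unfolding Lg_def by (rule Lip_bound) (use assms(9) in \<open>auto simp: BL_funs_def\<close>)
  have Lg0: "0 \<le> Lg" by (simp add: Lg_def)
  obtain G where G: "\<bar>g x\<bar> \<le> G" for x
    using assms(9) unfolding BL_funs_def bounded_iff by auto
  have "Lg-lipschitz_on UNIV g" by (rule lipschitz_onI) (use gL Lg0 in \<open>auto simp: dist_real_def\<close>)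
  then have gm: "g \<in> borel_measurable borel" by (intro borel_measurable_continuous_onI lipschitz_on_continuous_on)
  obtain \<gamma> where \<gamma>: "0 < \<gamma>" and d: "\<And>t x y. 0 \<le> t \<Longrightarrow> d_W (return borel x \<bind> P t) (return borel y \<bind> P t) \<le> ennreal (exp (- \<gamma> * t) * dist x y)"
    using assms(6) unfolding cond_A3_def by blast
  have contr: "\<bar>(\<integral>z. v z \<partial>P t x) - (\<integral>z. v z \<partial>P t y)\<bar> \<le> exp (- \<gamma> * t) * L * dist x y"
    if t: "0 \<le> t" and v: "\<And>a b. \<bar>v a - v b\<bar> \<le> L * dist a b" for v L t x y
  proof (cases "x = y")
    case False
    have "0 \<le> L * dist x y" using order_trans[OF abs_ge_zero v] .
    then have L: "0 \<le> L" using False by (simp add: zero_le_mult_iff)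
    have b: "return borel z \<bind> P t = P t z" for z by (rule bind_return[OF P_subprob[OF t]]) simp
    have "\<bar>(\<integral>z. v z \<partial>P t x) - (\<integral>z. v z \<partial>P t y)\<bar> \<le> L * (exp (- \<gamma> * t) * dist x y)"
      by (rule d_W_contraction[OF v _ _ P_prob[OF t] P_prob[OF t] L]) (use d[OF t, of x y] b in auto)
    then show ?thesis by (simp add: mult_ac)
  qed simp
  obtain x0 \<zeta> where \<zeta>: "2 < \<zeta>" and fin: "(SUP t\<in>{0..}. \<integral>\<^sup>+ x. ennreal (dist x0 x powr \<zeta>) \<partial>(\<mu> \<bind> P t)) < \<infinity>"
    using assms(7) unfolding cond_A4_def by blast
  define C where "C = enn2real (SUP t\<in>{0..}. \<integral>\<^sup>+ x. ennreal (dist x0 x powr \<zeta>) \<partial>(\<mu> \<bind> P t))"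
  have C0: "0 \<le> C" by (simp add: C_def)
  have mom: "(\<integral>\<^sup>+x. ennreal (dist x0 x powr \<zeta>) \<partial>(\<mu> \<bind> P t)) \<le> ennreal C" if "0 \<le> t" for t
  proof -
    have "(\<integral>\<^sup>+x. ennreal (dist x0 x powr \<zeta>) \<partial>(\<mu> \<bind> P t)) \<le> (SUP t\<in>{0..}. \<integral>\<^sup>+ x. ennreal (dist x0 x powr \<zeta>) \<partial>(\<mu> \<bind> P t))"
      by (rule SUP_upper) (use that in simp)
    also have "\<dots> = ennreal C" unfolding C_def using fin by simp
    finally show ?thesis .
  qed
  have sec: "integrable \<mu>\<^sub>s (\<lambda>x. (dist x0 x)\<^sup>2)"
    by (rule invariant_second_moment[OF \<gamma> contr assms(8) assms(3) \<zeta> C0 mom])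
  \<comment> \<open>Both signs are needed: the upper half for \<open>-g\<close> enters the lower half for \<open>g\<close>, and the limit
    inferior is a limit superior for \<open>-g\<close>.\<close>
  have stat: "stationary_functional P \<Omega> \<Phi> \<theta> \<PP> (\<lambda>x. s * g x) G Lg \<gamma> \<mu>\<^sub>s x0" if s: "s = 1 \<or> s = -1" for s
  proof unfold_locales
    show "\<bar>s * g x\<bar> \<le> G" for x using G[of x] s by auto
    show "\<bar>s * g x - s * g y\<bar> \<le> Lg * dist x y" for x y using gL[of x y] s by auto
    show "(\<integral>x. s * g x \<partial>\<mu>\<^sub>s) = 0" using assms(10) by simp
  qed (use gm \<gamma> Lg0 contr assms(4) assms(8) sec in auto)
  interpret pos: stationary_functional P \<Omega> \<Phi> \<theta> \<PP> g G Lg \<gamma> \<mu>\<^sub>s x0 using stat[of 1] by simp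
  interpret neg: stationary_functional P \<Omega> \<Phi> \<theta> \<PP> "\<lambda>x. - g x" G Lg \<gamma> \<mu>\<^sub>s x0 using stat[of "-1"] by simp
  have s1: "pos.\<sigma>2 = \<sigma>2" unfolding pos.\<sigma>2_def assms(1) asymptotic_variance_def ..
  have s2: "neg.\<sigma>2 = \<sigma>2" unfolding neg.\<sigma>2_def assms(1) asymptotic_variance_def corrector_increment_uminus by simp
  have "AE \<omega> in law_from \<PP> \<mu>.
        Liminf at_top (\<lambda>t. ereal (integral_functional \<Phi> g t \<omega> / sqrt (2 * \<sigma>2 * t * ln (ln t)))) = -1 \<and>
        Limsup at_top (\<lambda>t. ereal (integral_functional \<Phi> g t \<omega> / sqrt (2 * \<sigma>2 * t * ln (ln t)))) = 1" if s: "0 < \<sigma>2"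
  proof -
    interpret P: lil_functional P \<Omega> \<Phi> \<theta> \<PP> g G Lg \<gamma> \<mu>\<^sub>s x0 \<mu> \<zeta> C
      by unfold_locales (use assms(3) \<zeta> C0 mom s s1 in auto)
    interpret N: lil_functional P \<Omega> \<Phi> \<theta> \<PP> "\<lambda>x. - g x" G Lg \<gamma> \<mu>\<^sub>s x0 \<mu> \<zeta> C
      by unfold_locales (use assms(3) \<zeta> C0 mom s s2 in auto)
    have it: "P.iter t = sqrt (2 * \<sigma>2 * t * ln (ln t))" "N.iter t = sqrt (2 * \<sigma>2 * t * ln (ln t))" for t
      unfolding P.iter_def N.iter_def s1 s2 by simp_all
    have "AE \<omega> in law_from \<PP> \<mu>. Limsup at_top (\<lambda>t. ereal (integral_functional \<Phi> g t \<omega> / P.iter t)) = 1"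
      by (rule P.lil_limsup) (use N.upper_lil[of 1] in \<open>simp add: integral_functional_uminus it\<close>)
    moreover have "AE \<omega> in law_from \<PP> \<mu>. Limsup at_top (\<lambda>t. ereal (integral_functional \<Phi> (\<lambda>x. - g x) t \<omega> / N.iter t)) = 1"
      by (rule N.lil_limsup) (use P.upper_lil[of 1] in \<open>simp add: integral_functional_uminus it\<close>)
    ultimately show ?thesis
    proof eventually_elim
      fix \<omega>
      assume a: "Limsup at_top (\<lambda>t. ereal (integral_functional \<Phi> g t \<omega> / P.iter t)) = 1"
        and b: "Limsup at_top (\<lambda>t. ereal (integral_functional \<Phi> (\<lambda>x. - g x) t \<omega> / N.iter t)) = 1"
      have "Liminf at_top (\<lambda>t. ereal (integral_functional \<Phi> g t \<omega> / sqrt (2 * \<sigma>2 * t * ln (ln t)))) =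
          Liminf at_top (\<lambda>t. - ereal (integral_functional \<Phi> (\<lambda>x. - g x) t \<omega> / N.iter t))"
        unfolding integral_functional_uminus it by simp
      also have "\<dots> = - 1" unfolding ereal_Liminf_uminus b ..
      finally show "Liminf at_top (\<lambda>t. ereal (integral_functional \<Phi> g t \<omega> / sqrt (2 * \<sigma>2 * t * ln (ln t)))) = -1 \<and>
        Limsup at_top (\<lambda>t. ereal (integral_functional \<Phi> g t \<omega> / sqrt (2 * \<sigma>2 * t * ln (ln t)))) = 1"
        using a unfolding it by simp
    qed
  qed
  then show ?thesis using pos.increment_square_integrable by blast
qed

end
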